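(* Let $k$ be a field, $\Gamma$ a finite group with $\mathrm{char}\,k\nmid|\Gamma|$, and $\mathcal C$ a Hom-finite, Krull--Schmidt, Frobenius, stably 2-Calabi--Yau exact $k$-category with an exact 2-Calabi--Yau action of $\Gamma$. The functors $-[\Gamma]$ and $F$ induce reciprocal bijections between: 1. $\mathrm{Add}(\mathcal C)^\Gamma$ and $\mathrm{Add}(\mathcal C\Gamma)^{\mathrm{mod}\,k[\Gamma]}$; 2. the set of rigid $\mathcal T\in\mathrm{Add}(\mathcal C)^\Gamma$ and the set of rigid $\mathcal T\in\mathrm{Add}(\mathcal C\Gamma)^{\mathrm{mod}\,k[\Gamma]}$; 3. the set of maximal $\Gamma$-stable rigid $\mathcal T\in\mathrm{Add}(\mathcal C)^\Gamma$ and the set of maximal $\mathrm{mod}\,k[\Gamma]$-stable rigid $\mathcal T\in\mathrm{Add}(\mathcal C\Gamma)^{\mathrm{mod}\,k[\Gamma]}$; 4. the set of cluster-tilting $\mathcal T\in\mathrm{Add}(\mathcal C)^\Gamma$ and the set of cluster-tilting $\mathcal T\in\mathrm{Add}(\mathcal C\Gamma)^{\mathrm{mod}\,k[\Gamma]}$. Moreover, all these bijections restrict to bijections between the corresponding finitely generated classes.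
   Context: Frobenius: enough projectives and injectives, which coincide. Stably 2-Calabi--Yau: a fixed functorial isomorphism $c:\mathrm{Ext}^1_{\mathcal C}(X,Y)\simeq\mathrm{Ext}^1_{\mathcal C}(Y,X)^*$. An action of $\Gamma$ on $\mathcal C$ is a structure of module category over $\mathrm{mod}\,k(\Gamma)$, where $k(\Gamma)$ is the Hopf algebra of $k$-valued functions on $\Gamma$ with simple modules $\mathbf g$, $\mathbf g\otimes\mathbf h=\mathbf{gh}$: auto-equivalences $\mathbf g\otimes-$ with coherent structural isomorphisms $\alpha:\mathbf{gh}\otimes X\to\mathbf g\otimes(\mathbf h\otimes X)$, $\mathbf 1\otimes X\to X$. It is exact if each $\mathbf g\otimes-$ is exact, and 2-Calabi--Yau if moreover $c_{X,Y}=(\mathbf g\otimes-)^*\circ c_{\mathbf g\otimes X,\mathbf g\otimes Y}\circ(\mathbf g\otimes-)$ for all $g,X,Y$. $\mathcal C\Gamma$ has objects $(X,\psi)$, $\psi=(\psi_g:\mathbf g\otimes X\to X)_{g}$ isomorphisms with $\psi_{gh}=\psi_g\circ(\mathrm{id}_{\mathbf g}\otimes\psi_h)\circ\alpha$ and $\psi_e$ structural; morphisms are the morphisms of $\mathcal C$ commuting with the $\psi$'s; exact sequences are those exact in $\mathcal C$. $F:\mathcal C\Gamma\to\mathcal C$ is the forgetful functor; $-[\Gamma]:\mathcal C\to\mathcal C\Gamma$ sends $X$ to $\bigoplus_{g\in\Gamma}\mathbf g\otimes X$ with the $\psi_h$ given by the structural isomorphisms, and $f$ to $\bigoplus_g\mathrm{id}_{\mathbf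 g}\otimes f$. $\mathrm{mod}\,k[\Gamma]$ acts on $\mathcal C\Gamma$ by $(V,r)\otimes(X,\psi)=(V\otimes X,(r_g\otimes\psi_g)_g)$, $V\otimes X=X^{\dim V}$. $\mathrm{Add}(\mathcal D)$ is the class of full additive subcategories of $\mathcal D$ stable under isomorphisms and direct summands; $\mathrm{Add}(\mathcal C)^\Gamma$ (resp. $\mathrm{Add}(\mathcal C\Gamma)^{\mathrm{mod}\,k[\Gamma]}$) consists of those stable under all $\mathbf g\otimes-$ (resp. under tensoring by all objects of $\mathrm{mod}\,k[\Gamma]$). $\mathcal T$ is finitely generated if $\mathcal T=\mathrm{add}(M)$ for an object $M$. The image of $\mathcal T$ under a functor $G$ is $\mathrm{add}(\{G(X):X\in\mathcal T\})$. $\mathcal T$ is rigid if $\mathrm{Ext}^1(X,Y)=0$ for all $X,Y\in\mathcal T$; maximal $\Gamma$-stable (resp. $\mathrm{mod}\,k[\Gamma]$-stable) rigid if it is rigid in $\mathrm{Add}(\mathcal C)^\Gamma$ (resp. $\mathrm{Add}(\mathcal C\Gamma)^{\mathrm{mod}\,k[\Gamma]}$) and maximal for inclusion among such; cluster-tilting if for any object $X$: $\mathrm{Ext}^1(X,Y)=0$ for all $Y\in\mathcal T$ if and only if $X\in\mathcal T$. *)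

theory Defs
  imports
    "HOL-Algebra.Group"
    "HOL-Library.FuncSet"
    "Jordan_Normal_Form.Matrix"
begin

section \<open>Categories over a field\<close>

text \<open>
  All hom-spaces of a category are subspaces of one ambient vector space \<open>'m\<close>.  This is no
  restriction: given an arbitrary (small) category with a vector space \<open>Hom(X,Y)\<close> for each pair of
  objects, take for \<open>'m\<close> the direct sum of all \<open>Hom(X,Y)\<close>.  Hom-spaces may overlap (they all
  contain \<open>0\<close>); nothing is required of objects outside \<open>Obj\<close>.
\<close>

record ('k, 'o, 'm) kcat =
  Obj :: "'o set"
  Hom :: "'o \<Rightarrow> 'o \<Rightarrow> 'm set"
  idm :: "'o \<Rightarrow> 'm"
  cmp :: "'m \<Rightarrow> 'm \<Rightarrow> 'm" (infixl "\<cdot>\<index>" 70)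
  smul :: "'k \<Rightarrow> 'm \<Rightarrow> 'm"

locale k_category =
  fixes C :: "('k::field, 'o, 'm::ab_group_add, 'z) kcat_scheme" (structure)
  assumes vector_space: "vector_space (smul C)"
    and Hom_subspace: "\<lbrakk>X \<in> Obj C; Y \<in> Obj C\<rbrakk> \<Longrightarrow> module.subspace (smul C) (Hom C X Y)"
    and idm_in_Hom: "X \<in> Obj C \<Longrightarrow> idm C X \<in> Hom C X X"
    and cmp_in_Hom: "\<lbrakk>X \<in> Obj C; Y \<in> Obj C; Z \<in> Obj C; f \<in> Hom C X Y; g \<in> Hom C Y Z\<rbrakk>
        \<Longrightarrow> g \<cdot> f \<in> Hom C X Z"
    and cmp_assoc: "\<lbrakk>W \<in> Obj C; X \<in> Obj C; Y \<in> Obj C; Z \<in> Obj C;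
          f \<in> Hom C W X; g \<in> Hom C X Y; h \<in> Hom C Y Z\<rbrakk> \<Longrightarrow> h \<cdot> (g \<cdot> f) = h \<cdot> g \<cdot> f"
    and idm_cmp: "\<lbrakk>X \<in> Obj C; Y \<in> Obj C; f \<in> Hom C X Y\<rbrakk> \<Longrightarrow> idm C Y \<cdot> f = f"
    and cmp_idm: "\<lbrakk>X \<in> Obj C; Y \<in> Obj C; f \<in> Hom C X Y\<rbrakk> \<Longrightarrow> f \<cdot> idm C X = f"
    and cmp_add_right: "\<lbrakk>X \<in> Obj C; Y \<in> Obj C; Z \<in> Obj C;
          f \<in> Hom C X Y; f' \<in> Hom C X Y; g \<in> Hom C Y Z\<rbrakk> \<Longrightarrow> g \<cdot> (f + f') = g \<cdot> f + g \<cdot> f'"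
    and cmp_add_left: "\<lbrakk>X \<in> Obj C; Y \<in> Obj C; Z \<in> Obj C;
          f \<in> Hom C X Y; g \<in> Hom C Y Z; g' \<in> Hom C Y Z\<rbrakk> \<Longrightarrow> (g + g') \<cdot> f = g \<cdot> f + g' \<cdot> f"
    and cmp_smul_right: "\<lbrakk>X \<in> Obj C; Y \<in> Obj C; Z \<in> Obj C; f \<in> Hom C X Y; g \<in> Hom C Y Z\<rbrakk>
        \<Longrightarrow> g \<cdot> smul C a f = smul C a (g \<cdot> f)"
    and cmp_smul_left: "\<lbrakk>X \<in> Obj C; Y \<in> Obj C; Z \<in> Obj C; f \<in> Hom C X Y; g \<in> Hom C Y Z\<rbrakk>
        \<Longrightarrow> smul C a g \<cdot> f = smul C a (g \<cdot> f)"

definition is_iso :: "('k, 'o, 'm, 'z) kcat_scheme \<Rightarrow> 'o \<Rightarrow> 'o \<Rightarrow> 'm \<Rightarrow> bool" where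
  "is_iso C X Y f \<longleftrightarrow> f \<in> Hom C X Y \<and>
     (\<exists>h\<in>Hom C Y X. h \<cdot>\<^bsub>C\<^esub> f = idm C X \<and> f \<cdot>\<^bsub>C\<^esub> h = idm C Y)"

definition inv_mor :: "('k, 'o, 'm, 'z) kcat_scheme \<Rightarrow> 'o \<Rightarrow> 'o \<Rightarrow> 'm \<Rightarrow> 'm" where
  "inv_mor C X Y f = (THE h. h \<in> Hom C Y X \<and> h \<cdot>\<^bsub>C\<^esub> f = idm C X \<and> f \<cdot>\<^bsub>C\<^esub> h = idm C Y)"

definition isomorphic :: "('k, 'o, 'm, 'z) kcat_scheme \<Rightarrow> 'o \<Rightarrow> 'o \<Rightarrow> bool" where
  "isomorphic C X Y \<longleftrightarrow> (\<exists>f. is_iso C X Y f)"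

definition biproduct :: "('k, 'o, 'm::ab_group_add, 'z) kcat_scheme \<Rightarrow> 'i set \<Rightarrow> ('i \<Rightarrow> 'o) \<Rightarrow>
    'o \<Rightarrow> ('i \<Rightarrow> 'm) \<Rightarrow> ('i \<Rightarrow> 'm) \<Rightarrow> bool" where
  "biproduct C I X P \<iota> \<pi> \<longleftrightarrow> finite I \<and> P \<in> Obj C \<and>
     (\<forall>i\<in>I. X i \<in> Obj C \<and> \<iota> i \<in> Hom C (X i) P \<and> \<pi> i \<in> Hom C P (X i)) \<and>
     (\<forall>i\<in>I. \<forall>j\<in>I. \<pi> j \<cdot>\<^bsub>C\<^esub> \<iota> i = (if i = j then idm C (X i) else 0)) \<and>
     (\<Sum>i\<in>I. \<iota> i \<cdot>\<^bsub>C\<^esub> \<pi> i) = idm C P"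

definition is_direct_sum :: "('k, 'o, 'm::ab_group_add, 'z) kcat_scheme \<Rightarrow> 'i set \<Rightarrow> ('i \<Rightarrow> 'o) \<Rightarrow>
    'o \<Rightarrow> bool" where
  "is_direct_sum C I X P \<longleftrightarrow> (\<exists>\<iota> \<pi>. biproduct C I X P \<iota> \<pi>)"

definition dsum :: "('k, 'o, 'm::ab_group_add, 'z) kcat_scheme \<Rightarrow> 'i set \<Rightarrow> ('i \<Rightarrow> 'o) \<Rightarrow>
    'o \<times> ('i \<Rightarrow> 'm) \<times> ('i \<Rightarrow> 'm)" where
  "dsum C I X = (SOME (P, \<iota>, \<pi>). biproduct C I X P \<iota> \<pi>)"

text \<open>The direct sum of morphisms \<open>f i\<close>, for projections \<open>\<pi>\<close> of the source and injections \<open>\<iota>\<close> of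
  the target.\<close>

definition dsum_mor :: "('k, 'o, 'm::ab_group_add, 'z) kcat_scheme \<Rightarrow> 'i set \<Rightarrow> ('i \<Rightarrow> 'm) \<Rightarrow>
    ('i \<Rightarrow> 'm) \<Rightarrow> ('i \<Rightarrow> 'm) \<Rightarrow> 'm" where
  "dsum_mor C I \<pi> f \<iota> = (\<Sum>i\<in>I. \<iota> i \<cdot>\<^bsub>C\<^esub> f i \<cdot>\<^bsub>C\<^esub> \<pi> i)"

text \<open>The case \<open>n = 0\<close> provides a zero object.\<close>

locale additive_k_category = k_category +
  assumes direct_sums: "(\<And>i. i < n \<Longrightarrow> X i \<in> Obj C) \<Longrightarrow> \<exists>P. is_direct_sum C {..<n::nat} X P"

definition hom_finite :: "('k::field, 'o, 'm::ab_group_add, 'z) kcat_scheme \<Rightarrow> bool" where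
  "hom_finite C \<longleftrightarrow>
     (\<forall>X\<in>Obj C. \<forall>Y\<in>Obj C. \<exists>B. finite B \<and> Hom C X Y = module.span (smul C) B)"

definition local_End :: "('k, 'o, 'm::ab_group_add, 'z) kcat_scheme \<Rightarrow> 'o \<Rightarrow> bool" where
  "local_End C X \<longleftrightarrow> idm C X \<noteq> 0 \<and>
     (\<forall>f\<in>Hom C X X. \<forall>g\<in>Hom C X X. \<not> is_iso C X X f \<longrightarrow> \<not> is_iso C X X g \<longrightarrow> \<not> is_iso C X X (f + g))"

definition krull_schmidt :: "('k, 'o, 'm::ab_group_add, 'z) kcat_scheme \<Rightarrow> bool" where
  "krull_schmidt C \<longleftrightarrow> (\<forall>X\<in>Obj C. \<exists>(n::nat) Y.
     (\<forall>i<n. Y i \<in> Obj C \<and> local_End C (Y i)) \<and> is_direct_sum C {..<n} Y X)"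


section \<open>Exact categories\<close>

text \<open>\<open>confl C A E B i p\<close> says that \<open>i : A \<rightarrow> E\<close> and \<open>p : E \<rightarrow> B\<close> form an admissible short exact
  sequence (a conflation).\<close>

record ('k, 'o, 'm) excat = "('k, 'o, 'm) kcat" +
  confl :: "'o \<Rightarrow> 'o \<Rightarrow> 'o \<Rightarrow> 'm \<Rightarrow> 'm \<Rightarrow> bool"

definition is_kernel :: "('k, 'o, 'm::zero, 'z) kcat_scheme \<Rightarrow> 'o \<Rightarrow> 'o \<Rightarrow> 'o \<Rightarrow> 'm \<Rightarrow> 'm \<Rightarrow> bool" where
  "is_kernel C A E B i p \<longleftrightarrow> i \<in> Hom C A E \<and> p \<in> Hom C E B \<and> p \<cdot>\<^bsub>C\<^esub> i = 0 \<and>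
     (\<forall>W\<in>Obj C. \<forall>f\<in>Hom C W E. p \<cdot>\<^bsub>C\<^esub> f = 0 \<longrightarrow> (\<exists>!h. h \<in> Hom C W A \<and> i \<cdot>\<^bsub>C\<^esub> h = f))"

definition is_cokernel :: "('k, 'o, 'm::zero, 'z) kcat_scheme \<Rightarrow> 'o \<Rightarrow> 'o \<Rightarrow> 'o \<Rightarrow> 'm \<Rightarrow> 'm \<Rightarrow> bool" where
  "is_cokernel C A E B i p \<longleftrightarrow> i \<in> Hom C A E \<and> p \<in> Hom C E B \<and> p \<cdot>\<^bsub>C\<^esub> i = 0 \<and>
     (\<forall>W\<in>Obj C. \<forall>f\<in>Hom C E W. f \<cdot>\<^bsub>C\<^esub> i = 0 \<longrightarrow> (\<exists>!h. h \<in> Hom C B W \<and> h \<cdot>\<^bsub>C\<^esub> p = f))"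

definition inflation :: "('k, 'o, 'm, 'z) excat_scheme \<Rightarrow> 'o \<Rightarrow> 'o \<Rightarrow> 'm \<Rightarrow> bool" where
  "inflation C A E i \<longleftrightarrow> (\<exists>B p. confl C A E B i p)"

definition deflation :: "('k, 'o, 'm, 'z) excat_scheme \<Rightarrow> 'o \<Rightarrow> 'o \<Rightarrow> 'm \<Rightarrow> bool" where
  "deflation C E B p \<longleftrightarrow> (\<exists>A i. confl C A E B i p)"

text \<open>The square \<open>i' \<cdot> f = f' \<cdot> i\<close> with \<open>i : A \<rightarrow> E\<close>, \<open>f : A \<rightarrow> A'\<close>, \<open>i' : A' \<rightarrow> E'\<close>,
  \<open>f' : E \<rightarrow> E'\<close> is a pushout.\<close>

definition is_pushout :: "('k, 'o, 'm, 'z) kcat_scheme \<Rightarrow> 'o \<Rightarrow> 'o \<Rightarrow> 'o \<Rightarrow> 'o \<Rightarrow>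
    'm \<Rightarrow> 'm \<Rightarrow> 'm \<Rightarrow> 'm \<Rightarrow> bool" where
  "is_pushout C A E A' E' i f i' f' \<longleftrightarrow>
     i \<in> Hom C A E \<and> f \<in> Hom C A A' \<and> i' \<in> Hom C A' E' \<and> f' \<in> Hom C E E' \<and>
     i' \<cdot>\<^bsub>C\<^esub> f = f' \<cdot>\<^bsub>C\<^esub> i \<and>
     (\<forall>W\<in>Obj C. \<forall>u\<in>Hom C A' W. \<forall>v\<in>Hom C E W. u \<cdot>\<^bsub>C\<^esub> f = v \<cdot>\<^bsub>C\<^esub> i \<longrightarrow>
        (\<exists>!h. h \<in> Hom C E' W \<and> h \<cdot>\<^bsub>C\<^esub> i' = u \<and> h \<cdot>\<^bsub>C\<^esub> f' = v))"

text \<open>The square \<open>f \<cdot> p' = p \<cdot> f'\<close> with \<open>p : E \<rightarrow> B\<close>, \<open>f : B' \<rightarrow> B\<close>, \<open>p' : E' \<rightarrow> B'\<close>,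
  \<open>f' : E' \<rightarrow> E\<close> is a pullback.\<close>

definition is_pullback :: "('k, 'o, 'm, 'z) kcat_scheme \<Rightarrow> 'o \<Rightarrow> 'o \<Rightarrow> 'o \<Rightarrow> 'o \<Rightarrow>
    'm \<Rightarrow> 'm \<Rightarrow> 'm \<Rightarrow> 'm \<Rightarrow> bool" where
  "is_pullback C E B E' B' p f p' f' \<longleftrightarrow>
     p \<in> Hom C E B \<and> f \<in> Hom C B' B \<and> p' \<in> Hom C E' B' \<and> f' \<in> Hom C E' E \<and>
     f \<cdot>\<^bsub>C\<^esub> p' = p \<cdot>\<^bsub>C\<^esub> f' \<and>
     (\<forall>W\<in>Obj C. \<forall>u\<in>Hom C W B'. \<forall>v\<in>Hom C W E. f \<cdot>\<^bsub>C\<^esub> u = p \<cdot>\<^bsub>C\<^esub> v \<longrightarrow>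
        (\<exists>!h. h \<in> Hom C W E' \<and> p' \<cdot>\<^bsub>C\<^esub> h = u \<and> f' \<cdot>\<^bsub>C\<^esub> h = v))"

text \<open>Quillen's axioms, in the form given by Buehler.\<close>

locale exact_k_category = additive_k_category C
  for C :: "('k::field, 'o, 'm::ab_group_add, 'z) excat_scheme" (structure) +
  assumes confl_Obj: "confl C A E B i p \<Longrightarrow> A \<in> Obj C \<and> E \<in> Obj C \<and> B \<in> Obj C"
    and confl_kernel_cokernel:
      "confl C A E B i p \<Longrightarrow> is_kernel C A E B i p \<and> is_cokernel C A E B i p"
    and confl_iso: "\<lbrakk>confl C A E B i p; A' \<in> Obj C; E' \<in> Obj C; B' \<in> Obj C;
          is_iso C A A' a; is_iso C E E' e; is_iso C B B' b;
          i' \<in> Hom C A' E'; p' \<in> Hom C E' B'; i' \<cdot> a = e \<cdot> i; p' \<cdot> e = b \<cdot> p\<rbrakk>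
        \<Longrightarrow> confl C A' E' B' i' p'"
    and inflation_idm: "X \<in> Obj C \<Longrightarrow> inflation C X X (idm C X)"
    and deflation_idm: "X \<in> Obj C \<Longrightarrow> deflation C X X (idm C X)"
    and inflation_cmp: "\<lbrakk>inflation C X Y i; inflation C Y Z j\<rbrakk> \<Longrightarrow> inflation C X Z (j \<cdot> i)"
    and deflation_cmp: "\<lbrakk>deflation C X Y p; deflation C Y Z q\<rbrakk> \<Longrightarrow> deflation C X Z (q \<cdot> p)"
    and inflation_pushout: "\<lbrakk>inflation C A E i; A' \<in> Obj C; f \<in> Hom C A A'\<rbrakk>
        \<Longrightarrow> \<exists>E'\<in>Obj C. \<exists>i' f'. is_pushout C A E A' E' i f i' f' \<and> inflation C A' E' i'"
    and deflation_pullback: "\<lbrakk>deflation C E B p; B' \<in> Obj C; f \<in> Hom C B' B\<rbrakk>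
        \<Longrightarrow> \<exists>E'\<in>Obj C. \<exists>p' f'. is_pullback C E B E' B' p f p' f' \<and> deflation C E' B' p'"

definition projective :: "('k, 'o, 'm, 'z) excat_scheme \<Rightarrow> 'o \<Rightarrow> bool" where
  "projective C P \<longleftrightarrow> P \<in> Obj C \<and>
     (\<forall>E B p. deflation C E B p \<longrightarrow> (\<forall>f\<in>Hom C P B. \<exists>h\<in>Hom C P E. p \<cdot>\<^bsub>C\<^esub> h = f))"

definition injective :: "('k, 'o, 'm, 'z) excat_scheme \<Rightarrow> 'o \<Rightarrow> bool" where
  "injective C J \<longleftrightarrow> J \<in> Obj C \<and>
     (\<forall>A E i. inflation C A E i \<longrightarrow> (\<forall>f\<in>Hom C A J. \<exists>h\<in>Hom C E J. h \<cdot>\<^bsub>C\<^esub> i = f))"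

definition frobenius :: "('k, 'o, 'm, 'z) excat_scheme \<Rightarrow> bool" where
  "frobenius C \<longleftrightarrow>
     (\<forall>X\<in>Obj C. \<exists>P p. projective C P \<and> deflation C P X p) \<and>
     (\<forall>X\<in>Obj C. \<exists>J i. injective C J \<and> inflation C X J i) \<and>
     (\<forall>X\<in>Obj C. projective C X \<longleftrightarrow> injective C X)"


section \<open>Yoneda extensions\<close>

text \<open>An extension of \<open>X\<close> by \<open>Y\<close> is a triple \<open>(E, i, p)\<close> with a conflation \<open>Y \<rightarrow> E \<rightarrow> X\<close>;
  \<open>Ext1 C X Y\<close> is the set of its classes.\<close>

definition exts :: "('k, 'o, 'm, 'z) excat_scheme \<Rightarrow> 'o \<Rightarrow> 'o \<Rightarrow> ('o \<times> 'm \<times> 'm) set" where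
  "exts C X Y = {(E, i, p). confl C Y E X i p}"

definition ext_rel :: "('k, 'o, 'm, 'z) excat_scheme \<Rightarrow> 'o \<Rightarrow> 'o \<Rightarrow>
    (('o \<times> 'm \<times> 'm) \<times> ('o \<times> 'm \<times> 'm)) set" where
  "ext_rel C X Y = {((E, i, p), (E', i', p')). (E, i, p) \<in> exts C X Y \<and> (E', i', p') \<in> exts C X Y \<and>
     (\<exists>e. is_iso C E E' e \<and> e \<cdot>\<^bsub>C\<^esub> i = i' \<and> p' \<cdot>\<^bsub>C\<^esub> e = p)}"

definition Ext1 :: "('k, 'o, 'm, 'z) excat_scheme \<Rightarrow> 'o \<Rightarrow> 'o \<Rightarrow> ('o \<times> 'm \<times> 'm) set set" where
  "Ext1 C X Y = exts C X Y // ext_rel C X Y"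

text \<open>\<open>ext_push C X Y' f \<xi>\<close> is the class \<open>f\<^sub>* \<xi> \<in> Ext1 C X Y'\<close> for \<open>\<xi> \<in> Ext1 C X Y\<close> and \<open>f : Y \<rightarrow> Y'\<close>:
  a morphism of conflations that is the identity on \<open>X\<close> exhibits its target as the pushout along
  its component \<open>Y \<rightarrow> Y'\<close>.  Dually, \<open>ext_pull C X' Y h \<xi>\<close> is \<open>h\<^sup>* \<xi> \<in> Ext1 C X' Y\<close> for
  \<open>h : X' \<rightarrow> X\<close>.\<close>

definition ext_push :: "('k, 'o, 'm, 'z) excat_scheme \<Rightarrow> 'o \<Rightarrow> 'o \<Rightarrow> 'm \<Rightarrow>
    ('o \<times> 'm \<times> 'm) set \<Rightarrow> ('o \<times> 'm \<times> 'm) set" where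
  "ext_push C X Y' f \<xi> = {(E', i', p') \<in> exts C X Y'.
     \<exists>(E, i, p)\<in>\<xi>. \<exists>e\<in>Hom C E E'. e \<cdot>\<^bsub>C\<^esub> i = i' \<cdot>\<^bsub>C\<^esub> f \<and> p' \<cdot>\<^bsub>C\<^esub> e = p}"

definition ext_pull :: "('k, 'o, 'm, 'z) excat_scheme \<Rightarrow> 'o \<Rightarrow> 'o \<Rightarrow> 'm \<Rightarrow>
    ('o \<times> 'm \<times> 'm) set \<Rightarrow> ('o \<times> 'm \<times> 'm) set" where
  "ext_pull C X' Y h \<xi> = {(E', i', p') \<in> exts C X' Y.
     \<exists>(E, i, p)\<in>\<xi>. \<exists>e\<in>Hom C E' E. e \<cdot>\<^bsub>C\<^esub> i' = i \<and> p \<cdot>\<^bsub>C\<^esub> e = h \<cdot>\<^bsub>C\<^esub> p'}"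

text \<open>The vector space structure of \<open>Ext1 C X Y\<close>: zero is the class of split extensions, and the
  Baer sum is \<open>\<nabla>\<^sub>* \<Delta>\<^sup>* (\<xi> \<oplus> \<eta>)\<close> with the codiagonal \<open>\<nabla> : Y \<oplus> Y \<rightarrow> Y\<close> and the diagonal
  \<open>\<Delta> : X \<rightarrow> X \<oplus> X\<close>.  The result does not depend on the representatives and on the direct sums
  \<open>YY\<close>, \<open>XX\<close>, \<open>EE\<close>.\<close>

definition ext_zero :: "('k, 'o, 'm, 'z) excat_scheme \<Rightarrow> 'o \<Rightarrow> 'o \<Rightarrow> ('o \<times> 'm \<times> 'm) set" where
  "ext_zero C X Y = {(E, i, p) \<in> exts C X Y. \<exists>r\<in>Hom C E Y. r \<cdot>\<^bsub>C\<^esub> i = idm C Y}"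

definition baer_sum :: "('k, 'o, 'm::ab_group_add, 'z) excat_scheme \<Rightarrow> 'o \<Rightarrow> 'o \<Rightarrow>
    ('o \<times> 'm \<times> 'm) set \<Rightarrow> ('o \<times> 'm \<times> 'm) set \<Rightarrow> ('o \<times> 'm \<times> 'm) set" where
  "baer_sum C X Y \<xi> \<eta> = {\<zeta>. \<exists>(E, i, p)\<in>\<xi>. \<exists>(E', i', p')\<in>\<eta>.
     \<exists>YY \<iota>Y \<pi>Y XX \<iota>X \<pi>X EE \<iota>E \<pi>E.
       biproduct C (UNIV :: bool set) (\<lambda>_. Y) YY \<iota>Y \<pi>Y \<and>
       biproduct C (UNIV :: bool set) (\<lambda>_. X) XX \<iota>X \<pi>X \<and>
       biproduct C (UNIV :: bool set) (case_bool E E') EE \<iota>E \<pi>E \<and>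
       \<zeta> \<in> ext_push C X Y (\<Sum>b\<in>UNIV. \<pi>Y b) (ext_pull C X YY (\<Sum>b\<in>UNIV. \<iota>X b)
             {(EE, dsum_mor C UNIV \<pi>Y (case_bool i i') \<iota>E, dsum_mor C UNIV \<pi>E (case_bool p p') \<iota>X)})}"

definition ext_smul :: "('k, 'o, 'm, 'z) excat_scheme \<Rightarrow> 'o \<Rightarrow> 'o \<Rightarrow> 'k \<Rightarrow>
    ('o \<times> 'm \<times> 'm) set \<Rightarrow> ('o \<times> 'm \<times> 'm) set" where
  "ext_smul C X Y a \<xi> = ext_push C X Y (smul C a (idm C Y)) \<xi>"

definition Ext1_dual :: "('k::field, 'o, 'm::ab_group_add, 'z) excat_scheme \<Rightarrow> 'o \<Rightarrow> 'o \<Rightarrow>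
    (('o \<times> 'm \<times> 'm) set \<Rightarrow> 'k) set" where
  "Ext1_dual C X Y = {\<phi> \<in> extensional (Ext1 C X Y).
     (\<forall>\<xi>\<in>Ext1 C X Y. \<forall>\<eta>\<in>Ext1 C X Y. \<phi> (baer_sum C X Y \<xi> \<eta>) = \<phi> \<xi> + \<phi> \<eta>) \<and>
     (\<forall>a. \<forall>\<xi>\<in>Ext1 C X Y. \<phi> (ext_smul C X Y a \<xi>) = a * \<phi> \<xi>)}"

text \<open>\<open>c X Y : Ext1 C X Y \<rightarrow> (Ext1 C Y X)\<^sup>*\<close> is a linear isomorphism, functorial in \<open>X\<close> and \<open>Y\<close>.\<close>

locale stably_2CY =
  fixes C :: "('k::field, 'o, 'm::ab_group_add, 'z) excat_scheme"
    and c :: "'o \<Rightarrow> 'o \<Rightarrow> ('o \<times> 'm \<times> 'm) set \<Rightarrow> ('o \<times> 'm \<times> 'm) set \<Rightarrow> 'k"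
  assumes c_bij: "\<lbrakk>X \<in> Obj C; Y \<in> Obj C\<rbrakk> \<Longrightarrow> bij_betw (c X Y) (Ext1 C X Y) (Ext1_dual C Y X)"
    and c_add: "\<lbrakk>X \<in> Obj C; Y \<in> Obj C; \<xi> \<in> Ext1 C X Y; \<xi>' \<in> Ext1 C X Y; \<eta> \<in> Ext1 C Y X\<rbrakk>
        \<Longrightarrow> c X Y (baer_sum C X Y \<xi> \<xi>') \<eta> = c X Y \<xi> \<eta> + c X Y \<xi>' \<eta>"
    and c_smul: "\<lbrakk>X \<in> Obj C; Y \<in> Obj C; \<xi> \<in> Ext1 C X Y; \<eta> \<in> Ext1 C Y X\<rbrakk>
        \<Longrightarrow> c X Y (ext_smul C X Y a \<xi>) \<eta> = a * c X Y \<xi> \<eta>"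
    and c_natural: "\<lbrakk>X \<in> Obj C; Y \<in> Obj C; X' \<in> Obj C; Y' \<in> Obj C; f \<in> Hom C X' X; h \<in> Hom C Y Y';
          \<xi> \<in> Ext1 C X Y; \<eta> \<in> Ext1 C Y' X'\<rbrakk>
        \<Longrightarrow> c X' Y' (ext_push C X' Y' h (ext_pull C X' Y f \<xi>)) \<eta>
            = c X Y \<xi> (ext_pull C Y X h (ext_push C Y' X f \<eta>))"


section \<open>Functors and group actions\<close>

record ('o, 'm, 'p, 'n) kfunctor =
  fob :: "'o \<Rightarrow> 'p"
  fmor :: "'o \<Rightarrow> 'o \<Rightarrow> 'm \<Rightarrow> 'n"

locale k_functor =
  fixes C :: "('k::field, 'o, 'm::ab_group_add, 'y) kcat_scheme"
    and D :: "('k, 'p, 'n::ab_group_add, 'z) kcat_scheme"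
    and T :: "('o, 'm, 'p, 'n) kfunctor"
  assumes fob_Obj: "X \<in> Obj C \<Longrightarrow> fob T X \<in> Obj D"
    and fmor_Hom: "\<lbrakk>X \<in> Obj C; Y \<in> Obj C; f \<in> Hom C X Y\<rbrakk> \<Longrightarrow> fmor T X Y f \<in> Hom D (fob T X) (fob T Y)"
    and fmor_idm: "X \<in> Obj C \<Longrightarrow> fmor T X X (idm C X) = idm D (fob T X)"
    and fmor_cmp: "\<lbrakk>X \<in> Obj C; Y \<in> Obj C; Z \<in> Obj C; f \<in> Hom C X Y; g \<in> Hom C Y Z\<rbrakk>
        \<Longrightarrow> fmor T X Z (g \<cdot>\<^bsub>C\<^esub> f) = fmor T Y Z g \<cdot>\<^bsub>D\<^esub> fmor T X Y f"
    and fmor_add: "\<lbrakk>X \<in> Obj C; Y \<in> Obj C; f \<in> Hom C X Y; f' \<in> Hom C X Y\<rbrakk>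
        \<Longrightarrow> fmor T X Y (f + f') = fmor T X Y f + fmor T X Y f'"
    and fmor_smul: "\<lbrakk>X \<in> Obj C; Y \<in> Obj C; f \<in> Hom C X Y\<rbrakk>
        \<Longrightarrow> fmor T X Y (smul C a f) = smul D a (fmor T X Y f)"

locale k_equivalence = k_functor +
  assumes fully_faithful: "\<lbrakk>X \<in> Obj C; Y \<in> Obj C\<rbrakk>
        \<Longrightarrow> bij_betw (fmor T X Y) (Hom C X Y) (Hom D (fob T X) (fob T Y))"
    and essentially_surjective: "Z \<in> Obj D \<Longrightarrow> \<exists>X\<in>Obj C. isomorphic D (fob T X) Z"

text \<open>\<open>act A g\<close> is \<open>g \<otimes> -\<close>, \<open>assc A g h X : gh \<otimes> X \<rightarrow> g \<otimes> (h \<otimes> X)\<close> and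
  \<open>unt A X : 1 \<otimes> X \<rightarrow> X\<close>.\<close>

record ('g, 'o, 'm) gaction =
  act :: "'g \<Rightarrow> ('o, 'm, 'o, 'm) kfunctor"
  assc :: "'g \<Rightarrow> 'g \<Rightarrow> 'o \<Rightarrow> 'm"
  unt :: "'o \<Rightarrow> 'm"

abbreviation tens :: "('g, 'o, 'm) gaction \<Rightarrow> 'g \<Rightarrow> 'o \<Rightarrow> 'o" where
  "tens A g X \<equiv> fob (act A g) X"

abbreviation tens_mor :: "('g, 'o, 'm) gaction \<Rightarrow> 'g \<Rightarrow> 'o \<Rightarrow> 'o \<Rightarrow> 'm \<Rightarrow> 'm" where
  "tens_mor A g X Y f \<equiv> fmor (act A g) X Y f"

locale group_action_on =
  fixes G :: "'g monoid"
    and C :: "('k::field, 'o, 'm::ab_group_add, 'z) kcat_scheme"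
    and A :: "('g, 'o, 'm) gaction"
  assumes act_equivalence: "g \<in> carrier G \<Longrightarrow> k_equivalence C C (act A g)"
    and assc_iso: "\<lbrakk>g \<in> carrier G; h \<in> carrier G; X \<in> Obj C\<rbrakk>
        \<Longrightarrow> is_iso C (tens A (g \<otimes>\<^bsub>G\<^esub> h) X) (tens A g (tens A h X)) (assc A g h X)"
    and assc_natural: "\<lbrakk>g \<in> carrier G; h \<in> carrier G; X \<in> Obj C; Y \<in> Obj C; f \<in> Hom C X Y\<rbrakk>
        \<Longrightarrow> assc A g h Y \<cdot>\<^bsub>C\<^esub> tens_mor A (g \<otimes>\<^bsub>G\<^esub> h) X Y f
            = tens_mor A g (tens A h X) (tens A h Y) (tens_mor A h X Y f) \<cdot>\<^bsub>C\<^esub> assc A g h X"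
    and unt_iso: "X \<in> Obj C \<Longrightarrow> is_iso C (tens A \<one>\<^bsub>G\<^esub> X) X (unt A X)"
    and unt_natural: "\<lbrakk>X \<in> Obj C; Y \<in> Obj C; f \<in> Hom C X Y\<rbrakk>
        \<Longrightarrow> unt A Y \<cdot>\<^bsub>C\<^esub> tens_mor A \<one>\<^bsub>G\<^esub> X Y f = f \<cdot>\<^bsub>C\<^esub> unt A X"
    and pentagon: "\<lbrakk>g \<in> carrier G; h \<in> carrier G; l \<in> carrier G; X \<in> Obj C\<rbrakk>
        \<Longrightarrow> tens_mor A g (tens A (h \<otimes>\<^bsub>G\<^esub> l) X) (tens A h (tens A l X)) (assc A h l X)
              \<cdot>\<^bsub>C\<^esub> assc A g (h \<otimes>\<^bsub>G\<^esub> l) X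
            = assc A g h (tens A l X) \<cdot>\<^bsub>C\<^esub> assc A (g \<otimes>\<^bsub>G\<^esub> h) l X"
    and triangle_right: "\<lbrakk>g \<in> carrier G; X \<in> Obj C\<rbrakk>
        \<Longrightarrow> tens_mor A g (tens A \<one>\<^bsub>G\<^esub> X) X (unt A X) \<cdot>\<^bsub>C\<^esub> assc A g \<one>\<^bsub>G\<^esub> X = idm C (tens A g X)"
    and triangle_left: "\<lbrakk>g \<in> carrier G; X \<in> Obj C\<rbrakk>
        \<Longrightarrow> unt A (tens A g X) \<cdot>\<^bsub>C\<^esub> assc A \<one>\<^bsub>G\<^esub> g X = idm C (tens A g X)"

definition exact_functor :: "('k, 'o, 'm, 'y) excat_scheme \<Rightarrow> ('k, 'p, 'n, 'z) excat_scheme \<Rightarrow>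
    ('o, 'm, 'p, 'n) kfunctor \<Rightarrow> bool" where
  "exact_functor C D T \<longleftrightarrow> (\<forall>X E Y i p. confl C X E Y i p \<longrightarrow>
     confl D (fob T X) (fob T E) (fob T Y) (fmor T X E i) (fmor T E Y p))"

text \<open>The map \<open>Ext1 C X Y \<rightarrow> Ext1 D (T X) (T Y)\<close> induced by an exact functor \<open>T\<close>.\<close>

definition ext_map :: "('k, 'p, 'n, 'z) excat_scheme \<Rightarrow> ('o, 'm, 'p, 'n) kfunctor \<Rightarrow> 'o \<Rightarrow> 'o \<Rightarrow>
    ('o \<times> 'm \<times> 'm) set \<Rightarrow> ('p \<times> 'n \<times> 'n) set" where
  "ext_map D T X Y \<xi> =
     ext_rel D (fob T X) (fob T Y) `` ((\<lambda>(E, i, p). (fob T E, fmor T Y E i, fmor T E X p)) ` \<xi>)"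

locale exact_2CY_action = group_action_on G C A
  for G :: "'g monoid"
    and C :: "('k::field, 'o, 'm::ab_group_add, 'z) excat_scheme"
    and c :: "'o \<Rightarrow> 'o \<Rightarrow> ('o \<times> 'm \<times> 'm) set \<Rightarrow> ('o \<times> 'm \<times> 'm) set \<Rightarrow> 'k"
    and A :: "('g, 'o, 'm) gaction" +
  assumes act_exact: "g \<in> carrier G \<Longrightarrow> exact_functor C C (act A g)"
    and act_2CY: "\<lbrakk>g \<in> carrier G; X \<in> Obj C; Y \<in> Obj C; \<xi> \<in> Ext1 C X Y; \<eta> \<in> Ext1 C Y X\<rbrakk>
        \<Longrightarrow> c X Y \<xi> \<eta> = c (tens A g X) (tens A g Y)
              (ext_map C (act A g) X Y \<xi>) (ext_map C (act A g) Y X \<eta>)"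


section \<open>The equivariant category\<close>

definition equiv_Obj :: "'g monoid \<Rightarrow> ('k, 'o, 'm, 'z) kcat_scheme \<Rightarrow> ('g, 'o, 'm) gaction \<Rightarrow>
    ('o \<times> ('g \<Rightarrow> 'm)) set" where
  "equiv_Obj G C A = {(X, \<psi>). X \<in> Obj C \<and> \<psi> \<in> extensional (carrier G) \<and>
     (\<forall>g\<in>carrier G. is_iso C (tens A g X) X (\<psi> g)) \<and>
     (\<forall>g\<in>carrier G. \<forall>h\<in>carrier G.
        \<psi> (g \<otimes>\<^bsub>G\<^esub> h) = \<psi> g \<cdot>\<^bsub>C\<^esub> tens_mor A g (tens A h X) X (\<psi> h) \<cdot>\<^bsub>C\<^esub> assc A g h X) \<and>
     \<psi> \<one>\<^bsub>G\<^esub> = unt A X}"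

definition equiv_Hom :: "'g monoid \<Rightarrow> ('k, 'o, 'm, 'z) kcat_scheme \<Rightarrow> ('g, 'o, 'm) gaction \<Rightarrow>
    'o \<times> ('g \<Rightarrow> 'm) \<Rightarrow> 'o \<times> ('g \<Rightarrow> 'm) \<Rightarrow> 'm set" where
  "equiv_Hom G C A = (\<lambda>(X, \<psi>) (Y, \<phi>). {f \<in> Hom C X Y.
     \<forall>g\<in>carrier G. f \<cdot>\<^bsub>C\<^esub> \<psi> g = \<phi> g \<cdot>\<^bsub>C\<^esub> tens_mor A g X Y f})"

definition equiv_cat :: "'g monoid \<Rightarrow> ('k, 'o, 'm, 'z) excat_scheme \<Rightarrow> ('g, 'o, 'm) gaction \<Rightarrow>
    ('k, 'o \<times> ('g \<Rightarrow> 'm), 'm) excat" where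
  "equiv_cat G C A = \<lparr>
     Obj = equiv_Obj G C A,
     Hom = equiv_Hom G C A,
     idm = (\<lambda>(X, \<psi>). idm C X),
     cmp = cmp C,
     smul = smul C,
     confl = (\<lambda>M N L i p. M \<in> equiv_Obj G C A \<and> N \<in> equiv_Obj G C A \<and> L \<in> equiv_Obj G C A \<and>
        i \<in> equiv_Hom G C A M N \<and> p \<in> equiv_Hom G C A N L \<and> confl C (fst M) (fst N) (fst L) i p)\<rparr>"

definition forget_functor :: "('o \<times> ('g \<Rightarrow> 'm), 'm, 'o, 'm) kfunctor" where
  "forget_functor = \<lparr>fob = fst, fmor = (\<lambda>_ _ f. f)\<rparr>"

text \<open>The functor \<open>-[\<Gamma>]\<close>.  On \<open>\<Oplus>g. g \<otimes> X\<close>, the isomorphism \<open>\<psi> h\<close> maps the component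
  \<open>h \<otimes> (g \<otimes> X)\<close> to the component \<open>hg \<otimes> X\<close> by the inverse of the structural isomorphism.\<close>

definition orbit_functor :: "'g monoid \<Rightarrow> ('k, 'o, 'm::ab_group_add, 'z) kcat_scheme \<Rightarrow>
    ('g, 'o, 'm) gaction \<Rightarrow> ('o, 'm, 'o \<times> ('g \<Rightarrow> 'm), 'm) kfunctor" where
  "orbit_functor G C A = \<lparr>
     fob = (\<lambda>X. case dsum C (carrier G) (\<lambda>g. tens A g X) of (P, \<iota>, \<pi>) \<Rightarrow>
        (P, \<lambda>h\<in>carrier G. \<Sum>g\<in>carrier G.
           \<iota> (h \<otimes>\<^bsub>G\<^esub> g) \<cdot>\<^bsub>C\<^esub>
           inv_mor C (tens A (h \<otimes>\<^bsub>G\<^esub> g) X) (tens A h (tens A g X)) (assc A h g X) \<cdot>\<^bsub>C\<^esub>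
           tens_mor A h P (tens A g X) (\<pi> g))),
     fmor = (\<lambda>X Y f.
        case dsum C (carrier G) (\<lambda>g. tens A g X) of (P, \<iota>, \<pi>) \<Rightarrow>
        case dsum C (carrier G) (\<lambda>g. tens A g Y) of (P', \<iota>', \<pi>') \<Rightarrow>
          dsum_mor C (carrier G) \<pi> (\<lambda>g. tens_mor A g X Y f) \<iota>')\<rparr>"

text \<open>Objects \<open>(V, r)\<close> of \<open>mod k[\<Gamma>]\<close> are given in coordinates: \<open>V\<close> is the space of column vectors of
  length \<open>n\<close> and \<open>r g\<close> is an \<open>n \<times> n\<close> matrix.\<close>

definition reps :: "'g monoid \<Rightarrow> (nat \<times> ('g \<Rightarrow> 'k::field mat)) set" where
  "reps G = {(n, r). (\<forall>g\<in>carrier G. r g \<in> carrier_mat n n) \<and> r \<one>\<^bsub>G\<^esub> = 1\<^sub>m n \<and>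
     (\<forall>g\<in>carrier G. \<forall>h\<in>carrier G. r (g \<otimes>\<^bsub>G\<^esub> h) = r g * r h)}"

definition rep_tensor :: "'g monoid \<Rightarrow> ('k, 'o, 'm::ab_group_add, 'z) kcat_scheme \<Rightarrow>
    ('g, 'o, 'm) gaction \<Rightarrow> nat \<times> ('g \<Rightarrow> 'k mat) \<Rightarrow> 'o \<times> ('g \<Rightarrow> 'm) \<Rightarrow> 'o \<times> ('g \<Rightarrow> 'm)" where
  "rep_tensor G C A = (\<lambda>(n, r) (X, \<psi>). case dsum C {..<n} (\<lambda>_. X) of (P, \<iota>, \<pi>) \<Rightarrow>
     (P, \<lambda>g\<in>carrier G. \<Sum>i<n. \<Sum>j<n.
        smul C (r g $$ (i, j)) (\<iota> i \<cdot>\<^bsub>C\<^esub> \<psi> g \<cdot>\<^bsub>C\<^esub> tens_mor A g P X (\<pi> j))))"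


section \<open>Additive subcategories\<close>

text \<open>A full subcategory is identified with its set of objects.\<close>

definition is_summand :: "('k, 'o, 'm::ab_group_add, 'z) kcat_scheme \<Rightarrow> 'o \<Rightarrow> 'o \<Rightarrow> bool" where
  "is_summand C X P \<longleftrightarrow> (\<exists>X'. is_direct_sum C (UNIV :: bool set) (case_bool X X') P)"

definition Add :: "('k, 'o, 'm::ab_group_add, 'z) kcat_scheme \<Rightarrow> 'o set set" where
  "Add C = {\<T>. \<T> \<subseteq> Obj C \<and>
     (\<forall>(n::nat) X P. (\<forall>i<n. X i \<in> \<T>) \<longrightarrow> is_direct_sum C {..<n} X P \<longrightarrow> P \<in> \<T>) \<and>
     (\<forall>X\<in>\<T>. \<forall>Y\<in>Obj C. isomorphic C X Y \<longrightarrow> Y \<in> \<T>) \<and>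
     (\<forall>P\<in>\<T>. \<forall>X. is_summand C X P \<longrightarrow> X \<in> \<T>)}"

definition Add_act :: "'g monoid \<Rightarrow> ('k, 'o, 'm::ab_group_add, 'z) kcat_scheme \<Rightarrow>
    ('g, 'o, 'm) gaction \<Rightarrow> 'o set set" where
  "Add_act G C A = {\<T> \<in> Add C. \<forall>g\<in>carrier G. \<forall>X\<in>\<T>. tens A g X \<in> \<T>}"

definition Add_mod :: "'g monoid \<Rightarrow> ('k::field, 'o, 'm::ab_group_add, 'z) excat_scheme \<Rightarrow>
    ('g, 'o, 'm) gaction \<Rightarrow> ('o \<times> ('g \<Rightarrow> 'm)) set set" where
  "Add_mod G C A = {\<T> \<in> Add (equiv_cat G C A). \<forall>V\<in>reps G. \<forall>M\<in>\<T>. rep_tensor G C A V M \<in> \<T>}"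

definition add_closure :: "('k, 'o, 'm::ab_group_add, 'z) kcat_scheme \<Rightarrow> 'o set \<Rightarrow> 'o set" where
  "add_closure C S = {X \<in> Obj C. \<exists>(n::nat) Y P.
     (\<forall>i<n. Y i \<in> S) \<and> is_direct_sum C {..<n} Y P \<and> is_summand C X P}"

definition add_image :: "('k, 'p, 'n::ab_group_add, 'z) kcat_scheme \<Rightarrow> ('o, 'm, 'p, 'n) kfunctor \<Rightarrow>
    'o set \<Rightarrow> 'p set" where
  "add_image D T \<T> = add_closure D (fob T ` \<T>)"

definition finitely_generated :: "('k, 'o, 'm::ab_group_add, 'z) kcat_scheme \<Rightarrow> 'o set \<Rightarrow> bool" where
  "finitely_generated C \<T> \<longleftrightarrow> (\<exists>M\<in>Obj C. \<T> = add_closure C {M})"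

definition rigid :: "('k, 'o, 'm, 'z) excat_scheme \<Rightarrow> 'o set \<Rightarrow> bool" where
  "rigid C \<T> \<longleftrightarrow> (\<forall>X\<in>\<T>. \<forall>Y\<in>\<T>. Ext1 C X Y = {ext_zero C X Y})"

text \<open>\<open>\<T>\<close> is rigid in the class \<open>\<A>\<close> and maximal among the rigid members of \<open>\<A>\<close>.\<close>

definition maximal_rigid_in :: "('k, 'o, 'm, 'z) excat_scheme \<Rightarrow> 'o set set \<Rightarrow> 'o set \<Rightarrow> bool" where
  "maximal_rigid_in C \<A> \<T> \<longleftrightarrow> \<T> \<in> \<A> \<and> rigid C \<T> \<and> (\<forall>\<T>'\<in>\<A>. rigid C \<T>' \<longrightarrow> \<T> \<subseteq> \<T>' \<longrightarrow> \<T>' = \<T>)"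

definition cluster_tilting :: "('k, 'o, 'm, 'z) excat_scheme \<Rightarrow> 'o set \<Rightarrow> bool" where
  "cluster_tilting C \<T> \<longleftrightarrow>
     (\<forall>X\<in>Obj C. (\<forall>Y\<in>\<T>. Ext1 C X Y = {ext_zero C X Y}) \<longleftrightarrow> X \<in> \<T>)"

definition reciprocal_bijections :: "('a \<Rightarrow> 'b) \<Rightarrow> ('b \<Rightarrow> 'a) \<Rightarrow> 'a set \<Rightarrow> 'b set \<Rightarrow> bool" where
  "reciprocal_bijections \<Phi> \<Psi> S S' \<longleftrightarrow> bij_betw \<Phi> S S' \<and> bij_betw \<Psi> S' S \<and>
     (\<forall>x\<in>S. \<Psi> (\<Phi> x) = x) \<and> (\<forall>y\<in>S'. \<Phi> (\<Psi> y) = y)"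

end

theory Submission
  imports Defs
begin

text \<open>
  For \<open>\<T> \<in> Add(C)\<^sup>G\<close> the image under \<open>-[G]\<close> is the preimage \<open>{M. F M \<in> \<T>}\<close>, and for a subcategory \<open>\<S>\<close> of the
  equivariant category stable under \<open>mod k[G]\<close> the image under \<open>F\<close> is the preimage \<open>{X. X[G] \<in> \<S>}\<close>.  This
  rests on two facts about an equivariant object \<open>M\<close>: \<open>(F M)[G]\<close> is isomorphic to \<open>k[G] \<otimes> M\<close>, and since \<open>|G|\<close>
  is invertible, \<open>k\<close> is a summand of \<open>k[G]\<close> and therefore \<open>M\<close> a summand of \<open>(F M)[G]\<close>.  As
  \<open>F(X[G]) = \<Oplus>g. g \<otimes> X\<close>, the two maps are mutually inverse.

  Vanishing of \<open>Ext1\<close> is splitting of all conflations.  A section in \<open>C\<close> of an equivariant conflation becomes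
  equivariant by averaging, so \<open>Ext1(F M, F N) = 0\<close> implies \<open>Ext1(M, N) = 0\<close>.  Conversely, if
  \<open>Ext1(M, Y[G]) = 0\<close>, then for a conflation \<open>Y \<rightarrow> E \<rightarrow> F M\<close> the unit \<open>M \<rightarrow> (F M)[G]\<close> lifts to \<open>E[G]\<close>, and the
  component at \<open>1\<close> of the lift is a section; hence \<open>Ext1(F M, Y) = 0\<close>.
\<close>

text \<open>The functor \<open>-[G]\<close> is right adjoint to F, and both are exact, so one
  expects \<open>Ext1(M, Y[G])\<close> to agree with \<open>Ext1(F M, Y)\<close>. Only the unit of
  this adjunction is built: the isomorphism of \<open>(F M)[G]\<close> with
  \<open>k[G] \<otimes> M\<close> is the diagonal of the structure maps g \<otimes> F M
  \<rightarrow> F M, and the unit corresponds to the sum of the group elements in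
  \<open>k[G]\<close>. For the first variable, vanishing of \<open>Ext1(g \<otimes> X, Y)\<close>
  follows from vanishing of \<open>Ext1(X, g' \<otimes> Y)\<close> with g' inverse to g, so a stable
  family of test objects Y does not distinguish X from F(X[G]). The obstacle is bookkeeping: direct
  sums are chosen arbitrarily and translates compose only up to structural isomorphisms. Actions and
  equivariant morphisms are therefore encoded as matrices of morphisms, and identities are compared
  on injections or projections. The pentagon enters once, in the cocycle of orbit objects, and the
  splitting of \<open>k[G]\<close> becomes a computation with matrices over k.\<close>

section \<open>Morphisms and biproducts\<close>

text \<open>\<open>Hom C X Y\<close> is arbitrary when \<open>X\<close> or \<open>Y\<close> is not an object; membership in \<open>mor C X Y\<close> carries the
  object conditions, so the category axioms hold for \<open>mor\<close> without further premises.\<close>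

definition mor :: "('k, 'o, 'm, 'z) kcat_scheme \<Rightarrow> 'o \<Rightarrow> 'o \<Rightarrow> 'm set" where
  "mor C X Y = {f \<in> Hom C X Y. X \<in> Obj C \<and> Y \<in> Obj C}"

text \<open>Row index first, as for matrices. The projections of the source are a separate argument
  because the source is often g \<otimes> P, whose projections are the images of those of P.
  Products are bracketed to the right, the normal form towards which \<open>comp_assoc\<close>
  rewrites.\<close>

definition matmor :: "('k, 'o, 'm::ab_group_add, 'z) kcat_scheme \<Rightarrow> ('i \<Rightarrow> 'm) \<Rightarrow> 'i set \<Rightarrow>
    ('i \<Rightarrow> 'j \<Rightarrow> 'm) \<Rightarrow> 'j set \<Rightarrow> ('j \<Rightarrow> 'm) \<Rightarrow> 'm" where
  "matmor C \<iota> I f J \<pi> = (\<Sum>i\<in>I. \<Sum>j\<in>J. \<iota> i \<cdot>\<^bsub>C\<^esub> (f i j \<cdot>\<^bsub>C\<^esub> \<pi> j))"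

context k_category
begin

sublocale vs: vector_space "smul C"
  by (rule vector_space)

lemma morI: "\<lbrakk>X \<in> Obj C; Y \<in> Obj C; f \<in> Hom C X Y\<rbrakk> \<Longrightarrow> f \<in> mor C X Y"
  by (simp add: mor_def)

lemma morD: "f \<in> mor C X Y \<Longrightarrow> f \<in> Hom C X Y" "f \<in> mor C X Y \<Longrightarrow> X \<in> Obj C"
    "f \<in> mor C X Y \<Longrightarrow> Y \<in> Obj C"
  by (simp_all add: mor_def)

lemma mor_idm [intro]: "X \<in> Obj C \<Longrightarrow> idm C X \<in> mor C X X"
  by (simp add: mor_def idm_in_Hom)

lemma mor_comp [intro]: "\<lbrakk>f \<in> mor C X Y; g \<in> mor C Y Z\<rbrakk> \<Longrightarrow> g \<cdot> f \<in> mor C X Z"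
  by (auto simp: mor_def intro: cmp_in_Hom)

lemma mor_zero [intro]: "\<lbrakk>X \<in> Obj C; Y \<in> Obj C\<rbrakk> \<Longrightarrow> 0 \<in> mor C X Y"
  by (simp add: mor_def vs.subspace_0 Hom_subspace)

lemma mor_add [intro]: "\<lbrakk>f \<in> mor C X Y; g \<in> mor C X Y\<rbrakk> \<Longrightarrow> f + g \<in> mor C X Y"
  by (simp add: mor_def vs.subspace_add Hom_subspace)

lemma mor_diff [intro]: "\<lbrakk>f \<in> mor C X Y; g \<in> mor C X Y\<rbrakk> \<Longrightarrow> f - g \<in> mor C X Y"
  by (simp add: mor_def vs.subspace_diff Hom_subspace)

lemma mor_smul [intro]: "f \<in> mor C X Y \<Longrightarrow> smul C a f \<in> mor C X Y"
  by (simp add: mor_def vs.subspace_scale Hom_subspace)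

lemma mor_sum [intro]: "\<lbrakk>X \<in> Obj C; Y \<in> Obj C; \<And>i. i \<in> I \<Longrightarrow> f i \<in> mor C X Y\<rbrakk> \<Longrightarrow> sum f I \<in> mor C X Y"
  by (simp add: mor_def vs.subspace_sum Hom_subspace)

lemma comp_assoc:
  "\<lbrakk>f \<in> mor C W X; g \<in> mor C X Y; h \<in> mor C Y Z\<rbrakk> \<Longrightarrow> (h \<cdot> g) \<cdot> f = h \<cdot> (g \<cdot> f)"
  using cmp_assoc[of W X Y Z f g h] morD by metis

lemma comp_idm: "f \<in> mor C X Y \<Longrightarrow> f \<cdot> idm C X = f"
  unfolding mor_def by (blast intro: cmp_idm)

lemma idm_comp: "f \<in> mor C X Y \<Longrightarrow> idm C Y \<cdot> f = f"
  unfolding mor_def by (blast intro: idm_cmp)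

lemma comp_add_right: "\<lbrakk>f \<in> mor C X Y; f' \<in> mor C X Y; g \<in> mor C Y Z\<rbrakk> \<Longrightarrow> g \<cdot> (f + f') = g \<cdot> f + g \<cdot> f'"
  unfolding mor_def by (blast intro: cmp_add_right)

lemma comp_add_left: "\<lbrakk>f \<in> mor C X Y; g \<in> mor C Y Z; g' \<in> mor C Y Z\<rbrakk> \<Longrightarrow> (g + g') \<cdot> f = g \<cdot> f + g' \<cdot> f"
  unfolding mor_def by (blast intro: cmp_add_left)

lemma comp_smul_right: "\<lbrakk>f \<in> mor C X Y; g \<in> mor C Y Z\<rbrakk> \<Longrightarrow> g \<cdot> smul C a f = smul C a (g \<cdot> f)"
  unfolding mor_def by (blast intro: cmp_smul_right)

lemma comp_smul_left: "\<lbrakk>f \<in> mor C X Y; g \<in> mor C Y Z\<rbrakk> \<Longrightarrow> smul C a g \<cdot> f = smul C a (g \<cdot> f)"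
  unfolding mor_def by (blast intro: cmp_smul_left)

lemma comp_zero_right: "g \<in> mor C Y Z \<Longrightarrow> g \<cdot> 0 = 0"
  using comp_add_right[of 0 Y Y 0 g Z] mor_zero morD(2) by force

lemma comp_zero_left: "f \<in> mor C X Y \<Longrightarrow> 0 \<cdot> f = 0"
  using comp_add_left[of f X Y 0 Y 0] mor_zero morD(3) by force

lemma comp_diff_right: "\<lbrakk>f \<in> mor C X Y; f' \<in> mor C X Y; g \<in> mor C Y Z\<rbrakk> \<Longrightarrow> g \<cdot> (f - f') = g \<cdot> f - g \<cdot> f'"
  using comp_add_right[of "f - f'" X Y f' g Z] by (simp add: mor_diff algebra_simps)

lemma comp_diff_left: "\<lbrakk>f \<in> mor C X Y; g \<in> mor C Y Z; g' \<in> mor C Y Z\<rbrakk> \<Longrightarrow> (g - g') \<cdot> f = g \<cdot> f - g' \<cdot> f"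
  using comp_add_left[of f X Y "g - g'" Z g'] by (simp add: mor_diff algebra_simps)

lemma comp_sum_right:
  assumes g: "g \<in> mor C Y Z" and X: "X \<in> Obj C" and f: "\<And>i. i \<in> I \<Longrightarrow> f i \<in> mor C X Y"
  shows "g \<cdot> sum f I = (\<Sum>i\<in>I. g \<cdot> f i)"
  using f
proof (induction I rule: infinite_finite_induct)
  case (insert i I)
  then show ?case
    using comp_add_right[of "f i" X Y "sum f I" g Z] g X morD(2)[OF g] by (simp add: mor_sum)
qed (use g comp_zero_right in auto)

lemma comp_sum_left:
  assumes f: "f \<in> mor C X Y" and Z: "Z \<in> Obj C" and g: "\<And>i. i \<in> I \<Longrightarrow> g i \<in> mor C Y Z"
  shows "sum g I \<cdot> f = (\<Sum>i\<in>I. g i \<cdot> f)"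
  using g
proof (induction I rule: infinite_finite_induct)
  case (insert i I)
  then show ?case
    using comp_add_left[of f X Y "g i" Z "sum g I"] f Z morD(3)[OF f] by (simp add: mor_sum)
qed (use f comp_zero_left in auto)

section \<open>Isomorphisms and their inverses\<close>

lemma is_iso_iff: "\<lbrakk>X \<in> Obj C; Y \<in> Obj C\<rbrakk> \<Longrightarrow> is_iso C X Y f \<longleftrightarrow>
    f \<in> mor C X Y \<and> (\<exists>h\<in>mor C Y X. h \<cdot> f = idm C X \<and> f \<cdot> h = idm C Y)"
  by (simp add: is_iso_def mor_def)

lemma is_isoI: "\<lbrakk>f \<in> mor C X Y; h \<in> mor C Y X; h \<cdot> f = idm C X; f \<cdot> h = idm C Y\<rbrakk> \<Longrightarrow> is_iso C X Y f"
  by (auto simp: is_iso_def mor_def)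

text \<open>h = h \<cdot> (f \<cdot> h') = (h \<cdot> f) \<cdot> h' = h'. One identity is asked of
  each morphism, so a retraction and a section found by separate arguments can be
  identified.\<close>

lemma inverse_unique:
  assumes "f \<in> mor C X Y" "h \<in> mor C Y X" "h' \<in> mor C Y X" "h \<cdot> f = idm C X" "f \<cdot> h' = idm C Y"
  shows "h = h'"
  using comp_assoc[OF assms(3,1,2)] comp_idm[OF assms(2)] idm_comp[OF assms(3)] assms(4,5) by simp

lemma inv_mor:
  assumes "is_iso C X Y f" and "X \<in> Obj C" "Y \<in> Obj C"
  shows "inv_mor C X Y f \<in> mor C Y X" "inv_mor C X Y f \<cdot> f = idm C X" "f \<cdot> inv_mor C X Y f = idm C Y"
proof -
  obtain h where h: "h \<in> mor C Y X" "h \<cdot> f = idm C X" "f \<cdot> h = idm C Y" and f: "f \<in> mor C X Y"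
    using assms is_iso_iff by blast
  have "inv_mor C X Y f = h"
    unfolding inv_mor_def
    by (rule the_equality) (use h f inverse_unique assms in \<open>auto simp: mor_def\<close>)
  then show "inv_mor C X Y f \<in> mor C Y X" "inv_mor C X Y f \<cdot> f = idm C X" "f \<cdot> inv_mor C X Y f = idm C Y"
    using h by auto
qed

lemma is_iso_idm: "X \<in> Obj C \<Longrightarrow> is_iso C X X (idm C X)"
  by (rule is_isoI[of _ _ _ "idm C X"]) (auto simp: comp_idm[OF mor_idm])

lemma is_iso_comp:
  assumes "is_iso C X Y f" "is_iso C Y Z g" "X \<in> Obj C" "Y \<in> Obj C" "Z \<in> Obj C"
  shows "is_iso C X Z (g \<cdot> f)"
proof -
  obtain f' g' where f: "f \<in> mor C X Y" "f' \<in> mor C Y X" "f' \<cdot> f = idm C X" "f \<cdot> f' = idm C Y"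
    and g: "g \<in> mor C Y Z" "g' \<in> mor C Z Y" "g' \<cdot> g = idm C Y" "g \<cdot> g' = idm C Z"
    using assms by (auto simp: is_iso_iff)
  show ?thesis
  proof (rule is_isoI)
    show "g \<cdot> f \<in> mor C X Z" "f' \<cdot> g' \<in> mor C Z X"
      using f g by blast+
    have "(f' \<cdot> g') \<cdot> (g \<cdot> f) = f' \<cdot> ((g' \<cdot> g) \<cdot> f)"
      using comp_assoc[OF mor_comp[OF f(1) g(1)] g(2) f(2)] comp_assoc[OF f(1) g(1,2)] by simp
    then show "(f' \<cdot> g') \<cdot> (g \<cdot> f) = idm C X"
      using f g idm_comp by simp
    have "(g \<cdot> f) \<cdot> (f' \<cdot> g') = g \<cdot> ((f \<cdot> f') \<cdot> g')"
      using comp_assoc[OF mor_comp[OF g(2) f(2)] f(1) g(1)] comp_assoc[OF g(2) f(2,1)] by simp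
    then show "(g \<cdot> f) \<cdot> (f' \<cdot> g') = idm C Z"
      using f g idm_comp by simp
  qed
qed

lemma is_iso_inv_mor:
  assumes "is_iso C X Y f" "X \<in> Obj C" "Y \<in> Obj C"
  shows "is_iso C Y X (inv_mor C X Y f)"
  using inv_mor[OF assms] assms is_isoI by (metis is_iso_iff)

lemma isomorphicI: "is_iso C X Y f \<Longrightarrow> isomorphic C X Y"
  by (auto simp: isomorphic_def)

lemma isomorphic_sym: "\<lbrakk>isomorphic C X Y; X \<in> Obj C; Y \<in> Obj C\<rbrakk> \<Longrightarrow> isomorphic C Y X"
  unfolding isomorphic_def using is_iso_inv_mor by blast

text \<open>Serves to compare morphisms after composition with a structure map, which avoids
  computing with its inverse.\<close>

lemma iso_cancel_right:
  assumes "is_iso C X Y g" "f \<in> mor C Y Z" "f' \<in> mor C Y Z" "X \<in> Obj C" "f \<cdot> g = f' \<cdot> g"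
  shows "f = f'"
proof -
  obtain g' where g: "g \<in> mor C X Y" "g' \<in> mor C Y X" "g \<cdot> g' = idm C Y"
    using assms morD by (auto simp: is_iso_iff)
  show ?thesis
    using comp_assoc[OF g(2,1) assms(2)] comp_assoc[OF g(2,1) assms(3)] assms(2,3,5) g(3) comp_idm by metis
qed

section \<open>Biproducts as products and coproducts at once\<close>

lemma biproductD:
  assumes "biproduct C I X P \<iota> \<pi>"
  shows "finite I" "P \<in> Obj C"
    and "\<And>i. i \<in> I \<Longrightarrow> X i \<in> Obj C"
    and "\<And>i. i \<in> I \<Longrightarrow> \<iota> i \<in> mor C (X i) P"
    and "\<And>i. i \<in> I \<Longrightarrow> \<pi> i \<in> mor C P (X i)"
    and "\<And>i j. \<lbrakk>i \<in> I; j \<in> I\<rbrakk> \<Longrightarrow> \<pi> j \<cdot> \<iota> i = (if i = j then idm C (X i) else 0)"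
    and "(\<Sum>i\<in>I. \<iota> i \<cdot> \<pi> i) = idm C P"
  using assms by (auto simp: biproduct_def mor_def)

lemma biproductI:
  assumes "finite I" "P \<in> Obj C"
    and "\<And>i. i \<in> I \<Longrightarrow> \<iota> i \<in> mor C (X i) P"
    and "\<And>i. i \<in> I \<Longrightarrow> \<pi> i \<in> mor C P (X i)"
    and "\<And>i j. \<lbrakk>i \<in> I; j \<in> I\<rbrakk> \<Longrightarrow> \<pi> j \<cdot> \<iota> i = (if i = j then idm C (X i) else 0)"
    and "(\<Sum>i\<in>I. \<iota> i \<cdot> \<pi> i) = idm C P"
  shows "biproduct C I X P \<iota> \<pi>"
  unfolding biproduct_def using assms by (auto simp: mor_def)

text \<open>A morphism h out of P is the sum of the
  \<open>(h \<cdot> \<iota> i) \<cdot> \<pi> i\<close>, hence determined by its restrictions. Many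
  equations below are proved by this rule or by its dual for projections.\<close>

lemma biproduct_inj_ext:
  assumes "biproduct C I X P \<iota> \<pi>" "f \<in> mor C P Z" "g \<in> mor C P Z" "\<And>i. i \<in> I \<Longrightarrow> f \<cdot> \<iota> i = g \<cdot> \<iota> i"
  shows "f = g"
proof -
  note b = biproductD[OF assms(1)]
  have "h = (\<Sum>i\<in>I. (h \<cdot> \<iota> i) \<cdot> \<pi> i)" if h: "h \<in> mor C P Z" for h
  proof -
    have "h = h \<cdot> (\<Sum>i\<in>I. \<iota> i \<cdot> \<pi> i)"
      using b(7) comp_idm h by simp
    also have "\<dots> = (\<Sum>i\<in>I. h \<cdot> (\<iota> i \<cdot> \<pi> i))"
      by (rule comp_sum_right[OF h b(2)]) (use b(2-5) in blast)
    also have "\<dots> = (\<Sum>i\<in>I. (h \<cdot> \<iota> i) \<cdot> \<pi> i)"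
      by (rule sum.cong[OF refl], rule comp_assoc[symmetric]) (use b(2-5) h in blast)+
    finally show ?thesis .
  qed
  from this[OF assms(2)] this[OF assms(3)] assms(4) show ?thesis
    by (simp cong: sum.cong)
qed

lemma biproduct_proj_ext:
  assumes "biproduct C I X P \<iota> \<pi>" "f \<in> mor C Z P" "g \<in> mor C Z P" "\<And>i. i \<in> I \<Longrightarrow> \<pi> i \<cdot> f = \<pi> i \<cdot> g"
  shows "f = g"
proof -
  note b = biproductD[OF assms(1)]
  have "h = (\<Sum>i\<in>I. \<iota> i \<cdot> (\<pi> i \<cdot> h))" if h: "h \<in> mor C Z P" for h
  proof -
    have "h = (\<Sum>i\<in>I. \<iota> i \<cdot> \<pi> i) \<cdot> h"
      using b(7) idm_comp h by simp
    also have "\<dots> = (\<Sum>i\<in>I. (\<iota> i \<cdot> \<pi> i) \<cdot> h)"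
      by (rule comp_sum_left[OF h b(2)]) (use b(2-5) in blast)
    also have "\<dots> = (\<Sum>i\<in>I. \<iota> i \<cdot> (\<pi> i \<cdot> h))"
      by (rule sum.cong[OF refl], rule comp_assoc) (use b(2-5) h in blast)+
    finally show ?thesis .
  qed
  from this[OF assms(2)] this[OF assms(3)] assms(4) show ?thesis
    by (simp cong: sum.cong)
qed

lemma cotuple_mor:
  assumes "biproduct C I X P \<iota> \<pi>" "Z \<in> Obj C" "\<And>i. i \<in> I \<Longrightarrow> f i \<in> mor C (X i) Z"
  shows "(\<Sum>i\<in>I. f i \<cdot> \<pi> i) \<in> mor C P Z"
  using biproductD[OF assms(1)] assms by blast

lemma cotuple_inj:
  assumes "biproduct C I X P \<iota> \<pi>" "Z \<in> Obj C" "\<And>i. i \<in> I \<Longrightarrow> f i \<in> mor C (X i) Z" "j \<in> I"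
  shows "(\<Sum>i\<in>I. f i \<cdot> \<pi> i) \<cdot> \<iota> j = f j"
proof -
  note b = biproductD[OF assms(1)]
  have "(\<Sum>i\<in>I. f i \<cdot> \<pi> i) \<cdot> \<iota> j = (\<Sum>i\<in>I. (f i \<cdot> \<pi> i) \<cdot> \<iota> j)"
    by (rule comp_sum_left[OF b(4)[OF assms(4)] assms(2)]) (use b(2-5) assms in blast)
  also have "\<dots> = (\<Sum>i\<in>I. if i = j then f j else 0)"
  proof (rule sum.cong)
    fix i assume i: "i \<in> I"
    have "(f i \<cdot> \<pi> i) \<cdot> \<iota> j = f i \<cdot> (\<pi> i \<cdot> \<iota> j)"
      by (rule comp_assoc) (use b assms i in auto)
    then show "(f i \<cdot> \<pi> i) \<cdot> \<iota> j = (if i = j then f j else 0)"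
      using b(6)[OF assms(4) i] assms(3)[OF i] by (auto simp: comp_idm comp_zero_right)
  qed simp
  also have "\<dots> = f j"
    using b(1) assms(4) by simp
  finally show ?thesis .
qed

lemma tuple_mor:
  assumes "biproduct C I X P \<iota> \<pi>" "Z \<in> Obj C" "\<And>i. i \<in> I \<Longrightarrow> f i \<in> mor C Z (X i)"
  shows "(\<Sum>i\<in>I. \<iota> i \<cdot> f i) \<in> mor C Z P"
  using biproductD[OF assms(1)] assms by blast

lemma proj_tuple:
  assumes "biproduct C I X P \<iota> \<pi>" "Z \<in> Obj C" "\<And>i. i \<in> I \<Longrightarrow> f i \<in> mor C Z (X i)" "j \<in> I"
  shows "\<pi> j \<cdot> (\<Sum>i\<in>I. \<iota> i \<cdot> f i) = f j"
proof -
  note b = biproductD[OF assms(1)]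
  have "\<pi> j \<cdot> (\<Sum>i\<in>I. \<iota> i \<cdot> f i) = (\<Sum>i\<in>I. \<pi> j \<cdot> (\<iota> i \<cdot> f i))"
    by (rule comp_sum_right[OF b(5)[OF assms(4)] assms(2)]) (use b(2-5) assms in blast)
  also have "\<dots> = (\<Sum>i\<in>I. if i = j then f j else 0)"
  proof (rule sum.cong)
    fix i assume i: "i \<in> I"
    have "\<pi> j \<cdot> (\<iota> i \<cdot> f i) = (\<pi> j \<cdot> \<iota> i) \<cdot> f i"
      by (rule comp_assoc[symmetric]) (use b assms i in auto)
    then show "\<pi> j \<cdot> (\<iota> i \<cdot> f i) = (if i = j then f j else 0)"
      using b(6)[OF i assms(4)] assms(3)[OF i] by (auto simp: idm_comp comp_zero_left)
  qed simp
  also have "\<dots> = f j"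
    using b(1) assms(4) by simp
  finally show ?thesis .
qed

lemma tuple_comp:
  assumes "biproduct C I X P \<iota> \<pi>" "h \<in> mor C W Z" "\<And>i. i \<in> I \<Longrightarrow> f i \<in> mor C Z (X i)"
  shows "(\<Sum>i\<in>I. \<iota> i \<cdot> f i) \<cdot> h = (\<Sum>i\<in>I. \<iota> i \<cdot> (f i \<cdot> h))"
proof -
  note b = biproductD[OF assms(1)]
  have "(\<Sum>i\<in>I. \<iota> i \<cdot> f i) \<cdot> h = (\<Sum>i\<in>I. (\<iota> i \<cdot> f i) \<cdot> h)"
    by (rule comp_sum_left[OF assms(2) b(2)]) (use b(2-5) assms in blast)
  also have "\<dots> = (\<Sum>i\<in>I. \<iota> i \<cdot> (f i \<cdot> h))"
    by (rule sum.cong[OF refl], rule comp_assoc) (use b(2-5) assms in blast)+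
  finally show ?thesis .
qed

lemma comp_cotuple:
  assumes "biproduct C I X P \<iota> \<pi>" "h \<in> mor C Z W" "\<And>i. i \<in> I \<Longrightarrow> f i \<in> mor C (X i) Z"
  shows "h \<cdot> (\<Sum>i\<in>I. f i \<cdot> \<pi> i) = (\<Sum>i\<in>I. (h \<cdot> f i) \<cdot> \<pi> i)"
proof -
  note b = biproductD[OF assms(1)]
  have "h \<cdot> (\<Sum>i\<in>I. f i \<cdot> \<pi> i) = (\<Sum>i\<in>I. h \<cdot> (f i \<cdot> \<pi> i))"
    by (rule comp_sum_right[OF assms(2) b(2)]) (use b(2-5) assms in blast)
  also have "\<dots> = (\<Sum>i\<in>I. (h \<cdot> f i) \<cdot> \<pi> i)"
    by (rule sum.cong[OF refl], rule comp_assoc[symmetric]) (use b(2-5) assms in blast)+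
  finally show ?thesis .
qed

text \<open>The double sum is read as the tuple of its rows and, after exchanging the sums, as the
  cotuple of its columns. The first form yields the composites with projections, the second those
  with injections.\<close>

lemma matmor:
  assumes X: "biproduct C J X P \<iota>X \<pi>X" and Y: "biproduct C I Y Q \<iota>Y \<pi>Y"
    and f: "\<forall>i\<in>I. \<forall>j\<in>J. f i j \<in> mor C (X j) (Y i)"
  shows matmor_mor: "matmor C \<iota>Y I f J \<pi>X \<in> mor C P Q"
    and proj_matmor: "i \<in> I \<Longrightarrow> \<pi>Y i \<cdot> matmor C \<iota>Y I f J \<pi>X = (\<Sum>j\<in>J. f i j \<cdot> \<pi>X j)"
    and matmor_inj: "j \<in> J \<Longrightarrow> matmor C \<iota>Y I f J \<pi>X \<cdot> \<iota>X j = (\<Sum>i\<in>I. \<iota>Y i \<cdot> f i j)"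
proof -
  note x = biproductD[OF X] and y = biproductD[OF Y]
  have row: "(\<Sum>j\<in>J. f i j \<cdot> \<pi>X j) \<in> mor C P (Y i)" if "i \<in> I" for i
    by (rule cotuple_mor[OF X]) (use that y(3) f in auto)
  have col: "(\<Sum>i\<in>I. \<iota>Y i \<cdot> f i j) \<in> mor C (X j) Q" if "j \<in> J" for j
    by (rule tuple_mor[OF Y]) (use that x(3) f in auto)
  have rows: "matmor C \<iota>Y I f J \<pi>X = (\<Sum>i\<in>I. \<iota>Y i \<cdot> (\<Sum>j\<in>J. f i j \<cdot> \<pi>X j))"
    unfolding matmor_def
    by (rule sum.cong[OF refl], rule comp_sum_right[symmetric]) (use x(2-5) y(2-5) f in blast)+
  have "(\<Sum>j\<in>J. (\<Sum>i\<in>I. \<iota>Y i \<cdot> f i j) \<cdot> \<pi>X j) = (\<Sum>j\<in>J. (\<Sum>i\<in>I. \<iota>Y i \<cdot> (f i j \<cdot> \<pi>X j)))"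
    by (rule sum.cong[OF refl], rule tuple_comp[OF Y]) (use x(2-5) y(2-5) f in blast)+
  then have cols: "matmor C \<iota>Y I f J \<pi>X = (\<Sum>j\<in>J. (\<Sum>i\<in>I. \<iota>Y i \<cdot> f i j) \<cdot> \<pi>X j)"
    unfolding matmor_def by (subst sum.swap) simp
  show "matmor C \<iota>Y I f J \<pi>X \<in> mor C P Q"
    unfolding rows by (rule tuple_mor[OF Y x(2) row])
  show "\<pi>Y i \<cdot> matmor C \<iota>Y I f J \<pi>X = (\<Sum>j\<in>J. f i j \<cdot> \<pi>X j)" if "i \<in> I"
    unfolding rows by (rule proj_tuple[OF Y x(2) row that])
  show "matmor C \<iota>Y I f J \<pi>X \<cdot> \<iota>X j = (\<Sum>i\<in>I. \<iota>Y i \<cdot> f i j)" if "j \<in> J"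
    unfolding cols by (rule cotuple_inj[OF X y(2) col that])
qed

text \<open>Matrix times column vector. A matrix restricted to an injection is such a tuple, so
  cocycle and intertwining conditions can be evaluated one column at a time.\<close>

lemma matmor_tuple:
  assumes X: "biproduct C J X P \<iota>X \<pi>X" and Y: "biproduct C I Y Q \<iota>Y \<pi>Y"
    and f: "\<forall>i\<in>I. \<forall>j\<in>J. f i j \<in> mor C (X j) (Y i)" and W: "W \<in> Obj C" and w: "\<forall>j\<in>J. w j \<in> mor C W (X j)"
  shows "matmor C \<iota>Y I f J \<pi>X \<cdot> (\<Sum>j\<in>J. \<iota>X j \<cdot> w j) = (\<Sum>i\<in>I. \<iota>Y i \<cdot> (\<Sum>j\<in>J. f i j \<cdot> w j))"
proof -
  note x = biproductD[OF X] and y = biproductD[OF Y] and m = matmor[OF X Y f]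
  have "matmor C \<iota>Y I f J \<pi>X \<cdot> (\<Sum>j\<in>J. \<iota>X j \<cdot> w j) = (\<Sum>j\<in>J. matmor C \<iota>Y I f J \<pi>X \<cdot> (\<iota>X j \<cdot> w j))"
    by (rule comp_sum_right[OF m(1) W]) (use x(4) w in blast)
  also have "\<dots> = (\<Sum>j\<in>J. \<Sum>i\<in>I. \<iota>Y i \<cdot> (f i j \<cdot> w j))"
  proof (rule sum.cong[OF refl])
    fix j assume j: "j \<in> J"
    have fj: "f i j \<in> mor C (X j) (Y i)" if "i \<in> I" for i
      using f j that by blast
    have wj: "w j \<in> mor C W (X j)"
      using w j by blast
    have "matmor C \<iota>Y I f J \<pi>X \<cdot> (\<iota>X j \<cdot> w j) = (\<Sum>i\<in>I. \<iota>Y i \<cdot> f i j) \<cdot> w j"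
      using comp_assoc[OF wj x(4)[OF j] m(1)] m(3)[OF j] by simp
    also have "\<dots> = (\<Sum>i\<in>I. \<iota>Y i \<cdot> (f i j \<cdot> w j))"
      by (rule tuple_comp[OF Y wj fj])
    finally show "matmor C \<iota>Y I f J \<pi>X \<cdot> (\<iota>X j \<cdot> w j) = (\<Sum>i\<in>I. \<iota>Y i \<cdot> (f i j \<cdot> w j))" .
  qed
  also have "\<dots> = (\<Sum>i\<in>I. \<Sum>j\<in>J. \<iota>Y i \<cdot> (f i j \<cdot> w j))"
    by (rule sum.swap)
  also have "\<dots> = (\<Sum>i\<in>I. \<iota>Y i \<cdot> (\<Sum>j\<in>J. f i j \<cdot> w j))"
    by (rule sum.cong[OF refl], rule comp_sum_right[symmetric, OF y(4) W]) (use f w in blast)+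
  finally show ?thesis .
qed

end

section \<open>Additive subcategories\<close>

context k_category
begin

section \<open>Reindexing, nesting and splitting of biproducts\<close>

lemma biproduct_reindex:
  assumes e: "bij_betw e J I" and b: "biproduct C I X P \<iota> \<pi>"
  shows "biproduct C J (\<lambda>j. X (e j)) P (\<lambda>j. \<iota> (e j)) (\<lambda>j. \<pi> (e j))"
proof -
  note b = biproductD[OF b]
  have eI: "e j \<in> I" if "j \<in> J" for j
    using e that by (auto simp: bij_betw_def)
  have "(\<Sum>j\<in>J. \<iota> (e j) \<cdot> \<pi> (e j)) = idm C P"
    using sum.reindex_bij_betw[OF e, of "\<lambda>i. \<iota> i \<cdot> \<pi> i"] b(7) by simp
  moreover have "e i = e j \<longleftrightarrow> i = j" if "i \<in> J" "j \<in> J" for i j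
    using e that by (auto simp: bij_betw_def inj_on_def)
  ultimately show ?thesis
    by (intro biproductI) (use b eI bij_betw_finite[OF e] in auto)
qed

lemma biproduct_cong:
  assumes "\<And>i. i \<in> I \<Longrightarrow> X i = X' i" "\<And>i. i \<in> I \<Longrightarrow> \<iota> i = \<iota>' i" "\<And>i. i \<in> I \<Longrightarrow> \<pi> i = \<pi>' i"
  shows "biproduct C I X P \<iota> \<pi> \<longleftrightarrow> biproduct C I X' P \<iota>' \<pi>'"
  unfolding biproduct_def using assms by (auto cong: sum.cong)

text \<open>An isomorphism is a one-term direct sum decomposition of its target, so results on
  summands also cover isomorphic copies.\<close>

lemma biproduct_singleton:
  assumes "is_iso C (X i) Y f" "X i \<in> Obj C" "Y \<in> Obj C"
  shows "biproduct C {i} X Y (\<lambda>_. f) (\<lambda>_. inv_mor C (X i) Y f)"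
  by (rule biproductI) (use inv_mor[OF assms] assms in \<open>auto simp: is_iso_iff\<close>)

text \<open>Orthogonality is decided from the outside in: the factor
  \<open>\<pi>Q k \<cdot> \<iota>Q i\<close> in the middle vanishes unless i = k, and then it is an
  identity, which leaves the inner decomposition of P i.\<close>

lemma biproduct_Sigma:
  assumes Q: "biproduct C I P Q \<iota>Q \<pi>Q"
    and P: "\<And>i. i \<in> I \<Longrightarrow> biproduct C (J i) (Y i) (P i) (\<iota> i) (\<pi> i)"
  shows "biproduct C (Sigma I J) (\<lambda>(i, j). Y i j) Q (\<lambda>(i, j). \<iota>Q i \<cdot> \<iota> i j) (\<lambda>(i, j). \<pi> i j \<cdot> \<pi>Q i)"
proof -
  note q = biproductD[OF Q]
  note p = biproductD[OF P]
  have inj: "\<iota>Q i \<cdot> \<iota> i j \<in> mor C (Y i j) Q" and proj: "\<pi> i j \<cdot> \<pi>Q i \<in> mor C Q (Y i j)"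
    if "i \<in> I" "j \<in> J i" for i j
    using that q(4,5) p(4,5) by blast+
  show ?thesis
  proof (rule biproductI)
    show "finite (Sigma I J)"
      using q(1) p(1) by simp
    show "Q \<in> Obj C"
      by (rule q(2))
    fix x assume x: "x \<in> Sigma I J"
    then obtain i j where x: "x = (i, j)" "i \<in> I" "j \<in> J i"
      by auto
    then show "(case x of (i, j) \<Rightarrow> \<iota>Q i \<cdot> \<iota> i j) \<in> mor C (case x of (i, j) \<Rightarrow> Y i j) Q"
      "(case x of (i, j) \<Rightarrow> \<pi> i j \<cdot> \<pi>Q i) \<in> mor C Q (case x of (i, j) \<Rightarrow> Y i j)"
      using inj proj by auto
    fix y assume "y \<in> Sigma I J"
    then obtain k l where y: "y = (k, l)" "k \<in> I" "l \<in> J k"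
      by auto
    have "(\<pi> k l \<cdot> \<pi>Q k) \<cdot> (\<iota>Q i \<cdot> \<iota> i j) = \<pi> k l \<cdot> ((\<pi>Q k \<cdot> \<iota>Q i) \<cdot> \<iota> i j)"
      using comp_assoc[OF inj[OF x(2,3)] q(5)[OF y(2)] p(5)[OF y(2,3)]]
        comp_assoc[OF p(4)[OF x(2,3)] q(4)[OF x(2)] q(5)[OF y(2)]] by simp
    also have "\<dots> = (if (i, j) = (k, l) then idm C (Y i j) else 0)"
    proof (cases "i = k")
      case True
      then show ?thesis
        using q(6)[OF x(2) y(2)] p(6)[OF x(2,3), of l] y idm_comp[OF p(4)[OF x(2,3)]] by simp
    next
      case False
      then show ?thesis
        using q(6)[OF x(2) y(2)] comp_zero_left[OF p(4)[OF x(2,3)]] comp_zero_right[OF p(5)[OF y(2,3)]]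
        by simp
    qed
    finally show "(case y of (i, j) \<Rightarrow> \<pi> i j \<cdot> \<pi>Q i) \<cdot> (case x of (i, j) \<Rightarrow> \<iota>Q i \<cdot> \<iota> i j) =
        (if x = y then idm C (case x of (i, j) \<Rightarrow> Y i j) else 0)"
      by (simp add: x y)
  next
    have "(\<Sum>j\<in>J i. (\<iota>Q i \<cdot> \<iota> i j) \<cdot> (\<pi> i j \<cdot> \<pi>Q i)) = \<iota>Q i \<cdot> \<pi>Q i" if i: "i \<in> I" for i
    proof -
      have "(\<Sum>j\<in>J i. (\<iota>Q i \<cdot> \<iota> i j) \<cdot> (\<pi> i j \<cdot> \<pi>Q i)) = (\<Sum>j\<in>J i. \<iota>Q i \<cdot> ((\<iota> i j \<cdot> \<pi> i j) \<cdot> \<pi>Q i))"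
      proof (rule sum.cong[OF refl])
        fix j assume j: "j \<in> J i"
        show "(\<iota>Q i \<cdot> \<iota> i j) \<cdot> (\<pi> i j \<cdot> \<pi>Q i) = \<iota>Q i \<cdot> ((\<iota> i j \<cdot> \<pi> i j) \<cdot> \<pi>Q i)"
          using comp_assoc[OF proj[OF i j] p(4)[OF i j] q(4)[OF i]]
            comp_assoc[OF q(5)[OF i] p(5)[OF i j] p(4)[OF i j]] by simp
      qed
      also have "\<dots> = \<iota>Q i \<cdot> (\<Sum>j\<in>J i. (\<iota> i j \<cdot> \<pi> i j) \<cdot> \<pi>Q i)"
        by (rule comp_sum_right[symmetric, OF q(4)[OF i] q(2)])
          (use i p(4)[OF i] p(5)[OF i] q(5) in blast)
      also have "(\<Sum>j\<in>J i. (\<iota> i j \<cdot> \<pi> i j) \<cdot> \<pi>Q i) = (\<Sum>j\<in>J i. \<iota> i j \<cdot> \<pi> i j) \<cdot> \<pi>Q i"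
        by (rule comp_sum_left[symmetric, OF q(5)[OF i] q(3)[OF i]])
          (use i p(4)[OF i] p(5)[OF i] in blast)
      finally show ?thesis
        using p(7)[OF i] idm_comp[OF q(5)[OF i]] by simp
    qed
    then show "(\<Sum>x\<in>Sigma I J. (case x of (i, j) \<Rightarrow> \<iota>Q i \<cdot> \<iota> i j) \<cdot> (case x of (i, j) \<Rightarrow> \<pi> i j \<cdot> \<pi>Q i)) =
        idm C Q"
      using sum.Sigma[of I J "\<lambda>i j. (\<iota>Q i \<cdot> \<iota> i j) \<cdot> (\<pi> i j \<cdot> \<pi>Q i)"] q(1,7) p(1)
      by (simp add: split_def)
  qed
qed

text \<open>Q is included in P component by component, and P is projected to Q by forgetting the
  components outside J; likewise for R and K. All required products of these maps can be read off on
  injections.\<close>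

lemma biproduct_split:
  assumes P: "biproduct C I X P \<iota> \<pi>" and JK: "I = J \<union> K" "J \<inter> K = {}"
    and Q: "biproduct C J X Q \<iota>' \<pi>'" and R: "biproduct C K X R \<iota>'' \<pi>''"
  shows "biproduct C (UNIV :: bool set) (case_bool Q R) P
    (case_bool (\<Sum>j\<in>J. \<iota> j \<cdot> \<pi>' j) (\<Sum>k\<in>K. \<iota> k \<cdot> \<pi>'' k))
    (case_bool (\<Sum>j\<in>J. \<iota>' j \<cdot> \<pi> j) (\<Sum>k\<in>K. \<iota>'' k \<cdot> \<pi> k))"
proof -
  note p = biproductD[OF P] and q = biproductD[OF Q] and r = biproductD[OF R]
  \<comment> \<open>\<open>inj\<close> and \<open>proj\<close> treat the sub-sum over an arbitrary L
    contained in I; both are then used for J and for K.\<close>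
  have inj: "(\<Sum>j\<in>L. \<iota> j \<cdot> p j) \<in> mor C S P \<and> (\<forall>j\<in>L. (\<Sum>j\<in>L. \<iota> j \<cdot> p j) \<cdot> u j = \<iota> j)"
    if L: "L \<subseteq> I" and S: "biproduct C L X S u p" for L S u p
    using cotuple_mor[OF S p(2), of \<iota>] cotuple_inj[OF S p(2), of \<iota>] p(4) L by blast
  have proj: "(\<Sum>j\<in>L. u j \<cdot> \<pi> j) \<in> mor C P S \<and> (\<forall>i\<in>I. (\<Sum>j\<in>L. u j \<cdot> \<pi> j) \<cdot> \<iota> i = (if i \<in> L then u i else 0))"
    if L: "L \<subseteq> I" and S: "biproduct C L X S u p" for L S u p
  proof (intro conjI ballI)
    note s = biproductD[OF S]
    show "(\<Sum>j\<in>L. u j \<cdot> \<pi> j) \<in> mor C P S"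
      by (rule tuple_mor[OF S p(2)]) (use p(5) L in blast)
    fix i assume i: "i \<in> I"
    have "(\<Sum>j\<in>L. u j \<cdot> \<pi> j) \<cdot> \<iota> i = (\<Sum>j\<in>L. u j \<cdot> (\<pi> j \<cdot> \<iota> i))"
      by (rule tuple_comp[OF S p(4)[OF i]]) (use p(5) L in blast)
    also have "\<dots> = (\<Sum>j\<in>L. if j = i then u i else 0)"
    proof (rule sum.cong[OF refl])
      fix j assume j: "j \<in> L"
      then show "u j \<cdot> (\<pi> j \<cdot> \<iota> i) = (if j = i then u i else 0)"
        using p(6)[OF i, of j] L comp_idm[OF s(4)[OF j]] comp_zero_right[OF s(4)[OF j]] by auto
    qed
    finally show "(\<Sum>j\<in>L. u j \<cdot> \<pi> j) \<cdot> \<iota> i = (if i \<in> L then u i else 0)"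
      using s(1) by simp
  qed
  have J: "J \<subseteq> I" and K: "K \<subseteq> I"
    using JK by auto
  note iJ = inj[OF J Q] and iK = inj[OF K R] and pJ = proj[OF J Q] and pK = proj[OF K R]
  let ?iJ = "\<Sum>j\<in>J. \<iota> j \<cdot> \<pi>' j" and ?iK = "\<Sum>k\<in>K. \<iota> k \<cdot> \<pi>'' k"
  let ?pJ = "\<Sum>j\<in>J. \<iota>' j \<cdot> \<pi> j" and ?pK = "\<Sum>k\<in>K. \<iota>'' k \<cdot> \<pi> k"
  have m: "?iJ \<in> mor C Q P" "?iK \<in> mor C R P" "?pJ \<in> mor C P Q" "?pK \<in> mor C P R"
    using iJ iK pJ pK by auto
  have JJ: "?pJ \<cdot> ?iJ = idm C Q"
  proof (rule biproduct_inj_ext[OF Q])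
    fix i assume "i \<in> J"
    then show "(?pJ \<cdot> ?iJ) \<cdot> \<iota>' i = idm C Q \<cdot> \<iota>' i"
      using comp_assoc[OF q(4) m(1,3)] iJ pJ J idm_comp[OF q(4)] by auto
  qed (use m q(2) in auto)
  have KK: "?pK \<cdot> ?iK = idm C R"
  proof (rule biproduct_inj_ext[OF R])
    fix i assume "i \<in> K"
    then show "(?pK \<cdot> ?iK) \<cdot> \<iota>'' i = idm C R \<cdot> \<iota>'' i"
      using comp_assoc[OF r(4) m(2,4)] iK pK K idm_comp[OF r(4)] by auto
  qed (use m r(2) in auto)
  have KJ: "?pK \<cdot> ?iJ = 0"
  proof (rule biproduct_inj_ext[OF Q])
    fix i assume "i \<in> J"
    then show "(?pK \<cdot> ?iJ) \<cdot> \<iota>' i = 0 \<cdot> \<iota>' i"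
      using comp_assoc[OF q(4) m(1,4)] iJ pK J JK comp_zero_left[OF q(4)] by auto
  qed (use m q(2) r(2) in auto)
  have JK': "?pJ \<cdot> ?iK = 0"
  proof (rule biproduct_inj_ext[OF R])
    fix i assume "i \<in> K"
    then show "(?pJ \<cdot> ?iK) \<cdot> \<iota>'' i = 0 \<cdot> \<iota>'' i"
      using comp_assoc[OF r(4) m(2,3)] iK pJ K JK comp_zero_left[OF r(4)] by auto
  qed (use m q(2) r(2) in auto)
  have PP: "?iJ \<cdot> ?pJ + ?iK \<cdot> ?pK = idm C P"
  proof (rule biproduct_inj_ext[OF P])
    fix i assume i: "i \<in> I"
    have "(?iJ \<cdot> ?pJ + ?iK \<cdot> ?pK) \<cdot> \<iota> i = ?iJ \<cdot> (?pJ \<cdot> \<iota> i) + ?iK \<cdot> (?pK \<cdot> \<iota> i)"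
      using comp_add_left[OF p(4)[OF i] mor_comp[OF m(3,1)] mor_comp[OF m(4,2)]]
        comp_assoc[OF p(4)[OF i] m(3,1)] comp_assoc[OF p(4)[OF i] m(4,2)] by simp
    also have "\<dots> = \<iota> i"
      using i pJ pK iJ iK JK comp_zero_right[OF m(1)] comp_zero_right[OF m(2)] by auto
    finally show "(?iJ \<cdot> ?pJ + ?iK \<cdot> ?pK) \<cdot> \<iota> i = idm C P \<cdot> \<iota> i"
      using idm_comp[OF p(4)[OF i]] by simp
  qed (use m p(2) in auto)
  show ?thesis
    by (rule biproductI) (use m p(2) JJ KK KJ JK' PP in \<open>auto split: bool.splits simp: UNIV_bool add.commute\<close>)
qed

lemma is_summand_Obj: "is_summand C X P \<Longrightarrow> X \<in> Obj C \<and> P \<in> Obj C"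
  using biproductD(2) biproductD(3)[of UNIV "case_bool X _" P _ _ True]
  unfolding is_summand_def is_direct_sum_def by (metis UNIV_I bool.case(1))

lemma AddD:
  assumes "\<T> \<in> Add C"
  shows "\<T> \<subseteq> Obj C" "\<lbrakk>\<And>i. i < n \<Longrightarrow> X i \<in> \<T>; is_direct_sum C {..<n::nat} X P\<rbrakk> \<Longrightarrow> P \<in> \<T>"
    "\<lbrakk>X0 \<in> \<T>; Y \<in> Obj C; isomorphic C X0 Y\<rbrakk> \<Longrightarrow> Y \<in> \<T>" "\<lbrakk>P \<in> \<T>; is_summand C Y P\<rbrakk> \<Longrightarrow> Y \<in> \<T>"
proof -
  note a = assms[unfolded Add_def mem_Collect_eq]
  note * = conjunct1[OF a] conjunct1[OF conjunct2[OF a]] conjunct1[OF conjunct2[OF conjunct2[OF a]]]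
    conjunct2[OF conjunct2[OF conjunct2[OF a]]]
  show "\<T> \<subseteq> Obj C"
    by (rule *(1))
  show "P \<in> \<T>" if "\<And>i. i < n \<Longrightarrow> X i \<in> \<T>" "is_direct_sum C {..<n::nat} X P"
    using *(2)[rule_format, OF that] .
  show "Y \<in> \<T>" if "X0 \<in> \<T>" "Y \<in> Obj C" "isomorphic C X0 Y"
    using *(3) that by simp
  show "Y \<in> \<T>" if "P \<in> \<T>" "is_summand C Y P"
    using *(4)[rule_format, OF that] .
qed

text \<open>\<open>Add\<close> speaks of sums over {..<n} only. Numbering I extends the closure
  property to sums indexed by other finite sets, such as the group.\<close>

lemma Add_biproduct:
  assumes "\<T> \<in> Add C" "biproduct C I X P \<iota> \<pi>" "\<And>i. i \<in> I \<Longrightarrow> X i \<in> \<T>"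
  shows "P \<in> \<T>"
proof -
  have "finite I"
    using biproductD(1)[OF assms(2)] .
  then obtain e where e: "bij_betw e {..<card I} I"
    using ex_bij_betw_nat_finite[of I] by (auto simp: lessThan_atLeast0)
  show ?thesis
  proof (rule AddD(2)[OF assms(1)])
    show "is_direct_sum C {..<card I} (\<lambda>j. X (e j)) P"
      unfolding is_direct_sum_def using biproduct_reindex[OF e assms(2)] by blast
    show "X (e j) \<in> \<T>" if "j < card I" for j
      using e that assms(3) by (auto simp: bij_betw_def)
  qed
qed

section \<open>Additive closures\<close>

lemma add_closure_minimal:
  assumes "\<T> \<in> Add C" "S \<subseteq> \<T>"
  shows "add_closure C S \<subseteq> \<T>"
  unfolding add_closure_def using AddD[OF assms(1)] assms(2) by blast

lemma add_closure_subset_Obj: "add_closure C S \<subseteq> Obj C"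
  by (auto simp: add_closure_def)

lemma add_closureI:
  assumes "biproduct C I Y P \<iota> \<pi>" "\<And>i. i \<in> I \<Longrightarrow> Y i \<in> S" "is_summand C X P"
  shows "X \<in> add_closure C S"
proof -
  have "finite I"
    using biproductD(1)[OF assms(1)] .
  then obtain e where e: "bij_betw e {..<card I} I"
    using ex_bij_betw_nat_finite[of I] by (auto simp: lessThan_atLeast0)
  have "is_direct_sum C {..<card I} (\<lambda>j. Y (e j)) P"
    unfolding is_direct_sum_def using biproduct_reindex[OF e assms(1)] by blast
  moreover have "Y (e j) \<in> S" if "j < card I" for j
    using e that assms(2) by (auto simp: bij_betw_def)
  ultimately show ?thesis
    unfolding add_closure_def using is_summand_Obj[OF assms(3)] assms(3)
    by (intro CollectI conjI exI[of _ "card I"] exI[of _ "\<lambda>j. Y (e j)"] exI[of _ P]) auto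
qed

end

context additive_k_category
begin

lemma biproduct_exists:
  assumes "finite I" "\<And>i. i \<in> I \<Longrightarrow> X i \<in> Obj C"
  shows "\<exists>P \<iota> \<pi>. biproduct C I X P \<iota> \<pi>"
proof -
  obtain e where e: "bij_betw e I {..<card I}"
    using ex_bij_betw_finite_nat[OF assms(1)] by (auto simp: lessThan_atLeast0)
  define d where "d = inv_into I e"
  have d: "d (e i) = i" if "i \<in> I" for i
    using e that by (auto simp: d_def bij_betw_def)
  have "d j \<in> I" if "j < card I" for j
    using e that unfolding d_def bij_betw_def by (metis inv_into_into lessThan_iff)
  then obtain P \<iota> \<pi> where "biproduct C {..<card I} (\<lambda>j. X (d j)) P \<iota> \<pi>"
    using direct_sums[of "card I" "\<lambda>j. X (d j)"] assms(2) by (auto simp: is_direct_sum_def)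
  from biproduct_reindex[OF e this] have "biproduct C I X P (\<lambda>i. \<iota> (e i)) (\<lambda>i. \<pi> (e i))"
    using biproduct_cong[of I "\<lambda>i. X (d (e i))" X] d by auto
  then show ?thesis
    by blast
qed

lemma biproduct_dsum:
  assumes "finite I" "\<And>i. i \<in> I \<Longrightarrow> X i \<in> Obj C" "dsum C I X = (P, \<iota>, \<pi>)"
  shows "biproduct C I X P \<iota> \<pi>"
proof -
  obtain P' \<iota>' \<pi>' where "biproduct C I X P' \<iota>' \<pi>'"
    using biproduct_exists[of I X, OF assms(1,2)] by blast
  then have "case dsum C I X of (P, \<iota>, \<pi>) \<Rightarrow> biproduct C I X P \<iota> \<pi>"
    unfolding dsum_def
    by (intro someI[where P = "\<lambda>(P, \<iota>, \<pi>). biproduct C I X P \<iota> \<pi>" and x = "(P', \<iota>', \<pi>')"]) simp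
  then show ?thesis
    by (simp add: assms(3))
qed

text \<open>A complement of Q is a direct sum over I - J.\<close>

lemma sub_biproduct_summand:
  assumes P: "biproduct C I X P \<iota> \<pi>" and J: "J \<subseteq> I" and Q: "biproduct C J X Q \<iota>' \<pi>'"
  shows "is_summand C Q P"
proof -
  obtain R \<iota>'' \<pi>'' where R: "biproduct C (I - J) X R \<iota>'' \<pi>''"
    using biproduct_exists[of "I - J" X] biproductD(1,3)[OF P] by blast
  have "biproduct C (UNIV :: bool set) (case_bool Q R) P
    (case_bool (\<Sum>j\<in>J. \<iota> j \<cdot> \<pi>' j) (\<Sum>k\<in>I - J. \<iota> k \<cdot> \<pi>'' k))
    (case_bool (\<Sum>j\<in>J. \<iota>' j \<cdot> \<pi> j) (\<Sum>k\<in>I - J. \<iota>'' k \<cdot> \<pi> k))"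
    by (rule biproduct_split[OF P _ _ Q R]) (use J in auto)
  then show ?thesis
    unfolding is_summand_def is_direct_sum_def by blast
qed

text \<open>Y is allowed to be only isomorphic to a component. This is how X is recognised as a
  summand of its orbit object, whose component at the neutral element is 1 \<otimes> X.\<close>

lemma component_summand:
  assumes P: "biproduct C I X P \<iota> \<pi>" and i: "i \<in> I"
    and Y: "isomorphic C (X i) Y" "Y \<in> Obj C"
  shows "is_summand C Y P"
proof -
  obtain f where f: "is_iso C (X i) Y f"
    using Y by (auto simp: isomorphic_def)
  show ?thesis
    by (rule sub_biproduct_summand[OF P _ biproduct_singleton[where X = X and i = i, OF f]])
      (use i Y biproductD(3)[OF P] in auto)
qed

lemma isomorphic_refl: "X \<in> Obj C \<Longrightarrow> isomorphic C X X"
  using is_iso_idm isomorphicI by blast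

lemma is_summand_trans:
  assumes "is_summand C X P" "is_summand C P R"
  shows "is_summand C X R"
proof -
  obtain X' \<iota> \<pi> where X: "biproduct C (UNIV :: bool set) (case_bool X X') P \<iota> \<pi>"
    using assms(1) by (auto simp: is_summand_def is_direct_sum_def)
  obtain P' \<iota>' \<pi>' where P: "biproduct C (UNIV :: bool set) (case_bool P P') R \<iota>' \<pi>'"
    using assms(2) by (auto simp: is_summand_def is_direct_sum_def)
  have P': "P' \<in> Obj C"
    using biproductD(3)[OF P, of False] by simp
  \<comment> \<open>R = P + P' is refined over pairs: P is replaced by X + X', while P' is kept as a
    one-term sum. X then has the index (True, True).\<close>
  have b: "biproduct C (if b then UNIV else {True}) (if b then case_bool X X' else (\<lambda>_. P'))
      (case_bool P P' b) (if b then \<iota> else (\<lambda>_. idm C P')) (if b then \<pi> else (\<lambda>_. inv_mor C P' P' (idm C P')))" for b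
    using X biproduct_singleton[of "\<lambda>_. P'" True P' "idm C P'"] is_iso_idm[OF P'] P' by (cases b) auto
  show ?thesis
    by (rule component_summand[OF biproduct_Sigma[OF P b], of "(True, True)"])
      (use is_summand_Obj assms(1) isomorphic_refl in auto)
qed

lemma add_closure_Add:
  assumes S: "S \<subseteq> Obj C"
  shows "add_closure C S \<in> Add C"
  unfolding Add_def
proof (intro CollectI conjI allI impI ballI)
  show "add_closure C S \<subseteq> Obj C"
    by (rule add_closure_subset_Obj)
next
  fix X Y assume X: "X \<in> add_closure C S" and Y: "Y \<in> Obj C" "isomorphic C X Y"
  obtain n :: nat and Z P where Z: "\<forall>i<n. Z i \<in> S" "is_direct_sum C {..<n} Z P" "is_summand C X P"
    using X by (auto simp: add_closure_def)
  obtain X' \<iota> \<pi> where b: "biproduct C (UNIV :: bool set) (case_bool X X') P \<iota> \<pi>"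
    using Z(3) by (auto simp: is_summand_def is_direct_sum_def)
  have "is_summand C Y P"
    by (rule component_summand[OF b, of True]) (use Y in auto)
  then show "Y \<in> add_closure C S"
    using Z Y by (auto simp: add_closure_def)
next
  fix P X assume P: "P \<in> add_closure C S" and X: "is_summand C X P"
  then show "X \<in> add_closure C S"
    using is_summand_trans[OF X] is_summand_Obj[OF X] by (auto simp: add_closure_def)
next
  fix n :: nat and X P
  assume X: "\<forall>i<n. X i \<in> add_closure C S" and P: "is_direct_sum C {..<n} X P"
  have "\<forall>i\<in>{..<n}. \<exists>m Z Q \<iota> \<pi> X' \<iota>' \<pi>'. (\<forall>j<m. Z j \<in> S) \<and> biproduct C {..<m::nat} Z Q \<iota> \<pi> \<and>
      biproduct C (UNIV :: bool set) (case_bool (X i) X') Q \<iota>' \<pi>'"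
    using X unfolding add_closure_def is_summand_def is_direct_sum_def by blast
  then obtain m Z Q \<iota> \<pi> X' \<iota>' \<pi>' where Z: "\<And>i j. i < n \<Longrightarrow> j < m i \<Longrightarrow> Z i j \<in> S"
    and Q: "\<And>i. i \<in> {..<n} \<Longrightarrow> biproduct C {..<m i::nat} (Z i) (Q i) (\<iota> i) (\<pi> i)"
    and Q': "\<And>i. i \<in> {..<n} \<Longrightarrow> biproduct C (UNIV :: bool set) (case_bool (X i) (X' i)) (Q i) (\<iota>' i) (\<pi>' i)"
    unfolding bchoice_iff by (elim exE) (rule that; blast)
  obtain R \<iota>R \<pi>R where R: "biproduct C {..<n} Q R \<iota>R \<pi>R"
    using biproduct_exists[of "{..<n}" Q] biproductD(2)[OF Q] by blast
  \<comment> \<open>The sum R of the Q i is decomposed in two ways: into the generators Z i j, and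
    into the X i together with their complements X' i. The second shows that P, the part with index
    True, is a summand of R; the first shows that R is a sum of generators.\<close>
  note R1 = biproduct_Sigma[OF R Q] and R2 = biproduct_Sigma[OF R Q']
  obtain \<iota>P \<pi>P where P: "biproduct C {..<n} X P \<iota>P \<pi>P"
    using P by (auto simp: is_direct_sum_def)
  have e: "bij_betw fst ({..<n} \<times> {True}) {..<n}"
    by (auto simp: bij_betw_def inj_on_def image_iff)
  have "biproduct C ({..<n} \<times> {True}) (\<lambda>(i, b). case_bool (X i) (X' i) b) P (\<lambda>x. \<iota>P (fst x)) (\<lambda>x. \<pi>P (fst x))"
    by (rule biproduct_cong[THEN iffD1, OF _ refl refl biproduct_reindex[OF e P]]) auto
  note P' = this
  have "is_summand C P R"
    by (rule sub_biproduct_summand[OF R2 _ P']) auto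
  note PR = this
  show "P \<in> add_closure C S"
    by (rule add_closureI[OF R1 _ PR]) (use Z in auto)
qed

lemma add_closure_superset:
  assumes "S \<subseteq> Obj C"
  shows "S \<subseteq> add_closure C S"
proof
  fix X assume X: "X \<in> S"
  then have X': "X \<in> Obj C"
    using assms by blast
  have b: "biproduct C {()} (\<lambda>_. X) X (\<lambda>_. idm C X) (\<lambda>_. inv_mor C X X (idm C X))"
    by (rule biproduct_singleton) (use X' is_iso_idm in auto)
  show "X \<in> add_closure C S"
    by (rule add_closureI[OF b _ component_summand[OF b]]) (use X X' isomorphic_refl in auto)
qed

end

section \<open>Additive functors and additive subcategories\<close>

locale additive_functor = k_functor C D T + src: additive_k_category C + tgt: additive_k_category D
  for C :: "('k::field, 'o, 'm::ab_group_add, 'y) kcat_scheme"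
    and D :: "('k, 'p, 'n::ab_group_add, 'z) kcat_scheme"
    and T :: "('o, 'm, 'p, 'n) kfunctor"
begin

lemma fmor_mor: "f \<in> mor C X Y \<Longrightarrow> fmor T X Y f \<in> mor D (fob T X) (fob T Y)"
  by (auto simp: mor_def fob_Obj fmor_Hom)

lemma fmor_comp: "\<lbrakk>f \<in> mor C X Y; g \<in> mor C Y Z\<rbrakk>
    \<Longrightarrow> fmor T X Z (g \<cdot>\<^bsub>C\<^esub> f) = fmor T Y Z g \<cdot>\<^bsub>D\<^esub> fmor T X Y f"
  by (auto simp: mor_def fmor_cmp)

lemma fmor_plus: "\<lbrakk>f \<in> mor C X Y; g \<in> mor C X Y\<rbrakk> \<Longrightarrow> fmor T X Y (f + g) = fmor T X Y f + fmor T X Y g"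
  by (auto simp: mor_def fmor_add)

lemma fmor_scale: "f \<in> mor C X Y \<Longrightarrow> fmor T X Y (smul C a f) = smul D a (fmor T X Y f)"
  by (auto simp: mor_def fmor_smul)

lemma fmor_zero: "\<lbrakk>X \<in> Obj C; Y \<in> Obj C\<rbrakk> \<Longrightarrow> fmor T X Y 0 = 0"
  using fmor_plus[of 0 X Y 0] src.mor_zero by force

lemma fmor_sum:
  assumes "X \<in> Obj C" "Y \<in> Obj C" "\<And>i. i \<in> I \<Longrightarrow> f i \<in> mor C X Y"
  shows "fmor T X Y (sum f I) = (\<Sum>i\<in>I. fmor T X Y (f i))"
  using assms(3)
proof (induction I rule: infinite_finite_induct)
  case (insert i I)
  then show ?case
    using fmor_plus[of "f i" X Y "sum f I"] assms(1,2) by (simp add: src.mor_sum)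
qed (use assms fmor_zero in auto)

lemma fmor_iso:
  assumes "is_iso C X Y f" "X \<in> Obj C" "Y \<in> Obj C"
  shows "is_iso D (fob T X) (fob T Y) (fmor T X Y f)"
proof -
  note i = src.inv_mor[OF assms]
  have f: "f \<in> mor C X Y"
    using assms by (simp add: src.is_iso_iff)
  show ?thesis
    by (rule tgt.is_isoI[OF fmor_mor[OF f] fmor_mor[OF i(1)]])
      (use fmor_comp[OF f i(1)] fmor_comp[OF i(1) f] i fmor_idm assms in auto)
qed

lemma fob_isomorphic:
  "\<lbrakk>isomorphic C X Y; X \<in> Obj C; Y \<in> Obj C\<rbrakk> \<Longrightarrow> isomorphic D (fob T X) (fob T Y)"
  unfolding isomorphic_def using fmor_iso by blast

lemma fob_biproduct:
  assumes "biproduct C I X P \<iota> \<pi>"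
  shows "biproduct D I (\<lambda>i. fob T (X i)) (fob T P) (\<lambda>i. fmor T (X i) P (\<iota> i)) (\<lambda>i. fmor T P (X i) (\<pi> i))"
proof -
  note b = src.biproductD[OF assms]
  show ?thesis
  proof (rule tgt.biproductI)
    fix i j assume i: "i \<in> I" and j: "j \<in> I"
    show "fmor T P (X j) (\<pi> j) \<cdot>\<^bsub>D\<^esub> fmor T (X i) P (\<iota> i) = (if i = j then idm D (fob T (X i)) else 0)"
      using fmor_comp[OF b(4)[OF i] b(5)[OF j]] b(6)[OF i j] b(3)[OF i] b(3)[OF j]
      by (auto simp: fmor_idm fmor_zero)
  next
    have "(\<Sum>i\<in>I. fmor T (X i) P (\<iota> i) \<cdot>\<^bsub>D\<^esub> fmor T P (X i) (\<pi> i)) = (\<Sum>i\<in>I. fmor T P P (\<iota> i \<cdot>\<^bsub>C\<^esub> \<pi> i))"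
      by (rule sum.cong[OF refl], rule fmor_comp[symmetric]) (use b(4,5) in auto)
    also have "\<dots> = fmor T P P (\<Sum>i\<in>I. \<iota> i \<cdot>\<^bsub>C\<^esub> \<pi> i)"
      by (rule fmor_sum[symmetric]) (use b(2-5) in auto)
    finally show "(\<Sum>i\<in>I. fmor T (X i) P (\<iota> i) \<cdot>\<^bsub>D\<^esub> fmor T P (X i) (\<pi> i)) = idm D (fob T P)"
      using b(2,7) by (simp add: fmor_idm)
  qed (use b(1,2) fob_Obj fmor_mor[OF b(4)] fmor_mor[OF b(5)] in auto)
qed

lemma fob_summand:
  assumes "is_summand C X P"
  shows "is_summand D (fob T X) (fob T P)"
proof -
  obtain X' \<iota> \<pi> where b: "biproduct C (UNIV :: bool set) (case_bool X X') P \<iota> \<pi>"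
    using assms by (auto simp: is_summand_def is_direct_sum_def)
  show ?thesis
    by (rule tgt.component_summand[OF fob_biproduct[OF b], of True])
      (use src.biproductD(3)[OF b, of True] fob_Obj tgt.isomorphic_refl in auto)
qed

text \<open>Preimages bound \<open>add_image\<close> from above: by minimality of the additive
  closure it is enough to place the generators in a preimage.\<close>

lemma vimage_Add:
  assumes "\<S> \<in> Add D"
  shows "{X \<in> Obj C. fob T X \<in> \<S>} \<in> Add C"
  unfolding Add_def
proof (intro CollectI conjI allI impI ballI)
  fix n :: nat and X P
  assume X: "\<forall>i<n. X i \<in> {X \<in> Obj C. fob T X \<in> \<S>}" and P: "is_direct_sum C {..<n} X P"
  then obtain \<iota> \<pi> where b: "biproduct C {..<n} X P \<iota> \<pi>"
    by (auto simp: is_direct_sum_def)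
  show "P \<in> Obj C"
    using src.biproductD(2)[OF b] .
  show "fob T P \<in> \<S>"
    by (rule tgt.Add_biproduct[OF assms fob_biproduct[OF b]]) (use X in auto)
next
  fix X Y assume "X \<in> {X \<in> Obj C. fob T X \<in> \<S>}" "Y \<in> Obj C" "isomorphic C X Y"
  then show "Y \<in> Obj C" "fob T Y \<in> \<S>"
    using tgt.AddD(3)[OF assms, of "fob T X" "fob T Y"] fob_isomorphic fob_Obj by auto
next
  fix P X assume P: "P \<in> {X \<in> Obj C. fob T X \<in> \<S>}" and X: "is_summand C X P"
  show "X \<in> Obj C" "fob T X \<in> \<S>"
    using tgt.AddD(4)[OF assms _ fob_summand[OF X]] src.is_summand_Obj[OF X] P by blast+
qed auto

text \<open>Each inclusion is minimality of an additive closure; the first one is tested in the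
  preimage under T. For a singleton S this makes finite generation pass to images.\<close>

lemma add_image_add_closure:
  assumes "S \<subseteq> Obj C"
  shows "add_image D T (add_closure C S) = add_closure D (fob T ` S)"
proof
  have "fob T ` S \<subseteq> Obj D"
    using assms fob_Obj by blast
  note D = tgt.add_closure_Add[OF this] and sup = tgt.add_closure_superset[OF this]
  have "add_closure C S \<subseteq> {X \<in> Obj C. fob T X \<in> add_closure D (fob T ` S)}"
    by (rule src.add_closure_minimal[OF vimage_Add[OF D]]) (use assms sup in auto)
  then show "add_image D T (add_closure C S) \<subseteq> add_closure D (fob T ` S)"
    unfolding add_image_def by (intro tgt.add_closure_minimal[OF D]) auto
  have Obj: "fob T ` add_closure C S \<subseteq> Obj D"
    using src.add_closure_subset_Obj fob_Obj by blast
  show "add_closure D (fob T ` S) \<subseteq> add_image D T (add_closure C S)"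
    unfolding add_image_def
    by (rule tgt.add_closure_minimal[OF tgt.add_closure_Add[OF Obj]])
      (use src.add_closure_superset[OF assms] tgt.add_closure_superset[OF Obj] in auto)
qed

end

section \<open>Conflations\<close>

text \<open>An elementary form of the vanishing of \<open>Ext1 C X Y\<close>. It asks for sections
  of p, whereas \<open>ext_zero\<close> asks for retractions of i: sections are what lifting along
  pullbacks and averaging produce.\<close>

definition ext_vanishes :: "('k, 'o, 'm, 'z) excat_scheme \<Rightarrow> 'o \<Rightarrow> 'o \<Rightarrow> bool" where
  "ext_vanishes C X Y \<longleftrightarrow>
     (\<forall>E i p. confl C Y E X i p \<longrightarrow> (\<exists>s\<in>mor C X E. p \<cdot>\<^bsub>C\<^esub> s = idm C X))"

context k_category
begin

section \<open>Kernels, cokernels and pullbacks, with existence and uniqueness separated\<close>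

lemma is_kernelI:
  assumes "i \<in> mor C A E" "p \<in> mor C E B" "p \<cdot> i = 0"
    and "\<And>W f. \<lbrakk>f \<in> mor C W E; p \<cdot> f = 0\<rbrakk> \<Longrightarrow> \<exists>h\<in>mor C W A. i \<cdot> h = f"
    and "\<And>W h h'. \<lbrakk>h \<in> mor C W A; h' \<in> mor C W A; i \<cdot> h = i \<cdot> h'\<rbrakk> \<Longrightarrow> h = h'"
  shows "is_kernel C A E B i p"
  unfolding is_kernel_def
proof (intro conjI ballI impI)
  fix W f assume f: "W \<in> Obj C" "f \<in> Hom C W E" "p \<cdot> f = 0"
  obtain h where h: "h \<in> mor C W A" "i \<cdot> h = f"
    using assms(4)[of f W] f morD[OF assms(1)] by (auto simp: mor_def)
  show "\<exists>!h. h \<in> Hom C W A \<and> i \<cdot> h = f"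
  proof (rule ex1I[of _ h])
    show "h \<in> Hom C W A \<and> i \<cdot> h = f"
      using h morD by blast
    show "h' = h" if "h' \<in> Hom C W A \<and> i \<cdot> h' = f" for h'
      using assms(5)[of h' W h] h that morD[OF assms(1)] morD[OF h(1)] morI by simp
  qed
qed (use assms morD in blast)+

lemma is_kernelD:
  assumes "is_kernel C A E B i p" "A \<in> Obj C" "E \<in> Obj C" "B \<in> Obj C"
  shows "i \<in> mor C A E" "p \<in> mor C E B" "p \<cdot> i = 0"
    "\<lbrakk>f \<in> mor C W E; p \<cdot> f = 0\<rbrakk> \<Longrightarrow> \<exists>h\<in>mor C W A. i \<cdot> h = f"
    "\<lbrakk>h \<in> mor C W A; h' \<in> mor C W A; i \<cdot> h = i \<cdot> h'\<rbrakk> \<Longrightarrow> h = h'"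
proof -
  have k: "i \<in> Hom C A E" "p \<in> Hom C E B" "p \<cdot> i = 0"
    "\<And>W f. \<lbrakk>W \<in> Obj C; f \<in> Hom C W E; p \<cdot> f = 0\<rbrakk> \<Longrightarrow> \<exists>!h. h \<in> Hom C W A \<and> i \<cdot> h = f"
    using assms(1) by (auto simp: is_kernel_def)
  show i: "i \<in> mor C A E" and p: "p \<in> mor C E B" and pi: "p \<cdot> i = 0"
    using k(1-3) assms morI by auto
  show "\<exists>h\<in>mor C W A. i \<cdot> h = f" if "f \<in> mor C W E" "p \<cdot> f = 0"
    using k(4)[OF morD(2)[OF that(1)] morD(1)[OF that(1)] that(2)] assms(2) morD(2)[OF that(1)] morI
    by blast
  show "h = h'" if h: "h \<in> mor C W A" "h' \<in> mor C W A" "i \<cdot> h = i \<cdot> h'"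
  proof -
    \<comment> \<open>i is monic: p kills i \<cdot> h, so this morphism factors uniquely through i,
      and both h and h' are such factors.\<close>
    have "p \<cdot> (i \<cdot> h) = 0"
      using comp_assoc[OF h(1) i p] pi comp_zero_left[OF h(1)] by simp
    then have "\<exists>!u. u \<in> Hom C W A \<and> i \<cdot> u = i \<cdot> h"
      using k(4)[OF morD(2)[OF h(1)]] mor_comp[OF h(1) i] morD(1) by blast
    then show ?thesis
      using h morD(1) by metis
  qed
qed

lemma is_cokernelD:
  assumes "is_cokernel C A E B i p" "A \<in> Obj C" "E \<in> Obj C" "B \<in> Obj C"
  shows "\<lbrakk>f \<in> mor C E W; f \<cdot> i = 0\<rbrakk> \<Longrightarrow> \<exists>h\<in>mor C B W. h \<cdot> p = f"
    "\<lbrakk>h \<in> mor C B W; h' \<in> mor C B W; h \<cdot> p = h' \<cdot> p\<rbrakk> \<Longrightarrow> h = h'"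
proof -
  have k: "i \<in> Hom C A E" "p \<in> Hom C E B" "p \<cdot> i = 0"
    "\<And>W f. \<lbrakk>W \<in> Obj C; f \<in> Hom C E W; f \<cdot> i = 0\<rbrakk> \<Longrightarrow> \<exists>!h. h \<in> Hom C B W \<and> h \<cdot> p = f"
    using assms(1) by (auto simp: is_cokernel_def)
  have i: "i \<in> mor C A E" and p: "p \<in> mor C E B" and pi: "p \<cdot> i = 0"
    using k(1-3) assms morI by auto
  show "\<exists>h\<in>mor C B W. h \<cdot> p = f" if "f \<in> mor C E W" "f \<cdot> i = 0"
    using k(4)[OF morD(3)[OF that(1)] morD(1)[OF that(1)] that(2)] assms(4) morD(3)[OF that(1)] morI
    by blast
  show "h = h'" if h: "h \<in> mor C B W" "h' \<in> mor C B W" "h \<cdot> p = h' \<cdot> p"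
  proof -
    have "(h \<cdot> p) \<cdot> i = 0"
      using comp_assoc[OF i p h(1)] pi comp_zero_right[OF h(1)] by simp
    then have "\<exists>!u. u \<in> Hom C B W \<and> u \<cdot> p = h \<cdot> p"
      using k(4)[OF morD(3)[OF h(1)]] mor_comp[OF p h(1)] morD(1) by blast
    then show ?thesis
      using h morD(1) by metis
  qed
qed

lemma is_pullbackD:
  assumes "is_pullback C E B E' B' p f p' f'" "E \<in> Obj C" "B \<in> Obj C" "E' \<in> Obj C" "B' \<in> Obj C"
  shows "p \<in> mor C E B" "f \<in> mor C B' B" "p' \<in> mor C E' B'" "f' \<in> mor C E' E" "f \<cdot> p' = p \<cdot> f'"
    "\<lbrakk>u \<in> mor C W B'; v \<in> mor C W E; f \<cdot> u = p \<cdot> v\<rbrakk> \<Longrightarrow> \<exists>h\<in>mor C W E'. p' \<cdot> h = u \<and> f' \<cdot> h = v"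
    "\<lbrakk>h \<in> mor C W E'; h' \<in> mor C W E'; p' \<cdot> h = p' \<cdot> h'; f' \<cdot> h = f' \<cdot> h'\<rbrakk> \<Longrightarrow> h = h'"
proof -
  have k: "p \<in> Hom C E B" "f \<in> Hom C B' B" "p' \<in> Hom C E' B'" "f' \<in> Hom C E' E" "f \<cdot> p' = p \<cdot> f'"
    "\<And>W u v. \<lbrakk>W \<in> Obj C; u \<in> Hom C W B'; v \<in> Hom C W E; f \<cdot> u = p \<cdot> v\<rbrakk>
      \<Longrightarrow> \<exists>!h. h \<in> Hom C W E' \<and> p' \<cdot> h = u \<and> f' \<cdot> h = v"
    using assms(1) by (auto simp: is_pullback_def)
  show p: "p \<in> mor C E B" and f: "f \<in> mor C B' B" and p': "p' \<in> mor C E' B'" and f': "f' \<in> mor C E' E"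
    and e: "f \<cdot> p' = p \<cdot> f'"
    using k(1-5) assms morI by auto
  show "\<exists>h\<in>mor C W E'. p' \<cdot> h = u \<and> f' \<cdot> h = v" if "u \<in> mor C W B'" "v \<in> mor C W E" "f \<cdot> u = p \<cdot> v"
    using k(6)[OF morD(2)[OF that(1)] morD(1)[OF that(1)] morD(1)[OF that(2)] that(3)] assms(4)
      morD(2)[OF that(1)] morI by blast
  show "h = h'" if h: "h \<in> mor C W E'" "h' \<in> mor C W E'" "p' \<cdot> h = p' \<cdot> h'" "f' \<cdot> h = f' \<cdot> h'"
  proof -
    have "f \<cdot> (p' \<cdot> h) = p \<cdot> (f' \<cdot> h)"
      using comp_assoc[OF h(1) p' f] comp_assoc[OF h(1) f' p] e by simp
    then have "\<exists>!u. u \<in> Hom C W E' \<and> p' \<cdot> u = p' \<cdot> h \<and> f' \<cdot> u = f' \<cdot> h"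
      using k(6)[OF morD(2)[OF h(1)]] mor_comp[OF h(1) p'] mor_comp[OF h(1) f'] morD(1) by blast
    then show ?thesis
      using h morD(1) by metis
  qed
qed

lemma is_pullbackI:
  assumes "p \<in> mor C E B" "f \<in> mor C B' B" "p' \<in> mor C E' B'" "f' \<in> mor C E' E" "f \<cdot> p' = p \<cdot> f'"
    and "\<And>W u v. \<lbrakk>u \<in> mor C W B'; v \<in> mor C W E; f \<cdot> u = p \<cdot> v\<rbrakk>
      \<Longrightarrow> \<exists>h\<in>mor C W E'. p' \<cdot> h = u \<and> f' \<cdot> h = v"
    and "\<And>W h h'. \<lbrakk>h \<in> mor C W E'; h' \<in> mor C W E'; p' \<cdot> h = p' \<cdot> h'; f' \<cdot> h = f' \<cdot> h'\<rbrakk> \<Longrightarrow> h = h'"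
  shows "is_pullback C E B E' B' p f p' f'"
  unfolding is_pullback_def
proof (intro conjI ballI impI)
  fix W u v assume W: "W \<in> Obj C" "u \<in> Hom C W B'" "v \<in> Hom C W E" "f \<cdot> u = p \<cdot> v"
  have "u \<in> mor C W B'" "v \<in> mor C W E"
    using W morD[OF assms(1)] morD[OF assms(2)] morI by auto
  then obtain h where h: "h \<in> mor C W E'" "p' \<cdot> h = u" "f' \<cdot> h = v"
    using assms(6) W(4) by blast
  show "\<exists>!h. h \<in> Hom C W E' \<and> p' \<cdot> h = u \<and> f' \<cdot> h = v"
  proof (rule ex1I[of _ h])
    show "h \<in> Hom C W E' \<and> p' \<cdot> h = u \<and> f' \<cdot> h = v"
      using h morD by blast
    show "h' = h" if "h' \<in> Hom C W E' \<and> p' \<cdot> h' = u \<and> f' \<cdot> h' = v" for h'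
      using assms(7)[of h' W h] h that morD[OF h(1)] morI by simp
  qed
qed (use assms(5) morD[OF assms(1)] morD[OF assms(2)] morD[OF assms(3)] morD[OF assms(4)] in auto)

section \<open>Diagonal morphisms between direct sums\<close>

lemma dsum_mor:
  assumes X: "biproduct C I X P \<iota> \<pi>" and Y: "biproduct C I Y Q \<iota>' \<pi>'"
    and f: "\<forall>i\<in>I. f i \<in> mor C (X i) (Y i)"
  shows dsum_mor_mor: "dsum_mor C I \<pi> f \<iota>' \<in> mor C P Q"
    and dsum_mor_inj: "i \<in> I \<Longrightarrow> dsum_mor C I \<pi> f \<iota>' \<cdot> \<iota> i = \<iota>' i \<cdot> f i"
    and proj_dsum_mor: "i \<in> I \<Longrightarrow> \<pi>' i \<cdot> dsum_mor C I \<pi> f \<iota>' = f i \<cdot> \<pi> i"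
proof -
  note x = biproductD[OF X] and y = biproductD[OF Y]
  have c: "\<iota>' i \<cdot> f i \<in> mor C (X i) Q" and r: "f i \<cdot> \<pi> i \<in> mor C P (Y i)" if "i \<in> I" for i
    using that x(5) y(4) f by blast+
  have d: "dsum_mor C I \<pi> f \<iota>' = (\<Sum>i\<in>I. \<iota>' i \<cdot> (f i \<cdot> \<pi> i))"
    unfolding dsum_mor_def by (rule sum.cong[OF refl], rule comp_assoc) (use x(5) y(4) f in blast)+
  show "dsum_mor C I \<pi> f \<iota>' \<in> mor C P Q"
    unfolding dsum_mor_def by (rule cotuple_mor[OF X y(2) c])
  show "dsum_mor C I \<pi> f \<iota>' \<cdot> \<iota> i = \<iota>' i \<cdot> f i" if "i \<in> I"
    unfolding dsum_mor_def by (rule cotuple_inj[OF X y(2) c that])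
  show "\<pi>' i \<cdot> dsum_mor C I \<pi> f \<iota>' = f i \<cdot> \<pi> i" if "i \<in> I"
    unfolding d by (rule proj_tuple[OF Y x(2) r that])
qed

lemma dsum_mor_iso:
  assumes X: "biproduct C I X P \<iota> \<pi>" and Y: "biproduct C I Y Q \<iota>' \<pi>'"
    and f: "\<And>i. i \<in> I \<Longrightarrow> is_iso C (X i) (Y i) (f i)"
  shows "is_iso C P Q (dsum_mor C I \<pi> f \<iota>')"
proof -
  note x = biproductD[OF X] and y = biproductD[OF Y]
  have fm: "f i \<in> mor C (X i) (Y i)" if "i \<in> I" for i
    using f[OF that] x(3) y(3) that by (simp add: is_iso_iff)
  define g where "g i = inv_mor C (X i) (Y i) (f i)" for i
  have g: "g i \<in> mor C (Y i) (X i)" "g i \<cdot> f i = idm C (X i)" "f i \<cdot> g i = idm C (Y i)" if "i \<in> I" for i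
    using inv_mor[OF f[OF that] x(3)[OF that] y(3)[OF that]] by (simp_all add: g_def)
  have "\<forall>i\<in>I. f i \<in> mor C (X i) (Y i)" "\<forall>i\<in>I. g i \<in> mor C (Y i) (X i)"
    using fm g(1) by auto
  note F = dsum_mor[OF X Y this(1)] and G = dsum_mor[OF Y X this(2)]
  show ?thesis
  proof (rule is_isoI[OF F(1) G(1)])
    show "dsum_mor C I \<pi>' g \<iota> \<cdot> dsum_mor C I \<pi> f \<iota>' = idm C P"
    proof (rule biproduct_inj_ext[OF X])
      fix i assume i: "i \<in> I"
      show "(dsum_mor C I \<pi>' g \<iota> \<cdot> dsum_mor C I \<pi> f \<iota>') \<cdot> \<iota> i = idm C P \<cdot> \<iota> i"
        using comp_assoc[OF x(4)[OF i] F(1) G(1)] F(2)[OF i] G(2)[OF i] comp_assoc[OF fm[OF i] y(4)[OF i] G(1)]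
          comp_assoc[OF fm[OF i] g(1)[OF i] x(4)[OF i]] g(2)[OF i] idm_comp[OF x(4)[OF i]] comp_idm[OF x(4)[OF i]]
        by simp
    qed (use F(1) G(1) x(2) in blast)+
    show "dsum_mor C I \<pi> f \<iota>' \<cdot> dsum_mor C I \<pi>' g \<iota> = idm C Q"
    proof (rule biproduct_inj_ext[OF Y])
      fix i assume i: "i \<in> I"
      show "(dsum_mor C I \<pi> f \<iota>' \<cdot> dsum_mor C I \<pi>' g \<iota>) \<cdot> \<iota>' i = idm C Q \<cdot> \<iota>' i"
        using comp_assoc[OF y(4)[OF i] G(1) F(1)] F(2)[OF i] G(2)[OF i] comp_assoc[OF g(1)[OF i] x(4)[OF i] F(1)]
          comp_assoc[OF g(1)[OF i] fm[OF i] y(4)[OF i]] g(3)[OF i] idm_comp[OF y(4)[OF i]] comp_idm[OF y(4)[OF i]]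
        by simp
    qed (use F(1) G(1) y(2) in blast)+
  qed
qed

end

text \<open>The part of the structure of an exact category that is needed to discuss vanishing of \<open>Ext1\<close>; it is
  shared by \<open>C\<close> and the equivariant category.\<close>

locale conflation_category = additive_k_category C
  for C :: "('k::field, 'o, 'm::ab_group_add, 'z) excat_scheme" (structure) +
  assumes conflation_Obj: "confl C A E B i p \<Longrightarrow> A \<in> Obj C \<and> E \<in> Obj C \<and> B \<in> Obj C"
    and conflation_kernel_cokernel: "confl C A E B i p \<Longrightarrow> is_kernel C A E B i p \<and> is_cokernel C A E B i p"
    and split_conflation:
      "biproduct C (UNIV :: bool set) (case_bool Y X) P \<iota> \<pi> \<Longrightarrow> confl C Y P X (\<iota> True) (\<pi> False)"
    and conflation_pullback: "\<lbrakk>confl C A E B i p; f \<in> mor C B' B\<rbrakk>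
        \<Longrightarrow> \<exists>E' i' p' f'. confl C A E' B' i' p' \<and> f' \<in> mor C E' E \<and> f \<cdot> p' = p \<cdot> f'"
begin

lemma conflation_mor:
  assumes "confl C A E B i p"
  shows "i \<in> mor C A E" "p \<in> mor C E B"
  using is_kernelD(1,2) conflation_Obj[OF assms] conflation_kernel_cokernel[OF assms] by blast+

text \<open>Pulling the conflation back along f gives one with end terms Y and X, which splits. A
  section of it followed by E' \<rightarrow> E is the lift.\<close>

lemma ext_vanishes_lift:
  assumes v: "ext_vanishes C X Y" and c: "confl C Y E B i p" and f: "f \<in> mor C X B"
  shows "\<exists>l\<in>mor C X E. p \<cdot> l = f"
proof -
  obtain E' i' p' f' where e: "confl C Y E' X i' p'" "f' \<in> mor C E' E" "f \<cdot> p' = p \<cdot> f'"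
    using conflation_pullback[OF c f] by blast
  obtain s where s: "s \<in> mor C X E'" "p' \<cdot> s = idm C X"
    using v e(1) unfolding ext_vanishes_def by blast
  have "p \<cdot> (f' \<cdot> s) = f"
    using comp_assoc[OF s(1) e(2) conflation_mor(2)[OF c]] comp_assoc[OF s(1) conflation_mor(2)[OF e(1)] f]
      e(3) s(2) comp_idm[OF f] by simp
  then show ?thesis
    using s(1) e(2) by blast
qed

text \<open>1 - i \<cdot> r kills i and so factors through the cokernel p; the factor is s. The two
  further identities make E a biproduct of Y and X.\<close>

lemma section_of_retraction:
  assumes c: "confl C Y E X i p" and r: "r \<in> mor C E Y" "r \<cdot> i = idm C Y"
  shows "\<exists>s\<in>mor C X E. p \<cdot> s = idm C X \<and> s \<cdot> p = idm C E - i \<cdot> r \<and> r \<cdot> s = 0"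
proof -
  note o = conflation_Obj[OF c] and m = conflation_mor[OF c]
  note k = is_kernelD[OF conflation_kernel_cokernel[OF c, THEN conjunct1]]
    and ck = is_cokernelD[OF conflation_kernel_cokernel[OF c, THEN conjunct2]]
  have ir: "i \<cdot> r \<in> mor C E E" and d: "idm C E - i \<cdot> r \<in> mor C E E"
    using m r o by blast+
  have "(idm C E - i \<cdot> r) \<cdot> i = 0"
    using comp_diff_left[OF m(1) _ ir] comp_assoc[OF m(1) r(1) m(1)] r(2) o
      idm_comp[OF m(1)] comp_idm[OF m(1)] mor_idm by simp
  then obtain s where s: "s \<in> mor C X E" "s \<cdot> p = idm C E - i \<cdot> r"
    using ck(1)[OF _ _ _ d] o by blast
  have pi: "p \<cdot> i = 0"
    using k o by blast
  have "p \<cdot> (s \<cdot> p) = p"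
    unfolding s(2) using comp_diff_right[OF _ ir m(2)] comp_assoc[OF r(1) m(1) m(2)] pi
      comp_zero_left[OF r(1)] comp_idm[OF m(2)] o mor_idm by simp
  then have "(p \<cdot> s) \<cdot> p = idm C X \<cdot> p"
    using comp_assoc[OF m(2) s(1) m(2)] idm_comp[OF m(2)] by simp
  then have ps: "p \<cdot> s = idm C X"
    using ck(2) o mor_comp[OF s(1) m(2)] mor_idm by blast
  have "(r \<cdot> s) \<cdot> p = 0 \<cdot> p"
    using comp_assoc[OF m(2) s(1) r(1)] s(2) comp_diff_right[OF _ ir r(1)] comp_assoc[OF r(1) m(1) r(1)]
      r comp_idm[OF r(1)] idm_comp[OF r(1)] o mor_idm comp_zero_left[OF m(2)] by simp
  then have "r \<cdot> s = 0"
    using ck(2) o mor_comp[OF s(1) r(1)] mor_zero by blast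
  then show ?thesis
    using s ps by blast
qed

text \<open>Dually, 1 - s \<cdot> p is killed by p and so factors through the kernel i.\<close>

lemma retraction_of_section:
  assumes c: "confl C Y E X i p" and s: "s \<in> mor C X E" "p \<cdot> s = idm C X"
  shows "\<exists>r\<in>mor C E Y. r \<cdot> i = idm C Y"
proof -
  note o = conflation_Obj[OF c] and m = conflation_mor[OF c]
  note k = is_kernelD[OF conflation_kernel_cokernel[OF c, THEN conjunct1]]
  have sp: "s \<cdot> p \<in> mor C E E" and d: "idm C E - s \<cdot> p \<in> mor C E E"
    using m s o by blast+
  have "p \<cdot> (idm C E - s \<cdot> p) = 0"
    using comp_diff_right[OF _ sp m(2)] comp_assoc[OF m(2) s(1) m(2)] s(2) o
      idm_comp[OF m(2)] comp_idm[OF m(2)] mor_idm by simp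
  then obtain r where r: "r \<in> mor C E Y" "i \<cdot> r = idm C E - s \<cdot> p"
    using k(4)[OF _ _ _ d] o by blast
  have pi: "p \<cdot> i = 0"
    using k o by blast
  have "i \<cdot> (r \<cdot> i) = i \<cdot> idm C Y"
    using comp_assoc[OF m(1) r(1) m(1)] r(2) comp_diff_left[OF m(1) _ sp] comp_assoc[OF m(1) m(2) s(1)] pi
      comp_zero_right[OF s(1)] comp_idm[OF m(1)] idm_comp[OF m(1)] o mor_idm by simp
  then have "r \<cdot> i = idm C Y"
    using k(5) o mor_comp[OF m(1) r(1)] mor_idm by blast
  then show ?thesis
    using r by blast
qed

text \<open>The retractions turn both middle terms into biproducts of Y and X; the diagonal of the
  two identities between them respects the inclusions of Y and the projections to X.\<close>

lemma split_extensions_equivalent: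
  assumes c: "confl C Y E X i p" and r: "r \<in> mor C E Y" "r \<cdot> i = idm C Y"
    and c': "confl C Y E' X i' p'" and r': "r' \<in> mor C E' Y" "r' \<cdot> i' = idm C Y"
  shows "((E, i, p), (E', i', p')) \<in> ext_rel C X Y"
proof -
  obtain s where s: "s \<in> mor C X E" "p \<cdot> s = idm C X" "s \<cdot> p = idm C E - i \<cdot> r" "r \<cdot> s = 0"
    using section_of_retraction[OF c r] by blast
  obtain s' where s': "s' \<in> mor C X E'" "p' \<cdot> s' = idm C X" "s' \<cdot> p' = idm C E' - i' \<cdot> r'" "r' \<cdot> s' = 0"
    using section_of_retraction[OF c' r'] by blast
  note o = conflation_Obj[OF c] conflation_Obj[OF c'] and m = conflation_mor[OF c] and m' = conflation_mor[OF c']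
  have pi: "p \<cdot> i = 0" and pi': "p' \<cdot> i' = 0"
    using conflation_kernel_cokernel[OF c] conflation_kernel_cokernel[OF c'] by (auto simp: is_kernel_def)
  have E: "biproduct C (UNIV :: bool set) (case_bool Y X) E (case_bool i s) (case_bool r p)"
    by (rule biproductI) (use o m r s pi in \<open>auto split: bool.splits simp: UNIV_bool\<close>)
  have E': "biproduct C (UNIV :: bool set) (case_bool Y X) E' (case_bool i' s') (case_bool r' p')"
    by (rule biproductI) (use o m' r' s' pi' in \<open>auto split: bool.splits simp: UNIV_bool\<close>)
  let ?e = "dsum_mor C UNIV (case_bool r p) (case_bool (idm C Y) (idm C X)) (case_bool i' s')"
  have iso: "is_iso C E E' ?e"
    by (rule dsum_mor_iso[OF E E']) (use o is_iso_idm in \<open>auto split: bool.splits\<close>)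
  have id: "\<forall>b\<in>UNIV. case_bool (idm C Y) (idm C X) b \<in> mor C (case_bool Y X b) (case_bool Y X b)"
    using o by (auto split: bool.splits)
  have "?e \<cdot> i = i'"
    using dsum_mor_inj[OF E E' id, of True] comp_idm[OF m'(1)] by simp
  moreover have "p' \<cdot> ?e = p"
    using proj_dsum_mor[OF E E' id, of False] idm_comp[OF m(2)] by simp
  ultimately show ?thesis
    using c c' iso by (auto simp: ext_rel_def exts_def)
qed

text \<open>A conflation lies in its own class, so if \<open>ext_zero\<close> is the only class,
  every conflation splits. Conversely, split conflations are all equivalent, which leaves a single
  class consisting of all extensions.\<close>

lemma Ext1_eq_zero_iff:
  assumes "X \<in> Obj C" "Y \<in> Obj C"
  shows "Ext1 C X Y = {ext_zero C X Y} \<longleftrightarrow> ext_vanishes C X Y"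
proof
  assume z: "Ext1 C X Y = {ext_zero C X Y}"
  show "ext_vanishes C X Y"
    unfolding ext_vanishes_def
  proof (intro allI impI)
    fix E i p assume c: "confl C Y E X i p"
    note o = conflation_Obj[OF c] and m = conflation_mor[OF c]
    have e: "(E, i, p) \<in> exts C X Y"
      using c by (simp add: exts_def)
    have "((E, i, p), (E, i, p)) \<in> ext_rel C X Y"
      using e is_iso_idm[of E] o idm_comp[OF m(1)] comp_idm[OF m(2)] by (auto simp: ext_rel_def)
    then have "(E, i, p) \<in> ext_rel C X Y `` {(E, i, p)}"
      by blast
    moreover have "ext_rel C X Y `` {(E, i, p)} \<in> Ext1 C X Y"
      unfolding Ext1_def by (rule quotientI[OF e])
    ultimately have "(E, i, p) \<in> ext_zero C X Y"
      unfolding z by blast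
    then obtain r where r: "r \<in> mor C E Y" "r \<cdot> i = idm C Y"
      using o by (auto simp: ext_zero_def mor_def)
    show "\<exists>s\<in>mor C X E. p \<cdot> s = idm C X"
      using section_of_retraction[OF c r] by blast
  qed
next
  assume v: "ext_vanishes C X Y"
  have r: "\<exists>r\<in>mor C E Y. r \<cdot> i = idm C Y" if "confl C Y E X i p" for E i p
    using retraction_of_section[OF that] v that unfolding ext_vanishes_def by blast
  have rel: "((E, i, p), (E', i', p')) \<in> ext_rel C X Y" if "confl C Y E X i p" "confl C Y E' X i' p'" for E i p E' i' p'
    using r[OF that(1)] r[OF that(2)] split_extensions_equivalent[OF that(1) _ _ that(2)] by blast
  have zero: "ext_zero C X Y = exts C X Y"
    using r unfolding ext_zero_def exts_def mor_def by blast
  have "ext_rel C X Y `` {x} = exts C X Y" if "x \<in> exts C X Y" for x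
    using that rel unfolding exts_def by (auto simp: ext_rel_def[of C X Y] exts_def)
  \<comment> \<open>The quotient of an empty set would be empty instead of a singleton; the direct
    sum supplies an extension.\<close>
  moreover have "exts C X Y \<noteq> {}"
  proof -
    have "case_bool Y X b \<in> Obj C" for b
      using assms by (cases b) auto
    then obtain P \<iota> \<pi> where "biproduct C (UNIV :: bool set) (case_bool Y X) P \<iota> \<pi>"
      using biproduct_exists[of "UNIV :: bool set" "case_bool Y X"] by auto
    from split_conflation[OF this] show ?thesis
      by (auto simp: exts_def)
  qed
  ultimately show "Ext1 C X Y = {ext_zero C X Y}"
    unfolding Ext1_def quotient_def zero by auto
qed

text \<open>Each inclusion \<open>\<iota> i\<close> lifts along p, and the lifts assemble to a
  section.\<close>

lemma ext_vanishes_biproduct: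
  assumes P: "biproduct C I X P \<iota> \<pi>" and X: "\<And>i. i \<in> I \<Longrightarrow> ext_vanishes C (X i) Y"
  shows "ext_vanishes C P Y"
  unfolding ext_vanishes_def
proof (intro allI impI)
  fix E i p assume c: "confl C Y E P i p"
  note p = biproductD[OF P] and m = conflation_mor[OF c] and o = conflation_Obj[OF c]
  have "\<forall>i\<in>I. \<exists>l\<in>mor C (X i) E. p \<cdot> l = \<iota> i"
    using ext_vanishes_lift[OF X c p(4)] by blast
  then obtain l where l: "\<And>i. i \<in> I \<Longrightarrow> l i \<in> mor C (X i) E" "\<And>i. i \<in> I \<Longrightarrow> p \<cdot> l i = \<iota> i"
    by metis
  have "p \<cdot> (\<Sum>i\<in>I. l i \<cdot> \<pi> i) = (\<Sum>i\<in>I. (p \<cdot> l i) \<cdot> \<pi> i)"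
    by (rule comp_cotuple[OF P m(2) l(1)])
  also have "\<dots> = idm C P"
    using p(7) l(2) by simp
  finally show "\<exists>s\<in>mor C P E. p \<cdot> s = idm C P"
    using cotuple_mor[OF P _ l(1)] o by blast
qed

text \<open>Lift the retraction \<pi> along p and restrict the lift to X.\<close>

lemma ext_vanishes_retract:
  assumes v: "ext_vanishes C P Y" and \<iota>: "\<iota> \<in> mor C X P" and \<pi>: "\<pi> \<in> mor C P X" and e: "\<pi> \<cdot> \<iota> = idm C X"
  shows "ext_vanishes C X Y"
  unfolding ext_vanishes_def
proof (intro allI impI)
  fix E i p assume c: "confl C Y E X i p"
  obtain l where l: "l \<in> mor C P E" "p \<cdot> l = \<pi>"
    using ext_vanishes_lift[OF v c \<pi>] by blast
  have "p \<cdot> (l \<cdot> \<iota>) = idm C X"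
    using comp_assoc[OF \<iota> l(1) conflation_mor(2)[OF c]] l(2) e by simp
  then show "\<exists>s\<in>mor C X E. p \<cdot> s = idm C X"
    using l(1) \<iota> by blast
qed

end

context exact_k_category
begin

section \<open>Deflations, their kernels and pullbacks in an exact category\<close>

lemma confl_mor:
  assumes "confl C A E B i p"
  shows "i \<in> mor C A E" "p \<in> mor C E B"
  using is_kernelD(1,2) confl_Obj[OF assms] confl_kernel_cokernel[OF assms] by blast+

lemma deflation_iso:
  assumes "deflation C E B p" "is_iso C E E' e" "E' \<in> Obj C" "p' \<in> mor C E' B" "p' \<cdot> e = p"
  shows "deflation C E' B p'"
proof -
  obtain A i where c: "confl C A E B i p"
    using assms(1) by (auto simp: deflation_def)
  note o = confl_Obj[OF c] and m = confl_mor[OF c]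
  have e: "e \<in> mor C E E'"
    using assms o by (simp add: is_iso_iff)
  have "confl C A E' B (e \<cdot> i) p'"
    by (rule confl_iso[OF c _ _ _ is_iso_idm assms(2) is_iso_idm])
      (use o assms morD(1)[OF mor_comp[OF m(1) e]] morD(1)[OF assms(4)]
        comp_idm[OF mor_comp[OF m(1) e]] idm_comp[OF m(2)] in auto)
  then show ?thesis
    by (auto simp: deflation_def)
qed

text \<open>The axiom provides some pullback whose projection is a deflation. Any other pullback is
  isomorphic to it over B', and deflations are invariant under isomorphisms of the source.\<close>

lemma pullback_deflation:
  assumes d: "deflation C E B p" and pb: "is_pullback C E B E' B' p f p' f'"
    and o: "E' \<in> Obj C" "B' \<in> Obj C"
  shows "deflation C E' B' p'"
proof -
  obtain A i where c: "confl C A E B i p"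
    using d by (auto simp: deflation_def)
  have EB: "E \<in> Obj C" "B \<in> Obj C"
    using confl_Obj[OF c] by auto
  note x = is_pullbackD[OF pb EB o]
  obtain E'' p'' f'' where E'': "E'' \<in> Obj C" and pb': "is_pullback C E B E'' B' p f p'' f''"
    and d': "deflation C E'' B' p''"
    using deflation_pullback[OF d o(2) morD(1)[OF x(2)]] by blast
  note y = is_pullbackD[OF pb' EB E'' o(2)]
  obtain e where e: "e \<in> mor C E'' E'" "p' \<cdot> e = p''" "f' \<cdot> e = f''"
    using x(6)[OF y(3,4,5)] by blast
  obtain e' where e': "e' \<in> mor C E' E''" "p'' \<cdot> e' = p'" "f'' \<cdot> e' = f'"
    using y(6)[OF x(3,4,5)] by blast
  have "is_iso C E'' E' e"
  proof (rule is_isoI[OF e(1) e'(1)])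
    show "e' \<cdot> e = idm C E''"
      by (rule y(7)) (use e e' E'' comp_assoc[OF e(1) e'(1) y(3)] comp_assoc[OF e(1) e'(1) y(4)]
          comp_idm[OF y(3)] comp_idm[OF y(4)] in auto)
    show "e \<cdot> e' = idm C E'"
      by (rule x(7)) (use e e' o comp_assoc[OF e'(1) e(1) x(3)] comp_assoc[OF e'(1) e(1) x(4)]
          comp_idm[OF x(3)] comp_idm[OF x(4)] in auto)
  qed
  from deflation_iso[OF d' this o(1) x(3) e(2)] show ?thesis .
qed

text \<open>A deflation belongs to a conflation with some kernel, and kernels are unique up to
  isomorphism. Afterwards it is enough to exhibit a deflation and to verify a kernel.\<close>

lemma kernel_confl:
  assumes d: "deflation C E B p" and k: "is_kernel C A E B i p" and A: "A \<in> Obj C"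
  shows "confl C A E B i p"
proof -
  obtain A' i' where c: "confl C A' E B i' p"
    using d by (auto simp: deflation_def)
  have o: "A' \<in> Obj C" "E \<in> Obj C" "B \<in> Obj C"
    using confl_Obj[OF c] by auto
  note x = is_kernelD[OF k A o(2,3)]
    and y = is_kernelD[OF confl_kernel_cokernel[OF c, THEN conjunct1] o]
  obtain a where a: "a \<in> mor C A' A" "i \<cdot> a = i'"
    using x(4)[OF y(1,3)] by blast
  obtain a' where a': "a' \<in> mor C A A'" "i' \<cdot> a' = i"
    using y(4)[OF x(1,3)] by blast
  have iso: "is_iso C A' A a"
  proof (rule is_isoI[OF a(1) a'(1)])
    show "a' \<cdot> a = idm C A'"
      by (rule y(5)) (use a a' o comp_assoc[OF a(1) a'(1) y(1)] comp_idm[OF y(1)] in auto)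
    show "a \<cdot> a' = idm C A"
      by (rule x(5)) (use a a' A comp_assoc[OF a'(1) a(1) x(1)] comp_idm[OF x(1)] in auto)
  qed
  show ?thesis
    by (rule confl_iso[OF c A o(2,3) iso is_iso_idm is_iso_idm])
      (use o a morD(1)[OF x(1)] morD(1)[OF x(2)] idm_comp[OF y(1)] comp_idm[OF x(2)] idm_comp[OF x(2)] in auto)
qed

text \<open>The pullback has the same kernel A: i' is the morphism induced by 0 and i. The equation
  f' \<cdot> i' = i is recorded because it makes i' equivariant later.\<close>

lemma confl_pullback:
  assumes c: "confl C A E B i p" and f: "f \<in> mor C B' B"
  shows "\<exists>E' i' p' f'. E' \<in> Obj C \<and> is_pullback C E B E' B' p f p' f' \<and> confl C A E' B' i' p' \<and> f' \<cdot> i' = i"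
proof -
  have o: "A \<in> Obj C" "E \<in> Obj C" "B \<in> Obj C" "B' \<in> Obj C"
    using confl_Obj[OF c] morD[OF f] by auto
  note x = is_kernelD[OF confl_kernel_cokernel[OF c, THEN conjunct1] o(1-3)]
  have "deflation C E B p"
    using c by (auto simp: deflation_def)
  from deflation_pullback[OF this o(4) morD(1)[OF f]]
  obtain E' p' f' where E': "E' \<in> Obj C" and pb: "is_pullback C E B E' B' p f p' f'" and d: "deflation C E' B' p'"
    by blast
  note y = is_pullbackD[OF pb o(2,3) E' o(4)]
  have "f \<cdot> 0 = p \<cdot> i"
    using x(3) comp_zero_right[OF f] by simp
  then obtain i' where i': "i' \<in> mor C A E'" "p' \<cdot> i' = 0" "f' \<cdot> i' = i"
    using y(6)[OF _ x(1)] mor_zero[OF o(1,4)] by blast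
  have "is_kernel C A E' B' i' p'"
  proof (rule is_kernelI[OF i'(1) y(3) i'(2)])
    fix W w assume w: "w \<in> mor C W E'" "p' \<cdot> w = 0"
    have fw: "f' \<cdot> w \<in> mor C W E"
      using w y(4) by blast
    have "p \<cdot> (f' \<cdot> w) = 0"
      using comp_assoc[OF w(1) y(4) y(1)] comp_assoc[OF w(1) y(3) y(2)] y(5) w(2) comp_zero_right[OF y(2)] by simp
    then obtain h where h: "h \<in> mor C W A" "i \<cdot> h = f' \<cdot> w"
      using x(4)[OF fw] by blast
    have "i' \<cdot> h = w"
      by (rule y(7)) (use h w i' comp_assoc[OF h(1) i'(1) y(3)] comp_assoc[OF h(1) i'(1) y(4)]
          comp_zero_left[OF h(1)] in auto)
    then show "\<exists>h\<in>mor C W A. i' \<cdot> h = w"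
      using h(1) by blast
  next
    fix W h h' assume h: "h \<in> mor C W A" "h' \<in> mor C W A" "i' \<cdot> h = i' \<cdot> h'"
    then have "f' \<cdot> (i' \<cdot> h) = f' \<cdot> (i' \<cdot> h')"
      by simp
    then have "i \<cdot> h = i \<cdot> h'"
      using comp_assoc[OF h(1) i'(1) y(4)] comp_assoc[OF h(2) i'(1) y(4)] i'(3) by simp
    then show "h = h'"
      using x(5) h by blast
  qed
  from kernel_confl[OF d this o(1)] show ?thesis
    using E' pb i'(3) by blast
qed

text \<open>The projection \<open>P \<rightarrow> X\<close> is the pullback of the deflation \<open>Y \<rightarrow> 0\<close> along \<open>X \<rightarrow> 0\<close>.\<close>

lemma split_confl:
  assumes P: "biproduct C (UNIV :: bool set) (case_bool Y X) P \<iota> \<pi>"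
  shows "confl C Y P X (\<iota> True) (\<pi> False)"
proof -
  note b = biproductD[OF P]
  have m: "\<iota> True \<in> mor C Y P" "\<iota> False \<in> mor C X P" "\<pi> True \<in> mor C P Y" "\<pi> False \<in> mor C P X"
    using b(4)[of True] b(4)[of False] b(5)[of True] b(5)[of False] by auto
  have e: "\<pi> True \<cdot> \<iota> True = idm C Y" "\<pi> False \<cdot> \<iota> False = idm C X" "\<pi> False \<cdot> \<iota> True = 0" "\<pi> True \<cdot> \<iota> False = 0"
    using b(6)[of True True] b(6)[of False False] b(6)[of True False] b(6)[of False True] by auto
  have s: "\<iota> True \<cdot> \<pi> True + \<iota> False \<cdot> \<pi> False = idm C P"
    using b(7) by (simp add: UNIV_bool add.commute)
  have o: "X \<in> Obj C" "Y \<in> Obj C" "P \<in> Obj C"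
    using m morD by blast+
  \<comment> \<open>Z plays the role of the zero object. It is the end term of a conflation starting
    with the identity of Y, which forces z = z \<cdot> 1 = 0.\<close>
  obtain Z z where z: "confl C Y Y Z (idm C Y) z"
    using inflation_idm[OF o(2)] by (auto simp: inflation_def)
  have z0: "z = 0"
    using confl_kernel_cokernel[OF z] comp_idm[OF confl_mor(2)[OF z]] by (auto simp: is_kernel_def)
  have Z: "Z \<in> Obj C"
    using confl_Obj[OF z] by simp
  have "is_pullback C Y Z P X 0 0 (\<pi> False) (\<pi> True)"
  proof (rule is_pullbackI)
    show "0 \<cdot> \<pi> False = 0 \<cdot> \<pi> True"
      using comp_zero_left m by simp
    fix W u v assume u: "u \<in> mor C W X" and v: "v \<in> mor C W Y"
    have uv: "case_bool v u b \<in> mor C W (case_bool Y X b)" for b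
      using u v by (cases b) auto
    show "\<exists>h\<in>mor C W P. \<pi> False \<cdot> h = u \<and> \<pi> True \<cdot> h = v"
      using tuple_mor[OF P morD(2)[OF u], of "case_bool v u", OF uv] proj_tuple[OF P morD(2)[OF u], of "case_bool v u" True, OF uv]
        proj_tuple[OF P morD(2)[OF u], of "case_bool v u" False, OF uv] by auto
  next
    fix W h h' assume h: "h \<in> mor C W P" "h' \<in> mor C W P" "\<pi> False \<cdot> h = \<pi> False \<cdot> h'" "\<pi> True \<cdot> h = \<pi> True \<cdot> h'"
    show "h = h'"
    proof (rule biproduct_proj_ext[OF P h(1,2)])
      show "\<pi> b \<cdot> h = \<pi> b \<cdot> h'" for b
        using h(3,4) by (cases b) auto
    qed
  qed (use o Z m in auto)
  note pb = this
  have "deflation C Y Z 0"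
    using z z0 by (auto simp: deflation_def)
  then have d: "deflation C P X (\<pi> False)"
    by (rule pullback_deflation[OF _ pb o(3,1)])
  have "is_kernel C Y P X (\<iota> True) (\<pi> False)"
  proof (rule is_kernelI[OF m(1,4) e(3)])
    fix W f assume f: "f \<in> mor C W P" "\<pi> False \<cdot> f = 0"
    have "f = (\<iota> True \<cdot> \<pi> True + \<iota> False \<cdot> \<pi> False) \<cdot> f"
      using s idm_comp[OF f(1)] by simp
    also have "\<dots> = \<iota> True \<cdot> (\<pi> True \<cdot> f)"
      using comp_add_left[OF f(1) mor_comp[OF m(3,1)] mor_comp[OF m(4,2)]] comp_assoc[OF f(1) m(3,1)]
        comp_assoc[OF f(1) m(4,2)] f(2) comp_zero_right[OF m(2)] by simp
    finally show "\<exists>h\<in>mor C W Y. \<iota> True \<cdot> h = f"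
      using mor_comp[OF f(1) m(3)] by metis
  next
    fix W h h' assume h: "h \<in> mor C W Y" "h' \<in> mor C W Y" "\<iota> True \<cdot> h = \<iota> True \<cdot> h'"
    then show "h = h'"
      using comp_assoc[OF h(1) m(1,3)] comp_assoc[OF h(2) m(1,3)] e(1) idm_comp[OF h(1)] idm_comp[OF h(2)] by simp
  qed
  from kernel_confl[OF d this o(2)] show ?thesis .
qed

sublocale conflation_category
proof unfold_locales
  show "\<exists>E' i' p' f'. confl C A E' B' i' p' \<and> f' \<in> mor C E' E \<and> f \<cdot> p' = p \<cdot> f'"
    if c: "confl C A E B i p" and f: "f \<in> mor C B' B" for A E B i p f B'
  proof -
    obtain E' i' p' f' where e: "E' \<in> Obj C" "is_pullback C E B E' B' p f p' f'" "confl C A E' B' i' p'"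
      using confl_pullback[OF c f] by blast
    then show ?thesis
      using is_pullbackD(4,5)[OF e(2)] confl_Obj[OF c] morD[OF f] by blast
  qed
qed (use confl_Obj confl_kernel_cokernel split_confl in blast)+

text \<open>The components are changed one at a time: the step at \<open>k\<close> is a pullback of \<open>p k\<close> along the projection
  to \<open>B k\<close>.\<close>

lemma deflation_dsum:
  assumes c: "\<And>j. j \<in> I \<Longrightarrow> confl C (A j) (E j) (B j) (i j) (p j)"
    and E: "biproduct C I E Q \<iota>E \<pi>E"
    and "finite S" "S \<subseteq> I"
    and R: "biproduct C I (\<lambda>j. if j \<in> S then B j else E j) R \<iota> \<pi>"
  shows "deflation C Q R (dsum_mor C I \<pi>E (\<lambda>j. if j \<in> S then p j else idm C (E j)) \<iota>)"
  using assms(3,4) R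
proof (induction S arbitrary: R \<iota> \<pi> rule: finite_induct)
  case empty
  have R: "biproduct C I E R \<iota> \<pi>"
    using empty.prems by simp
  have Q: "Q \<in> Obj C" and o: "R \<in> Obj C"
    using biproductD(2)[OF E] biproductD(2)[OF R] by auto
  let ?d = "dsum_mor C I \<pi>E (\<lambda>j. idm C (E j)) \<iota>"
  have iso: "is_iso C Q R ?d"
    by (rule dsum_mor_iso[OF E R]) (use biproductD(3)[OF E] is_iso_idm in blast)
  have "deflation C R R (idm C R)"
    by (rule deflation_idm[OF o])
  then obtain h where h: "h \<in> mor C R Q" "h \<cdot> ?d = idm C Q" "?d \<cdot> h = idm C R" and d: "?d \<in> mor C Q R"
    using iso Q o by (auto simp: is_iso_iff)
  have "is_iso C R Q h"
    by (rule is_isoI[OF h(1) d h(3,2)])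
  from deflation_iso[OF deflation_idm[OF o] this Q d h(3)] show ?case
    by simp
next
  case (insert k S)
  let ?X = "\<lambda>j. if j \<in> S then B j else E j" and ?X' = "\<lambda>j. if j \<in> insert k S then B j else E j"
  have k: "k \<in> I" "k \<notin> S" "S \<subseteq> I"
    using insert by auto
  note R = insert.prems(2) and o = confl_Obj[OF c] and m = confl_mor[OF c]
  obtain R' \<iota>' \<pi>' where R': "biproduct C I ?X R' \<iota>' \<pi>'"
    using biproduct_exists[of I ?X] biproductD(1,3)[OF E] o by (metis (full_types))
  note d = insert.IH[OF k(3) R']
  note r = biproductD[OF R] and r' = biproductD[OF R']
  let ?f = "\<lambda>j. if j \<in> S then p j else idm C (E j)"
  let ?q = "\<lambda>j. if j = k then p k else idm C (?X j)"
  have f': "\<forall>j\<in>I. ?f j \<in> mor C (E j) (?X j)"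
    using m(2) o by auto
  have q': "\<forall>j\<in>I. ?q j \<in> mor C (?X j) (?X' j)"
    using m(2) o k by auto
  note f = bspec[OF f'] and q = bspec[OF q']
  note F = dsum_mor[OF E R' f'] and Q = dsum_mor[OF R' R q']
  have "is_pullback C (E k) (B k) R' R (p k) (\<pi> k) (dsum_mor C I \<pi>' ?q \<iota>) (\<pi>' k)"
  proof (rule is_pullbackI)
    show "p k \<in> mor C (E k) (B k)" "\<pi> k \<in> mor C R (B k)" "dsum_mor C I \<pi>' ?q \<iota> \<in> mor C R' R"
      "\<pi>' k \<in> mor C R' (E k)"
      using m(2)[OF k(1)] r(5)[OF k(1)] Q(1) r'(5)[OF k(1)] k(2) by auto
    show "\<pi> k \<cdot> dsum_mor C I \<pi>' ?q \<iota> = p k \<cdot> \<pi>' k"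
      using Q(3)[OF k(1)] by simp
  next
    fix W u v assume u: "u \<in> mor C W R" and v: "v \<in> mor C W (E k)" and uv: "\<pi> k \<cdot> u = p k \<cdot> v"
    \<comment> \<open>The lift has component v at k and the components of u elsewhere, where
      \<open>?q\<close> is an identity.\<close>
    let ?h = "\<lambda>j. if j = k then v else \<pi> j \<cdot> u"
    have h: "?h j \<in> mor C W (?X j)" if "j \<in> I" for j
      using that u v r(5)[OF that] k by auto
    let ?t = "\<Sum>j\<in>I. \<iota>' j \<cdot> ?h j"
    have t: "?t \<in> mor C W R'" "\<And>j. j \<in> I \<Longrightarrow> \<pi>' j \<cdot> ?t = ?h j"
      using tuple_mor[OF R' morD(2)[OF u] h] proj_tuple[OF R' morD(2)[OF u] h] by auto
    have "dsum_mor C I \<pi>' ?q \<iota> \<cdot> ?t = u"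
    proof (rule biproduct_proj_ext[OF R _ u])
      fix j assume j: "j \<in> I"
      have "\<pi> j \<cdot> (dsum_mor C I \<pi>' ?q \<iota> \<cdot> ?t) = ?q j \<cdot> (\<pi>' j \<cdot> ?t)"
        using comp_assoc[OF t(1) Q(1) r(5)[OF j]] Q(3)[OF j] comp_assoc[OF t(1) r'(5)[OF j] q[OF j]] by simp
      also have "\<dots> = ?q j \<cdot> ?h j"
        using t(2)[OF j] by simp
      also have "\<dots> = \<pi> j \<cdot> u"
        using uv idm_comp[OF h[OF j]] by auto
      finally show "\<pi> j \<cdot> (dsum_mor C I \<pi>' ?q \<iota> \<cdot> ?t) = \<pi> j \<cdot> u" .
    qed (use t(1) Q(1) in blast)
    then show "\<exists>h\<in>mor C W R'. dsum_mor C I \<pi>' ?q \<iota> \<cdot> h = u \<and> \<pi>' k \<cdot> h = v"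
      using t(1) t(2)[OF k(1)] by auto
  next
    fix W h h' assume h: "h \<in> mor C W R'" "h' \<in> mor C W R'"
      and e: "dsum_mor C I \<pi>' ?q \<iota> \<cdot> h = dsum_mor C I \<pi>' ?q \<iota> \<cdot> h'" "\<pi>' k \<cdot> h = \<pi>' k \<cdot> h'"
    show "h = h'"
    proof (rule biproduct_proj_ext[OF R' h])
      fix j assume j: "j \<in> I"
      have "?q j \<cdot> (\<pi>' j \<cdot> h) = ?q j \<cdot> (\<pi>' j \<cdot> h')"
        using comp_assoc[OF h(1) Q(1) r(5)[OF j]] comp_assoc[OF h(2) Q(1) r(5)[OF j]] Q(3)[OF j] e(1)
          comp_assoc[OF h(1) r'(5)[OF j] q[OF j]] comp_assoc[OF h(2) r'(5)[OF j] q[OF j]] by simp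
      then show "\<pi>' j \<cdot> h = \<pi>' j \<cdot> h'"
        using e(2) idm_comp[OF mor_comp[OF h(1) r'(5)[OF j]]] idm_comp[OF mor_comp[OF h(2) r'(5)[OF j]]]
        by (cases "j = k") auto
    qed
  qed
  moreover have "deflation C (E k) (B k) (p k)"
    using c[OF k(1)] by (auto simp: deflation_def)
  ultimately have "deflation C R' R (dsum_mor C I \<pi>' ?q \<iota>)"
    using pullback_deflation r(2) r'(2) by blast
  then have "deflation C Q R (dsum_mor C I \<pi>' ?q \<iota> \<cdot> dsum_mor C I \<pi>E ?f \<iota>')"
    using deflation_cmp d by blast
  moreover have "dsum_mor C I \<pi>' ?q \<iota> \<cdot> dsum_mor C I \<pi>E ?f \<iota>' =
      dsum_mor C I \<pi>E (\<lambda>j. if j \<in> insert k S then p j else idm C (E j)) \<iota>"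
  proof (rule biproduct_proj_ext[OF R])
    let ?g = "\<lambda>j. if j \<in> insert k S then p j else idm C (E j)"
    have g: "\<forall>j\<in>I. ?g j \<in> mor C (E j) (?X' j)"
      using m(2) o by auto
    note G = dsum_mor[OF E R g]
    show "dsum_mor C I \<pi>E ?g \<iota> \<in> mor C Q R"
      by (rule G(1))
    fix j assume j: "j \<in> I"
    have "\<pi> j \<cdot> (dsum_mor C I \<pi>' ?q \<iota> \<cdot> dsum_mor C I \<pi>E ?f \<iota>') = ?q j \<cdot> (?f j \<cdot> \<pi>E j)"
      using comp_assoc[OF F(1) Q(1) r(5)[OF j]] Q(3)[OF j] comp_assoc[OF F(1) r'(5)[OF j] q[OF j]] F(3)[OF j] by simp
    also have "\<dots> = ?g j \<cdot> \<pi>E j"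
      using k(2) idm_comp[OF mor_comp[OF biproductD(5)[OF E j] f[OF j]]] idm_comp[OF biproductD(5)[OF E j]] by auto
    finally show "\<pi> j \<cdot> (dsum_mor C I \<pi>' ?q \<iota> \<cdot> dsum_mor C I \<pi>E ?f \<iota>') = \<pi> j \<cdot> dsum_mor C I \<pi>E ?g \<iota>"
      using G(3)[OF j] by simp
  qed (use F(1) Q(1) in blast)
  ultimately show ?case
    by simp
qed

text \<open>The sum of the p j is a deflation by the stepwise replacement carried out for all of I,
  and the sum of the i j is its kernel, as is checked componentwise. \<open>kernel_confl\<close>
  combines the two.\<close>

lemma confl_dsum:
  assumes c: "\<And>j. j \<in> I \<Longrightarrow> confl C (A j) (E j) (B j) (i j) (p j)"
    and A: "biproduct C I A P \<iota>A \<pi>A" and E: "biproduct C I E Q \<iota>E \<pi>E" and B: "biproduct C I B R \<iota>B \<pi>B"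
  shows "confl C P Q R (dsum_mor C I \<pi>A i \<iota>E) (dsum_mor C I \<pi>E p \<iota>B)"
proof -
  note a = biproductD[OF A] and e = biproductD[OF E] and b = biproductD[OF B]
  note m = confl_mor[OF c]
  note k = is_kernelD[OF confl_kernel_cokernel[OF c, THEN conjunct1] a(3) e(3) b(3)]
  have "\<forall>j\<in>I. i j \<in> mor C (A j) (E j)" "\<forall>j\<in>I. p j \<in> mor C (E j) (B j)"
    using m by auto
  note i = dsum_mor[OF A E this(1)] and p = dsum_mor[OF E B this(2)]
  have B': "biproduct C I (\<lambda>j. if j \<in> I then B j else E j) R \<iota>B \<pi>B"
    using biproduct_cong[of I "\<lambda>j. if j \<in> I then B j else E j" B] B by auto
  have "deflation C Q R (dsum_mor C I \<pi>E (\<lambda>j. if j \<in> I then p j else idm C (E j)) \<iota>B)"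
    by (rule deflation_dsum[OF c E a(1) subset_refl B'])
  moreover have "dsum_mor C I \<pi>E (\<lambda>j. if j \<in> I then p j else idm C (E j)) \<iota>B = dsum_mor C I \<pi>E p \<iota>B"
    unfolding dsum_mor_def by (rule sum.cong) auto
  ultimately have d: "deflation C Q R (dsum_mor C I \<pi>E p \<iota>B)"
    by simp
  let ?i = "dsum_mor C I \<pi>A i \<iota>E" and ?p = "dsum_mor C I \<pi>E p \<iota>B"
  have "is_kernel C P Q R ?i ?p"
  proof (rule is_kernelI[OF i(1) p(1)])
    show "?p \<cdot> ?i = 0"
    proof (rule biproduct_proj_ext[OF B])
      fix j assume j: "j \<in> I"
      have "\<pi>B j \<cdot> (?p \<cdot> ?i) = p j \<cdot> (i j \<cdot> \<pi>A j)"
        using comp_assoc[OF i(1) p(1) b(5)[OF j]] p(3)[OF j] comp_assoc[OF i(1) e(5)[OF j] m(2)[OF j]] i(3)[OF j] by simp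
      also have "\<dots> = 0"
        using comp_assoc[OF a(5)[OF j] m[OF j]] k(3)[OF j j j j] comp_zero_left[OF a(5)[OF j]] by simp
      finally show "\<pi>B j \<cdot> (?p \<cdot> ?i) = \<pi>B j \<cdot> 0"
        using comp_zero_right[OF b(5)[OF j]] by simp
    qed (use i(1) p(1) a(2) b(2) in blast)+
  next
    fix W f assume f: "f \<in> mor C W Q" "?p \<cdot> f = 0"
    have "\<exists>h\<in>mor C W (A j). i j \<cdot> h = \<pi>E j \<cdot> f" if j: "j \<in> I" for j
    proof (rule k(4)[OF j j j j mor_comp[OF f(1) e(5)[OF j]]])
      show "p j \<cdot> (\<pi>E j \<cdot> f) = 0"
        using comp_assoc[OF f(1) e(5)[OF j] m(2)[OF j]] p(3)[OF j] comp_assoc[OF f(1) p(1) b(5)[OF j]] f(2)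
          comp_zero_right[OF b(5)[OF j]] by simp
    qed
    then obtain h where h: "\<And>j. j \<in> I \<Longrightarrow> h j \<in> mor C W (A j)" "\<And>j. j \<in> I \<Longrightarrow> i j \<cdot> h j = \<pi>E j \<cdot> f"
      by metis
    let ?h = "\<Sum>j\<in>I. \<iota>A j \<cdot> h j"
    have t: "?h \<in> mor C W P" "\<And>j. j \<in> I \<Longrightarrow> \<pi>A j \<cdot> ?h = h j"
      using tuple_mor[OF A morD(2)[OF f(1)] h(1)] proj_tuple[OF A morD(2)[OF f(1)] h(1)] by auto
    have "?i \<cdot> ?h = f"
    proof (rule biproduct_proj_ext[OF E mor_comp[OF t(1) i(1)] f(1)])
      fix j assume j: "j \<in> I"
      show "\<pi>E j \<cdot> (?i \<cdot> ?h) = \<pi>E j \<cdot> f"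
        using comp_assoc[OF t(1) i(1) e(5)[OF j]] i(3)[OF j] comp_assoc[OF t(1) a(5)[OF j] m(1)[OF j]] t(2)[OF j] h(2)[OF j]
        by simp
    qed
    then show "\<exists>h\<in>mor C W P. ?i \<cdot> h = f"
      using t(1) by blast
  next
    fix W h h' assume h: "h \<in> mor C W P" "h' \<in> mor C W P" "?i \<cdot> h = ?i \<cdot> h'"
    show "h = h'"
    proof (rule biproduct_proj_ext[OF A h(1,2)])
      fix j assume j: "j \<in> I"
      have "i j \<cdot> (\<pi>A j \<cdot> h) = i j \<cdot> (\<pi>A j \<cdot> h')"
        using comp_assoc[OF h(1) i(1) e(5)[OF j]] comp_assoc[OF h(2) i(1) e(5)[OF j]] i(3)[OF j]
          comp_assoc[OF h(1) a(5)[OF j] m(1)[OF j]] comp_assoc[OF h(2) a(5)[OF j] m(1)[OF j]] h(3) by simp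
      then show "\<pi>A j \<cdot> h = \<pi>A j \<cdot> h'"
        using k(5)[OF j j j j] mor_comp[OF h(1) a(5)[OF j]] mor_comp[OF h(2) a(5)[OF j]] by blast
    qed
  qed
  from kernel_confl[OF d this a(2)] show ?thesis .
qed

end

section \<open>Equivariant objects\<close>

lemma equiv_cat_simps [simp]:
  "Obj (equiv_cat G C A) = equiv_Obj G C A"
  "idm (equiv_cat G C A) M = idm C (fst M)"
  "cmp (equiv_cat G C A) = cmp C"
  "smul (equiv_cat G C A) = smul C"
  "confl (equiv_cat G C A) M N L i p \<longleftrightarrow> M \<in> equiv_Obj G C A \<and> N \<in> equiv_Obj G C A \<and> L \<in> equiv_Obj G C A \<and>
     i \<in> equiv_Hom G C A M N \<and> p \<in> equiv_Hom G C A N L \<and> confl C (fst M) (fst N) (fst L) i p"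
  by (simp_all add: equiv_cat_def split_def)

lemma Hom_equiv_cat: "Hom (equiv_cat G C A) M N = {f \<in> Hom C (fst M) (fst N).
    \<forall>g\<in>carrier G. f \<cdot>\<^bsub>C\<^esub> snd M g = snd N g \<cdot>\<^bsub>C\<^esub> tens_mor A g (fst M) (fst N) f}"
  by (simp add: equiv_cat_def equiv_Hom_def split_def)

locale exact_action = group G + exact_k_category C + group_action_on G C A
  for G :: "'g monoid" and C :: "('k::field, 'o, 'm::ab_group_add, 'z) excat_scheme" (structure)
    and A :: "('g, 'o, 'm) gaction" +
  assumes finite_group: "finite (carrier G)"
    and action_exact: "g \<in> carrier G \<Longrightarrow> exact_functor C C (act A g)"
begin

abbreviation D where "D \<equiv> equiv_cat G C A"

lemma act_functor: "g \<in> carrier G \<Longrightarrow> additive_functor C C (act A g)"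
  using act_equivalence additive_k_category_axioms
  by (simp add: additive_functor_def k_equivalence_def)

lemmas tens_Obj = k_functor.fob_Obj[OF act_equivalence[THEN k_equivalence.axioms(1)]]
lemmas tens_idm = k_functor.fmor_idm[OF act_equivalence[THEN k_equivalence.axioms(1)]]
lemmas tens_mor_mor = additive_functor.fmor_mor[OF act_functor]
lemmas tens_mor_comp = additive_functor.fmor_comp[OF act_functor]
lemmas tens_mor_plus = additive_functor.fmor_plus[OF act_functor]
lemmas tens_mor_scale = additive_functor.fmor_scale[OF act_functor]
lemmas tens_mor_zero = additive_functor.fmor_zero[OF act_functor]
lemmas tens_mor_sum = additive_functor.fmor_sum[OF act_functor]
lemmas tens_mor_iso = additive_functor.fmor_iso[OF act_functor]
lemmas tens_biproduct = additive_functor.fob_biproduct[OF act_functor]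

lemma assc_mor: "\<lbrakk>g \<in> carrier G; h \<in> carrier G; X \<in> Obj C\<rbrakk>
    \<Longrightarrow> assc A g h X \<in> mor C (tens A (g \<otimes>\<^bsub>G\<^esub> h) X) (tens A g (tens A h X))"
  using assc_iso tens_Obj by (simp add: is_iso_iff)

lemma unt_mor: "X \<in> Obj C \<Longrightarrow> unt A X \<in> mor C (tens A \<one>\<^bsub>G\<^esub> X) X"
  using unt_iso tens_Obj by (simp add: is_iso_iff)

lemma assc_nat: "\<lbrakk>g \<in> carrier G; h \<in> carrier G; f \<in> mor C X Y\<rbrakk>
    \<Longrightarrow> assc A g h Y \<cdot> tens_mor A (g \<otimes>\<^bsub>G\<^esub> h) X Y f
        = tens_mor A g (tens A h X) (tens A h Y) (tens_mor A h X Y f) \<cdot> assc A g h X"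
  using assc_natural morD by metis

lemma unt_nat: "f \<in> mor C X Y \<Longrightarrow> unt A Y \<cdot> tens_mor A \<one>\<^bsub>G\<^esub> X Y f = f \<cdot> unt A X"
  using unt_natural morD by metis

lemma equiv_ObjD:
  assumes "M \<in> equiv_Obj G C A"
  shows "fst M \<in> Obj C" "snd M \<in> extensional (carrier G)"
    "g \<in> carrier G \<Longrightarrow> is_iso C (tens A g (fst M)) (fst M) (snd M g)"
    "g \<in> carrier G \<Longrightarrow> snd M g \<in> mor C (tens A g (fst M)) (fst M)"
    "\<lbrakk>g \<in> carrier G; h \<in> carrier G\<rbrakk> \<Longrightarrow> snd M (g \<otimes>\<^bsub>G\<^esub> h) =
       snd M g \<cdot> (tens_mor A g (tens A h (fst M)) (fst M) (snd M h) \<cdot> assc A g h (fst M))"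
    "snd M \<one>\<^bsub>G\<^esub> = unt A (fst M)"
proof -
  show o: "fst M \<in> Obj C" and "snd M \<in> extensional (carrier G)"
    and "snd M \<one>\<^bsub>G\<^esub> = unt A (fst M)"
    and iso: "g \<in> carrier G \<Longrightarrow> is_iso C (tens A g (fst M)) (fst M) (snd M g)" for g
    using assms by (auto simp: equiv_Obj_def)
  show m: "g \<in> carrier G \<Longrightarrow> snd M g \<in> mor C (tens A g (fst M)) (fst M)" for g
    using iso[of g] o tens_Obj by (simp add: is_iso_iff)
  assume g: "g \<in> carrier G" and h: "h \<in> carrier G"
  have "snd M (g \<otimes>\<^bsub>G\<^esub> h) = snd M g \<cdot> tens_mor A g (tens A h (fst M)) (fst M) (snd M h) \<cdot> assc A g h (fst M)"
    using assms g h by (auto simp: equiv_Obj_def)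
  then show "snd M (g \<otimes>\<^bsub>G\<^esub> h) =
      snd M g \<cdot> (tens_mor A g (tens A h (fst M)) (fst M) (snd M h) \<cdot> assc A g h (fst M))"
    using comp_assoc[OF assc_mor[OF g h o] tens_mor_mor[OF g m[OF h]] m[OF g]] by simp
qed

lemma mor_equiv_iff:
  assumes "M \<in> equiv_Obj G C A" "N \<in> equiv_Obj G C A"
  shows "f \<in> mor D M N \<longleftrightarrow> f \<in> mor C (fst M) (fst N) \<and>
    (\<forall>g\<in>carrier G. f \<cdot> snd M g = snd N g \<cdot> tens_mor A g (fst M) (fst N) f)"
  using assms equiv_ObjD(1) by (auto simp: mor_def Hom_equiv_cat)

lemma equiv_morD:
  assumes "f \<in> mor D M N"
  shows "f \<in> mor C (fst M) (fst N)" "M \<in> equiv_Obj G C A" "N \<in> equiv_Obj G C A"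
    "g \<in> carrier G \<Longrightarrow> f \<cdot> snd M g = snd N g \<cdot> tens_mor A g (fst M) (fst N) f"
  using assms equiv_ObjD(1) by (auto simp: mor_def Hom_equiv_cat)

text \<open>The isomorphism condition in the definition of equivariant objects is automatic: \<open>\<psi> g\<close> has a right
  inverse built from \<open>\<psi> (inv g)\<close>, and a left inverse after applying \<open>inv g\<close>.\<close>

lemma equiv_ObjI:
  assumes X: "X \<in> Obj C" and ext: "\<psi> \<in> extensional (carrier G)"
    and m: "\<And>g. g \<in> carrier G \<Longrightarrow> \<psi> g \<in> mor C (tens A g X) X"
    and cocycle: "\<And>g h. \<lbrakk>g \<in> carrier G; h \<in> carrier G\<rbrakk>
      \<Longrightarrow> \<psi> (g \<otimes>\<^bsub>G\<^esub> h) = \<psi> g \<cdot> (tens_mor A g (tens A h X) X (\<psi> h) \<cdot> assc A g h X)"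
    and unit: "\<psi> \<one>\<^bsub>G\<^esub> = unt A X"
  shows "(X, \<psi>) \<in> equiv_Obj G C A"
proof -
  have "is_iso C (tens A g X) X (\<psi> g)" if g: "g \<in> carrier G" for g
  proof -
    define h where "h = inv\<^bsub>G\<^esub> g"
    have h: "h \<in> carrier G" "g \<otimes>\<^bsub>G\<^esub> h = \<one>\<^bsub>G\<^esub>" "h \<otimes>\<^bsub>G\<^esub> g = \<one>\<^bsub>G\<^esub>"
      using g by (simp_all add: h_def)
    have o: "tens A g X \<in> Obj C" "tens A h X \<in> Obj C" "tens A \<one>\<^bsub>G\<^esub> X \<in> Obj C"
      "tens A h (tens A g X) \<in> Obj C"
      using g h X tens_Obj by auto
    note un = inv_mor[OF unt_iso[OF X] o(3) X]
    let ?u = "inv_mor C (tens A \<one>\<^bsub>G\<^esub> X) X (unt A X)"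
    let ?Th = "tens_mor A g (tens A h X) X (\<psi> h)" and ?Tg = "tens_mor A h (tens A g X) X (\<psi> g)"
    have Th: "?Th \<in> mor C (tens A g (tens A h X)) (tens A g X)"
      by (rule tens_mor_mor[OF g m[OF h(1)]])
    have Tg: "?Tg \<in> mor C (tens A h (tens A g X)) (tens A h X)"
      by (rule tens_mor_mor[OF h(1) m[OF g]])
    have agh: "assc A g h X \<in> mor C (tens A \<one>\<^bsub>G\<^esub> X) (tens A g (tens A h X))"
      using assc_mor[OF g h(1) X] h(2) by simp
    have ahg: "assc A h g X \<in> mor C (tens A \<one>\<^bsub>G\<^esub> X) (tens A h (tens A g X))"
      and ahg_iso: "is_iso C (tens A \<one>\<^bsub>G\<^esub> X) (tens A h (tens A g X)) (assc A h g X)"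
      using assc_mor[OF h(1) g X] assc_iso[OF h(1) g X] h(3) by auto
    define r where "r = (?Th \<cdot> assc A g h X) \<cdot> ?u"
    have r: "r \<in> mor C X (tens A g X)" "\<psi> g \<cdot> r = idm C X"
      using comp_assoc[OF un(1) mor_comp[OF agh Th] m[OF g]] cocycle[OF g h(1)] h(2) unit un(3)
        mor_comp[OF un(1) mor_comp[OF agh Th]] by (auto simp: r_def)
    define l where "l = assc A h g X \<cdot> (?u \<cdot> \<psi> h)"
    have uh: "?u \<cdot> \<psi> h \<in> mor C (tens A h X) (tens A \<one>\<^bsub>G\<^esub> X)"
      using un(1) m[OF h(1)] by blast
    then have l: "l \<in> mor C (tens A h X) (tens A h (tens A g X))"
      unfolding l_def using ahg by blast
    have "(?u \<cdot> \<psi> h) \<cdot> (?Tg \<cdot> assc A h g X) = idm C (tens A \<one>\<^bsub>G\<^esub> X)"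
      using comp_assoc[OF mor_comp[OF ahg Tg] m[OF h(1)] un(1)] cocycle[OF h(1) g] h(3) unit un(2) by simp
    then have "(l \<cdot> ?Tg) \<cdot> assc A h g X = idm C (tens A h (tens A g X)) \<cdot> assc A h g X"
      using comp_assoc[OF ahg Tg l] comp_assoc[OF mor_comp[OF ahg Tg] uh ahg] comp_idm[OF ahg] idm_comp[OF ahg]
      by (simp add: l_def)
    then have lT: "l \<cdot> ?Tg = idm C (tens A h (tens A g X))"
      using iso_cancel_right[OF ahg_iso mor_comp[OF Tg l] mor_idm[OF o(4)] o(3)] by blast
    \<comment> \<open>l is a left inverse of \<open>?Tg\<close>, the image of \<psi> g under h
      \<otimes> -. This functor is full, so l comes from some l0, and faithful, so l0 is a left
      inverse of \<psi> g.\<close>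
    have ff: "bij_betw (tens_mor A h Y Z) (Hom C Y Z) (Hom C (tens A h Y) (tens A h Z))"
      if "Y \<in> Obj C" "Z \<in> Obj C" for Y Z
      using k_equivalence.fully_faithful[OF act_equivalence[OF h(1)] that] .
    have "l \<in> tens_mor A h X (tens A g X) ` Hom C X (tens A g X)"
      using ff[OF X o(1)] morD(1)[OF l] by (simp add: bij_betw_def)
    then obtain l0 where l0: "l0 \<in> mor C X (tens A g X)" "tens_mor A h X (tens A g X) l0 = l"
      using X o morI by blast
    have "tens_mor A h (tens A g X) (tens A g X) (l0 \<cdot> \<psi> g) = tens_mor A h (tens A g X) (tens A g X) (idm C (tens A g X))"
      using tens_mor_comp[OF h(1) m[OF g] l0(1)] l0(2) lT tens_idm[OF h(1) o(1)] by simp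
    then have l0g: "l0 \<cdot> \<psi> g = idm C (tens A g X)"
      using ff[OF o(1,1)] morD(1)[OF mor_comp[OF m[OF g] l0(1)]] idm_in_Hom[OF o(1)]
      unfolding bij_betw_def inj_on_def by blast
    have "l0 = r"
      by (rule inverse_unique[OF m[OF g] l0(1) r(1) l0g r(2)])
    then show ?thesis
      using is_isoI[OF m[OF g] r(1) _ r(2)] l0g by simp
  qed
  moreover have "\<psi> (g \<otimes>\<^bsub>G\<^esub> h) = \<psi> g \<cdot> tens_mor A g (tens A h X) X (\<psi> h) \<cdot> assc A g h X"
    if "g \<in> carrier G" "h \<in> carrier G" for g h
    using cocycle[OF that] comp_assoc[OF assc_mor[OF that X] tens_mor_mor[OF that(1) m[OF that(2)]] m[OF that(1)]] by simp
  ultimately show ?thesis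
    using X ext unit by (simp add: equiv_Obj_def)
qed

lemma equiv_HomD: "f \<in> Hom D M N \<Longrightarrow> f \<in> Hom C (fst M) (fst N)"
  by (simp add: Hom_equiv_cat)

lemma equiv_k_category: "k_category D"
proof (rule k_category.intro)
  show "module.subspace (smul D) (Hom D M N)" if "M \<in> Obj D" "N \<in> Obj D" for M N
  proof -
    have o: "M \<in> equiv_Obj G C A" "N \<in> equiv_Obj G C A" "fst M \<in> Obj C" "fst N \<in> Obj C"
      using that equiv_ObjD(1) by auto
    have "Hom D M N = mor D M N"
      using that by (auto simp: mor_def)
    moreover have "vs.subspace (mor D M N)"
    proof (rule vs.subspaceI)
      show "0 \<in> mor D M N"
        using o mor_zero comp_zero_left[OF equiv_ObjD(4)[OF o(1)]] comp_zero_right[OF equiv_ObjD(4)[OF o(2)]]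
          tens_mor_zero by (auto simp: mor_equiv_iff)
    next
      fix f f' assume f: "f \<in> mor D M N" "f' \<in> mor D M N"
      have "(f + f') \<cdot> snd M g = snd N g \<cdot> tens_mor A g (fst M) (fst N) (f + f')" if g: "g \<in> carrier G" for g
        using comp_add_left[OF equiv_ObjD(4)[OF o(1) g] f[THEN equiv_morD(1)]]
          comp_add_right[OF f[THEN equiv_morD(1), THEN tens_mor_mor[OF g]] equiv_ObjD(4)[OF o(2) g]]
          tens_mor_plus[OF g f[THEN equiv_morD(1)]] f[THEN equiv_morD(4), OF g] by simp
      then show "f + f' \<in> mor D M N"
        using f[THEN equiv_morD(1)] o by (simp add: mor_equiv_iff mor_add)
    next
      fix a f assume f: "f \<in> mor D M N"
      have "smul C a f \<cdot> snd M g = snd N g \<cdot> tens_mor A g (fst M) (fst N) (smul C a f)" if g: "g \<in> carrier G" for g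
        using comp_smul_left[OF equiv_ObjD(4)[OF o(1) g] f[THEN equiv_morD(1)]]
          comp_smul_right[OF f[THEN equiv_morD(1), THEN tens_mor_mor[OF g]] equiv_ObjD(4)[OF o(2) g]]
          tens_mor_scale[OF g f[THEN equiv_morD(1)]] f[THEN equiv_morD(4), OF g] by simp
      then show "smul C a f \<in> mor D M N"
        using f[THEN equiv_morD(1)] o by (simp add: mor_equiv_iff mor_smul)
    qed
    ultimately show ?thesis
      by simp
  qed
  show "idm D M \<in> Hom D M M" if "M \<in> Obj D" for M
    using that equiv_ObjD(1)[of M] comp_idm[OF equiv_ObjD(4)[of M]] idm_comp[OF equiv_ObjD(4)[of M]]
    by (simp add: Hom_equiv_cat tens_idm idm_in_Hom)
  show "g \<cdot>\<^bsub>D\<^esub> f \<in> Hom D M L" if o: "M \<in> Obj D" "N \<in> Obj D" "L \<in> Obj D" and h: "f \<in> Hom D M N" "g \<in> Hom D N L"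
    for M N L f g
  proof -
    have o: "M \<in> equiv_Obj G C A" "N \<in> equiv_Obj G C A" "L \<in> equiv_Obj G C A"
      using o by auto
    have f: "f \<in> mor D M N" and g: "g \<in> mor D N L"
      using o h by (auto simp: mor_def)
    note fm = equiv_morD(1)[OF f] and gm = equiv_morD(1)[OF g]
    have "(g \<cdot> f) \<cdot> snd M x = snd L x \<cdot> tens_mor A x (fst M) (fst L) (g \<cdot> f)" if x: "x \<in> carrier G" for x
      using comp_assoc[OF equiv_ObjD(4)[OF o(1) x] fm gm] equiv_morD(4)[OF f x]
        comp_assoc[OF tens_mor_mor[OF x fm] equiv_ObjD(4)[OF o(2) x] gm] equiv_morD(4)[OF g x]
        comp_assoc[OF tens_mor_mor[OF x fm] tens_mor_mor[OF x gm] equiv_ObjD(4)[OF o(3) x]]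
        tens_mor_comp[OF x fm gm] by simp
    then show ?thesis
      using morD(1)[OF mor_comp[OF fm gm]] by (simp add: Hom_equiv_cat)
  qed
  show "vector_space (smul D)"
    using vector_space by simp
qed (simp_all, (blast intro: equiv_ObjD(1) equiv_HomD cmp_assoc idm_cmp cmp_idm cmp_add_right cmp_add_left
      cmp_smul_right cmp_smul_left)+)

end

sublocale exact_action \<subseteq> equiv: k_category D
  by (rule equiv_k_category)

context exact_action
begin

text \<open>An action on a direct sum \<open>P = \<Oplus>i. X i\<close> is given by the matrices of its components
  \<open>u g i j : g \<otimes> X j \<rightarrow> X i\<close>.  The orbit objects, the tensor products with representations and the direct sums in
  the equivariant category all have this form.\<close>

definition matrix_obj :: "'i set \<Rightarrow> ('i \<Rightarrow> 'o) \<Rightarrow> 'o \<Rightarrow> ('i \<Rightarrow> 'm) \<Rightarrow> ('i \<Rightarrow> 'm) \<Rightarrow> ('g \<Rightarrow> 'i \<Rightarrow> 'i \<Rightarrow> 'm) \<Rightarrow>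
    'o \<times> ('g \<Rightarrow> 'm)" where
  "matrix_obj I X P \<iota> \<pi> u =
     (P, \<lambda>g\<in>carrier G. matmor C \<iota> I (u g) I (\<lambda>j. tens_mor A g P (X j) (\<pi> j)))"

text \<open>The associativity and unit laws of an equivariant object read entry by entry: the
  entries for gh form the product of the matrix of g with the g-translate of the matrix of h,
  corrected by the associativity isomorphism of the source component.\<close>

definition matrix_cocycle :: "'i set \<Rightarrow> ('i \<Rightarrow> 'o) \<Rightarrow> ('g \<Rightarrow> 'i \<Rightarrow> 'i \<Rightarrow> 'm) \<Rightarrow> bool" where
  "matrix_cocycle I X u \<longleftrightarrow> (\<forall>g\<in>carrier G. \<forall>i\<in>I. \<forall>j\<in>I. u g i j \<in> mor C (tens A g (X j)) (X i)) \<and>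
     (\<forall>g\<in>carrier G. \<forall>h\<in>carrier G. \<forall>i\<in>I. \<forall>l\<in>I. u (g \<otimes>\<^bsub>G\<^esub> h) i l =
        (\<Sum>j\<in>I. u g i j \<cdot> (tens_mor A g (tens A h (X l)) (X j) (u h j l) \<cdot> assc A g h (X l)))) \<and>
     (\<forall>i\<in>I. \<forall>j\<in>I. u \<one>\<^bsub>G\<^esub> i j = (if i = j then unt A (X j) else 0))"

lemma matrix_obj_act:
  assumes P: "biproduct C I X P \<iota> \<pi>" and u: "matrix_cocycle I X u" and g: "g \<in> carrier G"
  shows matrix_obj_act_mor: "snd (matrix_obj I X P \<iota> \<pi> u) g \<in> mor C (tens A g P) P"
    and proj_matrix_obj_act: "i \<in> I \<Longrightarrow> \<pi> i \<cdot> snd (matrix_obj I X P \<iota> \<pi> u) g =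
      (\<Sum>j\<in>I. u g i j \<cdot> tens_mor A g P (X j) (\<pi> j))"
    and matrix_obj_act_inj: "j \<in> I \<Longrightarrow> snd (matrix_obj I X P \<iota> \<pi> u) g \<cdot> tens_mor A g (X j) P (\<iota> j) =
      (\<Sum>i\<in>I. \<iota> i \<cdot> u g i j)"
    and matrix_obj_act_tuple: "\<lbrakk>W \<in> Obj C; \<forall>j\<in>I. w j \<in> mor C W (tens A g (X j))\<rbrakk> \<Longrightarrow>
      snd (matrix_obj I X P \<iota> \<pi> u) g \<cdot> (\<Sum>j\<in>I. tens_mor A g (X j) P (\<iota> j) \<cdot> w j) =
      (\<Sum>i\<in>I. \<iota> i \<cdot> (\<Sum>j\<in>I. u g i j \<cdot> w j))"
proof -
  have "\<forall>i\<in>I. \<forall>j\<in>I. u g i j \<in> mor C (tens A g (X j)) (X i)"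
    using u g by (simp add: matrix_cocycle_def)
  note m = matmor[OF tens_biproduct[OF g P] P this] and t = matmor_tuple[OF tens_biproduct[OF g P] P this]
  show "snd (matrix_obj I X P \<iota> \<pi> u) g \<in> mor C (tens A g P) P"
    "i \<in> I \<Longrightarrow> \<pi> i \<cdot> snd (matrix_obj I X P \<iota> \<pi> u) g = (\<Sum>j\<in>I. u g i j \<cdot> tens_mor A g P (X j) (\<pi> j))"
    "j \<in> I \<Longrightarrow> snd (matrix_obj I X P \<iota> \<pi> u) g \<cdot> tens_mor A g (X j) P (\<iota> j) = (\<Sum>i\<in>I. \<iota> i \<cdot> u g i j)"
    "\<lbrakk>W \<in> Obj C; \<forall>j\<in>I. w j \<in> mor C W (tens A g (X j))\<rbrakk> \<Longrightarrow>
      snd (matrix_obj I X P \<iota> \<pi> u) g \<cdot> (\<Sum>j\<in>I. tens_mor A g (X j) P (\<iota> j) \<cdot> w j) =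
      (\<Sum>i\<in>I. \<iota> i \<cdot> (\<Sum>j\<in>I. u g i j \<cdot> w j))"
    using m t g by (simp_all add: matrix_obj_def)
qed

lemma tens_mor_tuple:
  assumes P: "biproduct C I X P \<iota> \<pi>" and g: "g \<in> carrier G" and W: "W \<in> Obj C" and w: "\<forall>j\<in>I. w j \<in> mor C W (X j)"
  shows "tens_mor A g W P (\<Sum>j\<in>I. \<iota> j \<cdot> w j) = (\<Sum>j\<in>I. tens_mor A g (X j) P (\<iota> j) \<cdot> tens_mor A g W (X j) (w j))"
proof -
  note p = biproductD[OF P]
  have "tens_mor A g W P (\<Sum>j\<in>I. \<iota> j \<cdot> w j) = (\<Sum>j\<in>I. tens_mor A g W P (\<iota> j \<cdot> w j))"
    by (rule tens_mor_sum[OF g W p(2)]) (use p(4) w in blast)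
  also have "\<dots> = (\<Sum>j\<in>I. tens_mor A g (X j) P (\<iota> j) \<cdot> tens_mor A g W (X j) (w j))"
    by (rule sum.cong[OF refl], rule tens_mor_comp[OF g]) (use p(4) w in blast)+
  finally show ?thesis .
qed

text \<open>Both sides of the law for gh are morphisms out of (gh) \<otimes> P, so they are compared
  on the images of the injections of P. There each side is a column, and the entries agree by the
  matrix condition.\<close>

lemma matrix_obj_equiv_Obj:
  assumes P: "biproduct C I X P \<iota> \<pi>" and u: "matrix_cocycle I X u"
  shows "matrix_obj I X P \<iota> \<pi> u \<in> equiv_Obj G C A"
proof -
  note p = biproductD[OF P] and m = matrix_obj_act[OF P u]
  define \<psi> where "\<psi> = snd (matrix_obj I X P \<iota> \<pi> u)"
  have um: "u g i j \<in> mor C (tens A g (X j)) (X i)" if "g \<in> carrier G" "i \<in> I" "j \<in> I" for g i j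
    using u that by (simp add: matrix_cocycle_def)
  have "(P, \<psi>) \<in> equiv_Obj G C A"
  proof (rule equiv_ObjI[OF p(2)])
    show "\<psi> \<in> extensional (carrier G)"
      by (simp add: \<psi>_def matrix_obj_def)
    show \<psi>: "\<psi> g \<in> mor C (tens A g P) P" if "g \<in> carrier G" for g
      using m(1)[OF that] by (simp add: \<psi>_def)
    fix g h assume g: "g \<in> carrier G" and h: "h \<in> carrier G"
    have gh: "g \<otimes>\<^bsub>G\<^esub> h \<in> carrier G"
      using g h by simp
    let ?a = "tens_mor A g (tens A h P) P (\<psi> h) \<cdot> assc A g h P"
    have T: "tens_mor A g (tens A h P) P (\<psi> h) \<in> mor C (tens A g (tens A h P)) (tens A g P)"
      by (rule tens_mor_mor[OF g \<psi>[OF h]])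
    have a: "?a \<in> mor C (tens A (g \<otimes>\<^bsub>G\<^esub> h) P) (tens A g P)"
      using T assc_mor[OF g h p(2)] by blast
    show "\<psi> (g \<otimes>\<^bsub>G\<^esub> h) = \<psi> g \<cdot> ?a"
    proof (rule biproduct_inj_ext[OF tens_biproduct[OF gh P] \<psi>[OF gh] mor_comp[OF a \<psi>[OF g]]])
      fix l assume l: "l \<in> I"
      let ?\<iota> = "tens_mor A (g \<otimes>\<^bsub>G\<^esub> h) (X l) P (\<iota> l)"
      let ?w = "\<lambda>j. tens_mor A g (tens A h (X l)) (X j) (u h j l) \<cdot> assc A g h (X l)"
      have \<iota>: "?\<iota> \<in> mor C (tens A (g \<otimes>\<^bsub>G\<^esub> h) (X l)) (tens A (g \<otimes>\<^bsub>G\<^esub> h) P)"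
        by (rule tens_mor_mor[OF gh p(4)[OF l]])
      have al: "assc A g h (X l) \<in> mor C (tens A (g \<otimes>\<^bsub>G\<^esub> h) (X l)) (tens A g (tens A h (X l)))"
        by (rule assc_mor[OF g h p(3)[OF l]])
      have hl: "tens A h (X l) \<in> Obj C" and ghl: "tens A (g \<otimes>\<^bsub>G\<^esub> h) (X l) \<in> Obj C"
        using tens_Obj p(3)[OF l] h gh by auto
      have Tu: "\<forall>j\<in>I. tens_mor A g (tens A h (X l)) (X j) (u h j l) \<in> mor C (tens A g (tens A h (X l))) (tens A g (X j))"
        using tens_mor_mor[OF g um[OF h]] l by blast
      then have w: "\<forall>j\<in>I. ?w j \<in> mor C (tens A (g \<otimes>\<^bsub>G\<^esub> h) (X l)) (tens A g (X j))"
        using al by blast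
      have Th\<iota>: "tens_mor A h (X l) P (\<iota> l) \<in> mor C (tens A h (X l)) (tens A h P)"
        by (rule tens_mor_mor[OF h p(4)[OF l]])
      \<comment> \<open>Naturality moves the injection across \<open>assc\<close>; then \<psi> h
        restricted to it is the column l of u h.\<close>
      have "?a \<cdot> ?\<iota> = tens_mor A g (tens A h P) P (\<psi> h) \<cdot> (assc A g h P \<cdot> ?\<iota>)"
        by (rule comp_assoc[OF \<iota> assc_mor[OF g h p(2)] T])
      also have "assc A g h P \<cdot> ?\<iota> =
          tens_mor A g (tens A h (X l)) (tens A h P) (tens_mor A h (X l) P (\<iota> l)) \<cdot> assc A g h (X l)"
        by (rule assc_nat[OF g h p(4)[OF l]])
      also have "tens_mor A g (tens A h P) P (\<psi> h) \<cdot> \<dots> =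
          tens_mor A g (tens A h (X l)) P (\<psi> h \<cdot> tens_mor A h (X l) P (\<iota> l)) \<cdot> assc A g h (X l)"
        using comp_assoc[OF al tens_mor_mor[OF g Th\<iota>] T] tens_mor_comp[OF g Th\<iota> \<psi>[OF h]] by simp
      also have "\<psi> h \<cdot> tens_mor A h (X l) P (\<iota> l) = (\<Sum>j\<in>I. \<iota> j \<cdot> u h j l)"
        using m(3)[OF h l] by (simp add: \<psi>_def)
      also have "tens_mor A g (tens A h (X l)) P (\<Sum>j\<in>I. \<iota> j \<cdot> u h j l) =
          (\<Sum>j\<in>I. tens_mor A g (X j) P (\<iota> j) \<cdot> tens_mor A g (tens A h (X l)) (X j) (u h j l))"
        by (rule tens_mor_tuple[OF P g hl]) (use um[OF h] l in blast)
      also have "\<dots> \<cdot> assc A g h (X l) = (\<Sum>j\<in>I. tens_mor A g (X j) P (\<iota> j) \<cdot> ?w j)"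
        by (rule tuple_comp[OF tens_biproduct[OF g P] al]) (use Tu in blast)
      finally have "?a \<cdot> ?\<iota> = (\<Sum>j\<in>I. tens_mor A g (X j) P (\<iota> j) \<cdot> ?w j)" .
      then have "\<psi> g \<cdot> ?a \<cdot> ?\<iota> = (\<Sum>i\<in>I. \<iota> i \<cdot> (\<Sum>j\<in>I. u g i j \<cdot> ?w j))"
        using comp_assoc[OF \<iota> a \<psi>[OF g]] m(4)[OF g ghl w] by (simp add: \<psi>_def)
      also have "\<dots> = (\<Sum>i\<in>I. \<iota> i \<cdot> u (g \<otimes>\<^bsub>G\<^esub> h) i l)"
        by (rule sum.cong[OF refl]) (use u g h l in \<open>auto simp: matrix_cocycle_def\<close>)
      also have "\<dots> = \<psi> (g \<otimes>\<^bsub>G\<^esub> h) \<cdot> ?\<iota>"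
        using m(3)[OF gh l] by (simp add: \<psi>_def)
      finally show "\<psi> (g \<otimes>\<^bsub>G\<^esub> h) \<cdot> ?\<iota> = \<psi> g \<cdot> ?a \<cdot> ?\<iota>"
        by simp
    qed
  next
    have e: "\<one>\<^bsub>G\<^esub> \<in> carrier G"
      by simp
    show "\<psi> \<one>\<^bsub>G\<^esub> = unt A P"
    proof (rule biproduct_inj_ext[OF tens_biproduct[OF e P] _ unt_mor[OF p(2)]])
      show "\<psi> \<one>\<^bsub>G\<^esub> \<in> mor C (tens A \<one>\<^bsub>G\<^esub> P) P"
        using m(1)[OF e] by (simp add: \<psi>_def)
      fix l assume l: "l \<in> I"
      have "\<psi> \<one>\<^bsub>G\<^esub> \<cdot> tens_mor A \<one>\<^bsub>G\<^esub> (X l) P (\<iota> l) = (\<Sum>i\<in>I. \<iota> i \<cdot> u \<one>\<^bsub>G\<^esub> i l)"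
        using m(3)[OF e l] by (simp add: \<psi>_def)
      also have "\<dots> = (\<Sum>i\<in>I. if i = l then \<iota> l \<cdot> unt A (X l) else 0)"
        by (rule sum.cong[OF refl]) (use u l comp_zero_right[OF p(4)] in \<open>auto simp: matrix_cocycle_def\<close>)
      also have "\<dots> = unt A P \<cdot> tens_mor A \<one>\<^bsub>G\<^esub> (X l) P (\<iota> l)"
        using p(1) l unt_nat[OF p(4)[OF l]] by simp
      finally show "\<psi> \<one>\<^bsub>G\<^esub> \<cdot> tens_mor A \<one>\<^bsub>G\<^esub> (X l) P (\<iota> l) = unt A P \<cdot> tens_mor A \<one>\<^bsub>G\<^esub> (X l) P (\<iota> l)" .
    qed
  qed
  then show ?thesis
    by (simp add: \<psi>_def matrix_obj_def)
qed

text \<open>The premise is the matrix equation f u = v (g \<otimes> f), column by column; it is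
  commutation with the two actions after restriction to the injections.\<close>

lemma matrix_obj_mor:
  assumes P: "biproduct C I X P \<iota> \<pi>" and u: "matrix_cocycle I X u"
    and Q: "biproduct C K Y Q \<iota>' \<pi>'" and v: "matrix_cocycle K Y v"
    and f: "\<forall>k\<in>K. \<forall>i\<in>I. f k i \<in> mor C (X i) (Y k)"
    and uv: "\<And>g k i. \<lbrakk>g \<in> carrier G; k \<in> K; i \<in> I\<rbrakk> \<Longrightarrow>
      (\<Sum>j\<in>I. f k j \<cdot> u g j i) = (\<Sum>l\<in>K. v g k l \<cdot> tens_mor A g (X i) (Y l) (f l i))"
  shows "matmor C \<iota>' K f I \<pi> \<in> mor D (matrix_obj I X P \<iota> \<pi> u) (matrix_obj K Y Q \<iota>' \<pi>' v)"
proof -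
  note p = biproductD[OF P] and m = matrix_obj_act[OF P u] and n = matrix_obj_act[OF Q v] and F = matmor[OF P Q f]
  let ?M = "matrix_obj I X P \<iota> \<pi> u" and ?N = "matrix_obj K Y Q \<iota>' \<pi>' v" and ?f = "matmor C \<iota>' K f I \<pi>"
  have fst: "fst ?M = P" "fst ?N = Q"
    by (simp_all add: matrix_obj_def)
  have "?f \<cdot> snd ?M g = snd ?N g \<cdot> tens_mor A g P Q ?f" if g: "g \<in> carrier G" for g
  proof (rule biproduct_inj_ext[OF tens_biproduct[OF g P] mor_comp[OF m(1)[OF g] F(1)]
        mor_comp[OF tens_mor_mor[OF g F(1)] n(1)[OF g]]])
    fix i assume i: "i \<in> I"
    let ?\<iota> = "tens_mor A g (X i) P (\<iota> i)"
    have \<iota>: "?\<iota> \<in> mor C (tens A g (X i)) (tens A g P)"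
      by (rule tens_mor_mor[OF g p(4)[OF i]])
    have o: "tens A g (X i) \<in> Obj C"
      using tens_Obj[OF g p(3)[OF i]] .
    have ui: "\<forall>j\<in>I. u g j i \<in> mor C (tens A g (X i)) (X j)"
      using u g i by (simp add: matrix_cocycle_def)
    have fi: "\<forall>l\<in>K. f l i \<in> mor C (X i) (Y l)"
      using f i by blast
    then have Tf: "\<forall>l\<in>K. tens_mor A g (X i) (Y l) (f l i) \<in> mor C (tens A g (X i)) (tens A g (Y l))"
      using tens_mor_mor[OF g] by blast
    have "?f \<cdot> snd ?M g \<cdot> ?\<iota> = ?f \<cdot> (\<Sum>j\<in>I. \<iota> j \<cdot> u g j i)"
      using comp_assoc[OF \<iota> m(1)[OF g] F(1)] m(3)[OF g i] by simp
    also have "\<dots> = (\<Sum>k\<in>K. \<iota>' k \<cdot> (\<Sum>j\<in>I. f k j \<cdot> u g j i))"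
      by (rule matmor_tuple[OF P Q f o ui])
    also have "\<dots> = (\<Sum>k\<in>K. \<iota>' k \<cdot> (\<Sum>l\<in>K. v g k l \<cdot> tens_mor A g (X i) (Y l) (f l i)))"
      using uv[OF g _ i] by simp
    also have "\<dots> = snd ?N g \<cdot> (\<Sum>l\<in>K. tens_mor A g (Y l) Q (\<iota>' l) \<cdot> tens_mor A g (X i) (Y l) (f l i))"
      by (rule n(4)[symmetric, OF g o Tf])
    also have "\<dots> = snd ?N g \<cdot> tens_mor A g (X i) Q (\<Sum>l\<in>K. \<iota>' l \<cdot> f l i)"
      by (subst tens_mor_tuple[OF Q g p(3)[OF i] fi]) simp
    also have "\<dots> = snd ?N g \<cdot> tens_mor A g P Q ?f \<cdot> ?\<iota>"
      using F(3)[OF i] tens_mor_comp[OF g p(4)[OF i] F(1)] comp_assoc[OF \<iota> tens_mor_mor[OF g F(1)] n(1)[OF g]]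
      by simp
    finally show "?f \<cdot> snd ?M g \<cdot> ?\<iota> = snd ?N g \<cdot> tens_mor A g P Q ?f \<cdot> ?\<iota>" .
  qed
  then show ?thesis
    using F(1) fst matrix_obj_equiv_Obj[OF P u] matrix_obj_equiv_Obj[OF Q v] by (simp add: mor_equiv_iff)
qed

end

context exact_action
begin

lemma fst_matrix_obj [simp]: "fst (matrix_obj I X P \<iota> \<pi> u) = P"
  by (simp add: matrix_obj_def)

section \<open>Direct sums of equivariant objects\<close>

lemma equiv_biproductI:
  assumes b: "biproduct C I (\<lambda>i. fst (M i)) (fst N) \<iota> \<pi>"
    and "N \<in> equiv_Obj G C A"
    and "\<And>i. i \<in> I \<Longrightarrow> \<iota> i \<in> mor D (M i) N" "\<And>i. i \<in> I \<Longrightarrow> \<pi> i \<in> mor D N (M i)"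
  shows "biproduct D I M N \<iota> \<pi>"
  by (rule equiv.biproductI) (use assms biproductD[OF b] in auto)

lemma equiv_biproductD:
  assumes "biproduct D I M N \<iota> \<pi>"
  shows "biproduct C I (\<lambda>i. fst (M i)) (fst N) \<iota> \<pi>"
  by (rule biproductI)
    (use equiv.biproductD[OF assms] equiv_morD(1) equiv_ObjD(1) in auto)

lemma diagonal_cocycle:
  assumes "finite I" and M: "\<And>i. i \<in> I \<Longrightarrow> M i \<in> equiv_Obj G C A"
  shows "matrix_cocycle I (\<lambda>i. fst (M i)) (\<lambda>g i j. if i = j then snd (M j) g else 0)"
  unfolding matrix_cocycle_def
proof (intro conjI ballI)
  fix g i j assume g: "g \<in> carrier G" and i: "i \<in> I" and j: "j \<in> I"
  show "(if i = j then snd (M j) g else 0) \<in> mor C (tens A g (fst (M j))) (fst (M i))"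
    using equiv_ObjD(1,4)[OF M[OF j]] equiv_ObjD(1)[OF M[OF i]] g tens_Obj by auto
next
  fix g h i l assume g: "g \<in> carrier G" and h: "h \<in> carrier G" and i: "i \<in> I" and l: "l \<in> I"
  let ?w = "\<lambda>j. tens_mor A g (tens A h (fst (M l))) (fst (M j)) (if j = l then snd (M l) h else 0) \<cdot> assc A g h (fst (M l))"
  have o: "fst (M l) \<in> Obj C"
    using equiv_ObjD(1)[OF M[OF l]] .
  have w: "?w j \<in> mor C (tens A (g \<otimes>\<^bsub>G\<^esub> h) (fst (M l))) (tens A g (fst (M j)))" if "j \<in> I" for j
  proof (rule mor_comp[OF assc_mor[OF g h o] tens_mor_mor[OF g]])
    show "(if j = l then snd (M l) h else 0) \<in> mor C (tens A h (fst (M l))) (fst (M j))"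
      using equiv_ObjD(4)[OF M[OF l] h] equiv_ObjD(1)[OF M[OF that]] tens_Obj[OF h o] by auto
  qed
  have "(\<Sum>j\<in>I. (if i = j then snd (M j) g else 0) \<cdot> ?w j) = (\<Sum>j\<in>I. if j = i then snd (M i) g \<cdot> ?w i else 0)"
    by (rule sum.cong) (use comp_zero_left[OF w] in auto)
  also have "\<dots> = snd (M i) g \<cdot> ?w i"
    using assms(1) i by simp
  also have "\<dots> = (if i = l then snd (M l) (g \<otimes>\<^bsub>G\<^esub> h) else 0)"
    using equiv_ObjD(5)[OF M[OF i] g h] comp_zero_right[OF equiv_ObjD(4)[OF M[OF i] g]]
      tens_mor_zero[OF g tens_Obj[OF h o] equiv_ObjD(1)[OF M[OF i]]] comp_zero_left[OF assc_mor[OF g h o]] by auto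
  finally show "(if i = l then snd (M l) (g \<otimes>\<^bsub>G\<^esub> h) else 0) =
      (\<Sum>j\<in>I. (if i = j then snd (M j) g else 0) \<cdot> ?w j)"
    by simp
next
  fix i j assume "i \<in> I" "j \<in> I"
  then show "(if i = j then snd (M j) \<one>\<^bsub>G\<^esub> else 0) = (if i = j then unt A (fst (M j)) else 0)"
    using equiv_ObjD(6)[OF M] by simp
qed

text \<open>The injections and projections of C are kept and only an action on P has to be found:
  the diagonal matrix of the given actions makes all of them equivariant.\<close>

lemma equiv_direct_sum:
  assumes M: "\<And>i. i \<in> I \<Longrightarrow> M i \<in> equiv_Obj G C A" and b: "biproduct C I (\<lambda>i. fst (M i)) P \<iota> \<pi>"
  shows "\<exists>N. biproduct D I M N \<iota> \<pi>"
proof -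
  note p = biproductD[OF b]
  let ?u = "\<lambda>g i j. if i = j then snd (M j) g else 0"
  let ?N = "matrix_obj I (\<lambda>i. fst (M i)) P \<iota> \<pi> ?u"
  have u: "matrix_cocycle I (\<lambda>i. fst (M i)) ?u"
    by (rule diagonal_cocycle[OF p(1) M])
  note N = matrix_obj_equiv_Obj[OF b u] and m = matrix_obj_act[OF b u]
  have "\<iota> i \<in> mor D (M i) ?N" if i: "i \<in> I" for i
  proof -
    have "\<iota> i \<cdot> snd (M i) g = snd ?N g \<cdot> tens_mor A g (fst (M i)) P (\<iota> i)" if g: "g \<in> carrier G" for g
    proof -
      have "snd ?N g \<cdot> tens_mor A g (fst (M i)) P (\<iota> i) = (\<Sum>j\<in>I. if j = i then \<iota> i \<cdot> snd (M i) g else 0)"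
        unfolding m(3)[OF g i] by (rule sum.cong) (use comp_zero_right[OF p(4)] in auto)
      then show ?thesis
        using p(1) i by simp
    qed
    then show ?thesis
      using p(4)[OF i] M[OF i] N by (simp add: mor_equiv_iff)
  qed
  moreover have "\<pi> i \<in> mor D ?N (M i)" if i: "i \<in> I" for i
  proof -
    have "\<pi> i \<cdot> snd ?N g = snd (M i) g \<cdot> tens_mor A g P (fst (M i)) (\<pi> i)" if g: "g \<in> carrier G" for g
    proof -
      have "\<pi> i \<cdot> snd ?N g = (\<Sum>j\<in>I. if j = i then snd (M i) g \<cdot> tens_mor A g P (fst (M i)) (\<pi> i) else 0)"
        unfolding m(2)[OF g i] by (rule sum.cong) (use comp_zero_left[OF tens_mor_mor[OF g p(5)]] in auto)
      then show ?thesis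
        using p(1) i by simp
    qed
    then show ?thesis
      using p(5)[OF i] M[OF i] N by (simp add: mor_equiv_iff)
  qed
  ultimately have "biproduct D I M ?N \<iota> \<pi>"
    using N b by (intro equiv_biproductI) auto
  then show ?thesis
    by blast
qed

lemma equiv_additive: "additive_k_category D"
proof
  fix n :: nat and M assume "\<And>i. i < n \<Longrightarrow> M i \<in> Obj D"
  then have M: "M i \<in> equiv_Obj G C A" if "i \<in> {..<n}" for i
    using that by simp
  obtain P \<iota> \<pi> where "biproduct C {..<n} (\<lambda>i. fst (M i)) P \<iota> \<pi>"
    using biproduct_exists[of "{..<n}" "\<lambda>i. fst (M i)"] equiv_ObjD(1)[OF M] by auto
  from equiv_direct_sum[OF M this] obtain N where "biproduct D {..<n} M N \<iota> \<pi>"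
    by blast
  then show "\<exists>N. is_direct_sum D {..<n} M N"
    unfolding is_direct_sum_def by blast
qed

section \<open>Conflations of equivariant objects\<close>

lemma equiv_conflD:
  assumes "confl D M N L i p"
  shows "i \<in> mor D M N" "p \<in> mor D N L" "confl C (fst M) (fst N) (fst L) i p"
  using assms by (auto simp: mor_def equiv_cat_def)

lemma equiv_conflI:
  assumes "i \<in> mor D M N" "p \<in> mor D N L" "confl C (fst M) (fst N) (fst L) i p"
  shows "confl D M N L i p"
  using assms by (auto simp: mor_def equiv_cat_def)

lemma act_confl:
  assumes "g \<in> carrier G" "confl C X E Y i p"
  shows "confl C (tens A g X) (tens A g E) (tens A g Y) (tens_mor A g X E i) (tens_mor A g E Y p)"
  using action_exact[OF assms(1)] assms(2) by (auto simp: exact_functor_def)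

text \<open>The factorisation h exists in C. It is equivariant because the two sides of the
  condition agree after composition with i, which is monic.\<close>

lemma equiv_kernel:
  assumes c: "confl D M N L i p"
  shows "is_kernel D M N L i p"
proof -
  note m = equiv_conflD[OF c] and i = equiv_morD[OF equiv_conflD(1)[OF c]]
  note o = confl_Obj[OF m(3)]
  note k = is_kernelD[OF confl_kernel_cokernel[OF m(3), THEN conjunct1]]
  show ?thesis
  proof (rule equiv.is_kernelI[OF m(1,2)])
    show "p \<cdot>\<^bsub>D\<^esub> i = 0"
      using k(3) o by simp
    show "h = h'" if "h \<in> mor D W M" "h' \<in> mor D W M" "i \<cdot>\<^bsub>D\<^esub> h = i \<cdot>\<^bsub>D\<^esub> h'" for W h h'
      using k(5)[of h "fst W" h'] that o equiv_morD(1)[OF that(1)] equiv_morD(1)[OF that(2)] by simp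
    fix W f assume f: "f \<in> mor D W N" "p \<cdot>\<^bsub>D\<^esub> f = 0"
    note w = equiv_morD[OF f(1)]
    obtain h where h: "h \<in> mor C (fst W) (fst M)" "i \<cdot> h = f"
      using k(4)[OF _ _ _ w(1)] o f(2) by auto
    have "h \<cdot> snd W g = snd M g \<cdot> tens_mor A g (fst W) (fst M) h" if g: "g \<in> carrier G" for g
    proof (rule k(5))
      have W: "snd W g \<in> mor C (tens A g (fst W)) (fst W)" and M: "snd M g \<in> mor C (tens A g (fst M)) (fst M)"
        and N: "snd N g \<in> mor C (tens A g (fst N)) (fst N)"
        using equiv_ObjD(4) w i g by auto
      have T: "tens_mor A g (fst W) (fst M) h \<in> mor C (tens A g (fst W)) (tens A g (fst M))"
        by (rule tens_mor_mor[OF g h(1)])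
      show "h \<cdot> snd W g \<in> mor C (tens A g (fst W)) (fst M)"
        "snd M g \<cdot> tens_mor A g (fst W) (fst M) h \<in> mor C (tens A g (fst W)) (fst M)"
        using W M T h(1) by blast+
      have "i \<cdot> (h \<cdot> snd W g) = snd N g \<cdot> tens_mor A g (fst W) (fst N) (i \<cdot> h)"
        using comp_assoc[OF W h(1) i(1)] w(4)[OF g] h(2) by simp
      also have "\<dots> = (snd N g \<cdot> tens_mor A g (fst M) (fst N) i) \<cdot> tens_mor A g (fst W) (fst M) h"
        using tens_mor_comp[OF g h(1) i(1)] comp_assoc[OF T tens_mor_mor[OF g i(1)] N] by simp
      also have "\<dots> = i \<cdot> (snd M g \<cdot> tens_mor A g (fst W) (fst M) h)"
        using i(4)[OF g] comp_assoc[OF T M i(1)] by simp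
      finally show "i \<cdot> (h \<cdot> snd W g) = i \<cdot> (snd M g \<cdot> tens_mor A g (fst W) (fst M) h)" .
    qed (use o in auto)
    then show "\<exists>h\<in>mor D W M. i \<cdot>\<^bsub>D\<^esub> h = f"
      using h w(2) i(2) by (auto simp: mor_equiv_iff)
  qed
qed

text \<open>The factorisation through p again exists in C. To see that it is equivariant one has to
  cancel the g-translate of p rather than p; that translate is a cokernel because g \<otimes> - is
  exact.\<close>

lemma equiv_cokernel:
  assumes c: "confl D M N L i p"
  shows "is_cokernel D M N L i p"
proof -
  note m = equiv_conflD[OF c] and i = equiv_morD[OF equiv_conflD(1)[OF c]] and p = equiv_morD[OF equiv_conflD(2)[OF c]]
  note o = confl_Obj[OF m(3)]
  note k = is_cokernelD[OF confl_kernel_cokernel[OF m(3), THEN conjunct2]]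
  have pi: "p \<cdot> i = 0"
    using confl_kernel_cokernel[OF m(3)] by (simp add: is_kernel_def)
  have *: "\<exists>h. h \<in> mor D L W \<and> h \<cdot> p = f" if f: "f \<in> mor D N W" "f \<cdot> i = 0" for W f
  proof -
    note w = equiv_morD[OF f(1)]
    obtain h where h: "h \<in> mor C (fst L) (fst W)" "h \<cdot> p = f"
      using k(1)[OF _ _ _ w(1)] o f(2) by auto
    have "h \<cdot> snd L g = snd W g \<cdot> tens_mor A g (fst L) (fst W) h" if g: "g \<in> carrier G" for g
    proof -
      have W: "snd W g \<in> mor C (tens A g (fst W)) (fst W)" and L: "snd L g \<in> mor C (tens A g (fst L)) (fst L)"
        and N: "snd N g \<in> mor C (tens A g (fst N)) (fst N)"
        using equiv_ObjD(4) w p g by auto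
      have T: "tens_mor A g (fst L) (fst W) h \<in> mor C (tens A g (fst L)) (tens A g (fst W))"
        and Tp: "tens_mor A g (fst N) (fst L) p \<in> mor C (tens A g (fst N)) (tens A g (fst L))"
        using tens_mor_mor[OF g h(1)] tens_mor_mor[OF g p(1)] .
      have "(h \<cdot> snd L g) \<cdot> tens_mor A g (fst N) (fst L) p = (h \<cdot> p) \<cdot> snd N g"
        using comp_assoc[OF Tp L h(1)] p(4)[OF g] comp_assoc[OF N p(1) h(1)] by simp
      also have "\<dots> = snd W g \<cdot> tens_mor A g (fst N) (fst W) (h \<cdot> p)"
        using w(4)[OF g] h(2) by simp
      also have "\<dots> = (snd W g \<cdot> tens_mor A g (fst L) (fst W) h) \<cdot> tens_mor A g (fst N) (fst L) p"
        using tens_mor_comp[OF g p(1) h(1)] comp_assoc[OF Tp T W] by simp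
      finally show ?thesis
        using is_cokernelD(2)[OF confl_kernel_cokernel[OF act_confl[OF g m(3)], THEN conjunct2]]
          mor_comp[OF L h(1)] mor_comp[OF T W] confl_Obj[OF act_confl[OF g m(3)]] by blast
    qed
    then show ?thesis
      using h w(3) p(3) by (auto simp: mor_equiv_iff)
  qed
  show ?thesis
    unfolding is_cokernel_def
  proof (intro conjI ballI impI)
    fix W f assume W: "W \<in> Obj D" "f \<in> Hom D N W" "f \<cdot>\<^bsub>D\<^esub> i = 0"
    have "f \<in> mor D N W"
      using W p(2) by (simp add: mor_def)
    then obtain h where h: "h \<in> mor D L W" "h \<cdot> p = f"
      using *[of f W] W(3) by (metis equiv_cat_simps(3))
    show "\<exists>!h. h \<in> Hom D L W \<and> h \<cdot>\<^bsub>D\<^esub> p = f"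
    proof (rule ex1I[of _ h])
      show "h \<in> Hom D L W \<and> h \<cdot>\<^bsub>D\<^esub> p = f"
        using h equiv.morD(1)[OF h(1)] by simp
      fix h' assume h': "h' \<in> Hom D L W \<and> h' \<cdot>\<^bsub>D\<^esub> p = f"
      then have "h' \<in> mor D L W"
        using W(1) p(3) by (simp add: mor_def)
      from k(2)[OF _ _ _ equiv_morD(1)[OF this] equiv_morD(1)[OF h(1)]] show "h' = h"
        using h(2) h' o by simp
    qed
  qed (use equiv.morD(1)[OF m(1)] equiv.morD(1)[OF m(2)] pi in auto)
qed

text \<open>Form the pullback E in C. The actions on L' and N induce morphisms g \<otimes> E
  \<rightarrow> E by the universal property, and the laws of an action on E are checked after
  composition with p' and f', which are jointly monic.\<close>

lemma equiv_pullback: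
  assumes c: "confl D M N L i p" and f: "f \<in> mor D L' L"
  shows "\<exists>N' i' p' f'. confl D M N' L' i' p' \<and> f' \<in> mor D N' N \<and> f \<cdot>\<^bsub>D\<^esub> p' = p \<cdot>\<^bsub>D\<^esub> f'"
proof -
  note m = equiv_conflD[OF c] and i = equiv_morD[OF equiv_conflD(1)[OF c]] and p = equiv_morD[OF equiv_conflD(2)[OF c]]
    and ff = equiv_morD[OF f]
  obtain E i' p' f' where E: "E \<in> Obj C" and pb: "is_pullback C (fst N) (fst L) E (fst L') p f p' f'"
    and cE: "confl C (fst M) E (fst L') i' p'" and i': "f' \<cdot> i' = i"
    using confl_pullback[OF m(3) ff(1)] by blast
  have o: "fst M \<in> Obj C" "fst N \<in> Obj C" "fst L \<in> Obj C" "fst L' \<in> Obj C"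
    using equiv_ObjD(1) i(2) p(2,3) ff(2) by auto
  note x = is_pullbackD[OF pb o(2,3) E o(4)]
  note mE = confl_mor[OF cE]
  have p'i': "p' \<cdot> i' = 0"
    using confl_kernel_cokernel[OF cE] by (simp add: is_kernel_def)
  have "\<forall>g\<in>carrier G. \<exists>h\<in>mor C (tens A g E) E. p' \<cdot> h = snd L' g \<cdot> tens_mor A g E (fst L') p' \<and>
      f' \<cdot> h = snd N g \<cdot> tens_mor A g E (fst N) f'"
  proof
    fix g assume g: "g \<in> carrier G"
    have L': "snd L' g \<in> mor C (tens A g (fst L')) (fst L')" and L: "snd L g \<in> mor C (tens A g (fst L)) (fst L)"
      and N: "snd N g \<in> mor C (tens A g (fst N)) (fst N)"
      using equiv_ObjD(4) p ff g by auto
    have Tp: "tens_mor A g E (fst L') p' \<in> mor C (tens A g E) (tens A g (fst L'))"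
      and Tf: "tens_mor A g E (fst N) f' \<in> mor C (tens A g E) (tens A g (fst N))"
      using tens_mor_mor[OF g x(3)] tens_mor_mor[OF g x(4)] .
    have "f \<cdot> (snd L' g \<cdot> tens_mor A g E (fst L') p') = snd L g \<cdot> tens_mor A g E (fst L) (f \<cdot> p')"
      using comp_assoc[OF Tp L' ff(1)] ff(4)[OF g] comp_assoc[OF Tp tens_mor_mor[OF g ff(1)] L]
        tens_mor_comp[OF g x(3) ff(1)] by simp
    also have "\<dots> = p \<cdot> (snd N g \<cdot> tens_mor A g E (fst N) f')"
      using comp_assoc[OF Tf N p(1)] p(4)[OF g] comp_assoc[OF Tf tens_mor_mor[OF g p(1)] L]
        tens_mor_comp[OF g x(4) p(1)] x(5) by simp
    finally show "\<exists>h\<in>mor C (tens A g E) E. p' \<cdot> h = snd L' g \<cdot> tens_mor A g E (fst L') p' \<and>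
        f' \<cdot> h = snd N g \<cdot> tens_mor A g E (fst N) f'"
      using x(6) mor_comp[OF Tp L'] mor_comp[OF Tf N] by blast
  qed
  then obtain \<chi>' where \<chi>': "\<And>g. g \<in> carrier G \<Longrightarrow> \<chi>' g \<in> mor C (tens A g E) E"
    "\<And>g. g \<in> carrier G \<Longrightarrow> p' \<cdot> \<chi>' g = snd L' g \<cdot> tens_mor A g E (fst L') p'"
    "\<And>g. g \<in> carrier G \<Longrightarrow> f' \<cdot> \<chi>' g = snd N g \<cdot> tens_mor A g E (fst N) f'"
    by metis
  define \<chi> where "\<chi> = restrict \<chi>' (carrier G)"
  have \<chi>: "\<chi> g \<in> mor C (tens A g E) E" "p' \<cdot> \<chi> g = snd L' g \<cdot> tens_mor A g E (fst L') p'"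
    "f' \<cdot> \<chi> g = snd N g \<cdot> tens_mor A g E (fst N) f'" if "g \<in> carrier G" for g
    using \<chi>' that by (simp_all add: \<chi>_def)
  \<comment> \<open>Stated for an arbitrary q compatible with \<chi> and an equivariant target K, so
    that one computation serves both p' and f'.\<close>
  have cocycle: "q \<cdot> (\<chi> g \<cdot> (tens_mor A g (tens A h E) E (\<chi> h) \<cdot> assc A g h E)) = q \<cdot> \<chi> (g \<otimes>\<^bsub>G\<^esub> h)"
    if g: "g \<in> carrier G" and h: "h \<in> carrier G" and K: "K \<in> equiv_Obj G C A" and q: "q \<in> mor C E (fst K)"
      and q\<chi>: "\<And>g. g \<in> carrier G \<Longrightarrow> q \<cdot> \<chi> g = snd K g \<cdot> tens_mor A g E (fst K) q" for g h K q
  proof -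
    have gh: "g \<otimes>\<^bsub>G\<^esub> h \<in> carrier G"
      using g h by simp
    note k = equiv_ObjD[OF K]
    have T\<chi>: "tens_mor A g (tens A h E) E (\<chi> h) \<in> mor C (tens A g (tens A h E)) (tens A g E)"
      by (rule tens_mor_mor[OF g \<chi>(1)[OF h]])
    have a: "tens_mor A g (tens A h E) E (\<chi> h) \<cdot> assc A g h E \<in> mor C (tens A (g \<otimes>\<^bsub>G\<^esub> h) E) (tens A g E)"
      using T\<chi> assc_mor[OF g h E] by blast
    have Tq: "tens_mor A g E (fst K) q \<in> mor C (tens A g E) (tens A g (fst K))"
      by (rule tens_mor_mor[OF g q])
    have Thq: "tens_mor A h E (fst K) q \<in> mor C (tens A h E) (tens A h (fst K))"
      by (rule tens_mor_mor[OF h q])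
    have TTq: "tens_mor A g (tens A h E) (tens A h (fst K)) (tens_mor A h E (fst K) q)
        \<in> mor C (tens A g (tens A h E)) (tens A g (tens A h (fst K)))"
      by (rule tens_mor_mor[OF g Thq])
    have Tk: "tens_mor A g (tens A h (fst K)) (fst K) (snd K h) \<in> mor C (tens A g (tens A h (fst K))) (tens A g (fst K))"
      by (rule tens_mor_mor[OF g k(4)[OF h]])
    have "q \<cdot> (\<chi> g \<cdot> (tens_mor A g (tens A h E) E (\<chi> h) \<cdot> assc A g h E)) =
        snd K g \<cdot> (tens_mor A g E (fst K) q \<cdot> (tens_mor A g (tens A h E) E (\<chi> h) \<cdot> assc A g h E))"
      using comp_assoc[OF a \<chi>(1)[OF g] q] q\<chi>[OF g] comp_assoc[OF a Tq k(4)[OF g]] by simp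
    also have "tens_mor A g E (fst K) q \<cdot> (tens_mor A g (tens A h E) E (\<chi> h) \<cdot> assc A g h E) =
        tens_mor A g (tens A h E) (fst K) (q \<cdot> \<chi> h) \<cdot> assc A g h E"
      using comp_assoc[OF assc_mor[OF g h E] T\<chi> Tq] tens_mor_comp[OF g \<chi>(1)[OF h] q] by simp
    also have "\<dots> = tens_mor A g (tens A h (fst K)) (fst K) (snd K h) \<cdot>
        (assc A g h (fst K) \<cdot> tens_mor A (g \<otimes>\<^bsub>G\<^esub> h) E (fst K) q)"
      using q\<chi>[OF h] tens_mor_comp[OF g Thq k(4)[OF h]] comp_assoc[OF assc_mor[OF g h E] TTq Tk] assc_nat[OF g h q]
      by simp
    also have "snd K g \<cdot> \<dots> = snd K (g \<otimes>\<^bsub>G\<^esub> h) \<cdot> tens_mor A (g \<otimes>\<^bsub>G\<^esub> h) E (fst K) q"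
      using k(5)[OF g h] comp_assoc[OF tens_mor_mor[OF gh q] mor_comp[OF assc_mor[OF g h k(1)] Tk] k(4)[OF g]]
        comp_assoc[OF tens_mor_mor[OF gh q] assc_mor[OF g h k(1)] Tk] by simp
    finally show ?thesis
      using q\<chi>[OF gh] by simp
  qed
  have e: "\<one>\<^bsub>G\<^esub> \<in> carrier G"
    by simp
  have N': "(E, \<chi>) \<in> equiv_Obj G C A"
  proof (rule equiv_ObjI[OF E _ \<chi>(1)])
    show "\<chi> \<in> extensional (carrier G)"
      by (simp add: \<chi>_def)
    fix g h assume g: "g \<in> carrier G" and h: "h \<in> carrier G"
    have gh: "g \<otimes>\<^bsub>G\<^esub> h \<in> carrier G"
      using g h by simp
    show "\<chi> (g \<otimes>\<^bsub>G\<^esub> h) = \<chi> g \<cdot> (tens_mor A g (tens A h E) E (\<chi> h) \<cdot> assc A g h E)"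
    proof (rule x(7)[OF \<chi>(1)[OF gh]])
      show "\<chi> g \<cdot> (tens_mor A g (tens A h E) E (\<chi> h) \<cdot> assc A g h E) \<in> mor C (tens A (g \<otimes>\<^bsub>G\<^esub> h) E) E"
        using \<chi>(1)[OF g] tens_mor_mor[OF g \<chi>(1)[OF h]] assc_mor[OF g h E] by blast
    qed (use cocycle[OF g h ff(2) x(3) \<chi>(2)] cocycle[OF g h p(2) x(4) \<chi>(3)] in simp_all)
  next
    show "\<chi> \<one>\<^bsub>G\<^esub> = unt A E"
      by (rule x(7)[OF \<chi>(1)[OF e] unt_mor[OF E]])
        (use \<chi>(2,3)[OF e] unt_nat[OF x(3)] unt_nat[OF x(4)] equiv_ObjD(6)[OF ff(2)] equiv_ObjD(6)[OF p(2)] in auto)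
  qed
  have mp: "p' \<in> mor D (E, \<chi>) L'" and mf: "f' \<in> mor D (E, \<chi>) N"
    using N' ff(2) p(2) x(3,4) \<chi>(2,3) by (auto simp: mor_equiv_iff)
  \<comment> \<open>Under p' both sides vanish; under f' the claim becomes equivariance of i = f'
    \<cdot> i'.\<close>
  have "i' \<cdot> snd M g = \<chi> g \<cdot> tens_mor A g (fst M) E i'" if g: "g \<in> carrier G" for g
  proof (rule x(7))
    have M: "snd M g \<in> mor C (tens A g (fst M)) (fst M)" and N: "snd N g \<in> mor C (tens A g (fst N)) (fst N)"
      and L': "snd L' g \<in> mor C (tens A g (fst L')) (fst L')"
      using equiv_ObjD(4) i p ff g by auto
    have Ti: "tens_mor A g (fst M) E i' \<in> mor C (tens A g (fst M)) (tens A g E)"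
      and Tp: "tens_mor A g E (fst L') p' \<in> mor C (tens A g E) (tens A g (fst L'))"
      and Tf: "tens_mor A g E (fst N) f' \<in> mor C (tens A g E) (tens A g (fst N))"
      using tens_mor_mor[OF g mE(1)] tens_mor_mor[OF g x(3)] tens_mor_mor[OF g x(4)] .
    show "i' \<cdot> snd M g \<in> mor C (tens A g (fst M)) E" "\<chi> g \<cdot> tens_mor A g (fst M) E i' \<in> mor C (tens A g (fst M)) E"
      using M mE(1) \<chi>(1)[OF g] Ti by blast+
    have "p' \<cdot> (i' \<cdot> snd M g) = 0"
      using comp_assoc[OF M mE(1) x(3)] p'i' comp_zero_left[OF M] by simp
    moreover have "p' \<cdot> (\<chi> g \<cdot> tens_mor A g (fst M) E i') = snd L' g \<cdot> tens_mor A g (fst M) (fst L') (p' \<cdot> i')"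
      using comp_assoc[OF Ti \<chi>(1)[OF g] x(3)] \<chi>(2)[OF g] comp_assoc[OF Ti Tp L'] tens_mor_comp[OF g mE(1) x(3)] by simp
    ultimately show "p' \<cdot> (i' \<cdot> snd M g) = p' \<cdot> (\<chi> g \<cdot> tens_mor A g (fst M) E i')"
      using p'i' tens_mor_zero[OF g o(1,4)] comp_zero_right[OF L'] by simp
    show "f' \<cdot> (i' \<cdot> snd M g) = f' \<cdot> (\<chi> g \<cdot> tens_mor A g (fst M) E i')"
      using comp_assoc[OF M mE(1) x(4)] i' i(4)[OF g] comp_assoc[OF Ti \<chi>(1)[OF g] x(4)] \<chi>(3)[OF g]
        comp_assoc[OF Ti Tf N] tens_mor_comp[OF g mE(1) x(4)] by simp
  qed
  then have "i' \<in> mor D M (E, \<chi>)"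
    using N' i(2) mE(1) by (simp add: mor_equiv_iff)
  then have "confl D M (E, \<chi>) L' i' p'"
    using mp cE by (intro equiv_conflI) auto
  moreover have "f \<cdot>\<^bsub>D\<^esub> p' = p \<cdot>\<^bsub>D\<^esub> f'"
    using x(5) by simp
  ultimately show ?thesis
    using mf by blast
qed

lemma equiv_split_confl:
  assumes "biproduct D (UNIV :: bool set) (case_bool N M) P \<iota> \<pi>"
  shows "confl D N P M (\<iota> True) (\<pi> False)"
proof (rule equiv_conflI)
  have "biproduct C (UNIV :: bool set) (case_bool (fst N) (fst M)) (fst P) \<iota> \<pi>"
    by (rule biproduct_cong[THEN iffD1, OF _ refl refl equiv_biproductD[OF assms]]) (auto split: bool.splits)
  from split_confl[OF this] show "confl C (fst N) (fst P) (fst M) (\<iota> True) (\<pi> False)" .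
  show "\<iota> True \<in> mor D N P" "\<pi> False \<in> mor D P M"
    using equiv.biproductD(4)[OF assms, of True] equiv.biproductD(5)[OF assms, of False] by auto
qed

lemma equiv_conflation_category: "conflation_category D"
proof (rule conflation_category.intro[OF equiv_additive], rule conflation_category_axioms.intro)
  show "M \<in> Obj D \<and> N \<in> Obj D \<and> L \<in> Obj D" if "confl D M N L i p" for M N L i p
    using that by simp
  show "is_kernel D M N L i p \<and> is_cokernel D M N L i p" if "confl D M N L i p" for M N L i p
    using equiv_kernel[OF that] equiv_cokernel[OF that] ..
  show "confl D N P M (\<iota> True) (\<pi> False)"
    if "biproduct D (UNIV :: bool set) (case_bool N M) P \<iota> \<pi>" for N M P \<iota> \<pi>
    using equiv_split_confl[OF that] .
  show "\<exists>N' i' p' f'. confl D M N' L' i' p' \<and> f' \<in> mor D N' N \<and> f \<cdot>\<^bsub>D\<^esub> p' = p \<cdot>\<^bsub>D\<^esub> f'"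
    if "confl D M N L i p" "f \<in> mor D L' L" for M N L i p f L'
    using equiv_pullback[OF that] .
qed

end

sublocale exact_action \<subseteq> equiv: conflation_category D
  by (rule equiv_conflation_category)

section \<open>The orbit functor\<close>

context exact_action
begin

section \<open>The forgetful functor and diagonal equivariant morphisms\<close>

lemma forget_simps [simp]: "fob forget_functor M = fst M" "fmor forget_functor M N f = f"
  by (simp_all add: forget_functor_def)

lemma forget_additive: "additive_functor D C forget_functor"
proof (intro additive_functor.intro equiv_additive additive_k_category_axioms k_functor.intro)
qed (auto simp: equiv_ObjD(1) dest: equiv_HomD)

text \<open>The inverse in C is equivariant: the condition on it may be tested after composition
  with the g-translate of f, an isomorphism, where it becomes the condition on f.\<close>

lemma equiv_iso:
  assumes f: "f \<in> mor D M N" and iso: "is_iso C (fst M) (fst N) f"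
  shows "is_iso D M N f"
proof -
  note d = equiv_morD[OF f]
  note M = equiv_ObjD[OF d(2)] and N = equiv_ObjD[OF d(3)]
  obtain h where h: "h \<in> mor C (fst N) (fst M)" "h \<cdot> f = idm C (fst M)" "f \<cdot> h = idm C (fst N)"
    using iso M(1) N(1) by (auto simp: is_iso_iff)
  have "h \<cdot> snd N g = snd M g \<cdot> tens_mor A g (fst N) (fst M) h" if g: "g \<in> carrier G" for g
  proof (rule iso_cancel_right[OF tens_mor_iso[OF g iso M(1) N(1)]])
    have Tf: "tens_mor A g (fst M) (fst N) f \<in> mor C (tens A g (fst M)) (tens A g (fst N))"
      and Th: "tens_mor A g (fst N) (fst M) h \<in> mor C (tens A g (fst N)) (tens A g (fst M))"
      using tens_mor_mor[OF g d(1)] tens_mor_mor[OF g h(1)] .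
    show "h \<cdot> snd N g \<in> mor C (tens A g (fst N)) (fst M)"
      "snd M g \<cdot> tens_mor A g (fst N) (fst M) h \<in> mor C (tens A g (fst N)) (fst M)"
      using N(4)[OF g] M(4)[OF g] Th h(1) by blast+
    have "(h \<cdot> snd N g) \<cdot> tens_mor A g (fst M) (fst N) f = (h \<cdot> f) \<cdot> snd M g"
      using comp_assoc[OF Tf N(4)[OF g] h(1)] d(4)[OF g] comp_assoc[OF M(4)[OF g] d(1) h(1)] by simp
    also have "\<dots> = snd M g"
      using h(2) idm_comp[OF M(4)[OF g]] by simp
    also have "\<dots> = snd M g \<cdot> tens_mor A g (fst M) (fst M) (h \<cdot> f)"
      using h(2) comp_idm[OF M(4)[OF g]] tens_idm[OF g M(1)] by simp
    also have "\<dots> = (snd M g \<cdot> tens_mor A g (fst N) (fst M) h) \<cdot> tens_mor A g (fst M) (fst N) f"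
      using tens_mor_comp[OF g d(1) h(1)] comp_assoc[OF Tf Th M(4)[OF g]] by simp
    finally show "(h \<cdot> snd N g) \<cdot> tens_mor A g (fst M) (fst N) f =
        (snd M g \<cdot> tens_mor A g (fst N) (fst M) h) \<cdot> tens_mor A g (fst M) (fst N) f" .
  qed (use tens_Obj[OF g M(1)] in auto)
  then have "h \<in> mor D N M"
    using h(1) d(2,3) by (simp add: mor_equiv_iff)
  then show ?thesis
    using f h by (intro equiv.is_isoI[of _ _ _ h]) auto
qed

text \<open>Makes the intertwining criterion for matrices available for diagonal morphisms.\<close>

lemma dsum_mor_matmor:
  assumes X: "biproduct C I X P \<iota> \<pi>" and Y: "biproduct C I Y Q \<iota>' \<pi>'"
    and f: "\<forall>i\<in>I. f i \<in> mor C (X i) (Y i)"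
  shows "dsum_mor C I \<pi> f \<iota>' = matmor C \<iota>' I (\<lambda>i j. if i = j then f i else 0) I \<pi>"
proof -
  note x = biproductD[OF X] and y = biproductD[OF Y]
  have d: "\<forall>i\<in>I. \<forall>j\<in>I. (if i = j then f i else 0) \<in> mor C (X j) (Y i)"
    using f x(3) y(3) by auto
  show ?thesis
  proof (rule biproduct_inj_ext[OF X dsum_mor_mor[OF X Y f] matmor_mor[OF X Y d]])
    fix j assume j: "j \<in> I"
    have "(\<Sum>i\<in>I. \<iota>' i \<cdot> (if i = j then f i else 0)) = (\<Sum>i\<in>I. if i = j then \<iota>' j \<cdot> f j else 0)"
      by (rule sum.cong) (use comp_zero_right[OF y(4)] in auto)
    then show "dsum_mor C I \<pi> f \<iota>' \<cdot> \<iota> j = matmor C \<iota>' I (\<lambda>i j. if i = j then f i else 0) I \<pi> \<cdot> \<iota> j"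
      using dsum_mor_inj[OF X Y f j] matmor_inj[OF X Y d j] x(1) j by simp
  qed
qed

lemma diagonal_equiv_mor:
  assumes P: "biproduct C I X P \<iota> \<pi>" and u: "matrix_cocycle I X u"
    and Q: "biproduct C I Y Q \<iota>' \<pi>'" and v: "matrix_cocycle I Y v"
    and f: "\<forall>i\<in>I. f i \<in> mor C (X i) (Y i)"
    and uv: "\<And>g k i. \<lbrakk>g \<in> carrier G; k \<in> I; i \<in> I\<rbrakk> \<Longrightarrow>
      f k \<cdot> u g k i = v g k i \<cdot> tens_mor A g (X i) (Y i) (f i)"
  shows "dsum_mor C I \<pi> f \<iota>' \<in> mor D (matrix_obj I X P \<iota> \<pi> u) (matrix_obj I Y Q \<iota>' \<pi>' v)"
  unfolding dsum_mor_matmor[OF P Q f]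
proof (rule matrix_obj_mor[OF P u Q v])
  note p = biproductD[OF P] and q = biproductD[OF Q]
  show "\<forall>k\<in>I. \<forall>i\<in>I. (if k = i then f k else 0) \<in> mor C (X i) (Y k)"
    using f p(3) q(3) by auto
  fix g k i assume g: "g \<in> carrier G" and k: "k \<in> I" and i: "i \<in> I"
  have um: "u g j i \<in> mor C (tens A g (X i)) (X j)" and vm: "v g k j \<in> mor C (tens A g (Y j)) (Y k)" if "j \<in> I" for j
    using that g k i u v by (simp_all add: matrix_cocycle_def)
  have "(\<Sum>j\<in>I. (if k = j then f k else 0) \<cdot> u g j i) = (\<Sum>j\<in>I. if j = k then f k \<cdot> u g k i else 0)"
    by (rule sum.cong) (use comp_zero_left[OF um] in auto)
  also have "\<dots> = (\<Sum>l\<in>I. if l = i then v g k i \<cdot> tens_mor A g (X i) (Y i) (f i) else 0)"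
    using p(1) k i uv[OF g k i] by simp
  also have "\<dots> = (\<Sum>l\<in>I. v g k l \<cdot> tens_mor A g (X i) (Y l) (if l = i then f l else 0))"
    by (rule sum.cong) (use tens_mor_zero[OF g p(3)[OF i] q(3)] comp_zero_right[OF vm] in auto)
  finally show "(\<Sum>j\<in>I. (if k = j then f k else 0) \<cdot> u g j i) =
      (\<Sum>l\<in>I. v g k l \<cdot> tens_mor A g (X i) (Y l) (if l = i then f l else 0))" .
qed

text \<open>A permutation matrix with structural isomorphisms in place of the ones: under the action
  of h, the column g is nonzero only in row hg.\<close>

definition orbit_cocycle :: "'o \<Rightarrow> 'g \<Rightarrow> 'g \<Rightarrow> 'g \<Rightarrow> 'm" where
  "orbit_cocycle X h k g = (if k = h \<otimes>\<^bsub>G\<^esub> g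
     then inv_mor C (tens A (h \<otimes>\<^bsub>G\<^esub> g) X) (tens A h (tens A g X)) (assc A h g X) else 0)"

lemma inv_assc:
  assumes "g \<in> carrier G" "h \<in> carrier G" "X \<in> Obj C"
  defines "b \<equiv> inv_mor C (tens A (g \<otimes>\<^bsub>G\<^esub> h) X) (tens A g (tens A h X)) (assc A g h X)"
  shows "b \<in> mor C (tens A g (tens A h X)) (tens A (g \<otimes>\<^bsub>G\<^esub> h) X)"
    "b \<cdot> assc A g h X = idm C (tens A (g \<otimes>\<^bsub>G\<^esub> h) X)"
    "assc A g h X \<cdot> b = idm C (tens A g (tens A h X))"
  unfolding b_def using inv_mor[OF assc_iso[OF assms(1-3)]] assms tens_Obj by auto

text \<open>In the sum for gh only the index hl contributes, and what remains is the pentagon,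
  written for the inverses of the associativity isomorphisms. The unit law is
  \<open>triangle_left\<close>.\<close>

lemma orbit_matrix_cocycle:
  assumes X: "X \<in> Obj C"
  shows "matrix_cocycle (carrier G) (\<lambda>g. tens A g X) (orbit_cocycle X)"
  unfolding matrix_cocycle_def
proof (intro conjI ballI)
  fix g k h assume g: "g \<in> carrier G" and k: "k \<in> carrier G" and h: "h \<in> carrier G"
  show "orbit_cocycle X g k h \<in> mor C (tens A g (tens A h X)) (tens A k X)"
    using inv_assc(1)[OF g h X] tens_Obj g h k X by (auto simp: orbit_cocycle_def)
next
  fix g h k l assume g: "g \<in> carrier G" and h: "h \<in> carrier G" and k: "k \<in> carrier G" and l: "l \<in> carrier G"
  have hl: "h \<otimes>\<^bsub>G\<^esub> l \<in> carrier G" and gh: "g \<otimes>\<^bsub>G\<^esub> h \<in> carrier G"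
    and ghl: "(g \<otimes>\<^bsub>G\<^esub> h) \<otimes>\<^bsub>G\<^esub> l = g \<otimes>\<^bsub>G\<^esub> (h \<otimes>\<^bsub>G\<^esub> l)"
    using g h l by (simp_all add: m_assoc)
  have lX: "tens A l X \<in> Obj C" "tens A h (tens A l X) \<in> Obj C"
    using tens_Obj l h X by auto
  note a = assc_mor[OF g h lX(1)]
  have oc: "orbit_cocycle X h j l \<in> mor C (tens A h (tens A l X)) (tens A j X)"
    and oc': "orbit_cocycle X g k j \<in> mor C (tens A g (tens A j X)) (tens A k X)" if j: "j \<in> carrier G" for j
    using inv_assc(1)[OF h l X] inv_assc(1)[OF g j X] tens_Obj g h l k j X by (auto simp: orbit_cocycle_def)
  let ?w = "\<lambda>j. tens_mor A g (tens A h (tens A l X)) (tens A j X) (orbit_cocycle X h j l) \<cdot> assc A g h (tens A l X)"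
  have "(\<Sum>j\<in>carrier G. orbit_cocycle X g k j \<cdot> ?w j) =
      (\<Sum>j\<in>carrier G. if j = h \<otimes>\<^bsub>G\<^esub> l then orbit_cocycle X g k (h \<otimes>\<^bsub>G\<^esub> l) \<cdot> ?w (h \<otimes>\<^bsub>G\<^esub> l) else 0)"
  proof (rule sum.cong[OF refl])
    fix j assume j: "j \<in> carrier G"
    have "?w j = 0" if "j \<noteq> h \<otimes>\<^bsub>G\<^esub> l"
      using that tens_mor_zero[OF g lX(2) tens_Obj[OF j X]] comp_zero_left[OF a] by (simp add: orbit_cocycle_def)
    then show "orbit_cocycle X g k j \<cdot> ?w j =
        (if j = h \<otimes>\<^bsub>G\<^esub> l then orbit_cocycle X g k (h \<otimes>\<^bsub>G\<^esub> l) \<cdot> ?w (h \<otimes>\<^bsub>G\<^esub> l) else 0)"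
      using comp_zero_right[OF oc'[OF j]] by auto
  qed
  also have "\<dots> = orbit_cocycle X g k (h \<otimes>\<^bsub>G\<^esub> l) \<cdot> ?w (h \<otimes>\<^bsub>G\<^esub> l)"
    using hl finite_group by simp
  also have "\<dots> = orbit_cocycle X (g \<otimes>\<^bsub>G\<^esub> h) k l"
  proof (cases "k = g \<otimes>\<^bsub>G\<^esub> (h \<otimes>\<^bsub>G\<^esub> l)")
    case True
    let ?b = "inv_mor C (tens A (g \<otimes>\<^bsub>G\<^esub> (h \<otimes>\<^bsub>G\<^esub> l)) X) (tens A g (tens A (h \<otimes>\<^bsub>G\<^esub> l) X)) (assc A g (h \<otimes>\<^bsub>G\<^esub> l) X)"
    let ?b' = "inv_mor C (tens A (h \<otimes>\<^bsub>G\<^esub> l) X) (tens A h (tens A l X)) (assc A h l X)"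
    let ?c = "inv_mor C (tens A ((g \<otimes>\<^bsub>G\<^esub> h) \<otimes>\<^bsub>G\<^esub> l) X) (tens A (g \<otimes>\<^bsub>G\<^esub> h) (tens A l X)) (assc A (g \<otimes>\<^bsub>G\<^esub> h) l X)"
    note b = inv_assc[OF g hl X] and b' = inv_assc[OF h l X] and c = inv_assc[OF gh l X]
    have al: "assc A (g \<otimes>\<^bsub>G\<^esub> h) l X \<in> mor C (tens A (g \<otimes>\<^bsub>G\<^esub> (h \<otimes>\<^bsub>G\<^esub> l)) X) (tens A (g \<otimes>\<^bsub>G\<^esub> h) (tens A l X))"
      using assc_mor[OF gh l X] ghl by simp
    have Tb: "tens_mor A g (tens A h (tens A l X)) (tens A (h \<otimes>\<^bsub>G\<^esub> l) X) ?b'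
        \<in> mor C (tens A g (tens A h (tens A l X))) (tens A g (tens A (h \<otimes>\<^bsub>G\<^esub> l) X))"
      by (rule tens_mor_mor[OF g b'(1)])
    have Ta: "tens_mor A g (tens A (h \<otimes>\<^bsub>G\<^esub> l) X) (tens A h (tens A l X)) (assc A h l X)
        \<in> mor C (tens A g (tens A (h \<otimes>\<^bsub>G\<^esub> l) X)) (tens A g (tens A h (tens A l X)))"
      by (rule tens_mor_mor[OF g assc_mor[OF h l X]])
    let ?w' = "tens_mor A g (tens A h (tens A l X)) (tens A (h \<otimes>\<^bsub>G\<^esub> l) X) ?b' \<cdot> assc A g h (tens A l X)"
    have w: "?w' \<in> mor C (tens A (g \<otimes>\<^bsub>G\<^esub> h) (tens A l X)) (tens A g (tens A (h \<otimes>\<^bsub>G\<^esub> l) X))"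
      using a Tb by blast
    \<comment> \<open>By the pentagon the composite contains the g-translate of
      \<open>assc A h l X\<close>, which the translate of its inverse \<open>?b'\<close>
      cancels.\<close>
    have "?w' \<cdot> assc A (g \<otimes>\<^bsub>G\<^esub> h) l X = tens_mor A g (tens A h (tens A l X)) (tens A (h \<otimes>\<^bsub>G\<^esub> l) X) ?b' \<cdot>
        (tens_mor A g (tens A (h \<otimes>\<^bsub>G\<^esub> l) X) (tens A h (tens A l X)) (assc A h l X) \<cdot> assc A g (h \<otimes>\<^bsub>G\<^esub> l) X)"
      using comp_assoc[OF al a Tb] pentagon[OF g h l X] by simp
    also have "\<dots> = tens_mor A g (tens A (h \<otimes>\<^bsub>G\<^esub> l) X) (tens A (h \<otimes>\<^bsub>G\<^esub> l) X) (?b' \<cdot> assc A h l X) \<cdot> assc A g (h \<otimes>\<^bsub>G\<^esub> l) X"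
      using comp_assoc[OF assc_mor[OF g hl X] Ta Tb] tens_mor_comp[OF g assc_mor[OF h l X] b'(1)] by simp
    also have "\<dots> = assc A g (h \<otimes>\<^bsub>G\<^esub> l) X"
      using b'(2) tens_idm[OF g tens_Obj[OF hl X]] idm_comp[OF assc_mor[OF g hl X]] by simp
    finally have "?b \<cdot> ?w' \<cdot> assc A (g \<otimes>\<^bsub>G\<^esub> h) l X = idm C (tens A (g \<otimes>\<^bsub>G\<^esub> (h \<otimes>\<^bsub>G\<^esub> l)) X)"
      using comp_assoc[OF al w b(1)] b(2) by simp
    \<comment> \<open>\<open>?b \<cdot> ?w'\<close> has been shown to be a left inverse of an
      isomorphism whose inverse is \<open>?c\<close>.\<close>
    then have "?b \<cdot> ?w' = ?c"
      using inverse_unique[OF al mor_comp[OF w b(1)]] c ghl by simp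
    then show ?thesis
      using True ghl by (simp add: orbit_cocycle_def)
  next
    case False
    have "?w (h \<otimes>\<^bsub>G\<^esub> l) \<in> mor C (tens A (g \<otimes>\<^bsub>G\<^esub> h) (tens A l X)) (tens A g (tens A (h \<otimes>\<^bsub>G\<^esub> l) X))"
      using a tens_mor_mor[OF g oc[OF hl]] by blast
    then show ?thesis
      using False ghl comp_zero_left by (simp add: orbit_cocycle_def)
  qed
  finally show "orbit_cocycle X (g \<otimes>\<^bsub>G\<^esub> h) k l = (\<Sum>j\<in>carrier G. orbit_cocycle X g k j \<cdot> ?w j)"
    by simp
next
  fix k g assume k: "k \<in> carrier G" and g: "g \<in> carrier G"
  have e: "\<one>\<^bsub>G\<^esub> \<in> carrier G"
    by simp
  \<comment> \<open>\<open>triangle_left\<close> exhibits the unit isomorphism as a left inverse of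
    the associativity isomorphism at 1 and g, hence as its inverse.\<close>
  have "unt A (tens A g X) = inv_mor C (tens A (\<one>\<^bsub>G\<^esub> \<otimes>\<^bsub>G\<^esub> g) X) (tens A \<one>\<^bsub>G\<^esub> (tens A g X)) (assc A \<one>\<^bsub>G\<^esub> g X)"
  proof (rule inverse_unique[OF assc_mor[OF e g X] _ inv_assc(1)[OF e g X] _ inv_assc(3)[OF e g X]])
    show "unt A (tens A g X) \<in> mor C (tens A \<one>\<^bsub>G\<^esub> (tens A g X)) (tens A (\<one>\<^bsub>G\<^esub> \<otimes>\<^bsub>G\<^esub> g) X)"
      using unt_mor[OF tens_Obj[OF g X]] g by simp
    show "unt A (tens A g X) \<cdot> assc A \<one>\<^bsub>G\<^esub> g X = idm C (tens A (\<one>\<^bsub>G\<^esub> \<otimes>\<^bsub>G\<^esub> g) X)"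
      using triangle_left[OF g X] g by simp
  qed
  then show "orbit_cocycle X \<one>\<^bsub>G\<^esub> k g = (if k = g then unt A (tens A g X) else 0)"
    using g by (simp add: orbit_cocycle_def)
qed

section \<open>The orbit construction as an exact functor\<close>

lemma orbit_biproduct:
  assumes "X \<in> Obj C" "dsum C (carrier G) (\<lambda>g. tens A g X) = (P, \<iota>, \<pi>)"
  shows "biproduct C (carrier G) (\<lambda>g. tens A g X) P \<iota> \<pi>"
  using biproduct_dsum[OF finite_group _ assms(2)] tens_Obj assms(1) by blast

text \<open>\<open>orbit_functor\<close> writes the action with one term per column. Filling the
  columns up with zeros turns this into the full matrix.\<close>

lemma fob_orbit:
  assumes X: "X \<in> Obj C" and P: "dsum C (carrier G) (\<lambda>g. tens A g X) = (P, \<iota>, \<pi>)"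
  shows "fob (orbit_functor G C A) X = matrix_obj (carrier G) (\<lambda>g. tens A g X) P \<iota> \<pi> (orbit_cocycle X)"
proof -
  note b = orbit_biproduct[OF X P]
  note p = biproductD[OF b]
  have "(\<Sum>g\<in>carrier G. \<iota> (h \<otimes>\<^bsub>G\<^esub> g) \<cdot>
      inv_mor C (tens A (h \<otimes>\<^bsub>G\<^esub> g) X) (tens A h (tens A g X)) (assc A h g X) \<cdot> tens_mor A h P (tens A g X) (\<pi> g)) =
    matmor C \<iota> (carrier G) (orbit_cocycle X h) (carrier G) (\<lambda>g. tens_mor A h P (tens A g X) (\<pi> g))"
    if h: "h \<in> carrier G" for h
  proof -
    have "(\<Sum>k\<in>carrier G. \<iota> k \<cdot> (orbit_cocycle X h k g \<cdot> tens_mor A h P (tens A g X) (\<pi> g))) =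
      \<iota> (h \<otimes>\<^bsub>G\<^esub> g) \<cdot> inv_mor C (tens A (h \<otimes>\<^bsub>G\<^esub> g) X) (tens A h (tens A g X)) (assc A h g X) \<cdot>
        tens_mor A h P (tens A g X) (\<pi> g)" if g: "g \<in> carrier G" for g
    proof -
      let ?b = "inv_mor C (tens A (h \<otimes>\<^bsub>G\<^esub> g) X) (tens A h (tens A g X)) (assc A h g X)"
      let ?T = "tens_mor A h P (tens A g X) (\<pi> g)"
      have hg: "h \<otimes>\<^bsub>G\<^esub> g \<in> carrier G"
        using h g by simp
      have T: "?T \<in> mor C (tens A h P) (tens A h (tens A g X))"
        by (rule tens_mor_mor[OF h p(5)[OF g]])
      have "(\<Sum>k\<in>carrier G. \<iota> k \<cdot> (orbit_cocycle X h k g \<cdot> ?T)) =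
          (\<Sum>k\<in>carrier G. if k = h \<otimes>\<^bsub>G\<^esub> g then \<iota> (h \<otimes>\<^bsub>G\<^esub> g) \<cdot> (?b \<cdot> ?T) else 0)"
        by (rule sum.cong) (use comp_zero_left[OF T] comp_zero_right[OF p(4)] in \<open>auto simp: orbit_cocycle_def\<close>)
      then show ?thesis
        using comp_assoc[OF T inv_assc(1)[OF h g X] p(4)[OF hg]] hg finite_group by simp
    qed
    then show ?thesis
      unfolding matmor_def by (subst sum.swap) simp
  qed
  then show ?thesis
    by (simp add: orbit_functor_def matrix_obj_def P cong: restrict_cong)
qed

lemma fmor_orbit:
  assumes "dsum C (carrier G) (\<lambda>g. tens A g X) = (P, \<iota>, \<pi>)" "dsum C (carrier G) (\<lambda>g. tens A g Y) = (P', \<iota>', \<pi>')"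
  shows "fmor (orbit_functor G C A) X Y f = dsum_mor C (carrier G) \<pi> (\<lambda>g. tens_mor A g X Y f) \<iota>'"
  by (simp add: orbit_functor_def assms)

lemma orbit_functor: "k_functor C D (orbit_functor G C A)"
proof
  let ?F = "orbit_functor G C A"
  show "fob ?F X \<in> Obj D" if X: "X \<in> Obj C" for X
  proof -
    obtain P \<iota> \<pi> where P: "dsum C (carrier G) (\<lambda>g. tens A g X) = (P, \<iota>, \<pi>)"
      by (rule prod_cases3)
    show ?thesis
      using matrix_obj_equiv_Obj[OF orbit_biproduct[OF X P] orbit_matrix_cocycle[OF X]] fob_orbit[OF X P] by simp
  qed
  show "fmor ?F X Y f \<in> Hom D (fob ?F X) (fob ?F Y)" if X: "X \<in> Obj C" and Y: "Y \<in> Obj C" and f: "f \<in> Hom C X Y" for X Y f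
  proof -
    obtain P \<iota> \<pi> where P: "dsum C (carrier G) (\<lambda>g. tens A g X) = (P, \<iota>, \<pi>)"
      by (rule prod_cases3)
    obtain P' \<iota>' \<pi>' where P': "dsum C (carrier G) (\<lambda>g. tens A g Y) = (P', \<iota>', \<pi>')"
      by (rule prod_cases3)
    have f: "f \<in> mor C X Y"
      using X Y f by (rule morI)
    have "fmor ?F X Y f \<in> mor D (fob ?F X) (fob ?F Y)"
      unfolding fob_orbit[OF X P] fob_orbit[OF Y P'] fmor_orbit[OF P P']
    proof (rule diagonal_equiv_mor[OF orbit_biproduct[OF X P] orbit_matrix_cocycle[OF X]
          orbit_biproduct[OF Y P'] orbit_matrix_cocycle[OF Y]])
      show "\<forall>g\<in>carrier G. tens_mor A g X Y f \<in> mor C (tens A g X) (tens A g Y)"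
        using tens_mor_mor[OF _ f] by blast
      fix g k i assume g: "g \<in> carrier G" and k: "k \<in> carrier G" and i: "i \<in> carrier G"
      have gi: "g \<otimes>\<^bsub>G\<^esub> i \<in> carrier G"
        using g i by simp
      let ?TT = "tens_mor A g (tens A i X) (tens A i Y) (tens_mor A i X Y f)"
      have TT: "?TT \<in> mor C (tens A g (tens A i X)) (tens A g (tens A i Y))"
        by (rule tens_mor_mor[OF g tens_mor_mor[OF i f]])
      have T: "tens_mor A (g \<otimes>\<^bsub>G\<^esub> i) X Y f \<in> mor C (tens A (g \<otimes>\<^bsub>G\<^esub> i) X) (tens A (g \<otimes>\<^bsub>G\<^esub> i) Y)"
        by (rule tens_mor_mor[OF gi f])
      note bX = inv_assc[OF g i X] and bY = inv_assc[OF g i Y] and aX = assc_mor[OF g i X] and aY = assc_mor[OF g i Y]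
      let ?bX = "inv_mor C (tens A (g \<otimes>\<^bsub>G\<^esub> i) X) (tens A g (tens A i X)) (assc A g i X)"
      let ?bY = "inv_mor C (tens A (g \<otimes>\<^bsub>G\<^esub> i) Y) (tens A g (tens A i Y)) (assc A g i Y)"
      \<comment> \<open>Naturality of \<open>assc\<close> is carried over to its inverses by
        inserting \<open>?bY \<cdot> assc A g i Y = 1\<close> on the left and cancelling
        \<open>assc A g i X \<cdot> ?bX\<close> on the right.\<close>
      have "tens_mor A (g \<otimes>\<^bsub>G\<^esub> i) X Y f \<cdot> ?bX = ?bY \<cdot> ((assc A g i Y \<cdot> tens_mor A (g \<otimes>\<^bsub>G\<^esub> i) X Y f) \<cdot> ?bX)"
        using comp_assoc[OF bX(1) T aY] comp_assoc[OF mor_comp[OF bX(1) T] aY bY(1)] bY(2) idm_comp[OF mor_comp[OF bX(1) T]]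
        by simp
      also have "\<dots> = ?bY \<cdot> ?TT"
        using assc_nat[OF g i f] comp_assoc[OF bX(1) aX TT] bX(3) comp_idm[OF TT] by simp
      finally show "tens_mor A k X Y f \<cdot> orbit_cocycle X g k i = orbit_cocycle Y g k i \<cdot> ?TT"
        using comp_zero_right[OF tens_mor_mor[OF k f]] comp_zero_left[OF TT] by (auto simp: orbit_cocycle_def)
    qed
    then show ?thesis
      by (rule equiv.morD)
  qed
  show "fmor ?F X X (idm C X) = idm D (fob ?F X)" if X: "X \<in> Obj C" for X
  proof -
    obtain P \<iota> \<pi> where P: "dsum C (carrier G) (\<lambda>g. tens A g X) = (P, \<iota>, \<pi>)"
      by (rule prod_cases3)
    note b = orbit_biproduct[OF X P]
    note p = biproductD[OF b]
    have f: "\<forall>g\<in>carrier G. tens_mor A g X X (idm C X) \<in> mor C (tens A g X) (tens A g X)"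
      using tens_mor_mor[OF _ mor_idm[OF X]] by blast
    have "dsum_mor C (carrier G) \<pi> (\<lambda>g. tens_mor A g X X (idm C X)) \<iota> = idm C P"
      by (rule biproduct_inj_ext[OF b dsum_mor_mor[OF b b f] mor_idm[OF p(2)]])
        (use dsum_mor_inj[OF b b f] tens_idm[OF _ X] comp_idm[OF p(4)] idm_comp[OF p(4)] in auto)
    then show ?thesis
      using fob_orbit[OF X P] fmor_orbit[OF P P] by simp
  qed
  show "fmor ?F X Z (g \<cdot> f) = fmor ?F Y Z g \<cdot>\<^bsub>D\<^esub> fmor ?F X Y f"
    if X: "X \<in> Obj C" and Y: "Y \<in> Obj C" and Z: "Z \<in> Obj C" and f: "f \<in> Hom C X Y" and g: "g \<in> Hom C Y Z" for X Y Z f g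
  proof -
    obtain P \<iota> \<pi> where P: "dsum C (carrier G) (\<lambda>g. tens A g X) = (P, \<iota>, \<pi>)"
      by (rule prod_cases3)
    obtain P' \<iota>' \<pi>' where P': "dsum C (carrier G) (\<lambda>g. tens A g Y) = (P', \<iota>', \<pi>')"
      by (rule prod_cases3)
    obtain P'' \<iota>'' \<pi>'' where P'': "dsum C (carrier G) (\<lambda>g. tens A g Z) = (P'', \<iota>'', \<pi>'')"
      by (rule prod_cases3)
    note bX = orbit_biproduct[OF X P] and bY = orbit_biproduct[OF Y P'] and bZ = orbit_biproduct[OF Z P'']
    have fm: "f \<in> mor C X Y" and gm: "g \<in> mor C Y Z"
      using X Y Z f g morI by auto
    have F: "\<forall>h\<in>carrier G. tens_mor A h X Y f \<in> mor C (tens A h X) (tens A h Y)"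
      and G: "\<forall>h\<in>carrier G. tens_mor A h Y Z g \<in> mor C (tens A h Y) (tens A h Z)"
      and H: "\<forall>h\<in>carrier G. tens_mor A h X Z (g \<cdot> f) \<in> mor C (tens A h X) (tens A h Z)"
      using tens_mor_mor[OF _ fm] tens_mor_mor[OF _ gm] tens_mor_mor[OF _ mor_comp[OF fm gm]] by blast+
    note Fd = dsum_mor[OF bX bY F] and Gd = dsum_mor[OF bY bZ G] and Hd = dsum_mor[OF bX bZ H]
    have "dsum_mor C (carrier G) \<pi> (\<lambda>h. tens_mor A h X Z (g \<cdot> f)) \<iota>'' =
        dsum_mor C (carrier G) \<pi>' (\<lambda>h. tens_mor A h Y Z g) \<iota>'' \<cdot> dsum_mor C (carrier G) \<pi> (\<lambda>h. tens_mor A h X Y f) \<iota>'"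
    proof (rule biproduct_inj_ext[OF bX Hd(1) mor_comp[OF Fd(1) Gd(1)]])
      fix h assume h: "h \<in> carrier G"
      note fh = bspec[OF F h] and gh = bspec[OF G h]
      show "dsum_mor C (carrier G) \<pi> (\<lambda>h. tens_mor A h X Z (g \<cdot> f)) \<iota>'' \<cdot> \<iota> h =
        dsum_mor C (carrier G) \<pi>' (\<lambda>h. tens_mor A h Y Z g) \<iota>'' \<cdot>
          dsum_mor C (carrier G) \<pi> (\<lambda>h. tens_mor A h X Y f) \<iota>' \<cdot> \<iota> h"
        using Hd(2)[OF h] comp_assoc[OF biproductD(4)[OF bX h] Fd(1) Gd(1)] Fd(2)[OF h] Gd(2)[OF h]
          comp_assoc[OF fh biproductD(4)[OF bY h] Gd(1)] comp_assoc[OF fh gh biproductD(4)[OF bZ h]]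
          tens_mor_comp[OF h fm gm] by simp
    qed
    then show ?thesis
      using fmor_orbit[OF P P'] fmor_orbit[OF P' P''] fmor_orbit[OF P P''] by simp
  qed
  show "fmor ?F X Y (f + f') = fmor ?F X Y f + fmor ?F X Y f'"
    if X: "X \<in> Obj C" and Y: "Y \<in> Obj C" and f: "f \<in> Hom C X Y" and f': "f' \<in> Hom C X Y" for X Y f f'
  proof -
    obtain P \<iota> \<pi> where P: "dsum C (carrier G) (\<lambda>g. tens A g X) = (P, \<iota>, \<pi>)"
      by (rule prod_cases3)
    obtain P' \<iota>' \<pi>' where P': "dsum C (carrier G) (\<lambda>g. tens A g Y) = (P', \<iota>', \<pi>')"
      by (rule prod_cases3)
    note bX = orbit_biproduct[OF X P] and bY = orbit_biproduct[OF Y P']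
    have fm: "f \<in> mor C X Y" "f' \<in> mor C X Y"
      using X Y f f' morI by auto
    have F: "\<forall>h\<in>carrier G. tens_mor A h X Y f \<in> mor C (tens A h X) (tens A h Y)"
      and G: "\<forall>h\<in>carrier G. tens_mor A h X Y f' \<in> mor C (tens A h X) (tens A h Y)"
      and H: "\<forall>h\<in>carrier G. tens_mor A h X Y (f + f') \<in> mor C (tens A h X) (tens A h Y)"
      using tens_mor_mor[OF _ fm(1)] tens_mor_mor[OF _ fm(2)] tens_mor_mor[OF _ mor_add[OF fm]] by blast+
    note Fd = dsum_mor[OF bX bY F] and Gd = dsum_mor[OF bX bY G] and Hd = dsum_mor[OF bX bY H]
    have "dsum_mor C (carrier G) \<pi> (\<lambda>h. tens_mor A h X Y (f + f')) \<iota>' =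
        dsum_mor C (carrier G) \<pi> (\<lambda>h. tens_mor A h X Y f) \<iota>' + dsum_mor C (carrier G) \<pi> (\<lambda>h. tens_mor A h X Y f') \<iota>'"
    proof (rule biproduct_inj_ext[OF bX Hd(1) mor_add[OF Fd(1) Gd(1)]])
      fix h assume h: "h \<in> carrier G"
      show "dsum_mor C (carrier G) \<pi> (\<lambda>h. tens_mor A h X Y (f + f')) \<iota>' \<cdot> \<iota> h =
        (dsum_mor C (carrier G) \<pi> (\<lambda>h. tens_mor A h X Y f) \<iota>' +
          dsum_mor C (carrier G) \<pi> (\<lambda>h. tens_mor A h X Y f') \<iota>') \<cdot> \<iota> h"
        using Hd(2)[OF h] comp_add_left[OF biproductD(4)[OF bX h] Fd(1) Gd(1)] Fd(2)[OF h] Gd(2)[OF h]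
          comp_add_right[OF bspec[OF F h] bspec[OF G h] biproductD(4)[OF bY h]] tens_mor_plus[OF h fm] by simp
    qed
    then show ?thesis
      using fmor_orbit[OF P P'] by simp
  qed
  show "fmor ?F X Y (smul C a f) = smul D a (fmor ?F X Y f)"
    if X: "X \<in> Obj C" and Y: "Y \<in> Obj C" and f: "f \<in> Hom C X Y" for X Y f a
  proof -
    obtain P \<iota> \<pi> where P: "dsum C (carrier G) (\<lambda>g. tens A g X) = (P, \<iota>, \<pi>)"
      by (rule prod_cases3)
    obtain P' \<iota>' \<pi>' where P': "dsum C (carrier G) (\<lambda>g. tens A g Y) = (P', \<iota>', \<pi>')"
      by (rule prod_cases3)
    note bX = orbit_biproduct[OF X P] and bY = orbit_biproduct[OF Y P']
    have fm: "f \<in> mor C X Y"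
      using X Y f morI by auto
    have F: "\<forall>h\<in>carrier G. tens_mor A h X Y f \<in> mor C (tens A h X) (tens A h Y)"
      and H: "\<forall>h\<in>carrier G. tens_mor A h X Y (smul C a f) \<in> mor C (tens A h X) (tens A h Y)"
      using tens_mor_mor[OF _ fm] tens_mor_mor[OF _ mor_smul[OF fm]] by blast+
    note Fd = dsum_mor[OF bX bY F] and Hd = dsum_mor[OF bX bY H]
    have "dsum_mor C (carrier G) \<pi> (\<lambda>h. tens_mor A h X Y (smul C a f)) \<iota>' =
        smul C a (dsum_mor C (carrier G) \<pi> (\<lambda>h. tens_mor A h X Y f) \<iota>')"
    proof (rule biproduct_inj_ext[OF bX Hd(1) mor_smul[OF Fd(1)]])
      fix h assume h: "h \<in> carrier G"
      show "dsum_mor C (carrier G) \<pi> (\<lambda>h. tens_mor A h X Y (smul C a f)) \<iota>' \<cdot> \<iota> h =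
        smul C a (dsum_mor C (carrier G) \<pi> (\<lambda>h. tens_mor A h X Y f) \<iota>') \<cdot> \<iota> h"
        using Hd(2)[OF h] comp_smul_left[OF biproductD(4)[OF bX h] Fd(1)] Fd(2)[OF h]
          comp_smul_right[OF bspec[OF F h] biproductD(4)[OF bY h]] tens_mor_scale[OF h fm] by simp
    qed
    then show ?thesis
      using fmor_orbit[OF P P'] by simp
  qed
qed

lemma orbit_additive: "additive_functor C D (orbit_functor G C A)"
  by (intro additive_functor.intro orbit_functor equiv_additive additive_k_category_axioms)

text \<open>On underlying objects this is the direct sum of the conflations obtained by applying the
  exact functors g \<otimes> -.\<close>

lemma orbit_confl:
  assumes c: "confl C Y E X i p"
  defines "F \<equiv> orbit_functor G C A"
  shows "confl D (fob F Y) (fob F E) (fob F X) (fmor F Y E i) (fmor F E X p)"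
proof (rule equiv_conflI)
  note o = confl_Obj[OF c] and m = confl_mor[OF c]
  have oX: "X \<in> Obj C" and oE: "E \<in> Obj C" and oY: "Y \<in> Obj C"
    using o by auto
  show "fmor F Y E i \<in> mor D (fob F Y) (fob F E)" "fmor F E X p \<in> mor D (fob F E) (fob F X)"
    unfolding F_def using additive_functor.fmor_mor[OF orbit_additive] m by blast+
  obtain P \<iota> \<pi> where P: "dsum C (carrier G) (\<lambda>g. tens A g Y) = (P, \<iota>, \<pi>)"
    by (rule prod_cases3)
  obtain P' \<iota>' \<pi>' where P': "dsum C (carrier G) (\<lambda>g. tens A g E) = (P', \<iota>', \<pi>')"
    by (rule prod_cases3)
  obtain P'' \<iota>'' \<pi>'' where P'': "dsum C (carrier G) (\<lambda>g. tens A g X) = (P'', \<iota>'', \<pi>'')"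
    by (rule prod_cases3)
  show "confl C (fst (fob F Y)) (fst (fob F E)) (fst (fob F X)) (fmor F Y E i) (fmor F E X p)"
    unfolding F_def fob_orbit[OF oY P] fob_orbit[OF oE P'] fob_orbit[OF oX P''] fmor_orbit[OF P P']
      fmor_orbit[OF P' P''] fst_matrix_obj
    by (rule confl_dsum[OF act_confl[OF _ c] orbit_biproduct[OF oY P] orbit_biproduct[OF oE P']
          orbit_biproduct[OF oX P'']])
qed

end

section \<open>The regular representation and averaging\<close>

lemma sum_indicator:
  fixes f :: "'a \<Rightarrow> 'b::comm_ring_1"
  assumes "finite S" "a \<in> S"
  shows "(\<Sum>j\<in>S. f j * (if j = a then 1 else 0)) = f a"
  using assms by (simp add: if_distrib cong: if_cong)

context exact_action
begin

text \<open>Other index sets than {..<n} are allowed so that the regular representation can be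
  indexed by the group, the augmentation ideal by the elements other than 1, and the trivial
  representation by the unit type.\<close>

definition matrix_rep :: "'i set \<Rightarrow> ('g \<Rightarrow> 'i \<Rightarrow> 'i \<Rightarrow> 'k) \<Rightarrow> bool" where
  "matrix_rep I r \<longleftrightarrow> finite I \<and>
     (\<forall>g\<in>carrier G. \<forall>h\<in>carrier G. \<forall>i\<in>I. \<forall>l\<in>I. r (g \<otimes>\<^bsub>G\<^esub> h) i l = (\<Sum>j\<in>I. r g i j * r h j l)) \<and>
     (\<forall>i\<in>I. \<forall>j\<in>I. r \<one>\<^bsub>G\<^esub> i j = (if i = j then 1 else 0))"

text \<open>The representation tensored with M. The direct sum is an argument:
  \<open>rep_tensor\<close> takes the chosen one, while the one-term sum on \<open>fst M\<close>
  itself makes the trivial representation reproduce M.\<close>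

definition rep_obj :: "'i set \<Rightarrow> ('g \<Rightarrow> 'i \<Rightarrow> 'i \<Rightarrow> 'k) \<Rightarrow> 'o \<times> ('g \<Rightarrow> 'm) \<Rightarrow> 'o \<Rightarrow> ('i \<Rightarrow> 'm) \<Rightarrow> ('i \<Rightarrow> 'm) \<Rightarrow>
    'o \<times> ('g \<Rightarrow> 'm)" where
  "rep_obj I r M P \<iota> \<pi> = matrix_obj I (\<lambda>_. fst M) P \<iota> \<pi> (\<lambda>g i j. smul C (r g i j) (snd M g))"

definition scalar_matmor :: "'o \<Rightarrow> ('j \<Rightarrow> 'm) \<Rightarrow> 'j set \<Rightarrow> ('j \<Rightarrow> 'i \<Rightarrow> 'k) \<Rightarrow> 'i set \<Rightarrow> ('i \<Rightarrow> 'm) \<Rightarrow> 'm" where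
  "scalar_matmor X \<iota> K a I \<pi> = matmor C \<iota> K (\<lambda>k i. smul C (a k i) (idm C X)) I \<pi>"

lemma fst_rep_obj [simp]: "fst (rep_obj I r M P \<iota> \<pi>) = P"
  by (simp add: rep_obj_def)

lemma rep_obj_cocycle:
  assumes M: "M \<in> equiv_Obj G C A" and r: "matrix_rep I r"
  shows "matrix_cocycle I (\<lambda>_. fst M) (\<lambda>g i j. smul C (r g i j) (snd M g))"
  unfolding matrix_cocycle_def
proof (intro conjI ballI)
  note m = equiv_ObjD[OF M]
  show "smul C (r g i j) (snd M g) \<in> mor C (tens A g (fst M)) (fst M)" if "g \<in> carrier G" for g i j
    using m(4)[OF that] by blast
  fix g h i l assume g: "g \<in> carrier G" and h: "h \<in> carrier G" and i: "i \<in> I" and l: "l \<in> I"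
  have "smul C (r g i j) (snd M g) \<cdot> (tens_mor A g (tens A h (fst M)) (fst M) (smul C (r h j l) (snd M h)) \<cdot> assc A g h (fst M)) =
      smul C (r g i j * r h j l) (snd M (g \<otimes>\<^bsub>G\<^esub> h))" for j
  proof -
    note a = assc_mor[OF g h m(1)] and T = tens_mor_mor[OF g m(4)[OF h]]
    show ?thesis
      using tens_mor_scale[OF g m(4)[OF h]] comp_smul_left[OF a T] comp_smul_right[OF mor_comp[OF a T] mor_smul[OF m(4)[OF g]]]
        comp_smul_left[OF mor_comp[OF a T] m(4)[OF g]] m(5)[OF g h] by (simp add: mult.commute)
  qed
  then show "smul C (r (g \<otimes>\<^bsub>G\<^esub> h) i l) (snd M (g \<otimes>\<^bsub>G\<^esub> h)) =
      (\<Sum>j\<in>I. smul C (r g i j) (snd M g) \<cdot>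
        (tens_mor A g (tens A h (fst M)) (fst M) (smul C (r h j l) (snd M h)) \<cdot> assc A g h (fst M)))"
    using r g h i l by (simp add: matrix_rep_def vs.scale_sum_left)
next
  fix i j assume "i \<in> I" "j \<in> I"
  then show "smul C (r \<one>\<^bsub>G\<^esub> i j) (snd M \<one>\<^bsub>G\<^esub>) = (if i = j then unt A (fst M) else 0)"
    using r equiv_ObjD(6)[OF M] by (simp add: matrix_rep_def)
qed

lemma rep_obj_equiv_Obj:
  assumes "M \<in> equiv_Obj G C A" "matrix_rep I r" "biproduct C I (\<lambda>_. fst M) P \<iota> \<pi>"
  shows "rep_obj I r M P \<iota> \<pi> \<in> equiv_Obj G C A"
  unfolding rep_obj_def by (rule matrix_obj_equiv_Obj[OF assms(3) rep_obj_cocycle[OF assms(1,2)]])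

text \<open>Functoriality of tensoring with M in the representation: scalar matrices commute with
  the action on M, so equivariance reduces to the intertwining equation a r = s a over k.\<close>

lemma scalar_matmor_intertwiner:
  assumes M: "M \<in> equiv_Obj G C A" and r: "matrix_rep I r" and P: "biproduct C I (\<lambda>_. fst M) P \<iota> \<pi>"
    and s: "matrix_rep K s" and Q: "biproduct C K (\<lambda>_. fst M) Q \<iota>' \<pi>'"
    and a: "\<And>g k i. \<lbrakk>g \<in> carrier G; k \<in> K; i \<in> I\<rbrakk> \<Longrightarrow> (\<Sum>j\<in>I. a k j * r g j i) = (\<Sum>l\<in>K. s g k l * a l i)"
  shows "scalar_matmor (fst M) \<iota>' K a I \<pi> \<in> mor D (rep_obj I r M P \<iota> \<pi>) (rep_obj K s M Q \<iota>' \<pi>')"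
  unfolding rep_obj_def scalar_matmor_def
proof (rule matrix_obj_mor[OF P rep_obj_cocycle[OF M r] Q rep_obj_cocycle[OF M s]])
  note m = equiv_ObjD[OF M]
  note id = mor_idm[OF m(1)]
  show "\<forall>k\<in>K. \<forall>i\<in>I. smul C (a k i) (idm C (fst M)) \<in> mor C (fst M) (fst M)"
    using id by blast
  fix g k i assume g: "g \<in> carrier G" and k: "k \<in> K" and i: "i \<in> I"
  have 1: "smul C (a k j) (idm C (fst M)) \<cdot> smul C (r g j i) (snd M g) = smul C (a k j * r g j i) (snd M g)" for j
    using comp_smul_left[OF mor_smul[OF m(4)[OF g]] id] idm_comp[OF mor_smul[OF m(4)[OF g]]] by simp
  have 2: "smul C (s g k l) (snd M g) \<cdot> tens_mor A g (fst M) (fst M) (smul C (a l i) (idm C (fst M))) =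
      smul C (s g k l * a l i) (snd M g)" for l
    using tens_mor_scale[OF g id] tens_idm[OF g m(1)] comp_smul_right[OF mor_idm[OF tens_Obj[OF g m(1)]] mor_smul[OF m(4)[OF g]]]
      comp_idm[OF mor_smul[OF m(4)[OF g]]] by (simp add: mult.commute)
  show "(\<Sum>j\<in>I. smul C (a k j) (idm C (fst M)) \<cdot> smul C (r g j i) (snd M g)) =
      (\<Sum>l\<in>K. smul C (s g k l) (snd M g) \<cdot> tens_mor A g (fst M) (fst M) (smul C (a l i) (idm C (fst M))))"
    unfolding 1 2 using a[OF g k i] by (simp add: vs.scale_sum_left[symmetric])
qed

section \<open>Calculus of scalar matrices\<close>

lemma scalar_matmor_entries:
  assumes X: "X \<in> Obj C"
  shows "\<forall>k\<in>K. \<forall>i\<in>I. smul C (a k i) (idm C X) \<in> mor C X X"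
  using X by blast

lemma scalar_matmor_mor:
  assumes "X \<in> Obj C" "biproduct C I (\<lambda>_. X) P \<iota> \<pi>" "biproduct C K (\<lambda>_. X) Q \<iota>' \<pi>'"
  shows "scalar_matmor X \<iota>' K a I \<pi> \<in> mor C P Q"
  unfolding scalar_matmor_def by (rule matmor_mor[OF assms(2,3) scalar_matmor_entries[OF assms(1)]])

lemma scalar_matmor_inj:
  assumes "X \<in> Obj C" "biproduct C I (\<lambda>_. X) P \<iota> \<pi>" "biproduct C K (\<lambda>_. X) Q \<iota>' \<pi>'" "i \<in> I"
  shows "scalar_matmor X \<iota>' K a I \<pi> \<cdot> \<iota> i = (\<Sum>k\<in>K. smul C (a k i) (\<iota>' k))"
  unfolding scalar_matmor_def matmor_inj[OF assms(2,3) scalar_matmor_entries[OF assms(1)] assms(4)]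
  by (rule sum.cong) (use comp_smul_right[OF mor_idm[OF assms(1)] biproductD(4)[OF assms(3)]]
      comp_idm[OF biproductD(4)[OF assms(3)]] in auto)

text \<open>With the rules for identity, zero and sum below, identities between matrices over k
  become identities between morphisms; a splitting of \<open>k[G]\<close> thereby yields a splitting
  of its tensor product with M.\<close>

lemma scalar_matmor_comp:
  assumes X: "X \<in> Obj C" and P: "biproduct C I (\<lambda>_. X) P \<iota> \<pi>" and Q: "biproduct C K (\<lambda>_. X) Q \<iota>' \<pi>'"
    and R: "biproduct C L (\<lambda>_. X) R \<iota>'' \<pi>''"
  shows "scalar_matmor X \<iota>'' L b K \<pi>' \<cdot> scalar_matmor X \<iota>' K a I \<pi> =
    scalar_matmor X \<iota>'' L (\<lambda>l i. \<Sum>k\<in>K. b l k * a k i) I \<pi>"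
proof (rule biproduct_inj_ext[OF P])
  show "scalar_matmor X \<iota>'' L b K \<pi>' \<cdot> scalar_matmor X \<iota>' K a I \<pi> \<in> mor C P R"
    using scalar_matmor_mor[OF X P Q] scalar_matmor_mor[OF X Q R] by blast
  show "scalar_matmor X \<iota>'' L (\<lambda>l i. \<Sum>k\<in>K. b l k * a k i) I \<pi> \<in> mor C P R"
    by (rule scalar_matmor_mor[OF X P R])
  fix i assume i: "i \<in> I"
  note q = biproductD[OF Q] and B = scalar_matmor_mor[OF X Q R, of b]
  have "scalar_matmor X \<iota>'' L b K \<pi>' \<cdot> scalar_matmor X \<iota>' K a I \<pi> \<cdot> \<iota> i =
      scalar_matmor X \<iota>'' L b K \<pi>' \<cdot> (\<Sum>k\<in>K. smul C (a k i) (\<iota>' k))"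
    using comp_assoc[OF biproductD(4)[OF P i] scalar_matmor_mor[OF X P Q] B] scalar_matmor_inj[OF X P Q i] by simp
  also have "\<dots> = (\<Sum>k\<in>K. scalar_matmor X \<iota>'' L b K \<pi>' \<cdot> smul C (a k i) (\<iota>' k))"
    by (rule comp_sum_right[OF B X]) (use q(4) in blast)
  also have "\<dots> = (\<Sum>k\<in>K. \<Sum>l\<in>L. smul C (b l k * a k i) (\<iota>'' l))"
  proof (rule sum.cong[OF refl])
    fix k assume k: "k \<in> K"
    show "scalar_matmor X \<iota>'' L b K \<pi>' \<cdot> smul C (a k i) (\<iota>' k) = (\<Sum>l\<in>L. smul C (b l k * a k i) (\<iota>'' l))"
      using comp_smul_right[OF q(4)[OF k] B] scalar_matmor_inj[OF X Q R k, of b]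
      by (simp add: vs.scale_sum_right mult.commute)
  qed
  also have "\<dots> = (\<Sum>l\<in>L. smul C (\<Sum>k\<in>K. b l k * a k i) (\<iota>'' l))"
    by (subst sum.swap) (simp add: vs.scale_sum_left)
  finally show "scalar_matmor X \<iota>'' L b K \<pi>' \<cdot> scalar_matmor X \<iota>' K a I \<pi> \<cdot> \<iota> i =
      scalar_matmor X \<iota>'' L (\<lambda>l i. \<Sum>k\<in>K. b l k * a k i) I \<pi> \<cdot> \<iota> i"
    using scalar_matmor_inj[OF X P R i] by simp
qed

lemma scalar_matmor_cong:
  "(\<And>k i. \<lbrakk>k \<in> K; i \<in> I\<rbrakk> \<Longrightarrow> a k i = b k i) \<Longrightarrow> scalar_matmor X \<iota> K a I \<pi> = scalar_matmor X \<iota> K b I \<pi>"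
  unfolding scalar_matmor_def matmor_def by (auto intro!: sum.cong)

lemma scalar_matmor_idm:
  assumes X: "X \<in> Obj C" and P: "biproduct C I (\<lambda>_. X) P \<iota> \<pi>"
  shows "scalar_matmor X \<iota> I (\<lambda>i j. if i = j then 1 else 0) I \<pi> = idm C P"
proof (rule biproduct_inj_ext[OF P scalar_matmor_mor[OF X P P] mor_idm[OF biproductD(2)[OF P]]])
  fix i assume i: "i \<in> I"
  have "(\<Sum>k\<in>I. smul C (if k = i then 1 else 0) (\<iota> k)) = (\<Sum>k\<in>I. if k = i then \<iota> i else 0)"
    by (rule sum.cong) auto
  then show "scalar_matmor X \<iota> I (\<lambda>i j. if i = j then 1 else 0) I \<pi> \<cdot> \<iota> i = idm C P \<cdot> \<iota> i"
    using scalar_matmor_inj[OF X P P i] idm_comp[OF biproductD(4)[OF P i]] biproductD(1)[OF P] i by simp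
qed

lemma scalar_matmor_zero:
  assumes X: "X \<in> Obj C" and P: "biproduct C I (\<lambda>_. X) P \<iota> \<pi>" and Q: "biproduct C K (\<lambda>_. X) Q \<iota>' \<pi>'"
  shows "scalar_matmor X \<iota>' K (\<lambda>_ _. 0) I \<pi> = 0"
proof (rule biproduct_inj_ext[OF P scalar_matmor_mor[OF X P Q]])
  show "0 \<in> mor C P Q"
    using biproductD(2)[OF P] biproductD(2)[OF Q] by blast
  show "scalar_matmor X \<iota>' K (\<lambda>_ _. 0) I \<pi> \<cdot> \<iota> i = 0 \<cdot> \<iota> i" if "i \<in> I" for i
    using scalar_matmor_inj[OF X P Q that] comp_zero_left[OF biproductD(4)[OF P that]] by simp
qed

lemma scalar_matmor_add:
  assumes X: "X \<in> Obj C" and P: "biproduct C I (\<lambda>_. X) P \<iota> \<pi>" and Q: "biproduct C K (\<lambda>_. X) Q \<iota>' \<pi>'"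
  shows "scalar_matmor X \<iota>' K a I \<pi> + scalar_matmor X \<iota>' K b I \<pi> = scalar_matmor X \<iota>' K (\<lambda>k i. a k i + b k i) I \<pi>"
proof (rule biproduct_inj_ext[OF P mor_add[OF scalar_matmor_mor[OF X P Q] scalar_matmor_mor[OF X P Q]] scalar_matmor_mor[OF X P Q]])
  show "(scalar_matmor X \<iota>' K a I \<pi> + scalar_matmor X \<iota>' K b I \<pi>) \<cdot> \<iota> i =
      scalar_matmor X \<iota>' K (\<lambda>k i. a k i + b k i) I \<pi> \<cdot> \<iota> i" if "i \<in> I" for i
    using comp_add_left[OF biproductD(4)[OF P that] scalar_matmor_mor[OF X P Q] scalar_matmor_mor[OF X P Q]]
      scalar_matmor_inj[OF X P Q that] by (simp add: vs.scale_left_distrib sum.distrib)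
qed

section \<open>The regular representation and orbit objects\<close>

definition regular_rep :: "('i \<Rightarrow> 'g) \<Rightarrow> 'g \<Rightarrow> 'i \<Rightarrow> 'i \<Rightarrow> 'k" where
  "regular_rep e g i j = (if e i = g \<otimes>\<^bsub>G\<^esub> e j then 1 else 0)"

text \<open>Column l of the matrix of h has its only 1 in the row m with e m = h (e l), so the
  product sum has one term. The enumeration e covers both uses: G indexed by itself, and G numbered
  by {..<card G} for membership in \<open>reps\<close>.\<close>

lemma regular_matrix_rep:
  assumes e: "bij_betw e I (carrier G)"
  shows "matrix_rep I (regular_rep e)"
  unfolding matrix_rep_def
proof (intro conjI ballI)
  show fin: "finite I"
    using bij_betw_finite[OF e] finite_group by simp
  have eI: "e i \<in> carrier G" if "i \<in> I" for i
    using e that by (auto simp: bij_betw_def)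
  have inj: "e i = e j \<longleftrightarrow> i = j" if "i \<in> I" "j \<in> I" for i j
    using e that by (auto simp: bij_betw_def inj_on_def)
  fix g h i l assume g: "g \<in> carrier G" and h: "h \<in> carrier G" and i: "i \<in> I" and l: "l \<in> I"
  have "h \<otimes>\<^bsub>G\<^esub> e l \<in> e ` I"
    using e h eI[OF l] by (simp add: bij_betw_def)
  then obtain m where m: "m \<in> I" "e m = h \<otimes>\<^bsub>G\<^esub> e l"
    by force
  have "regular_rep e h j l = (if j = m then 1 else 0)" if "j \<in> I" for j
    using inj[OF that m(1)] m(2) by (simp add: regular_rep_def)
  then have "(\<Sum>j\<in>I. regular_rep e g i j * regular_rep e h j l) = (\<Sum>j\<in>I. regular_rep e g i j * (if j = m then 1 else 0))"
    by simp
  also have "\<dots> = regular_rep e g i m"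
    by (rule sum_indicator[OF fin m(1)])
  also have "\<dots> = regular_rep e (g \<otimes>\<^bsub>G\<^esub> h) i l"
    using m g h eI[OF l] by (simp add: regular_rep_def m_assoc)
  finally show "regular_rep e (g \<otimes>\<^bsub>G\<^esub> h) i l = (\<Sum>j\<in>I. regular_rep e g i j * regular_rep e h j l)"
    by simp
next
  fix i j assume "i \<in> I" "j \<in> I"
  moreover from this have "e i = e j \<longleftrightarrow> i = j" "e j \<in> carrier G"
    using e by (auto simp: bij_betw_def inj_on_def)
  ultimately show "regular_rep e \<one>\<^bsub>G\<^esub> i j = (if i = j then 1 else 0)"
    by (simp add: regular_rep_def)
qed

text \<open>\<theta> is the diagonal of the structure maps of M from g \<otimes> F M to F M, each an
  isomorphism. It is equivariant by the cocycle law of M: the map for hg, after inverse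
  associativity, is the map for h after the h-translate of the map for g.\<close>

lemma orbit_iso_regular:
  assumes M: "M \<in> equiv_Obj G C A" and e: "bij_betw e I (carrier G)"
    and Q: "biproduct C I (\<lambda>_. fst M) Q \<iota>' \<pi>'"
    and P: "dsum C (carrier G) (\<lambda>g. tens A g (fst M)) = (P, \<iota>, \<pi>)"
  defines "\<theta> \<equiv> dsum_mor C I (\<lambda>i. \<pi> (e i)) (\<lambda>i. snd M (e i)) \<iota>'"
  shows "is_iso D (fob (orbit_functor G C A) (fst M)) (rep_obj I (regular_rep e) M Q \<iota>' \<pi>') \<theta>"
    and "i \<in> I \<Longrightarrow> \<pi>' i \<cdot> \<theta> = snd M (e i) \<cdot> \<pi> (e i)"
proof -
  note m = equiv_ObjD[OF M]
  have eI: "e i \<in> carrier G" if "i \<in> I" for i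
    using e that by (auto simp: bij_betw_def)
  have inj: "e i = e j \<longleftrightarrow> i = j" if "i \<in> I" "j \<in> I" for i j
    using e that by (auto simp: bij_betw_def inj_on_def)
  let ?u = "\<lambda>g i j. orbit_cocycle (fst M) g (e i) (e j)"
  note b = biproduct_reindex[OF e orbit_biproduct[OF m(1) P]]
  have re: "(\<Sum>j\<in>carrier G. f j) = (\<Sum>i\<in>I. f (e i))" for f :: "'g \<Rightarrow> 'm"
    by (rule sum.reindex_bij_betw[OF e, symmetric])
  have orb: "fob (orbit_functor G C A) (fst M) =
      matrix_obj I (\<lambda>i. tens A (e i) (fst M)) P (\<lambda>i. \<iota> (e i)) (\<lambda>i. \<pi> (e i)) ?u"
    unfolding fob_orbit[OF m(1) P] matrix_obj_def matmor_def re ..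
  have u: "matrix_cocycle I (\<lambda>i. tens A (e i) (fst M)) ?u"
    using orbit_matrix_cocycle[OF m(1)] eI inj unfolding matrix_cocycle_def re by simp
  have \<psi>: "\<forall>i\<in>I. snd M (e i) \<in> mor C (tens A (e i) (fst M)) (fst M)"
    using m(4)[OF eI] by blast
  have "\<theta> \<in> mor D (fob (orbit_functor G C A) (fst M)) (rep_obj I (regular_rep e) M Q \<iota>' \<pi>')"
    unfolding orb rep_obj_def \<theta>_def
  proof (rule diagonal_equiv_mor[OF b u Q rep_obj_cocycle[OF M regular_matrix_rep[OF e]] \<psi>])
    fix g k i assume g: "g \<in> carrier G" and k: "k \<in> I" and i: "i \<in> I"
    note b = inv_assc[OF g eI[OF i] m(1)] and a = assc_mor[OF g eI[OF i] m(1)]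
    let ?T = "tens_mor A g (tens A (e i) (fst M)) (fst M) (snd M (e i))"
    have T: "?T \<in> mor C (tens A g (tens A (e i) (fst M))) (tens A g (fst M))"
      by (rule tens_mor_mor[OF g m(4)[OF eI[OF i]]])
    have "snd M (g \<otimes>\<^bsub>G\<^esub> e i) \<cdot> inv_mor C (tens A (g \<otimes>\<^bsub>G\<^esub> e i) (fst M)) (tens A g (tens A (e i) (fst M))) (assc A g (e i) (fst M))
        = snd M g \<cdot> ?T"
      unfolding m(5)[OF g eI[OF i]]
      using comp_assoc[OF b(1) mor_comp[OF a T] m(4)[OF g]] comp_assoc[OF b(1) a T] b(3) comp_idm[OF T] by simp
    then show "snd M (e k) \<cdot> orbit_cocycle (fst M) g (e k) (e i) = smul C (regular_rep e g k i) (snd M g) \<cdot> ?T"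
      using comp_zero_right[OF m(4)[OF eI[OF k]]] comp_zero_left[OF T]
      by (simp add: orbit_cocycle_def regular_rep_def)
  qed
  moreover have "is_iso C P Q \<theta>"
    unfolding \<theta>_def by (rule dsum_mor_iso[OF b Q]) (use m(3)[OF eI] in blast)
  ultimately show "is_iso D (fob (orbit_functor G C A) (fst M)) (rep_obj I (regular_rep e) M Q \<iota>' \<pi>') \<theta>"
    by (intro equiv_iso) (auto simp: fob_orbit[OF m(1) P])
  show "\<pi>' i \<cdot> \<theta> = snd M (e i) \<cdot> \<pi> (e i)" if "i \<in> I"
    unfolding \<theta>_def by (rule proj_dsum_mor[OF b Q \<psi> that])
qed

text \<open>An equality, so that intertwiners from or to the trivial representation are morphisms
  from or to M itself.\<close>

lemma trivial_rep_obj: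
  assumes M: "M \<in> equiv_Obj G C A"
  shows "rep_obj {()} (\<lambda>_ _ _. 1) M (fst M) (\<lambda>_. idm C (fst M)) (\<lambda>_. idm C (fst M)) = M"
proof -
  note m = equiv_ObjD[OF M]
  have "(\<lambda>g\<in>carrier G. idm C (fst M) \<cdot> (snd M g \<cdot> tens_mor A g (fst M) (fst M) (idm C (fst M)))) = snd M"
  proof (rule extensionalityI[OF _ m(2)])
    fix g assume g: "g \<in> carrier G"
    show "(\<lambda>g\<in>carrier G. idm C (fst M) \<cdot> (snd M g \<cdot> tens_mor A g (fst M) (fst M) (idm C (fst M)))) g = snd M g"
      using g tens_idm[OF g m(1)] comp_idm[OF m(4)[OF g]] idm_comp[OF m(4)[OF g]] by simp
  qed simp
  then show ?thesis
    by (simp add: rep_obj_def matrix_obj_def matmor_def prod_eq_iff)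
qed

lemma trivial_biproduct:
  assumes "X \<in> Obj C"
  shows "biproduct C {()} (\<lambda>_. X) X (\<lambda>_. idm C X) (\<lambda>_. idm C X)"
  by (rule biproductI) (use assms idm_comp[OF mor_idm] in auto)

lemma trivial_matrix_rep: "matrix_rep {()} (\<lambda>_ _ _. 1)"
  by (simp add: matrix_rep_def)

lemma mult_eq_iff:
  assumes "k \<in> carrier G" "g \<in> carrier G" "l \<in> carrier G"
  shows "k = g \<otimes>\<^bsub>G\<^esub> l \<longleftrightarrow> l = inv\<^bsub>G\<^esub> g \<otimes>\<^bsub>G\<^esub> k"
  using assms inv_solve_left by auto

text \<open>The sum of all group elements is fixed by every g: row k of the matrix of g has exactly
  one 1, in the column of the product of the inverse of g with k.\<close>

lemma norm_intertwiner:
  assumes g: "g \<in> carrier G" and k: "k \<in> carrier G"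
  shows "(\<Sum>l\<in>carrier G. regular_rep (\<lambda>x. x) g k l * 1) = 1"
proof -
  have "(\<Sum>l\<in>carrier G. regular_rep (\<lambda>x. x) g k l * 1) =
      (\<Sum>l\<in>carrier G. 1 * (if l = inv\<^bsub>G\<^esub> g \<otimes>\<^bsub>G\<^esub> k then 1 else 0 :: 'k))"
    by (rule sum.cong) (use mult_eq_iff[OF k g] in \<open>auto simp: regular_rep_def\<close>)
  also have "\<dots> = 1"
    by (rule sum_indicator) (use g k finite_group in auto)
  finally show ?thesis .
qed

text \<open>Under the isomorphism with \<open>k[G] \<otimes> M\<close>, the unit is the inclusion of the sum of all group elements.\<close>

lemma orbit_unit:
  assumes M: "M \<in> equiv_Obj G C A" and P: "dsum C (carrier G) (\<lambda>g. tens A g (fst M)) = (P, \<iota>, \<pi>)"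
  shows "\<exists>\<eta>\<in>mor D M (fob (orbit_functor G C A) (fst M)). unt A (fst M) \<cdot> (\<pi> \<one>\<^bsub>G\<^esub> \<cdot> \<eta>) = idm C (fst M)"
proof -
  note m = equiv_ObjD[OF M]
  obtain Q \<iota>' \<pi>' where Q: "biproduct C (carrier G) (\<lambda>_. fst M) Q \<iota>' \<pi>'"
    using biproduct_exists[OF finite_group, of "\<lambda>_. fst M"] m(1) by blast
  have bij: "bij_betw (\<lambda>x. x) (carrier G) (carrier G)"
    by (simp add: bij_betw_def)
  let ?R = "rep_obj (carrier G) (regular_rep (\<lambda>x. x)) M Q \<iota>' \<pi>'"
  define \<theta> where "\<theta> = dsum_mor C (carrier G) \<pi> (snd M) \<iota>'"
  have \<theta>: "is_iso D (fob (orbit_functor G C A) (fst M)) ?R \<theta>"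
    and \<pi>\<theta>: "\<And>i. i \<in> carrier G \<Longrightarrow> \<pi>' i \<cdot> \<theta> = snd M i \<cdot> \<pi> i"
    using orbit_iso_regular[OF M bij Q P] by (auto simp: \<theta>_def)
  have o: "fob (orbit_functor G C A) (fst M) \<in> Obj D" "?R \<in> Obj D"
    using k_functor.fob_Obj[OF orbit_functor m(1)] rep_obj_equiv_Obj[OF M regular_matrix_rep[OF bij] Q] by auto
  let ?j = "scalar_matmor (fst M) \<iota>' (carrier G) (\<lambda>_ _. 1) {()} (\<lambda>_. idm C (fst M))"
  have "?j \<in> mor D (rep_obj {()} (\<lambda>_ _ _. 1) M (fst M) (\<lambda>_. idm C (fst M)) (\<lambda>_. idm C (fst M))) ?R"
    by (rule scalar_matmor_intertwiner[OF M trivial_matrix_rep trivial_biproduct[OF m(1)] regular_matrix_rep[OF bij] Q])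
      (use norm_intertwiner in auto)
  then have j: "?j \<in> mor D M ?R"
    by (simp add: trivial_rep_obj[OF M])
  let ?\<eta> = "inv_mor D (fob (orbit_functor G C A) (fst M)) ?R \<theta> \<cdot> ?j"
  note i = equiv.inv_mor[OF \<theta> o]
  have \<theta>m: "\<theta> \<in> mor D (fob (orbit_functor G C A) (fst M)) ?R"
    using \<theta> o equiv.is_iso_iff by blast
  have \<eta>: "?\<eta> \<in> mor D M (fob (orbit_functor G C A) (fst M))"
    using equiv.mor_comp[OF j i(1)] by simp
  have \<theta>\<eta>: "\<theta> \<cdot> ?\<eta> = ?j"
    using equiv.comp_assoc[OF j i(1) \<theta>m] i(3) equiv.idm_comp[OF j] by simp
  have e: "\<one>\<^bsub>G\<^esub> \<in> carrier G"
    by simp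
  have fo: "fst (fob (orbit_functor G C A) (fst M)) = P"
    by (simp add: fob_orbit[OF m(1) P])
  have \<theta>c: "\<theta> \<in> mor C P Q" and \<eta>c: "?\<eta> \<in> mor C (fst M) P"
    using equiv_morD(1)[OF \<theta>m] equiv_morD(1)[OF \<eta>] fo by auto
  have \<pi>m: "\<pi> \<one>\<^bsub>G\<^esub> \<in> mor C P (tens A \<one>\<^bsub>G\<^esub> (fst M))"
    using biproductD(5)[OF orbit_biproduct[OF m(1) P] e] .
  \<comment> \<open>The structure map of M at 1 is \<open>unt\<close>, so \<open>unt\<close> after
    the component at 1 is the component of \<theta> at 1. After \<eta> this is the coefficient of 1
    in the sum of the group elements.\<close>
  have "unt A (fst M) \<cdot> (\<pi> \<one>\<^bsub>G\<^esub> \<cdot> ?\<eta>) = \<pi>' \<one>\<^bsub>G\<^esub> \<cdot> (\<theta> \<cdot> ?\<eta>)"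
    using comp_assoc[OF \<eta>c \<pi>m unt_mor[OF m(1)]] m(6) \<pi>\<theta>[OF e] comp_assoc[OF \<eta>c \<theta>c biproductD(5)[OF Q e]] by simp
  also have "\<dots> = \<pi>' \<one>\<^bsub>G\<^esub> \<cdot> ?j"
    by (simp only: \<theta>\<eta>)
  also have "\<dots> = idm C (fst M)"
    unfolding scalar_matmor_def proj_matmor[OF trivial_biproduct[OF m(1)] Q scalar_matmor_entries[OF m(1)] e]
    using comp_idm[OF mor_idm[OF m(1)]] by simp
  finally show ?thesis
    using \<eta> by blast
qed

lemma ext_vanishes_orbit:
  assumes M: "M \<in> equiv_Obj G C A" and v: "ext_vanishes D M (fob (orbit_functor G C A) Y)"
  shows "ext_vanishes C (fst M) Y"
  unfolding ext_vanishes_def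
proof (intro allI impI)
  let ?F = "orbit_functor G C A"
  fix E i p assume c: "confl C Y E (fst M) i p"
  note m = equiv_ObjD[OF M]
  obtain P \<iota> \<pi> where P: "dsum C (carrier G) (\<lambda>g. tens A g (fst M)) = (P, \<iota>, \<pi>)"
    by (rule prod_cases3)
  obtain P' \<iota>' \<pi>' where P': "dsum C (carrier G) (\<lambda>g. tens A g E) = (P', \<iota>', \<pi>')"
    by (rule prod_cases3)
  have E: "E \<in> Obj C"
    using confl_Obj[OF c] by simp
  note p = confl_mor(2)[OF c]
  obtain \<eta> where \<eta>: "\<eta> \<in> mor D M (fob ?F (fst M))" "unt A (fst M) \<cdot> (\<pi> \<one>\<^bsub>G\<^esub> \<cdot> \<eta>) = idm C (fst M)"
    using orbit_unit[OF M P] by blast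
  obtain \<sigma> where \<sigma>: "\<sigma> \<in> mor D M (fob ?F E)" "fmor ?F E (fst M) p \<cdot> \<sigma> = \<eta>"
    using equiv.ext_vanishes_lift[OF v orbit_confl[OF c] \<eta>(1)] by auto
  have e: "\<one>\<^bsub>G\<^esub> \<in> carrier G"
    by simp
  note b = orbit_biproduct[OF m(1) P] and b' = orbit_biproduct[OF E P']
  have T: "\<forall>g\<in>carrier G. tens_mor A g E (fst M) p \<in> mor C (tens A g E) (tens A g (fst M))"
    using tens_mor_mor[OF _ p] by blast
  note d = dsum_mor[OF b' b T]
  have \<sigma>c: "\<sigma> \<in> mor C (fst M) P'"
    using equiv_morD(1)[OF \<sigma>(1)] by (simp add: fob_orbit[OF E P'])
  note \<pi> = biproductD(5)[OF b e] and \<pi>' = biproductD(5)[OF b' e]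
  have \<pi>\<sigma>: "\<pi>' \<one>\<^bsub>G\<^esub> \<cdot> \<sigma> \<in> mor C (fst M) (tens A \<one>\<^bsub>G\<^esub> E)"
    using \<pi>' \<sigma>c by blast
  \<comment> \<open>The section is the component of \<sigma> at 1, freed from 1 \<otimes> - by the
    unit isomorphism. Naturality of \<open>unt\<close> replaces p by its translate under 1, which is
    the component at 1 of the image of p under the orbit functor.\<close>
  have "p \<cdot> (unt A E \<cdot> (\<pi>' \<one>\<^bsub>G\<^esub> \<cdot> \<sigma>)) = unt A (fst M) \<cdot> (tens_mor A \<one>\<^bsub>G\<^esub> E (fst M) p \<cdot> (\<pi>' \<one>\<^bsub>G\<^esub> \<cdot> \<sigma>))"
    using comp_assoc[OF \<pi>\<sigma> unt_mor[OF E] p] unt_nat[OF p] comp_assoc[OF \<pi>\<sigma> tens_mor_mor[OF e p] unt_mor[OF m(1)]] by simp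
  also have "tens_mor A \<one>\<^bsub>G\<^esub> E (fst M) p \<cdot> (\<pi>' \<one>\<^bsub>G\<^esub> \<cdot> \<sigma>) = \<pi> \<one>\<^bsub>G\<^esub> \<cdot> \<eta>"
    using comp_assoc[OF \<sigma>c \<pi>' tens_mor_mor[OF e p]] d(3)[OF e] comp_assoc[OF \<sigma>c d(1) \<pi>] \<sigma>(2) fmor_orbit[OF P' P] by simp
  finally have "p \<cdot> (unt A E \<cdot> (\<pi>' \<one>\<^bsub>G\<^esub> \<cdot> \<sigma>)) = idm C (fst M)"
    using \<eta>(2) by simp
  then show "\<exists>s\<in>mor C (fst M) E. p \<cdot> s = idm C (fst M)"
    using \<pi>\<sigma> unt_mor[OF E] by blast
qed

text \<open>The conjugation action of the group on the morphisms F M \<rightarrow> F N of C. Its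
  fixed points are the equivariant morphisms.\<close>

definition translate :: "'o \<times> ('g \<Rightarrow> 'm) \<Rightarrow> 'o \<times> ('g \<Rightarrow> 'm) \<Rightarrow> 'g \<Rightarrow> 'm \<Rightarrow> 'm" where
  "translate M N g f = snd N g \<cdot> (tens_mor A g (fst M) (fst N) f \<cdot> inv_mor C (tens A g (fst M)) (fst M) (snd M g))"

lemma translate:
  assumes M: "M \<in> equiv_Obj G C A" and N: "N \<in> equiv_Obj G C A" and g: "g \<in> carrier G" and f: "f \<in> mor C (fst M) (fst N)"
  shows translate_mor: "translate M N g f \<in> mor C (fst M) (fst N)"
    and translate_act: "translate M N g f \<cdot> snd M g = snd N g \<cdot> tens_mor A g (fst M) (fst N) f"
proof -
  note m = equiv_ObjD[OF M] and n = equiv_ObjD[OF N]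
  note i = inv_mor[OF m(3)[OF g] tens_Obj[OF g m(1)] m(1)] and T = tens_mor_mor[OF g f]
  show "translate M N g f \<in> mor C (fst M) (fst N)"
    unfolding translate_def using i(1) T n(4)[OF g] by blast
  show "translate M N g f \<cdot> snd M g = snd N g \<cdot> tens_mor A g (fst M) (fst N) f"
    unfolding translate_def
    using comp_assoc[OF m(4)[OF g] mor_comp[OF i(1) T] n(4)[OF g]] comp_assoc[OF m(4)[OF g] i(1) T] i(2) comp_idm[OF T] by simp
qed

text \<open>Translating by g and then by h is translating by hg, stated without the inverse of the
  action of h. The two sides are compared after the isomorphism from (hg) \<otimes> F M to h
  \<otimes> F M given by associativity and the action of g.\<close>

lemma translate_translate:
  assumes M: "M \<in> equiv_Obj G C A" and N: "N \<in> equiv_Obj G C A" and g: "g \<in> carrier G" and h: "h \<in> carrier G"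
    and f: "f \<in> mor C (fst M) (fst N)"
  shows "translate M N (h \<otimes>\<^bsub>G\<^esub> g) f \<cdot> snd M h = snd N h \<cdot> tens_mor A h (fst M) (fst N) (translate M N g f)"
proof -
  note m = equiv_ObjD[OF M] and n = equiv_ObjD[OF N]
  have hg: "h \<otimes>\<^bsub>G\<^esub> g \<in> carrier G"
    using g h by simp
  note t = translate[OF M N g f] and t' = translate[OF M N hg f]
  let ?T = "tens_mor A h (tens A g (fst M)) (fst M) (snd M g)"
  let ?U = "tens_mor A h (tens A g (fst N)) (fst N) (snd N g)"
  have T: "?T \<in> mor C (tens A h (tens A g (fst M))) (tens A h (fst M))"
    by (rule tens_mor_mor[OF h m(4)[OF g]])
  have U: "?U \<in> mor C (tens A h (tens A g (fst N))) (tens A h (fst N))"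
    by (rule tens_mor_mor[OF h n(4)[OF g]])
  note a = assc_mor[OF h g m(1)] and a' = assc_mor[OF h g n(1)]
  note Tf = tens_mor_mor[OF g f] and Tt = tens_mor_mor[OF h t(1)]
  note TTf = tens_mor_mor[OF h Tf] and Thgf = tens_mor_mor[OF hg f]
  have o: "tens A (h \<otimes>\<^bsub>G\<^esub> g) (fst M) \<in> Obj C" "tens A h (fst M) \<in> Obj C" "tens A h (tens A g (fst M)) \<in> Obj C"
    using tens_Obj m(1) g h hg by auto
  have iso: "is_iso C (tens A (h \<otimes>\<^bsub>G\<^esub> g) (fst M)) (tens A h (fst M)) (?T \<cdot> assc A h g (fst M))"
    by (rule is_iso_comp[OF assc_iso[OF h g m(1)] tens_mor_iso[OF h m(3)[OF g] tens_Obj[OF g m(1)] m(1)] o(1,3,2)])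
  have "(snd N h \<cdot> tens_mor A h (fst M) (fst N) (translate M N g f)) \<cdot> (?T \<cdot> assc A h g (fst M)) =
      snd N h \<cdot> (tens_mor A h (tens A g (fst M)) (fst N) (translate M N g f \<cdot> snd M g) \<cdot> assc A h g (fst M))"
    using comp_assoc[OF mor_comp[OF a T] Tt n(4)[OF h]] comp_assoc[OF a T Tt] tens_mor_comp[OF h m(4)[OF g] t(1)] by simp
  also have "\<dots> = snd N h \<cdot> (?U \<cdot> (assc A h g (fst N) \<cdot> tens_mor A (h \<otimes>\<^bsub>G\<^esub> g) (fst M) (fst N) f))"
    using t(2) tens_mor_comp[OF h Tf n(4)[OF g]] comp_assoc[OF a TTf U] assc_nat[OF h g f] by simp
  also have "\<dots> = snd N (h \<otimes>\<^bsub>G\<^esub> g) \<cdot> tens_mor A (h \<otimes>\<^bsub>G\<^esub> g) (fst M) (fst N) f"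
    using n(5)[OF h g] comp_assoc[OF Thgf mor_comp[OF a' U] n(4)[OF h]] comp_assoc[OF Thgf a' U] by simp
  also have "\<dots> = (translate M N (h \<otimes>\<^bsub>G\<^esub> g) f \<cdot> snd M h) \<cdot> (?T \<cdot> assc A h g (fst M))"
    using t'(2) m(5)[OF h g] comp_assoc[OF mor_comp[OF a T] m(4)[OF h] t'(1)] by simp
  finally show ?thesis
    using iso_cancel_right[OF iso mor_comp[OF m(4)[OF h] t'(1)] mor_comp[OF Tt n(4)[OF h]] o(1)] by simp
qed

text \<open>Left multiplication by h permutes the summands, so the sum over an orbit is fixed by
  h.\<close>

lemma sum_translate_equiv_mor:
  assumes M: "M \<in> equiv_Obj G C A" and N: "N \<in> equiv_Obj G C A" and f: "f \<in> mor C (fst M) (fst N)"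
  shows "(\<Sum>g\<in>carrier G. translate M N g f) \<in> mor D M N"
proof -
  note m = equiv_ObjD[OF M] and n = equiv_ObjD[OF N]
  let ?s = "\<Sum>g\<in>carrier G. translate M N g f"
  have s: "?s \<in> mor C (fst M) (fst N)"
    by (rule mor_sum[OF m(1) n(1) translate_mor[OF M N _ f]])
  have "?s \<cdot> snd M h = snd N h \<cdot> tens_mor A h (fst M) (fst N) ?s" if h: "h \<in> carrier G" for h
  proof -
    have bij: "bij_betw (\<lambda>g. h \<otimes>\<^bsub>G\<^esub> g) (carrier G) (carrier G)"
      unfolding bij_betw_def using inj_on_cmult[OF h] surj_const_mult[OF h] by blast
    have "?s = (\<Sum>g\<in>carrier G. translate M N (h \<otimes>\<^bsub>G\<^esub> g) f)"
      by (rule sum.reindex_bij_betw[OF bij, symmetric])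
    also have "\<dots> \<cdot> snd M h = (\<Sum>g\<in>carrier G. translate M N (h \<otimes>\<^bsub>G\<^esub> g) f \<cdot> snd M h)"
      by (rule comp_sum_left[OF m(4)[OF h] n(1)]) (use translate_mor[OF M N _ f] h in auto)
    also have "\<dots> = (\<Sum>g\<in>carrier G. snd N h \<cdot> tens_mor A h (fst M) (fst N) (translate M N g f))"
      by (rule sum.cong) (use translate_translate[OF M N _ h f] in auto)
    also have "\<dots> = snd N h \<cdot> (\<Sum>g\<in>carrier G. tens_mor A h (fst M) (fst N) (translate M N g f))"
      by (rule comp_sum_right[symmetric, OF n(4)[OF h] tens_Obj[OF h m(1)]])
        (use tens_mor_mor[OF h translate_mor[OF M N _ f]] in auto)
    also have "(\<Sum>g\<in>carrier G. tens_mor A h (fst M) (fst N) (translate M N g f)) = tens_mor A h (fst M) (fst N) ?s"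
      by (rule tens_mor_sum[symmetric, OF h m(1) n(1) translate_mor[OF M N _ f]])
    finally show ?thesis .
  qed
  then show ?thesis
    using s M N by (simp add: mor_equiv_iff)
qed

text \<open>Composition respects the conjugation actions, and p is a fixed point of its own.\<close>

lemma comp_translate:
  assumes M: "M \<in> equiv_Obj G C A" and f: "f \<in> mor C (fst M) (fst N)" and p: "p \<in> mor D N L" and g: "g \<in> carrier G"
  shows "p \<cdot> translate M N g f = translate M L g (p \<cdot> f)"
proof -
  note d = equiv_morD[OF p]
  note m = equiv_ObjD[OF M] and n = equiv_ObjD[OF d(2)] and l = equiv_ObjD[OF d(3)]
  note t = translate[OF M d(2) g f] and t' = translate[OF M d(3) g mor_comp[OF f d(1)]]
  have "(p \<cdot> translate M N g f) \<cdot> snd M g = (translate M L g (p \<cdot> f)) \<cdot> snd M g"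
    using comp_assoc[OF m(4)[OF g] t(1) d(1)] t(2) comp_assoc[OF tens_mor_mor[OF g f] n(4)[OF g] d(1)] d(4)[OF g]
      comp_assoc[OF tens_mor_mor[OF g f] tens_mor_mor[OF g d(1)] l(4)[OF g]] tens_mor_comp[OF g f d(1)] t'(2) by simp
  then show ?thesis
    using iso_cancel_right[OF m(3)[OF g] mor_comp[OF t(1) d(1)] t'(1) tens_Obj[OF g m(1)]] by simp
qed

lemma translate_idm:
  assumes M: "M \<in> equiv_Obj G C A" and g: "g \<in> carrier G"
  shows "translate M M g (idm C (fst M)) = idm C (fst M)"
proof -
  note m = equiv_ObjD[OF M]
  note t = translate[OF M M g mor_idm[OF m(1)]]
  show ?thesis
    using iso_cancel_right[OF m(3)[OF g] t(1) mor_idm[OF m(1)] tens_Obj[OF g m(1)]] t(2) tens_idm[OF g m(1)]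
      comp_idm[OF m(4)[OF g]] idm_comp[OF m(4)[OF g]] by simp
qed

end

section \<open>Consequences of the invertibility of the group order\<close>

locale nonmodular_action = exact_action G C A
  for G :: "'g monoid" and C :: "('k::field, 'o, 'm::ab_group_add, 'z) excat_scheme" (structure)
    and A :: "('g, 'o, 'm) gaction" +
  assumes char: "\<not> CHAR('k) dvd card (carrier G)"
begin

lemma order_nonzero: "of_nat (card (carrier G)) \<noteq> (0::'k)"
  using char by (simp add: of_nat_eq_0_iff_char_dvd)

lemma ext_vanishes_equiv:
  assumes M: "M \<in> equiv_Obj G C A" and v: "ext_vanishes C (fst M) (fst N)"
  shows "ext_vanishes D M N"
  unfolding ext_vanishes_def
proof (intro allI impI)
  fix E i p assume c: "confl D N E M i p"
  note d = equiv_conflD[OF c]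
  have E: "E \<in> equiv_Obj G C A"
    using c by simp
  note m = equiv_ObjD[OF M] and pm = equiv_morD(1)[OF d(2)]
  obtain s where s: "s \<in> mor C (fst M) (fst E)" "p \<cdot> s = idm C (fst M)"
    using v d(3) unfolding ext_vanishes_def by blast
  let ?n = "of_nat (card (carrier G)) :: 'k" and ?s = "\<Sum>g\<in>carrier G. translate M E g s"
  have s': "?s \<in> mor D M E"
    by (rule sum_translate_equiv_mor[OF M E s(1)])
  have "p \<cdot> ?s = (\<Sum>g\<in>carrier G. p \<cdot> translate M E g s)"
    by (rule comp_sum_right[OF pm m(1)]) (rule translate_mor[OF M E _ s(1)])
  \<comment> \<open>p composed with a translate of s is the translate of p \<cdot> s = 1, which is
    again 1. The sum is therefore the group order times 1.\<close>
  also have "\<dots> = (\<Sum>g\<in>carrier G. smul C 1 (idm C (fst M)))"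
    by (rule sum.cong) (use comp_translate[OF M s(1) d(2)] s(2) translate_idm[OF M] in auto)
  also have "\<dots> = smul C ?n (idm C (fst M))"
    by (simp only: vs.scale_sum_left[symmetric] sum_constant) simp
  finally have "p \<cdot> smul C (1 / ?n) ?s = idm C (fst M)"
    using comp_smul_right[OF equiv_morD(1)[OF s'] pm] order_nonzero by simp
  then show "\<exists>s\<in>mor D M E. p \<cdot>\<^bsub>D\<^esub> s = idm D M"
    using equiv.mor_smul[OF s', of "1 / ?n"] by auto
qed

text \<open>Maschke: with \<open>s\<close> the sum of all group elements, \<open>k[G]\<close> is the direct sum of the trivial representation
  \<open>k s\<close> and the augmentation ideal, which has the basis \<open>k - 1\<close> for \<open>k \<noteq> 1\<close>.\<close>

definition augmentation_rep :: "'g \<Rightarrow> 'g \<Rightarrow> 'g \<Rightarrow> 'k" where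
  "augmentation_rep g k l = (if k = g \<otimes>\<^bsub>G\<^esub> l then 1 else 0) - (if k = g then 1 else 0)"

text \<open>Lets sums over the basis of the augmentation ideal run over the whole group whenever the
  term at 1 vanishes; for \<open>augmentation_rep\<close> it does, because g (1 - 1) = 0.\<close>

lemma sum_minus_one:
  assumes "f \<one>\<^bsub>G\<^esub> = (0::'k)"
  shows "(\<Sum>j\<in>carrier G - {\<one>\<^bsub>G\<^esub>}. f j) = (\<Sum>j\<in>carrier G. f j)"
  using sum.remove[OF finite_group, of "\<one>\<^bsub>G\<^esub>" f] assms by simp

lemma sum_translate_indicator:
  assumes "g \<in> carrier G" "k \<in> carrier G"
  shows "(\<Sum>l\<in>carrier G. (if k = g \<otimes>\<^bsub>G\<^esub> l then 1 else 0) * f l) = (f (inv\<^bsub>G\<^esub> g \<otimes>\<^bsub>G\<^esub> k) :: 'k)"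
proof -
  have "(\<Sum>l\<in>carrier G. (if k = g \<otimes>\<^bsub>G\<^esub> l then 1 else 0) * f l) =
      (\<Sum>l\<in>carrier G. f l * (if l = inv\<^bsub>G\<^esub> g \<otimes>\<^bsub>G\<^esub> k then 1 else 0))"
    by (rule sum.cong) (use mult_eq_iff[OF assms(2,1)] in auto)
  also have "\<dots> = f (inv\<^bsub>G\<^esub> g \<otimes>\<^bsub>G\<^esub> k)"
    by (rule sum_indicator) (use assms finite_group in auto)
  finally show ?thesis .
qed

text \<open>From g (l - 1) = (gl - 1) - (g - 1): acting on coordinates f gives the translate of f
  and a correction at k = g. The correction is the total of f over the whole group, which is 0 in
  each application below.\<close>

lemma augmentation_sum:
  assumes g: "g \<in> carrier G" and k: "k \<in> carrier G"
  shows "(\<Sum>l\<in>carrier G - {\<one>\<^bsub>G\<^esub>}. augmentation_rep g k l * f l) =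
    f (inv\<^bsub>G\<^esub> g \<otimes>\<^bsub>G\<^esub> k) - (if k = g then 1 else 0) * (\<Sum>l\<in>carrier G. f l)"
proof -
  have "(\<Sum>l\<in>carrier G - {\<one>\<^bsub>G\<^esub>}. augmentation_rep g k l * f l) = (\<Sum>l\<in>carrier G. augmentation_rep g k l * f l)"
    by (rule sum_minus_one) (use g in \<open>simp add: augmentation_rep_def\<close>)
  also have "\<dots> = (\<Sum>l\<in>carrier G. (if k = g \<otimes>\<^bsub>G\<^esub> l then 1 else 0) * f l) - (\<Sum>l\<in>carrier G. (if k = g then 1 else 0) * f l)"
    by (simp add: augmentation_rep_def left_diff_distrib sum_subtractf)
  finally show ?thesis
    unfolding sum_translate_indicator[OF g k] sum_distrib_left[symmetric] .
qed

lemma sum_indicators: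
  assumes "a \<in> carrier G" "b \<in> carrier G"
  shows "(\<Sum>l\<in>carrier G. (if l = a then 1 else 0) - (if l = b then 1 else 0)) = (0::'k)"
  using assms finite_group by (simp add: sum_subtractf)

lemma augmentation_matrix_rep: "matrix_rep (carrier G - {\<one>\<^bsub>G\<^esub>}) augmentation_rep"
  unfolding matrix_rep_def
proof (intro conjI ballI)
  show "finite (carrier G - {\<one>\<^bsub>G\<^esub>})"
    using finite_group by simp
  fix g h i l assume g: "g \<in> carrier G" and h: "h \<in> carrier G"
    and i: "i \<in> carrier G - {\<one>\<^bsub>G\<^esub>}" and l: "l \<in> carrier G - {\<one>\<^bsub>G\<^esub>}"
  have hl: "h \<otimes>\<^bsub>G\<^esub> l \<in> carrier G" and i': "i \<in> carrier G"
    using h l i by auto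
  have "(\<Sum>j\<in>carrier G - {\<one>\<^bsub>G\<^esub>}. augmentation_rep g i j * augmentation_rep h j l) = augmentation_rep h (inv\<^bsub>G\<^esub> g \<otimes>\<^bsub>G\<^esub> i) l"
    using augmentation_sum[OF g i', of "\<lambda>j. augmentation_rep h j l"] sum_indicators[OF hl h]
    by (simp add: augmentation_rep_def)
  also have "\<dots> = augmentation_rep (g \<otimes>\<^bsub>G\<^esub> h) i l"
    using mult_eq_iff[OF i' g hl] mult_eq_iff[OF i' g h] g h l by (auto simp: augmentation_rep_def m_assoc)
  finally show "augmentation_rep (g \<otimes>\<^bsub>G\<^esub> h) i l =
      (\<Sum>j\<in>carrier G - {\<one>\<^bsub>G\<^esub>}. augmentation_rep g i j * augmentation_rep h j l)"
    by simp
qed (auto simp: augmentation_rep_def)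

lemma regular_summand:
  assumes M: "M \<in> equiv_Obj G C A" and Q: "biproduct C (carrier G) (\<lambda>_. fst M) Q \<iota> \<pi>"
  shows "is_summand D M (rep_obj (carrier G) (regular_rep (\<lambda>x. x)) M Q \<iota> \<pi>)"
proof -
  note m = equiv_ObjD[OF M]
  let ?H = "carrier G - {\<one>\<^bsub>G\<^esub>}" and ?n = "of_nat (card (carrier G)) :: 'k"
  note n = order_nonzero
  have bij: "bij_betw (\<lambda>x. x) (carrier G) (carrier G)"
    by (simp add: bij_betw_def)
  obtain S \<iota>' \<pi>' where S: "biproduct C ?H (\<lambda>_. fst M) S \<iota>' \<pi>'"
    using biproduct_exists[of ?H "\<lambda>_. fst M"] finite_group m(1) by blast
  let ?R = "rep_obj (carrier G) (regular_rep (\<lambda>x. x)) M Q \<iota> \<pi>" and ?N = "rep_obj ?H augmentation_rep M S \<iota>' \<pi>'"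
  note reg = regular_matrix_rep[OF bij] and aug = augmentation_matrix_rep
    and triv = trivial_matrix_rep and T = trivial_biproduct[OF m(1)]
  let ?id = "\<lambda>_::unit. idm C (fst M)"
  \<comment> \<open>\<open>iM\<close> sends 1 to the sum s of the group elements, and
    \<open>pM\<close> is the augmentation divided by the group order n.\<close>
  define iM where "iM = scalar_matmor (fst M) \<iota> (carrier G) (\<lambda>_ _. 1) {()} ?id"
  define pM where "pM = scalar_matmor (fst M) ?id {()} (\<lambda>_ _. 1 / ?n) (carrier G) \<pi>"
  \<comment> \<open>Column l of \<open>iN\<close> is l - 1. \<open>pN\<close> sends l to l - s / n,
    written in the basis k - 1: for k \<noteq> 1 the coordinate is just the coefficient of
    k.\<close>
  define iN where "iN = scalar_matmor (fst M) \<iota> (carrier G) (\<lambda>k l. (if k = l then 1 else 0) - (if k = \<one>\<^bsub>G\<^esub> then 1 else 0)) ?H \<pi>'"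
  define pN where "pN = scalar_matmor (fst M) \<iota>' ?H (\<lambda>k l. (if k = l then 1 else 0) - 1 / ?n) (carrier G) \<pi>"
  note defs = iM_def pM_def iN_def pN_def
  have ind: "(\<Sum>l\<in>carrier G. f l * (if l = a then 1 else 0)) = f a" if "a \<in> carrier G" for f :: "'g \<Rightarrow> 'k" and a
    by (rule sum_indicator[OF finite_group that])
  have "iM \<in> mor D (rep_obj {()} (\<lambda>_ _ _. 1) M (fst M) ?id ?id) ?R"
    unfolding defs by (rule scalar_matmor_intertwiner[OF M triv T reg Q]) (use norm_intertwiner in auto)
  then have iM: "iM \<in> mor D M ?R"
    by (simp add: trivial_rep_obj[OF M])
  have "pM \<in> mor D ?R (rep_obj {()} (\<lambda>_ _ _. 1) M (fst M) ?id ?id)"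
    unfolding defs
  proof (rule scalar_matmor_intertwiner[OF M reg Q triv T])
    fix g k and i :: 'g assume g: "g \<in> carrier G" and i: "i \<in> carrier G"
    have gi: "g \<otimes>\<^bsub>G\<^esub> i \<in> carrier G"
      using g i by simp
    show "(\<Sum>j\<in>carrier G. 1 / ?n * regular_rep (\<lambda>x. x) g j i) = (\<Sum>l\<in>{()}. 1 * (1 / ?n))"
      using ind[OF gi, of "\<lambda>_. 1 / ?n"] by (simp add: regular_rep_def)
  qed
  then have pM: "pM \<in> mor D ?R M"
    by (simp add: trivial_rep_obj[OF M])
  have iN: "iN \<in> mor D ?N ?R"
    unfolding defs
  proof (rule scalar_matmor_intertwiner[OF M aug S reg Q])
    fix g k i assume g: "g \<in> carrier G" and k: "k \<in> carrier G" and i: "i \<in> ?H"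
    have i': "i \<in> carrier G" and gi: "g \<otimes>\<^bsub>G\<^esub> i \<in> carrier G"
      using g i by auto
    let ?a = "\<lambda>k l. (if k = l then 1 else 0) - (if k = \<one>\<^bsub>G\<^esub> then 1 else 0 :: 'k)"
    \<comment> \<open>The term j = 1 may be added, because \<open>?a k 1\<close> is 0.\<close>
    have "(\<Sum>j\<in>?H. ?a k j * augmentation_rep g j i) = (\<Sum>j\<in>carrier G. ?a k j * augmentation_rep g j i)"
      by (rule sum_minus_one) simp
    also have "\<dots> = (\<Sum>j\<in>carrier G. ?a k j * (if j = g \<otimes>\<^bsub>G\<^esub> i then 1 else 0)) - (\<Sum>j\<in>carrier G. ?a k j * (if j = g then 1 else 0))"
      by (simp only: augmentation_rep_def right_diff_distrib sum_subtractf)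
    also have "\<dots> = (if k = g \<otimes>\<^bsub>G\<^esub> i then 1 else 0) - (if k = g then 1 else 0)"
      using ind[OF gi, of "?a k"] ind[OF g, of "?a k"] by simp
    also have "\<dots> = ?a (inv\<^bsub>G\<^esub> g \<otimes>\<^bsub>G\<^esub> k) i"
      using mult_eq_iff[OF k g i'] mult_eq_iff[OF k g one_closed] g by auto
    also have "\<dots> = (\<Sum>l\<in>carrier G. regular_rep (\<lambda>x. x) g k l * ?a l i)"
      unfolding regular_rep_def by (rule sum_translate_indicator[OF g k, symmetric])
    finally show "(\<Sum>j\<in>?H. ?a k j * augmentation_rep g j i) = (\<Sum>l\<in>carrier G. regular_rep (\<lambda>x. x) g k l * ?a l i)" .
  qed
  have pN: "pN \<in> mor D ?R ?N"
    unfolding defs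
  proof (rule scalar_matmor_intertwiner[OF M reg Q aug S])
    fix g k i assume g: "g \<in> carrier G" and k: "k \<in> ?H" and i: "i \<in> carrier G"
    have k': "k \<in> carrier G" and gi: "g \<otimes>\<^bsub>G\<^esub> i \<in> carrier G"
      using g k i by auto
    let ?a = "\<lambda>k l. (if k = l then 1 else 0) - 1 / ?n"
    have s: "(\<Sum>l\<in>carrier G. ?a l i) = 0"
      using finite_group i n by (simp add: sum_subtractf)
    have "(\<Sum>j\<in>carrier G. ?a k j * regular_rep (\<lambda>x. x) g j i) = ?a k (g \<otimes>\<^bsub>G\<^esub> i)"
      unfolding regular_rep_def by (rule ind[OF gi])
    also have "\<dots> = ?a (inv\<^bsub>G\<^esub> g \<otimes>\<^bsub>G\<^esub> k) i"
      using mult_eq_iff[OF k' g i] by auto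
    also have "\<dots> = (\<Sum>l\<in>?H. augmentation_rep g k l * ?a l i)"
      unfolding augmentation_sum[OF g k'] s by simp
    finally show "(\<Sum>j\<in>carrier G. ?a k j * regular_rep (\<lambda>x. x) g j i) = (\<Sum>l\<in>?H. augmentation_rep g k l * ?a l i)" .
  qed
  have MM: "pM \<cdot> iM = idm C (fst M)"
  proof -
    have "pM \<cdot> iM = scalar_matmor (fst M) ?id {()} (\<lambda>i j. if i = j then 1 else 0) {()} ?id"
      unfolding defs scalar_matmor_comp[OF m(1) T Q T] by (rule scalar_matmor_cong) (use n in simp)
    then show ?thesis
      using scalar_matmor_idm[OF m(1) T] by simp
  qed
  have NN: "pN \<cdot> iN = idm C S"
  proof -
    have "pN \<cdot> iN = scalar_matmor (fst M) \<iota>' ?H (\<lambda>i j. if i = j then 1 else 0) ?H \<pi>'"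
      unfolding defs scalar_matmor_comp[OF m(1) S Q S]
    proof (rule scalar_matmor_cong)
      fix k i assume k: "k \<in> ?H" and i: "i \<in> ?H"
      let ?a = "\<lambda>l. (if k = l then 1 else 0) - 1 / ?n"
      have "(\<Sum>l\<in>carrier G. ?a l * ((if l = i then 1 else 0) - (if l = \<one>\<^bsub>G\<^esub> then 1 else 0))) =
          (\<Sum>l\<in>carrier G. ?a l * (if l = i then 1 else 0)) - (\<Sum>l\<in>carrier G. ?a l * (if l = \<one>\<^bsub>G\<^esub> then 1 else 0))"
        by (simp only: right_diff_distrib sum_subtractf)
      also have "\<dots> = ?a i - ?a \<one>\<^bsub>G\<^esub>"
        using ind[of i ?a] ind[of "\<one>\<^bsub>G\<^esub>" ?a] i by simp
      finally show "(\<Sum>l\<in>carrier G. ?a l * ((if l = i then 1 else 0) - (if l = \<one>\<^bsub>G\<^esub> then 1 else 0))) = (if k = i then 1 else 0)"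
        using k by auto
    qed
    then show ?thesis
      using scalar_matmor_idm[OF m(1) S] by simp
  qed
  have NM: "pN \<cdot> iM = 0"
  proof -
    have "pN \<cdot> iM = scalar_matmor (fst M) \<iota>' ?H (\<lambda>_ _. 0) {()} ?id"
      unfolding defs scalar_matmor_comp[OF m(1) T Q S]
      by (rule scalar_matmor_cong) (use finite_group n in \<open>simp add: sum_subtractf\<close>)
    then show ?thesis
      using scalar_matmor_zero[OF m(1) T S] by simp
  qed
  have MN: "pM \<cdot> iN = 0"
  proof -
    have "pM \<cdot> iN = scalar_matmor (fst M) ?id {()} (\<lambda>_ _. 0) ?H \<pi>'"
      unfolding defs scalar_matmor_comp[OF m(1) S Q T]
    proof (rule scalar_matmor_cong)
      fix k :: unit and i assume i: "i \<in> ?H"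
      show "(\<Sum>l\<in>carrier G. 1 / ?n * ((if l = i then 1 else 0) - (if l = \<one>\<^bsub>G\<^esub> then 1 else 0))) = 0"
        unfolding sum_distrib_left[symmetric] using sum_indicators[of i "\<one>\<^bsub>G\<^esub>"] i by simp
    qed
    then show ?thesis
      using scalar_matmor_zero[OF m(1) S T] by simp
  qed
  have RR: "iM \<cdot> pM + iN \<cdot> pN = idm C Q"
  proof -
    have "iM \<cdot> pM + iN \<cdot> pN = scalar_matmor (fst M) \<iota> (carrier G) (\<lambda>i j. if i = j then 1 else 0) (carrier G) \<pi>"
      unfolding defs scalar_matmor_comp[OF m(1) Q T Q] scalar_matmor_comp[OF m(1) Q S Q] scalar_matmor_add[OF m(1) Q Q]
    proof (rule scalar_matmor_cong)
      fix k i assume k: "k \<in> carrier G" and i: "i \<in> carrier G"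
      let ?b = "\<lambda>l. (if l = i then 1 else 0) - 1 / ?n"
      have s: "(\<Sum>l\<in>carrier G. ?b l) = 0"
        using finite_group i n by (simp add: sum_subtractf)
      \<comment> \<open>The coefficients are those of \<open>augmentation_rep\<close> at the neutral
        element, so \<open>augmentation_sum\<close> evaluates the sum; the coordinates
        \<open>?b\<close> have total 0.\<close>
      have "(\<Sum>l\<in>?H. ((if k = l then 1 else 0) - (if k = \<one>\<^bsub>G\<^esub> then 1 else 0)) * ?b l) =
          (\<Sum>l\<in>?H. augmentation_rep \<one>\<^bsub>G\<^esub> k l * ?b l)"
        by (rule sum.cong) (auto simp: augmentation_rep_def)
      also have "\<dots> = ?b k"
        unfolding augmentation_sum[OF one_closed k] s using k by simp
      finally show "(\<Sum>l\<in>{()}. 1 * (1 / ?n)) + (\<Sum>l\<in>?H. ((if k = l then 1 else 0) - (if k = \<one>\<^bsub>G\<^esub> then 1 else 0)) * ?b l) =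
          (if k = i then 1 else 0)"
        by simp
    qed
    then show ?thesis
      using scalar_matmor_idm[OF m(1) Q] by simp
  qed
  have "biproduct D (UNIV :: bool set) (case_bool M ?N) ?R (case_bool iM iN) (case_bool pM pN)"
  proof (rule equiv.biproductI)
    show "?R \<in> Obj D"
      using rep_obj_equiv_Obj[OF M reg Q] by simp
  qed (use iM pM iN pN MM NN NM MN RR in \<open>auto split: bool.splits simp: UNIV_bool add.commute\<close>)
  then show ?thesis
    unfolding is_summand_def is_direct_sum_def by blast
qed

end

section \<open>The bijections\<close>

lemma reciprocal_bijectionsI:
  assumes "\<And>x. x \<in> S \<Longrightarrow> \<Phi> x \<in> S'" "\<And>y. y \<in> S' \<Longrightarrow> \<Psi> y \<in> S"
    and "\<And>x. x \<in> S \<Longrightarrow> \<Psi> (\<Phi> x) = x" "\<And>y. y \<in> S' \<Longrightarrow> \<Phi> (\<Psi> y) = y"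
  shows "reciprocal_bijections \<Phi> \<Psi> S S'"
proof -
  have "bij_betw \<Phi> S S'" "bij_betw \<Psi> S' S"
    by (rule bij_betw_byWitness[of _ \<Psi>] bij_betw_byWitness[of _ \<Phi>]; use assms in blast)+
  then show ?thesis
    using assms by (simp add: reciprocal_bijections_def)
qed

text \<open>The properties are compared along \<Phi> only: for y in S' the comparison at \<Psi> y
  settles the other direction.\<close>

lemma reciprocal_bijections_restrict:
  assumes b: "reciprocal_bijections \<Phi> \<Psi> S S'" and PQ: "\<And>x. x \<in> S \<Longrightarrow> P x \<longleftrightarrow> Q (\<Phi> x)"
  shows "reciprocal_bijections \<Phi> \<Psi> {x \<in> S. P x} {y \<in> S'. Q y}"
proof (rule reciprocal_bijectionsI)
  have *: "\<And>x. x \<in> S \<Longrightarrow> \<Phi> x \<in> S'" "\<And>y. y \<in> S' \<Longrightarrow> \<Psi> y \<in> S" "\<And>x. x \<in> S \<Longrightarrow> \<Psi> (\<Phi> x) = x"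
    "\<And>y. y \<in> S' \<Longrightarrow> \<Phi> (\<Psi> y) = y"
    using b by (auto simp: reciprocal_bijections_def bij_betw_def)
  show "\<Phi> x \<in> {y \<in> S'. Q y}" if "x \<in> {x \<in> S. P x}" for x
    using that *(1) PQ by auto
  show "\<Psi> y \<in> {x \<in> S. P x}" if "y \<in> {y \<in> S'. Q y}" for y
    using that *(2)[of y] *(4)[of y] PQ[of "\<Psi> y"] by auto
  show "\<Psi> (\<Phi> x) = x" if "x \<in> {x \<in> S. P x}" for x
    using that *(3) by auto
  show "\<Phi> (\<Psi> y) = y" if "y \<in> {y \<in> S'. Q y}" for y
    using that *(4) by auto
qed

context exact_action
begin

abbreviation orbit where "orbit \<equiv> fob (orbit_functor G C A)"

section \<open>Orbit objects and stable subcategories\<close>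

lemma orbit_Obj: "X \<in> Obj C \<Longrightarrow> orbit X \<in> equiv_Obj G C A"
  using k_functor.fob_Obj[OF orbit_functor] by simp

lemma orbit_components:
  assumes "X \<in> Obj C"
  obtains \<iota> \<pi> where "biproduct C (carrier G) (\<lambda>g. tens A g X) (fst (orbit X)) \<iota> \<pi>"
proof -
  obtain P \<iota> \<pi> where P: "dsum C (carrier G) (\<lambda>g. tens A g X) = (P, \<iota>, \<pi>)"
    by (rule prod_cases3)
  show ?thesis
    using that orbit_biproduct[OF assms P] fob_orbit[OF assms P] by simp
qed

lemma tens_summand_orbit: "\<lbrakk>X \<in> Obj C; g \<in> carrier G\<rbrakk> \<Longrightarrow> is_summand C (tens A g X) (fst (orbit X))"
  by (rule orbit_components, assumption)
    (rule component_summand, assumption+, auto simp: tens_Obj isomorphic_refl)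

text \<open>The component at the neutral element is 1 \<otimes> X, identified with X by the unit
  isomorphism.\<close>

lemma summand_orbit:
  assumes X: "X \<in> Obj C"
  shows "is_summand C X (fst (orbit X))"
proof -
  obtain \<iota> \<pi> where b: "biproduct C (carrier G) (\<lambda>g. tens A g X) (fst (orbit X)) \<iota> \<pi>"
    by (rule orbit_components[OF X])
  show ?thesis
    by (rule component_summand[OF b one_closed isomorphicI[OF unt_iso[OF X]] X])
qed

text \<open>Connects the coordinate form of \<open>rep_tensor\<close> with the matrix formalism: the
  scalar moves past the injection onto the action of M.\<close>

lemma rep_tensor_rep_obj:
  assumes M: "M \<in> equiv_Obj G C A" and r: "(n, r) \<in> reps G" and P: "dsum C {..<n} (\<lambda>_. fst M) = (P, \<iota>, \<pi>)"
  shows "matrix_rep {..<n} (\<lambda>g i j. r g $$ (i, j))"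
    and "rep_tensor G C A (n, r) M = rep_obj {..<n} (\<lambda>g i j. r g $$ (i, j)) M P \<iota> \<pi>"
    and "biproduct C {..<n} (\<lambda>_. fst M) P \<iota> \<pi>"
proof -
  note m = equiv_ObjD[OF M]
  have r': "r g \<in> carrier_mat n n" "r \<one>\<^bsub>G\<^esub> = 1\<^sub>m n" "h \<in> carrier G \<Longrightarrow> r (g \<otimes>\<^bsub>G\<^esub> h) = r g * r h"
    if "g \<in> carrier G" for g h
    using r that by (auto simp: reps_def)
  show "matrix_rep {..<n} (\<lambda>g i j. r g $$ (i, j))"
    unfolding matrix_rep_def
  proof (intro conjI ballI)
    fix g h i l assume g: "g \<in> carrier G" and h: "h \<in> carrier G" and i: "i \<in> {..<n}" and l: "l \<in> {..<n}"
    show "r (g \<otimes>\<^bsub>G\<^esub> h) $$ (i, l) = (\<Sum>j\<in>{..<n}. r g $$ (i, j) * r h $$ (j, l))"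
      unfolding r'(3)[OF g h] using r'(1)[OF g] r'(1)[OF h] i l by (auto simp: scalar_prod_def lessThan_atLeast0)
  qed (use r'(2)[OF one_closed] in auto)
  show b: "biproduct C {..<n} (\<lambda>_. fst M) P \<iota> \<pi>"
    using biproduct_dsum[OF _ _ P] m(1) by simp
  have "smul C (r g $$ (i, j)) (\<iota> i \<cdot> snd M g \<cdot> tens_mor A g P (fst M) (\<pi> j)) =
      \<iota> i \<cdot> (smul C (r g $$ (i, j)) (snd M g) \<cdot> tens_mor A g P (fst M) (\<pi> j))"
    if g: "g \<in> carrier G" and i: "i < n" and j: "j < n" for g i j
  proof -
    have \<iota>: "\<iota> i \<in> mor C (fst M) P" and T: "tens_mor A g P (fst M) (\<pi> j) \<in> mor C (tens A g P) (tens A g (fst M))"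
      using biproductD(4)[OF b] biproductD(5)[OF b] tens_mor_mor[OF g] i j by auto
    show ?thesis
      using comp_assoc[OF T m(4)[OF g] \<iota>] comp_smul_left[OF T m(4)[OF g]] comp_smul_right[OF mor_comp[OF T m(4)[OF g]] \<iota>]
      by simp
  qed
  then have "(\<Sum>i<n. \<Sum>j<n. smul C (r g $$ (i, j)) (\<iota> i \<cdot> snd M g \<cdot> tens_mor A g P (fst M) (\<pi> j))) =
      matmor C \<iota> {..<n} (\<lambda>i j. smul C (r g $$ (i, j)) (snd M g)) {..<n} (\<lambda>j. tens_mor A g P (fst M) (\<pi> j))"
    if g: "g \<in> carrier G" for g
    using that unfolding matmor_def by (intro sum.cong) auto
  then show "rep_tensor G C A (n, r) M = rep_obj {..<n} (\<lambda>g i j. r g $$ (i, j)) M P \<iota> \<pi>"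
    by (simp add: rep_tensor_def split_def P rep_obj_def matrix_obj_def cong: restrict_cong)
qed

lemma Add_actD:
  assumes "\<T> \<in> Add_act G C A"
  shows "\<T> \<in> Add C" "\<T> \<subseteq> Obj C" "\<lbrakk>g \<in> carrier G; X \<in> \<T>\<rbrakk> \<Longrightarrow> tens A g X \<in> \<T>"
  using assms AddD(1) by (auto simp: Add_act_def)

lemma Add_modD:
  assumes "\<S> \<in> Add_mod G C A"
  shows "\<S> \<in> Add D" "\<S> \<subseteq> equiv_Obj G C A" "\<lbrakk>V \<in> reps G; M \<in> \<S>\<rbrakk> \<Longrightarrow> rep_tensor G C A V M \<in> \<S>"
proof -
  show *: "\<S> \<in> Add D" and "\<lbrakk>V \<in> reps G; M \<in> \<S>\<rbrakk> \<Longrightarrow> rep_tensor G C A V M \<in> \<S>"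
    using assms by (auto simp: Add_mod_def)
  show "\<S> \<subseteq> equiv_Obj G C A"
    using equiv.AddD(1)[OF *] by simp
qed

lemma fst_orbit_mem:
  assumes "\<T> \<in> Add_act G C A" "X \<in> Obj C"
  shows "fst (orbit X) \<in> \<T> \<longleftrightarrow> X \<in> \<T>"
proof
  note T = Add_actD[OF assms(1)]
  show "X \<in> \<T>" if "fst (orbit X) \<in> \<T>"
    using AddD(4)[OF T(1) that summand_orbit[OF assms(2)]] .
  assume X: "X \<in> \<T>"
  obtain \<iota> \<pi> where b: "biproduct C (carrier G) (\<lambda>g. tens A g X) (fst (orbit X)) \<iota> \<pi>"
    by (rule orbit_components[OF assms(2)])
  show "fst (orbit X) \<in> \<T>"
    by (rule Add_biproduct[OF T(1) b]) (use T(3) X in blast)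
qed

text \<open>The orbit object of F M is \<open>k[G] \<otimes> M\<close> up to isomorphism. To use
  stability under \<open>reps\<close>, the regular representation is written with honest matrices
  along a numbering e of the group.\<close>

lemma orbit_fst_mem:
  assumes S: "\<S> \<in> Add_mod G C A" and M: "M \<in> \<S>"
  shows "orbit (fst M) \<in> \<S>"
proof -
  note d = Add_modD[OF S]
  have M': "M \<in> equiv_Obj G C A"
    using d(2) M by blast
  note m = equiv_ObjD[OF M']
  let ?n = "card (carrier G)"
  obtain e where e: "bij_betw e {..<?n} (carrier G)"
    using ex_bij_betw_nat_finite[OF finite_group] by (auto simp: lessThan_atLeast0)
  let ?r = "\<lambda>g. Matrix.mat ?n ?n (\<lambda>(i, j). regular_rep e g i j)"
  note reg = regular_matrix_rep[OF e]
  have V: "(?n, ?r) \<in> reps G"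
    unfolding reps_def
  proof (intro CollectI case_prodI conjI ballI)
    show "?r \<one>\<^bsub>G\<^esub> = 1\<^sub>m ?n"
      by (rule eq_matI) (use reg in \<open>auto simp: matrix_rep_def\<close>)
    fix g h assume g: "g \<in> carrier G" and h: "h \<in> carrier G"
    show "?r (g \<otimes>\<^bsub>G\<^esub> h) = ?r g * ?r h"
      by (rule eq_matI) (use reg g h in \<open>auto simp: matrix_rep_def scalar_prod_def lessThan_atLeast0\<close>)
  qed auto
  obtain Q \<iota>' \<pi>' where Q: "dsum C {..<?n} (\<lambda>_. fst M) = (Q, \<iota>', \<pi>')"
    by (rule prod_cases3)
  obtain P \<iota> \<pi> where P: "dsum C (carrier G) (\<lambda>g. tens A g (fst M)) = (P, \<iota>, \<pi>)"
    by (rule prod_cases3)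
  note R = rep_tensor_rep_obj[OF M' V Q]
  have "rep_obj {..<?n} (\<lambda>g i j. ?r g $$ (i, j)) M Q \<iota>' \<pi>' = rep_obj {..<?n} (regular_rep e) M Q \<iota>' \<pi>'"
    unfolding rep_obj_def matrix_obj_def matmor_def by (auto intro!: restrict_ext sum.cong)
  then have mem: "rep_obj {..<?n} (regular_rep e) M Q \<iota>' \<pi>' \<in> \<S>"
    using d(3)[OF V M] R(2) by simp
  have "isomorphic D (rep_obj {..<?n} (regular_rep e) M Q \<iota>' \<pi>') (orbit (fst M))"
    by (rule equiv.isomorphic_sym[OF equiv.isomorphicI[OF orbit_iso_regular(1)[OF M' e R(3) P]]])
      (use mem d(2) orbit_Obj[OF m(1)] in auto)
  then show ?thesis
    using equiv.AddD(3)[OF d(1) mem] orbit_Obj[OF m(1)] by simp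
qed

text \<open>Let h be inverse to g. Applying h \<otimes> - to a conflation ending in g \<otimes> X
  gives one ending in an object isomorphic to X, which splits by assumption. As h \<otimes> - is
  full and faithful, the section comes from a section of the original conflation.\<close>

lemma ext_vanishes_tens:
  assumes g: "g \<in> carrier G" and X: "X \<in> Obj C" and v: "ext_vanishes C X (tens A (inv\<^bsub>G\<^esub> g) Y)"
  shows "ext_vanishes C (tens A g X) Y"
  unfolding ext_vanishes_def
proof (intro allI impI)
  fix E i p assume c: "confl C Y E (tens A g X) i p"
  define h where "h = inv\<^bsub>G\<^esub> g"
  have h: "h \<in> carrier G" "h \<otimes>\<^bsub>G\<^esub> g = \<one>\<^bsub>G\<^esub>"
    using g by (simp_all add: h_def)
  have o: "tens A g X \<in> Obj C" "tens A h (tens A g X) \<in> Obj C" "tens A \<one>\<^bsub>G\<^esub> X \<in> Obj C" "E \<in> Obj C"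
    using tens_Obj g h X confl_Obj[OF c] by auto
  note p = confl_mor(2)[OF c]
  have iso: "is_iso C (tens A \<one>\<^bsub>G\<^esub> X) (tens A h (tens A g X)) (assc A h g X)"
    using assc_iso[OF h(1) g X] h(2) by simp
  have "is_iso C X (tens A h (tens A g X)) (assc A h g X \<cdot> inv_mor C (tens A \<one>\<^bsub>G\<^esub> X) X (unt A X))"
    by (rule is_iso_comp[OF is_iso_inv_mor[OF unt_iso[OF X] o(3) X] iso X o(3,2)])
  then obtain b b' where b: "b \<in> mor C X (tens A h (tens A g X))" "b' \<in> mor C (tens A h (tens A g X)) X"
    "b \<cdot> b' = idm C (tens A h (tens A g X))"
    using is_iso_iff[OF X o(2)] by blast
  have "ext_vanishes C (tens A h (tens A g X)) (tens A h Y)"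
    by (rule ext_vanishes_retract[OF v[folded h_def] b(2,1,3)])
  then obtain s where s: "s \<in> mor C (tens A h (tens A g X)) (tens A h E)"
    "tens_mor A h E (tens A g X) p \<cdot> s = idm C (tens A h (tens A g X))"
    using act_confl[OF h(1) c] unfolding ext_vanishes_def by blast
  have ff: "bij_betw (tens_mor A h Z W) (Hom C Z W) (Hom C (tens A h Z) (tens A h W))"
    if "Z \<in> Obj C" "W \<in> Obj C" for Z W
    using k_equivalence.fully_faithful[OF act_equivalence[OF h(1)] that] .
  have "s \<in> tens_mor A h (tens A g X) E ` Hom C (tens A g X) E"
    using ff[OF o(1,4)] morD(1)[OF s(1)] by (simp add: bij_betw_def)
  then obtain t where t: "t \<in> mor C (tens A g X) E" "tens_mor A h (tens A g X) E t = s"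
    using o morI by blast
  have "tens_mor A h (tens A g X) (tens A g X) (p \<cdot> t) = tens_mor A h (tens A g X) (tens A g X) (idm C (tens A g X))"
    using tens_mor_comp[OF h(1) t(1) p] t(2) s(2) tens_idm[OF h(1) o(1)] by simp
  then have "p \<cdot> t = idm C (tens A g X)"
    using ff[OF o(1,1)] morD(1)[OF mor_comp[OF t(1) p]] idm_in_Hom[OF o(1)]
    unfolding bij_betw_def inj_on_def by blast
  then show "\<exists>s\<in>mor C (tens A g X) E. p \<cdot> s = idm C (tens A g X)"
    using t(1) by blast
qed

text \<open>The equivalence holds for all Y of a stable \<T> together: passing from X to g \<otimes>
  X replaces Y by a translate, which stays in \<T>. Conversely, X is a retract of the sum.\<close>

lemma ext_vanishes_fst_orbit:
  assumes T: "\<T> \<in> Add_act G C A" and X: "X \<in> Obj C"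
  shows "(\<forall>Y\<in>\<T>. ext_vanishes C (fst (orbit X)) Y) \<longleftrightarrow> (\<forall>Y\<in>\<T>. ext_vanishes C X Y)"
proof -
  obtain \<iota> \<pi> where b: "biproduct C (carrier G) (\<lambda>g. tens A g X) (fst (orbit X)) \<iota> \<pi>"
    by (rule orbit_components[OF X])
  have "ext_vanishes C X Y" if "ext_vanishes C (fst (orbit X)) Y" for Y
  proof -
    obtain X' j q where s: "biproduct C (UNIV :: bool set) (case_bool X X') (fst (orbit X)) j q"
      using summand_orbit[OF X] by (auto simp: is_summand_def is_direct_sum_def)
    show ?thesis
      by (rule ext_vanishes_retract[OF that, of "j True" X "q True"])
        (use biproductD(4)[OF s, of True] biproductD(5)[OF s, of True] biproductD(6)[OF s, of True True] in auto)
  qed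
  moreover have "ext_vanishes C (fst (orbit X)) Y" if "\<forall>Y\<in>\<T>. ext_vanishes C X Y" "Y \<in> \<T>" for Y
    by (rule ext_vanishes_biproduct[OF b], rule ext_vanishes_tens[OF _ X]) (use that Add_actD(3)[OF T] in auto)
  ultimately show ?thesis
    by blast
qed

end

context nonmodular_action
begin

section \<open>The two maps as preimages, and the bijection\<close>

abbreviation \<Phi> where "\<Phi> \<equiv> add_image D (orbit_functor G C A)"
abbreviation \<Psi> where "\<Psi> \<equiv> add_image C forget_functor"

text \<open>The orbit object is isomorphic to the regular representation tensored with M, of which M
  is a summand. Membership in \<open>Add D\<close> is enough here, so this applies to
  \<open>\<Phi> \<T>\<close> before its stability under \<open>reps\<close> is known.\<close>

lemma mem_if_orbit_fst_mem:
  assumes S: "\<S> \<in> Add D" and M: "M \<in> equiv_Obj G C A" and o: "orbit (fst M) \<in> \<S>"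
  shows "M \<in> \<S>"
proof -
  note m = equiv_ObjD[OF M]
  have bij: "bij_betw (\<lambda>x. x) (carrier G) (carrier G)"
    by (simp add: bij_betw_def)
  obtain Q \<iota>' \<pi>' where Q: "biproduct C (carrier G) (\<lambda>_. fst M) Q \<iota>' \<pi>'"
    using biproduct_exists[OF finite_group, of "\<lambda>_. fst M"] m(1) by blast
  obtain P \<iota> \<pi> where P: "dsum C (carrier G) (\<lambda>g. tens A g (fst M)) = (P, \<iota>, \<pi>)"
    by (rule prod_cases3)
  let ?R = "rep_obj (carrier G) (regular_rep (\<lambda>x. x)) M Q \<iota>' \<pi>'"
  have "?R \<in> \<S>"
    using equiv.AddD(3)[OF S o _ equiv.isomorphicI[OF orbit_iso_regular(1)[OF M bij Q P]]]
      rep_obj_equiv_Obj[OF M regular_matrix_rep[OF bij] Q] by simp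
  then show ?thesis
    using equiv.AddD(4)[OF S _ regular_summand[OF M Q]] by blast
qed

lemma \<Phi>_eq:
  assumes T: "\<T> \<in> Add_act G C A"
  shows "\<Phi> \<T> = {M \<in> equiv_Obj G C A. fst M \<in> \<T>}"
proof
  note d = Add_actD[OF T]
  have "{M \<in> equiv_Obj G C A. fst M \<in> \<T>} \<in> Add D"
    using additive_functor.vimage_Add[OF forget_additive d(1)] by simp
  then show "\<Phi> \<T> \<subseteq> {M \<in> equiv_Obj G C A. fst M \<in> \<T>}"
    unfolding add_image_def
    by (rule equiv.add_closure_minimal) (use fst_orbit_mem[OF T] orbit_Obj d(2) in auto)
  have O: "orbit ` \<T> \<subseteq> Obj D"
    using orbit_Obj d(2) by auto
  show "{M \<in> equiv_Obj G C A. fst M \<in> \<T>} \<subseteq> \<Phi> \<T>"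
    \<comment> \<open>If \<open>fst M\<close> lies in \<T>, its orbit object is one of the
      generators of the image.\<close>
    using mem_if_orbit_fst_mem[OF equiv.add_closure_Add[OF O]] equiv.add_closure_superset[OF O]
    by (auto simp: add_image_def)
qed

lemma \<Psi>_eq:
  assumes S: "\<S> \<in> Add_mod G C A"
  shows "\<Psi> \<S> = {X \<in> Obj C. orbit X \<in> \<S>}"
proof
  note d = Add_modD[OF S]
  have "{X \<in> Obj C. orbit X \<in> \<S>} \<in> Add C"
    using additive_functor.vimage_Add[OF orbit_additive d(1)] .
  then show "\<Psi> \<S> \<subseteq> {X \<in> Obj C. orbit X \<in> \<S>}"
    unfolding add_image_def
    by (rule add_closure_minimal) (use orbit_fst_mem[OF S] equiv_ObjD(1) d(2) in auto)
  have O: "fob forget_functor ` \<S> \<subseteq> Obj C"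
    using equiv_ObjD(1) d(2) by auto
  show "{X \<in> Obj C. orbit X \<in> \<S>} \<subseteq> \<Psi> \<S>"
  proof
    fix X assume X: "X \<in> {X \<in> Obj C. orbit X \<in> \<S>}"
    \<comment> \<open>The underlying object of \<open>orbit X\<close> is a generator of the image
      and has X as a summand.\<close>
    then have "fst (orbit X) \<in> \<Psi> \<S>"
      using add_closure_superset[OF O] by (auto simp: add_image_def)
    then show "X \<in> \<Psi> \<S>"
      using AddD(4)[OF add_closure_Add[OF O] _ summand_orbit] X by (simp add: add_image_def)
  qed
qed

text \<open>The underlying object of a tensor product with a representation is a power of
  \<open>fst M\<close>, so with the description as a preimage the stability is closure under
  sums.\<close>

lemma \<Phi>_Add_mod:
  assumes T: "\<T> \<in> Add_act G C A"
  shows "\<Phi> \<T> \<in> Add_mod G C A"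
  unfolding Add_mod_def
proof (intro CollectI conjI ballI)
  note d = Add_actD[OF T]
  have "orbit ` \<T> \<subseteq> Obj D"
    using orbit_Obj d(2) by auto
  then show "\<Phi> \<T> \<in> Add D"
    unfolding add_image_def by (rule equiv.add_closure_Add)
  fix V :: "nat \<times> ('g \<Rightarrow> 'k Matrix.mat)" and M assume V: "V \<in> reps G" and "M \<in> \<Phi> \<T>"
  then have M: "M \<in> equiv_Obj G C A" "fst M \<in> \<T>"
    using \<Phi>_eq[OF T] by auto
  obtain n r where nr: "V = (n, r)"
    by (cases V)
  obtain P \<iota> \<pi> where P: "dsum C {..<n} (\<lambda>_. fst M) = (P, \<iota>, \<pi>)"
    by (rule prod_cases3)
  note R = rep_tensor_rep_obj[OF M(1) V[unfolded nr] P]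
  have "P \<in> \<T>"
    by (rule Add_biproduct[OF d(1) R(3) M(2)])
  then show "rep_tensor G C A V M \<in> \<Phi> \<T>"
    using rep_obj_equiv_Obj[OF M(1) R(1,3)] R(2) \<Phi>_eq[OF T] nr by simp
qed

text \<open>g \<otimes> X is, like X, a component of the underlying object of
  \<open>orbit X\<close>.\<close>

lemma \<Psi>_Add_act:
  assumes S: "\<S> \<in> Add_mod G C A"
  shows "\<Psi> \<S> \<in> Add_act G C A"
  unfolding Add_act_def
proof (intro CollectI conjI ballI)
  note d = Add_modD[OF S]
  have O: "fob forget_functor ` \<S> \<subseteq> Obj C"
    using equiv_ObjD(1) d(2) by auto
  then show A: "\<Psi> \<S> \<in> Add C"
    unfolding add_image_def by (rule add_closure_Add)
  fix g X assume g: "g \<in> carrier G" and X: "X \<in> \<Psi> \<S>"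
  then have X': "X \<in> Obj C" "orbit X \<in> \<S>"
    using \<Psi>_eq[OF S] by auto
  then have "fst (orbit X) \<in> \<Psi> \<S>"
    using add_closure_superset[OF O] by (auto simp: add_image_def)
  then show "tens A g X \<in> \<Psi> \<S>"
    using AddD(4)[OF A _ tens_summand_orbit[OF X'(1) g]] by blast
qed

lemma \<Psi>_\<Phi>:
  assumes T: "\<T> \<in> Add_act G C A"
  shows "\<Psi> (\<Phi> \<T>) = \<T>"
proof -
  have "\<Psi> (\<Phi> \<T>) = {X \<in> Obj C. orbit X \<in> \<Phi> \<T>}"
    by (rule \<Psi>_eq[OF \<Phi>_Add_mod[OF T]])
  also have "\<dots> = \<T>"
    unfolding \<Phi>_eq[OF T] using fst_orbit_mem[OF T] Add_actD(2)[OF T] orbit_Obj by blast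
  finally show ?thesis .
qed

lemma \<Phi>_\<Psi>:
  assumes S: "\<S> \<in> Add_mod G C A"
  shows "\<Phi> (\<Psi> \<S>) = \<S>"
proof -
  note d = Add_modD[OF S]
  have "\<Phi> (\<Psi> \<S>) = {M \<in> equiv_Obj G C A. fst M \<in> \<Psi> \<S>}"
    by (rule \<Phi>_eq[OF \<Psi>_Add_act[OF S]])
  also have "\<dots> = \<S>"
    unfolding \<Psi>_eq[OF S] using orbit_fst_mem[OF S] mem_if_orbit_fst_mem[OF d(1)] d(2) equiv_ObjD(1) by blast
  finally show ?thesis .
qed

lemma bijections: "reciprocal_bijections \<Phi> \<Psi> (Add_act G C A) (Add_mod G C A)"
  by (rule reciprocal_bijectionsI) (rule \<Phi>_Add_mod \<Psi>_Add_act \<Psi>_\<Phi> \<Phi>_\<Psi>, assumption)+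

section \<open>Rigidity, maximality, cluster tilting and finite generation along the
  bijection\<close>

lemma ext_vanishes_\<Phi>:
  assumes T: "\<T> \<in> Add_act G C A" and M: "M \<in> equiv_Obj G C A"
  shows "(\<forall>N\<in>\<Phi> \<T>. ext_vanishes D M N) \<longleftrightarrow> (\<forall>Y\<in>\<T>. ext_vanishes C (fst M) Y)"
proof
  assume v: "\<forall>N\<in>\<Phi> \<T>. ext_vanishes D M N"
  show "\<forall>Y\<in>\<T>. ext_vanishes C (fst M) Y"
  proof
    fix Y assume Y: "Y \<in> \<T>"
    then have "orbit Y \<in> \<Phi> \<T>"
      using \<Phi>_eq[OF T] fst_orbit_mem[OF T] Add_actD(2)[OF T] orbit_Obj by blast
    then show "ext_vanishes C (fst M) Y"
      using ext_vanishes_orbit[OF M] v by blast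
  qed
next
  assume "\<forall>Y\<in>\<T>. ext_vanishes C (fst M) Y"
  then show "\<forall>N\<in>\<Phi> \<T>. ext_vanishes D M N"
    using ext_vanishes_equiv[OF M] \<Phi>_eq[OF T] by blast
qed

text \<open>\<open>ext_vanishes_\<Phi>\<close> treats the second variable. In the first, the
  underlying objects of \<open>\<Phi> \<T>\<close> lie in \<T>, and conversely X in \<T> is tested
  through its orbit object.\<close>

lemma rigid_\<Phi>:
  assumes T: "\<T> \<in> Add_act G C A"
  shows "rigid C \<T> \<longleftrightarrow> rigid D (\<Phi> \<T>)"
proof -
  have sub: "\<T> \<subseteq> Obj C" "\<Phi> \<T> \<subseteq> equiv_Obj G C A"
    using Add_actD(2)[OF T] \<Phi>_eq[OF T] by auto
  have "rigid D (\<Phi> \<T>) \<longleftrightarrow> (\<forall>M\<in>\<Phi> \<T>. \<forall>N\<in>\<Phi> \<T>. ext_vanishes D M N)"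
    unfolding rigid_def using sub(2) by (intro ball_cong refl equiv.Ext1_eq_zero_iff) auto
  also have "\<dots> \<longleftrightarrow> (\<forall>M\<in>\<Phi> \<T>. \<forall>Y\<in>\<T>. ext_vanishes C (fst M) Y)"
    using ext_vanishes_\<Phi>[OF T] sub(2) by blast
  also have "\<dots> \<longleftrightarrow> (\<forall>X\<in>\<T>. \<forall>Y\<in>\<T>. ext_vanishes C X Y)"
  proof
    assume v: "\<forall>M\<in>\<Phi> \<T>. \<forall>Y\<in>\<T>. ext_vanishes C (fst M) Y"
    show "\<forall>X\<in>\<T>. \<forall>Y\<in>\<T>. ext_vanishes C X Y"
    proof
      fix X assume X: "X \<in> \<T>"
      then have X': "X \<in> Obj C"
        using sub(1) by blast
      have "orbit X \<in> \<Phi> \<T>"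
        using \<Phi>_eq[OF T] fst_orbit_mem[OF T X'] orbit_Obj[OF X'] X by blast
      then show "\<forall>Y\<in>\<T>. ext_vanishes C X Y"
        using v ext_vanishes_fst_orbit[OF T X'] by blast
    qed
  next
    assume "\<forall>X\<in>\<T>. \<forall>Y\<in>\<T>. ext_vanishes C X Y"
    then show "\<forall>M\<in>\<Phi> \<T>. \<forall>Y\<in>\<T>. ext_vanishes C (fst M) Y"
      using \<Phi>_eq[OF T] by blast
  qed
  also have "\<dots> \<longleftrightarrow> rigid C \<T>"
    unfolding rigid_def using sub(1) by (intro ball_cong refl Ext1_eq_zero_iff[symmetric]) auto
  finally show ?thesis ..
qed

lemma \<Phi>_mono:
  "\<lbrakk>\<T> \<in> Add_act G C A; \<T>' \<in> Add_act G C A; \<T> \<subseteq> \<T>'\<rbrakk> \<Longrightarrow> \<Phi> \<T> \<subseteq> \<Phi> \<T>'"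
  using \<Phi>_eq by blast

lemma \<Psi>_mono:
  "\<lbrakk>\<S> \<in> Add_mod G C A; \<S>' \<in> Add_mod G C A; \<S> \<subseteq> \<S>'\<rbrakk> \<Longrightarrow> \<Psi> \<S> \<subseteq> \<Psi> \<S>'"
  using \<Psi>_eq by blast

text \<open>The bijections are monotone in both directions and preserve rigidity, so they preserve
  maximal elements among the rigid ones.\<close>

lemma maximal_rigid_\<Phi>:
  assumes T: "\<T> \<in> Add_act G C A"
  shows "maximal_rigid_in C (Add_act G C A) \<T> \<longleftrightarrow> maximal_rigid_in D (Add_mod G C A) (\<Phi> \<T>)"
proof
  assume max: "maximal_rigid_in C (Add_act G C A) \<T>"
  show "maximal_rigid_in D (Add_mod G C A) (\<Phi> \<T>)"
    unfolding maximal_rigid_in_def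
  proof (intro conjI ballI impI)
    show "\<Phi> \<T> \<in> Add_mod G C A" "rigid D (\<Phi> \<T>)"
      using \<Phi>_Add_mod[OF T] rigid_\<Phi>[OF T] max by (auto simp: maximal_rigid_in_def)
    fix \<S> assume S: "\<S> \<in> Add_mod G C A" "rigid D \<S>" "\<Phi> \<T> \<subseteq> \<S>"
    have "rigid C (\<Psi> \<S>)"
      using rigid_\<Phi>[OF \<Psi>_Add_act[OF S(1)]] \<Phi>_\<Psi>[OF S(1)] S(2) by simp
    moreover have "\<T> \<subseteq> \<Psi> \<S>"
      using \<Psi>_mono[OF \<Phi>_Add_mod[OF T] S(1,3)] \<Psi>_\<Phi>[OF T] by simp
    ultimately have "\<Psi> \<S> = \<T>"
      using max \<Psi>_Add_act[OF S(1)] by (auto simp: maximal_rigid_in_def)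
    then show "\<S> = \<Phi> \<T>"
      using \<Phi>_\<Psi>[OF S(1)] by simp
  qed
next
  assume max: "maximal_rigid_in D (Add_mod G C A) (\<Phi> \<T>)"
  show "maximal_rigid_in C (Add_act G C A) \<T>"
    unfolding maximal_rigid_in_def
  proof (intro conjI ballI impI)
    show "\<T> \<in> Add_act G C A" "rigid C \<T>"
      using T rigid_\<Phi>[OF T] max by (auto simp: maximal_rigid_in_def)
    fix \<T>' assume T': "\<T>' \<in> Add_act G C A" "rigid C \<T>'" "\<T> \<subseteq> \<T>'"
    have "\<Phi> \<T>' = \<Phi> \<T>"
      using max \<Phi>_Add_mod[OF T'(1)] rigid_\<Phi>[OF T'(1)] T'(2) \<Phi>_mono[OF T T'(1,3)]
      by (auto simp: maximal_rigid_in_def)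
    then show "\<T>' = \<T>"
      using \<Psi>_\<Phi>[OF T] \<Psi>_\<Phi>[OF T'(1)] by simp
  qed
qed

text \<open>Over the equivariant category both sides of the defining equivalence depend only on
  \<open>fst M\<close>. An arbitrary X of C is reached through M = \<open>orbit X\<close>, since
  neither condition changes when X is replaced by \<open>fst (orbit X)\<close>.\<close>

lemma cluster_tilting_\<Phi>:
  assumes T: "\<T> \<in> Add_act G C A"
  shows "cluster_tilting C \<T> \<longleftrightarrow> cluster_tilting D (\<Phi> \<T>)"
proof -
  have sub: "\<T> \<subseteq> Obj C" "\<Phi> \<T> \<subseteq> equiv_Obj G C A"
    using Add_actD(2)[OF T] \<Phi>_eq[OF T] by auto
  have "(\<forall>Y\<in>\<T>. Ext1 C X Y = {ext_zero C X Y}) \<longleftrightarrow> (\<forall>Y\<in>\<T>. ext_vanishes C X Y)" if "X \<in> Obj C" for X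
    by (rule ball_cong[OF refl], rule Ext1_eq_zero_iff) (use that sub(1) in auto)
  then have CT: "cluster_tilting C \<T> \<longleftrightarrow> (\<forall>X\<in>Obj C. (\<forall>Y\<in>\<T>. ext_vanishes C X Y) \<longleftrightarrow> X \<in> \<T>)"
    by (simp add: cluster_tilting_def cong: ball_cong)
  have D: "(\<forall>N\<in>\<Phi> \<T>. Ext1 D M N = {ext_zero D M N}) \<longleftrightarrow> (\<forall>Y\<in>\<T>. ext_vanishes C (fst M) Y)"
    if "M \<in> equiv_Obj G C A" for M
  proof -
    have "(\<forall>N\<in>\<Phi> \<T>. Ext1 D M N = {ext_zero D M N}) \<longleftrightarrow> (\<forall>N\<in>\<Phi> \<T>. ext_vanishes D M N)"
      by (rule ball_cong[OF refl], rule equiv.Ext1_eq_zero_iff) (use that sub(2) in auto)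
    then show ?thesis
      using ext_vanishes_\<Phi>[OF T that] by simp
  qed
  have "M \<in> \<Phi> \<T> \<longleftrightarrow> fst M \<in> \<T>" if "M \<in> equiv_Obj G C A" for M
    using that \<Phi>_eq[OF T] by simp
  with D have "cluster_tilting D (\<Phi> \<T>) \<longleftrightarrow>
      (\<forall>M\<in>equiv_Obj G C A. (\<forall>Y\<in>\<T>. ext_vanishes C (fst M) Y) \<longleftrightarrow> fst M \<in> \<T>)"
    by (simp add: cluster_tilting_def cong: ball_cong)
  also have "\<dots> \<longleftrightarrow> (\<forall>X\<in>Obj C. (\<forall>Y\<in>\<T>. ext_vanishes C X Y) \<longleftrightarrow> X \<in> \<T>)"
  proof
    assume ct: "\<forall>M\<in>equiv_Obj G C A. (\<forall>Y\<in>\<T>. ext_vanishes C (fst M) Y) \<longleftrightarrow> fst M \<in> \<T>"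
    show "\<forall>X\<in>Obj C. (\<forall>Y\<in>\<T>. ext_vanishes C X Y) \<longleftrightarrow> X \<in> \<T>"
    proof
      fix X assume X: "X \<in> Obj C"
      show "(\<forall>Y\<in>\<T>. ext_vanishes C X Y) \<longleftrightarrow> X \<in> \<T>"
        using bspec[OF ct orbit_Obj[OF X]] ext_vanishes_fst_orbit[OF T X] fst_orbit_mem[OF T X] by simp
    qed
  next
    assume ct: "\<forall>X\<in>Obj C. (\<forall>Y\<in>\<T>. ext_vanishes C X Y) \<longleftrightarrow> X \<in> \<T>"
    then show "\<forall>M\<in>equiv_Obj G C A. (\<forall>Y\<in>\<T>. ext_vanishes C (fst M) Y) \<longleftrightarrow> fst M \<in> \<T>"
      using equiv_ObjD(1) by simp
  qed
  finally show ?thesis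
    using CT by simp
qed

text \<open>Both functors carry the additive closure of one object to that of its image; the
  converse applies this to the forgetful functor and
  \<open>\<Psi> (\<Phi> \<T>) = \<T>\<close>.\<close>

lemma finitely_generated_\<Phi>:
  assumes T: "\<T> \<in> Add_act G C A"
  shows "finitely_generated C \<T> \<longleftrightarrow> finitely_generated D (\<Phi> \<T>)"
proof
  assume "finitely_generated C \<T>"
  then obtain X where X: "X \<in> Obj C" "\<T> = add_closure C {X}"
    unfolding finitely_generated_def by blast
  then have "\<Phi> \<T> = add_closure D {orbit X}"
    using additive_functor.add_image_add_closure[OF orbit_additive, of "{X}"] by simp
  then show "finitely_generated D (\<Phi> \<T>)"
    unfolding finitely_generated_def equiv_cat_simps using orbit_Obj[OF X(1)] by blast
next
  assume "finitely_generated D (\<Phi> \<T>)"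
  then obtain M where M: "M \<in> equiv_Obj G C A" "\<Phi> \<T> = add_closure D {M}"
    unfolding finitely_generated_def equiv_cat_simps by blast
  then have "\<T> = add_closure C {fst M}"
    using additive_functor.add_image_add_closure[OF forget_additive, of "{M}"] \<Psi>_\<Phi>[OF T] by simp
  then show "finitely_generated C \<T>"
    unfolding finitely_generated_def using equiv_ObjD(1)[OF M(1)] by blast
qed

end

theorem proposition3p5:
  fixes C :: "('k::field, 'o, 'm::ab_group_add) excat"
    and c :: "'o \<Rightarrow> 'o \<Rightarrow> ('o \<times> 'm \<times> 'm) set \<Rightarrow> ('o \<times> 'm \<times> 'm) set \<Rightarrow> 'k"
    and G :: "'g monoid"
    and A :: "('g, 'o, 'm) gaction"
  assumes "group G" and "finite (carrier G)" and "\<not> CHAR('k) dvd card (carrier G)"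
    and "exact_k_category C" and "hom_finite C" and "krull_schmidt C" and "frobenius C"
    and "stably_2CY C c" and "exact_2CY_action G C c A"
  shows "let D = equiv_cat G C A;
             \<A> = Add_act G C A;
             \<B> = Add_mod G C A;
             \<Phi> = add_image D (orbit_functor G C A);
             \<Psi> = add_image C forget_functor
         in
           reciprocal_bijections \<Phi> \<Psi> \<A> \<B> \<and>
           reciprocal_bijections \<Phi> \<Psi> {\<T> \<in> \<A>. rigid C \<T>} {\<T> \<in> \<B>. rigid D \<T>} \<and>
           reciprocal_bijections \<Phi> \<Psi> {\<T> \<in> \<A>. maximal_rigid_in C \<A> \<T>} {\<T> \<in> \<B>. maximal_rigid_in D \<B> \<T>} \<and>
           reciprocal_bijections \<Phi> \<Psi> {\<T> \<in> \<A>. cluster_tilting C \<T>} {\<T> \<in> \<B>. cluster_tilting D \<T>} \<and>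
           reciprocal_bijections \<Phi> \<Psi> {\<T> \<in> \<A>. finitely_generated C \<T>} {\<T> \<in> \<B>. finitely_generated D \<T>} \<and>
           reciprocal_bijections \<Phi> \<Psi> {\<T> \<in> \<A>. rigid C \<T> \<and> finitely_generated C \<T>}
             {\<T> \<in> \<B>. rigid D \<T> \<and> finitely_generated D \<T>} \<and>
           reciprocal_bijections \<Phi> \<Psi> {\<T> \<in> \<A>. maximal_rigid_in C \<A> \<T> \<and> finitely_generated C \<T>}
             {\<T> \<in> \<B>. maximal_rigid_in D \<B> \<T> \<and> finitely_generated D \<T>} \<and>
           reciprocal_bijections \<Phi> \<Psi> {\<T> \<in> \<A>. cluster_tilting C \<T> \<and> finitely_generated C \<T>}
             {\<T> \<in> \<B>. cluster_tilting D \<T> \<and> finitely_generated D \<T>}"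
proof -
  interpret nonmodular_action G C A
    by (intro nonmodular_action.intro exact_action.intro exact_action_axioms.intro nonmodular_action_axioms.intro
        assms(1-4) exact_2CY_action.axioms(1)[OF assms(9)] exact_2CY_action.act_exact[OF assms(9)])
  \<comment> \<open>Every further claim restricts the first bijection to a property and to its
    counterpart along \<Phi>; conjunctions with finite generation are handled in the same
    way.\<close>
  note restrict = reciprocal_bijections_restrict[OF bijections]
  show ?thesis
    unfolding Let_def
    by (intro conjI bijections restrict)
      (simp_all add: rigid_\<Phi> maximal_rigid_\<Phi> cluster_tilting_\<Phi> finitely_generated_\<Phi>)
qed

end
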